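(* Let $D\subset\mathbb R^d$, $d\in\{1,2,3\}$, be a convex bounded polyhedron with plane faces and $U=[0,1]^{\mathbb N}$. Let $a_0\in L_\infty(D)$ and $0\neq\psi_j\in L_\infty(D)$ ($j\ge1$) with $\sum_{j\ge1}\|\psi_j\|_{L_\infty(D)}<\infty$ and $\sum_{j\ge1}\|\psi_j\|^p_{L_\infty(D)}<\infty$ for some $0<p<1$, and let $a(\boldsymbol x,\boldsymbol y)=a_0(\boldsymbol x)+\frac1{\sqrt6}\sum_{j\ge1}\sin(2\pi y_j)\psi_j(\boldsymbol x)$ satisfy $0<a_{\min}\le a(\boldsymbol x,\boldsymbol y)\le a_{\max}<\infty$ for all $\boldsymbol x\in D$, $\boldsymbol y\in U$. Take $\alpha=2\lfloor\frac1p+\frac12\rfloor$, $\sigma=\frac\alpha2$, $\lambda=\frac p{2-p}$, and define the weights, with $\gamma_\emptyset=1$ and for $\emptyset\ne\mathfrak u\subset\mathbb N$, $|\mathfrak u|<\infty$, either by $$\gamma_{\mathfrak u}=\Big(\frac1{\max(|\mathfrak u|,1)[2\zeta(\alpha\lambda)]^{|\mathfrak u|}}\Big(\sum_{\boldsymbol m_{\mathfrak u}\in\{1,\dots,\sigma\}^{|\mathfrak u|}}|\boldsymbol m_{\mathfrak u}|!\prod_{j\in\mathfrak u}\big(b_j^{m_j}S(\sigma,m_j)\big)\Big)^2\Big)^{\frac1{1+\lambda}}$$ or by the SPOD weights $$\gamma_{\mathfrak u}=\sum_{\boldsymbol m_{\mathfrak u}\in\{1,\dots,\sigma\}^{|\mathfrak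 u|}}(|\boldsymbol m_{\mathfrak u}|!)^{\frac2{1+\lambda}}\prod_{j\in\mathfrak u}\Big(\frac{b_j^{m_j}S(\sigma,m_j)}{\sqrt{2e^{1/e}\zeta(\alpha\lambda)}}\Big)^{\frac2{1+\lambda}} .$$ Let $q\in H^{-1}(D)$ and let $u_{s,h}$ be the dimensionally truncated finite element solution. For each $s\ge1$ and prime $n$, for every $\boldsymbol x\in D$ let $u_{s,h,n}(\boldsymbol x,\cdot)=A_n^*(u_{s,h}(\boldsymbol x,\cdot))$ be the kernel interpolant (with smoothness parameter $\alpha=2\lfloor\frac1p+\frac12\rfloor$ and weights $\gamma_{\mathfrak u}$ given by either of the two formulas for $\gamma_{\mathfrak u}$ in this statement) at the lattice points whose generating vector is obtained by the component-by-component (CBC) construction. Then $$\sqrt{\int_{U_s}\int_D\big(u_{s,h}(\boldsymbol x,\boldsymbol y)-u_{s,h,n}(\boldsymbol x,\boldsymbol y)\big)^2\,d\boldsymbol x\,d\boldsymbol y}\ \le\ C\,\|q\|_{H^{-1}(D)}\,n^{-(\frac1{2p}-\frac14)},$$ where $U_s=[0,1]^s$ and the constant $C>0$ is independent of the dimension $s$ (and of $n$, $h$, $q$).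
   Context: PDE notation. $H_0^1(D)$ carries the norm $\|\nabla v\|_{L_2(D)}$; $H^{-1}(D)$ is its dual. $\{V_h\}_h$ is a family of conforming finite element subspaces $V_h\subset H_0^1(D)$ with mesh size $h>0$, spanned by continuous piecewise linear basis functions on triangulations obtained from an initial regular triangulation of $D$ by recursive uniform partition of simplices. For $\boldsymbol y\in U$, $u_h(\cdot,\boldsymbol y)\in V_h$ solves $\int_Da(\boldsymbol x,\boldsymbol y)\nabla u_h\cdot\nabla v_h\,d\boldsymbol x=\langle q,v_h\rangle_{H^{-1},H_0^1}$ for all $v_h\in V_h$. The dimensionally truncated finite element solution is $u_{s,h}(\cdot,\boldsymbol y)=u_h(\cdot,(y_1,\dots,y_s,0,0,\dots))$. Put $b_j=\frac1{\sqrt6}\|\psi_j\|_{L_\infty(D)}/a_{\min}$. $S(\sigma,m)$ is the Stirling number of the second kind; $|\boldsymbol m_{\mathfrak u}|=\sum_{j\in\mathfrak u}m_j$; $\zeta$ is the Riemann zeta function. Kernel interpolation. For $\boldsymbol h\in\mathbb Z^s$: $\mathrm{supp}(\boldsymbol h)=\{j:h_j\neq0\}$, $r(\boldsymbol h)=\gamma_{\mathrm{supp}(\boldsymbol h)}^{-1}\prod_{j\in\mathrm{supp}(\boldsymbol h)}|h_j|^\alpha$. The kernel is $K(\boldsymbol y,\boldsymbol y')=\sum_{\mathfrak u\subseteq\{1,\dots,s\}}\gamma_{\mathfrak u}\prod_{j\in\mathfrak u}\eta_\alpha(y_j-y_j')$, $\eta_\alpha(y)=\sum_{h\ne0}|h|^{-\alpha}e^{2\pi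 ihy}$, which is the reproducing kernel of the Hilbert space of 1-periodic functions on $[0,1]^s$ with finite norm $(\sum_{\boldsymbol h\in\mathbb Z^s}r(\boldsymbol h)|\widehat f(\boldsymbol h)|^2)^{1/2}$. For $\boldsymbol z\in\{1,\dots,n-1\}^s$ let $\boldsymbol t_k=\{k\boldsymbol z/n\}$ (componentwise fractional parts), $k=1,\dots,n$. $A_n^*(f)$ is the unique function of the form $\sum_{k=1}^na_kK(\boldsymbol t_k,\cdot)$ that agrees with $f$ at $\boldsymbol t_1,\dots,\boldsymbol t_n$. CBC construction (from Cools, Kuo, Nuyens, Sloan). $\mathcal S_s(\boldsymbol z)=\sum_{\boldsymbol h\in\mathbb Z^s}\sum_{\boldsymbol\ell\in\mathbb Z^s\setminus\{\boldsymbol0\},\,\boldsymbol\ell\cdot\boldsymbol z\equiv0\,(\mathrm{mod}\,n)}\frac1{r(\boldsymbol h)r(\boldsymbol h+\boldsymbol\ell)}=\sum_{d=1}^sT_d(z_1,\dots,z_d)$, where $T_d$ is the part of the sum over those $\boldsymbol\ell$ with $\ell_d\ne0$ and $\ell_j=0$ for $j>d$. For $d=1,\dots,s$ successively, with $z_1,\dots,z_{d-1}$ fixed, $z_d\in\{1,\dots,n-1\}$ is chosen to minimize $T_d(z_1,\dots,z_d)$. *)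

theory Defs
  imports
    "HOL-Analysis.Analysis"
    "HOL-Probability.Probability"
    "HOL-Combinatorics.Stirling"
    "HOL-Computational_Algebra.Primes"
begin

section \<open>Function spaces on a domain\<close>

text \<open>Functions on \<open>D\<close> are represented by total functions, of which only the restriction to \<open>D\<close>
  matters; all integrals over \<open>D\<close> are taken with respect to \<open>lebesgue_on D\<close>.\<close>

definition Linf_norm :: "(real^'d) set \<Rightarrow> (real^'d \<Rightarrow> real) \<Rightarrow> real" where
  "Linf_norm D f = real_of_ereal (esssup (lebesgue_on D) (\<lambda>x. ereal \<bar>f x\<bar>))"

definition Linf :: "(real^'d) set \<Rightarrow> (real^'d \<Rightarrow> real) set" where
  "Linf D = {f. f \<in> borel_measurable (lebesgue_on D) \<and>
                esssup (lebesgue_on D) (\<lambda>x. ereal \<bar>f x\<bar>) < \<infinity>}"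

definition L2_on :: "(real^'d) set \<Rightarrow> (real^'d \<Rightarrow> 'b::euclidean_space) set" where
  "L2_on D = {f. f \<in> borel_measurable (lebesgue_on D) \<and>
                 integrable (lebesgue_on D) (\<lambda>x. (norm (f x))\<^sup>2)}"

definition L2_norm_on :: "(real^'d) set \<Rightarrow> (real^'d \<Rightarrow> 'b::euclidean_space) \<Rightarrow> real" where
  "L2_norm_on D f = sqrt (\<integral>x. (norm (f x))\<^sup>2 \<partial>lebesgue_on D)"

definition partial_deriv :: "'d \<Rightarrow> (real^'d \<Rightarrow> real) \<Rightarrow> real^'d \<Rightarrow> real" where
  "partial_deriv i f x = frechet_derivative f (at x) (axis i 1)"

primrec C_k :: "nat \<Rightarrow> (real^'d \<Rightarrow> real) \<Rightarrow> bool" where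
  "C_k 0 f \<longleftrightarrow> continuous_on UNIV f"
| "C_k (Suc k) f \<longleftrightarrow> (\<forall>x. f differentiable (at x)) \<and> (\<forall>i. C_k k (partial_deriv i f))"

definition test_function :: "(real^'d) set \<Rightarrow> (real^'d \<Rightarrow> real) \<Rightarrow> bool" where
  "test_function D \<phi> \<longleftrightarrow> (\<forall>k. C_k k \<phi>) \<and>
     compact (closure {x. \<phi> x \<noteq> 0}) \<and> closure {x. \<phi> x \<noteq> 0} \<subseteq> D"

definition has_weak_gradient ::
  "(real^'d) set \<Rightarrow> (real^'d \<Rightarrow> real) \<Rightarrow> (real^'d \<Rightarrow> real^'d) \<Rightarrow> bool" where
  "has_weak_gradient D v g \<longleftrightarrow> v \<in> L2_on D \<and> g \<in> L2_on D \<and>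
     (\<forall>\<phi> i. test_function D \<phi> \<longrightarrow>
        (\<integral>x. v x * partial_deriv i \<phi> x \<partial>lebesgue_on D) = - (\<integral>x. g x $ i * \<phi> x \<partial>lebesgue_on D))"

text \<open>The weak gradient is only determined up to null sets; \<open>weak_grad\<close> picks a representative.\<close>

definition weak_grad :: "(real^'d) set \<Rightarrow> (real^'d \<Rightarrow> real) \<Rightarrow> real^'d \<Rightarrow> real^'d" where
  "weak_grad D v = (SOME g. has_weak_gradient D v g)"

text \<open>\<open>H01 D\<close> is the closure of the test functions in the \<open>H\<^sup>1\<close> norm.\<close>

definition H01 :: "(real^'d) set \<Rightarrow> (real^'d \<Rightarrow> real) set" where
  "H01 D = {v. \<exists>g \<phi>. has_weak_gradient D v g \<and> (\<forall>k::nat. test_function D (\<phi> k)) \<and>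
     (\<lambda>k. L2_norm_on D (\<lambda>x. v x - \<phi> k x)) \<longlonglongrightarrow> 0 \<and>
     (\<lambda>k. L2_norm_on D (\<lambda>x. g x - (\<chi> i. partial_deriv i (\<phi> k) x))) \<longlonglongrightarrow> 0}"

definition H01_norm :: "(real^'d) set \<Rightarrow> (real^'d \<Rightarrow> real) \<Rightarrow> real" where
  "H01_norm D v = L2_norm_on D (weak_grad D v)"

text \<open>An element of the dual space is a functional on representatives; that it does not distinguish
  representatives which agree almost everywhere follows from linearity and boundedness.\<close>

definition Hminus1 :: "(real^'d) set \<Rightarrow> ((real^'d \<Rightarrow> real) \<Rightarrow> real) set" where
  "Hminus1 D = {q.
     (\<forall>v\<in>H01 D. \<forall>w\<in>H01 D. q (\<lambda>x. v x + w x) = q v + q w) \<and>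
     (\<forall>c. \<forall>v\<in>H01 D. q (\<lambda>x. c * v x) = c * q v) \<and>
     (\<exists>B. \<forall>v\<in>H01 D. \<bar>q v\<bar> \<le> B * H01_norm D v)}"

definition Hminus1_norm :: "(real^'d) set \<Rightarrow> ((real^'d \<Rightarrow> real) \<Rightarrow> real) \<Rightarrow> real" where
  "Hminus1_norm D q = Sup {\<bar>q v\<bar> | v. v \<in> H01 D \<and> H01_norm D v \<le> 1}"


section \<open>Piecewise linear finite elements\<close>

definition nodes :: "(real^'d) set set \<Rightarrow> (real^'d) set" where
  "nodes \<T> = {z. \<exists>K\<in>\<T>. z extreme_point_of K}"

text \<open>A regular (that is, face-to-face) decomposition of the closed domain into
  nondegenerate simplices.\<close>

definition regular_triangulation :: "(real^'d) set \<Rightarrow> (real^'d) set set \<Rightarrow> bool" where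
  "regular_triangulation D \<T> \<longleftrightarrow> triangulation \<T> \<and>
     (\<forall>K\<in>\<T>. int CARD('d) simplex K) \<and> \<Union>\<T> = closure D"

text \<open>Uniform (``red'') refinement: every simplex is divided into \<open>2\<^sup>d\<close> simplices whose vertices are
  vertices or edge midpoints of the given one, among them the \<open>d + 1\<close> half-size copies at its
  corners. For \<open>d \<le> 2\<close> this determines the refinement. For \<open>d = 3\<close> it leaves
  open along which diagonal the remaining octahedron is cut into four tetrahedra.
  The case \<open>v = v'\<close> below gives the vertices of \<open>K\<close> itself.\<close>

definition uniform_partition :: "(real^'d) set set \<Rightarrow> (real^'d) set set \<Rightarrow> bool" where
  "uniform_partition \<T> \<T>' \<longleftrightarrow> triangulation \<T>' \<and>
     (\<forall>K'\<in>\<T>'. int CARD('d) simplex K' \<and> (\<exists>K\<in>\<T>. K' \<subseteq> K)) \<and>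
     (\<forall>K\<in>\<T>.
        \<Union>{K'\<in>\<T>'. K' \<subseteq> K} = K \<and>
        card {K'\<in>\<T>'. K' \<subseteq> K} = 2 ^ CARD('d) \<and>
        (\<forall>v. v extreme_point_of K \<longrightarrow> midpoint v ` K \<in> \<T>') \<and>
        (\<forall>K'\<in>\<T>'. K' \<subseteq> K \<longrightarrow> (\<forall>w. w extreme_point_of K' \<longrightarrow>
           (\<exists>v v'. v extreme_point_of K \<and> v' extreme_point_of K \<and> w = midpoint v v'))))"

definition mesh_size :: "(real^'d) set set \<Rightarrow> real" where
  "mesh_size \<T> = Max (diameter ` \<T>)"

text \<open>The nodal basis function of the node \<open>z\<close>, extended by zero.\<close>

definition hat_function :: "(real^'d) set set \<Rightarrow> real^'d \<Rightarrow> real^'d \<Rightarrow> real" where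
  "hat_function \<T> z = (THE \<phi>.
     continuous_on (\<Union>\<T>) \<phi> \<and>
     (\<forall>K\<in>\<T>. \<exists>b c. \<forall>x\<in>K. \<phi> x = b \<bullet> x + c) \<and>
     (\<forall>w\<in>nodes \<T>. \<phi> w = (if w = z then 1 else 0)) \<and>
     (\<forall>x. x \<notin> \<Union>\<T> \<longrightarrow> \<phi> x = 0))"

text \<open>The span of the basis functions of the nodes in the (open) domain \<open>D\<close>, so that all its elements
  vanish on the boundary.\<close>

definition P1_space :: "(real^'d) set \<Rightarrow> (real^'d) set set \<Rightarrow> (real^'d \<Rightarrow> real) set" where
  "P1_space D \<T> = {v. \<exists>c. v = (\<lambda>x. \<Sum>z\<in>nodes \<T> \<inter> D. c z * hat_function \<T> z x)}"

text \<open>\<open>H\<close> is the set of mesh sizes that index the family \<open>V\<close>.\<close>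

definition fe_family :: "(real^'d) set \<Rightarrow> real set \<Rightarrow> (real \<Rightarrow> (real^'d \<Rightarrow> real) set) \<Rightarrow> bool" where
  "fe_family D H V \<longleftrightarrow> (\<exists>\<T> :: nat \<Rightarrow> (real^'d) set set.
     regular_triangulation D (\<T> 0) \<and> (\<forall>k. uniform_partition (\<T> k) (\<T> (Suc k))) \<and>
     (\<forall>h\<in>H. (\<exists>k. mesh_size (\<T> k) = h \<and> V h = P1_space D (\<T> k)) \<and> V h \<subseteq> H01 D))"


section \<open>The parametric problem\<close>

text \<open>Sequences \<open>(\<psi>\<^sub>j)\<close>, \<open>(y\<^sub>j)\<close> and coordinates are indexed from 0, so that \<open>{1,\<dots>,s}\<close> becomes
  \<open>{..<s}\<close>.\<close>

definition param_set :: "(nat \<Rightarrow> real) set" where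
  "param_set = UNIV \<rightarrow> {0..1}"

definition diffusion ::
  "(real^'d \<Rightarrow> real) \<Rightarrow> (nat \<Rightarrow> real^'d \<Rightarrow> real) \<Rightarrow> real^'d \<Rightarrow> (nat \<Rightarrow> real) \<Rightarrow> real" where
  "diffusion a0 \<psi> x y = a0 x + 1 / sqrt 6 * (\<Sum>j. sin (2 * pi * y j) * \<psi> j x)"

definition fe_solution ::
  "(real^'d) set \<Rightarrow> (real^'d \<Rightarrow> real) \<Rightarrow> (real^'d \<Rightarrow> real) set \<Rightarrow>
     ((real^'d \<Rightarrow> real) \<Rightarrow> real) \<Rightarrow> (real^'d \<Rightarrow> real) \<Rightarrow> bool" where
  "fe_solution D a Vh q u \<longleftrightarrow> u \<in> Vh \<and>
     (\<forall>v\<in>Vh. (\<integral>x. a x * (weak_grad D u x \<bullet> weak_grad D v x) \<partial>lebesgue_on D) = q v)"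

definition truncate :: "nat \<Rightarrow> (nat \<Rightarrow> real) \<Rightarrow> nat \<Rightarrow> real" where
  "truncate s y j = (if j < s then y j else 0)"


section \<open>Weights\<close>

definition b_seq :: "(real^'d) set \<Rightarrow> (nat \<Rightarrow> real^'d \<Rightarrow> real) \<Rightarrow> real \<Rightarrow> nat \<Rightarrow> real" where
  "b_seq D \<psi> amin j = 1 / sqrt 6 * Linf_norm D (\<psi> j) / amin"

definition zeta_real :: "real \<Rightarrow> real" where
  "zeta_real t = (\<Sum>k. 1 / real (Suc k) powr t)"

text \<open>Both weights are meant for finite index sets, and both have value 1 at the empty set.\<close>

definition weight1 :: "nat \<Rightarrow> nat \<Rightarrow> real \<Rightarrow> (nat \<Rightarrow> real) \<Rightarrow> nat set \<Rightarrow> real" where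
  "weight1 \<alpha> \<sigma> lam b u =
     (1 / (real (max (card u) 1) * (2 * zeta_real (real \<alpha> * lam)) ^ card u) *
      (\<Sum>m \<in> u \<rightarrow>\<^sub>E {1..\<sigma>}. fact (\<Sum>j\<in>u. m j) *
         (\<Prod>j\<in>u. b j ^ m j * real (Stirling \<sigma> (m j))))\<^sup>2) powr (1 / (1 + lam))"

definition weight2 :: "nat \<Rightarrow> nat \<Rightarrow> real \<Rightarrow> (nat \<Rightarrow> real) \<Rightarrow> nat set \<Rightarrow> real" where
  "weight2 \<alpha> \<sigma> lam b u =
     (\<Sum>m \<in> u \<rightarrow>\<^sub>E {1..\<sigma>}. fact (\<Sum>j\<in>u. m j) powr (2 / (1 + lam)) *
        (\<Prod>j\<in>u. (b j ^ m j * real (Stirling \<sigma> (m j)) /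
            sqrt (2 * exp (1 / exp 1) * zeta_real (real \<alpha> * lam))) powr (2 / (1 + lam))))"


section \<open>Kernel interpolation at lattice points\<close>

text \<open>\<open>\<int>\<^sup>s\<close>, as the integer sequences that vanish from index \<open>s\<close> on.\<close>

definition Zs :: "nat \<Rightarrow> (nat \<Rightarrow> int) set" where
  "Zs s = {h. \<forall>j\<ge>s. h j = 0}"

definition r_fun :: "nat \<Rightarrow> (nat set \<Rightarrow> real) \<Rightarrow> (nat \<Rightarrow> int) \<Rightarrow> real" where
  "r_fun \<alpha> \<gamma> h = inverse (\<gamma> {j. h j \<noteq> 0}) * (\<Prod>j\<in>{j. h j \<noteq> 0}. real_of_int \<bar>h j\<bar> ^ \<alpha>)"

text \<open>The sum is real, since the terms for \<open>h\<close> and \<open>-h\<close> are conjugate.\<close>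

definition eta :: "nat \<Rightarrow> real \<Rightarrow> real" where
  "eta \<alpha> y = Re (\<Sum>\<^sub>\<infinity>h\<in>UNIV - {0::int}. cis (2 * pi * real_of_int h * y) / of_int \<bar>h\<bar> ^ \<alpha>)"

definition kernel ::
  "nat \<Rightarrow> (nat set \<Rightarrow> real) \<Rightarrow> nat \<Rightarrow> (nat \<Rightarrow> real) \<Rightarrow> (nat \<Rightarrow> real) \<Rightarrow> real" where
  "kernel \<alpha> \<gamma> s y y' = (\<Sum>u\<in>Pow {..<s}. \<gamma> u * (\<Prod>j\<in>u. eta \<alpha> (y j - y' j)))"

definition lattice_point :: "nat \<Rightarrow> (nat \<Rightarrow> nat) \<Rightarrow> nat \<Rightarrow> nat \<Rightarrow> real" where
  "lattice_point n z k j = frac (real k * real (z j) / real n)"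

definition kernel_interpolant ::
  "nat \<Rightarrow> (nat set \<Rightarrow> real) \<Rightarrow> nat \<Rightarrow> nat \<Rightarrow> (nat \<Rightarrow> nat) \<Rightarrow>
     ((nat \<Rightarrow> real) \<Rightarrow> real) \<Rightarrow> (nat \<Rightarrow> real) \<Rightarrow> real" where
  "kernel_interpolant \<alpha> \<gamma> s n z f = (THE g.
     (\<exists>c. g = (\<lambda>y. \<Sum>k=1..n. c k * kernel \<alpha> \<gamma> s (lattice_point n z k) y)) \<and>
     (\<forall>k\<in>{1..n}. g (lattice_point n z k) = f (lattice_point n z k)))"


section \<open>Component-by-component construction\<close>

definition CBC_T :: "nat \<Rightarrow> (nat set \<Rightarrow> real) \<Rightarrow> nat \<Rightarrow> nat \<Rightarrow> nat \<Rightarrow> (nat \<Rightarrow> nat) \<Rightarrow> real" where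
  "CBC_T \<alpha> \<gamma> s n d z =
     (\<Sum>\<^sub>\<infinity>h\<in>Zs s. \<Sum>\<^sub>\<infinity>l\<in>{l\<in>Zs s. int n dvd (\<Sum>j<s. l j * int (z j)) \<and> l d \<noteq> 0 \<and> (\<forall>j>d. l j = 0)}.
        1 / (r_fun \<alpha> \<gamma> h * r_fun \<alpha> \<gamma> (\<lambda>j. h j + l j)))"

text \<open>\<open>CBC_T \<dots> d z\<close> depends only on the components \<open>z 0, \<dots>, z d\<close>; each \<open>z d\<close> may be any minimizer.\<close>

definition CBC_vector :: "nat \<Rightarrow> (nat set \<Rightarrow> real) \<Rightarrow> nat \<Rightarrow> nat \<Rightarrow> (nat \<Rightarrow> nat) \<Rightarrow> bool" where
  "CBC_vector \<alpha> \<gamma> s n z \<longleftrightarrow> (\<forall>d<s. z d \<in> {1..n-1} \<and>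
     (\<forall>w\<in>{1..n-1}. CBC_T \<alpha> \<gamma> s n d z \<le> CBC_T \<alpha> \<gamma> s n d (z(d := w))))"

text \<open>The unit cube, as a product measure space; its points are extensional on \<open>{..<s}\<close>.\<close>

definition cube_measure :: "nat \<Rightarrow> (nat \<Rightarrow> real) measure" where
  "cube_measure s = Pi\<^sub>M {..<s} (\<lambda>_. restrict_space lborel {0..1})"

end

theory Submission
  imports Defs "HOL-Real_Asymp.Real_Asymp"
begin

text \<open>In an orthonormal basis \<open>\<phi>\<^sub>i\<close> of \<open>V h\<close> with respect to the \<open>H01\<close> inner product the discrete problem
  is a linear system whose matrix is affine in \<open>sin (2 \<pi> y\<^sub>j)\<close>. The Neumann series shows that the Fourier
  coefficients of its solution decay rapidly, and the recursion for the derivatives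
  bounds the kernel norm by \<open>\<Sum>u. B\<^sub>u\<^sup>2 / \<gamma>\<^sub>u\<close>, where \<open>B\<^sub>u\<close> is the sum over multi-indices that defines the weights.
  The interpolation error has vanishing Fourier sums over every residue class of \<open>h \<cdot> z\<close> modulo \<open>n\<close>, because it
  vanishes at the lattice points; so its \<open>L2\<close> norm is controlled by the kernel norm and
  by the fourth root of the lattice sum \<open>S\<close>. Averaging over the components in the CBC construction
  and Jensen's inequality bound \<open>S\<close> by a multiple of \<open>n powr - (1 / lam)\<close> that does not depend on \<open>s\<close>,
  by the choice of the weights. Interpolation acts on the coefficients of the \<open>\<phi>\<^sub>i\<close>, and the Poincare
  inequality passes from the \<open>H01\<close> norm in \<open>x\<close> to the \<open>L2\<close> norm.\<close>

text \<open>\<open>abs_summable_on\<close> refers to the notion from \<open>HOL-Analysis.Infinite_Sum\<close> throughout.\<close>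

no_notation Infinite_Set_Sum.abs_summable_on (infix "abs'_summable'_on" 50)

section \<open>Fourier series on the cube\<close>

text \<open>The functions of \<open>y\<close> are never differentiated. A mixed derivative is
  multiplication of the Fourier coefficients by \<open>ipow s \<nu> h\<close>, so the solution must
  first be known to be an absolutely convergent Fourier series, although the given \<open>uh\<close>
  carries no regularity in \<open>y\<close>: the series is built by iteration, and unique
  solvability identifies \<open>uh\<close> with it. Neither \<open>s\<close> nor the mesh may enter
  the constant. The mesh disappears because in a basis orthonormal in \<open>H01\<close> the matrix
  contributed by each \<open>\<psi> j\<close> has norm at most \<open>amin * b j\<close>, and the
  vector of values of \<open>q\<close> has norm at most \<open>Hminus1_norm D q\<close>, whatever
  the number of basis functions. The dimension survives in two sums over subsets \<open>u\<close>:
  the lattice sum favours small weights, the kernel norm large ones. With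
  \<open>lam = p / (2 - p)\<close> both are dominated by the same sum of \<open>p\<close>-th powers
  of the terms of \<open>B\<^sub>u\<close>, which stays bounded because \<open>p < 1\<close>. The
  squared error is at most of the order \<open>n powr - (1 / (2 * lam))\<close>, the square root of
  the bound for the lattice sum, and \<open>1 / (4 * lam)\<close> equals
  \<open>1 / (2 * p) - 1 / 4\<close>.\<close>

definition trig :: "nat \<Rightarrow> (nat \<Rightarrow> int) \<Rightarrow> (nat \<Rightarrow> real) \<Rightarrow> complex" where
  "trig s h y = cis (2 * pi * (\<Sum>j<s. of_int (h j) * y j))"

lemma norm_trig [simp]: "cmod (trig s h y) = 1"
  by (simp add: trig_def)

lemma trig_diff: "trig s (\<lambda>j. h j - k j) y = trig s h y * cnj (trig s k y)"
  by (simp add: trig_def cis_mult cis_cnj sum_subtractf algebra_simps)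

lemma cis_sum: "finite A \<Longrightarrow> cis (sum f A) = (\<Prod>j\<in>A. cis (f j))"
  by (induction A rule: finite_induct) (simp_all add: cis_mult[symmetric])

lemma trig_prod: "trig s h y = (\<Prod>j<s. cis (2 * pi * of_int (h j) * y j))"
  by (simp add: trig_def sum_distrib_left cis_sum mult.assoc)

lemma trig_0 [simp]: "trig s (\<lambda>_. 0) y = 1"
  by (simp add: trig_def)

abbreviation unit_measure :: "real measure" where
  "unit_measure \<equiv> restrict_space lborel {0..1}"

lemma prob_space_unit_measure: "prob_space unit_measure"
  by (rule prob_space_restrict_space) auto

lemma product_prob_space_unit: "product_prob_space (\<lambda>_. unit_measure)"
  unfolding product_prob_space_def product_prob_space_axioms_def product_sigma_finite_def
  using prob_space_unit_measure prob_space_imp_sigma_finite by blast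

lemma prob_space_cube: "prob_space (cube_measure s)"
  unfolding cube_measure_def
  by (intro prob_space_PiM prob_space_unit_measure)

lemma measurable_cis_unit [measurable]: "(\<lambda>x. cis (c * x)) \<in> borel_measurable unit_measure"
  by (rule measurable_restrict_space1)
     (auto intro!: borel_measurable_continuous_onI continuous_intros simp: measurable_lborel1)

lemma integral_cis_unit:
  "(\<integral>x. cis (2 * pi * of_int k * x) \<partial>unit_measure) = (if k = 0 then 1 else 0)"
proof (cases "k = 0")
  case True
  then show ?thesis using prob_space.prob_space[OF prob_space_unit_measure] by simp
next
  case False
  let ?a = "2 * pi * of_int k :: real"
  have a: "?a \<noteq> 0" using False by simp
  have "(\<integral>x. cis (?a * x) \<partial>unit_measure) = (\<integral>x. indicator {0..1} x *\<^sub>R cis (?a * x) \<partial>lborel)"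
    by (subst integral_restrict_space) auto
  also have "\<dots> = cis (?a * 1) / (\<i> * ?a) - cis (?a * 0) / (\<i> * ?a)"
  proof (rule integral_FTC_atLeastAtMost)
    show "continuous_on {0..1} (\<lambda>x. cis (?a * x))"
      by (intro continuous_intros)
    fix x :: real
    have "((\<lambda>x. cis (?a * x)) has_vector_derivative (\<i> * ?a) * cis (?a * x)) (at x within {0..1})"
      using exp_scaleR_has_vector_derivative_right[of "\<i> * ?a" x "{0..1}"]
      by (simp add: cis_conv_exp scaleR_conv_of_real mult_ac)
    from has_vector_derivative_divide[OF this, of "\<i> * ?a"] a
    show "((\<lambda>x. cis (?a * x) / (\<i> * ?a)) has_vector_derivative cis (?a * x)) (at x within {0..1})"
      by (simp add: scaleR_conv_of_real)
  qed simp
  also have "\<dots> = 0"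
    using cis_multiple_2pi[of "of_int k"] by simp
  finally show ?thesis using False by simp
qed

lemma integrable_cis_unit: "integrable unit_measure (\<lambda>x. cis (c * x))"
proof -
  interpret prob_space unit_measure by (rule prob_space_unit_measure)
  show ?thesis by (rule integrable_const_bound[where B=1]) auto
qed

lemma integral_trig:
  assumes "h \<in> Zs s"
  shows "(\<integral>y. trig s h y \<partial>cube_measure s) = (if h = (\<lambda>_. 0) then 1 else 0)"
proof -
  interpret product_prob_space "\<lambda>_::nat. unit_measure" by (rule product_prob_space_unit)
  have "(\<integral>y. trig s h y \<partial>cube_measure s) =
      (\<Prod>j<s. \<integral>x. cis (2 * pi * of_int (h j) * x) \<partial>unit_measure)"
    unfolding trig_prod cube_measure_def
    by (rule product_integral_prod) (auto intro: integrable_cis_unit)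
  also have "\<dots> = (\<Prod>j<s. if h j = 0 then 1 else 0)"
    by (simp only: integral_cis_unit)
  also have "\<dots> = (if \<forall>j<s. h j = 0 then 1 else 0)"
    by auto
  also have "(\<forall>j<s. h j = 0) \<longleftrightarrow> h = (\<lambda>_. 0)"
    using assms by (auto simp: Zs_def fun_eq_iff) (metis not_less)
  finally show ?thesis .
qed

lemma measurable_cnj [measurable (raw)]:
  "f \<in> borel_measurable M \<Longrightarrow> (\<lambda>x. cnj (f x)) \<in> borel_measurable M"
  by (rule measurable_compose[where N=borel and g=cnj]) (auto intro: borel_measurable_continuous_onI continuous_intros)

lemma measurable_trig [measurable]: "trig s h \<in> borel_measurable (cube_measure s)"
proof -
  have *: "(\<lambda>y. y j) \<in> borel_measurable (cube_measure s)" if "j < s" for j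
  proof -
    have "(\<lambda>y. y j) \<in> measurable (cube_measure s) unit_measure"
      unfolding cube_measure_def using that by (intro measurable_component_singleton) auto
    moreover have "(\<lambda>x. x) \<in> borel_measurable unit_measure"
      by (rule measurable_restrict_space1) auto
    ultimately show ?thesis
      using measurable_compose by blast
  qed
  show ?thesis
    unfolding trig_prod
    by (intro borel_measurable_prod measurable_compose[OF *]) (auto intro!: borel_measurable_continuous_onI continuous_intros)
qed

lemma countable_Zs: "countable (Zs s)"
proof -
  have "Zs s \<subseteq> (\<lambda>l j. if j < length l then l ! j else 0) ` (UNIV :: int list set)"
  proof
    fix h assume "h \<in> Zs s"
    then have "h = (\<lambda>j. if j < length (map h [0..<s]) then map h [0..<s] ! j else 0)"
      by (auto simp: Zs_def fun_eq_iff)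
    then show "h \<in> (\<lambda>l j. if j < length l then l ! j else 0) ` UNIV" by blast
  qed
  then show ?thesis by (rule countable_subset) auto
qed

text \<open>An enumeration of \<open>A\<close> turns the sum over an unordered index set into a
  series, to which termwise integration by dominated convergence applies. The common bound
  \<open>B\<close> for all \<open>g h\<close> reduces every convergence question to absolute
  summability of the coefficients. Finite \<open>A\<close> is treated apart because it has no
  bijection with the naturals.\<close>

lemma
  fixes c :: "'a \<Rightarrow> complex" and g :: "'a \<Rightarrow> 'b \<Rightarrow> complex"
  assumes "prob_space M" and A: "countable A" and c: "c abs_summable_on A"
    and g [measurable]: "\<And>h. h \<in> A \<Longrightarrow> g h \<in> borel_measurable M"
    and B: "\<And>h x. h \<in> A \<Longrightarrow> x \<in> space M \<Longrightarrow> cmod (g h x) \<le> B"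
  shows integrable_infsum_bounded: "integrable M (\<lambda>x. \<Sum>\<^sub>\<infinity>h\<in>A. c h * g h x)"
    and integral_infsum_bounded: "(\<integral>x. (\<Sum>\<^sub>\<infinity>h\<in>A. c h * g h x) \<partial>M) = (\<Sum>\<^sub>\<infinity>h\<in>A. c h * (\<integral>x. g h x \<partial>M))"
proof -
  interpret prob_space M by fact
  have fini: "integrable M (\<lambda>x. \<Sum>\<^sub>\<infinity>h\<in>A. c h * g h x) \<and>
    (\<integral>x. (\<Sum>\<^sub>\<infinity>h\<in>A. c h * g h x) \<partial>M) = (\<Sum>\<^sub>\<infinity>h\<in>A. c h * (\<integral>x. g h x \<partial>M))"
  proof (cases "finite A")
    case True
    have int: "integrable M (g h)" if "h \<in> A" for h
      using that B by (intro integrable_const_bound[where B=B]) auto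
    show ?thesis using True int by simp
  next
    case False
    define e where "e = from_nat_into A"
    have e: "bij_betw e UNIV A" using bij_betw_from_nat_into[OF A False] by (simp add: e_def)
    have eA: "e i \<in> A" for i using e by (auto simp: bij_betw_def)
    have int: "integrable M (g h)" if "h \<in> A" for h
      using that B by (intro integrable_const_bound[where B=B]) auto
    obtain x0 where x0: "x0 \<in> space M" using not_empty by blast
    have B0: "B \<ge> 0" using B[OF eA x0, of 0] norm_ge_zero order_trans by blast
    have sc: "summable (\<lambda>i. cmod (c (e i)))"
      using c summable_on_reindex_bij_betw[OF e, of "\<lambda>h. cmod (c h)"]
      by (auto intro: summable_on_imp_summable)
    have bnd: "cmod (c (e i) * g (e i) x) \<le> cmod (c (e i)) * B" if "x \<in> space M" for i x
      using B[OF eA that] by (auto simp: norm_mult intro: mult_left_mono)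
    have s1: "summable (\<lambda>i. cmod (c (e i) * g (e i) x))" if "x \<in> space M" for x
      by (rule summable_comparison_test'[OF summable_mult2[OF sc, of B]]) (use bnd[OF that] in auto)
    have ab: "(\<lambda>i. c (e i) * w i) abs_summable_on UNIV"
      if "\<And>i. cmod (w i) \<le> B" for w :: "nat \<Rightarrow> complex"
    proof -
      have "summable (\<lambda>i. cmod (c (e i) * w i))"
        by (rule summable_comparison_test'[OF summable_mult2[OF sc, of B]])
           (use that in \<open>auto simp: norm_mult intro: mult_left_mono\<close>)
      then show ?thesis by (simp add: summable_on_UNIV_nonneg_real_iff)
    qed
    have eq: "(\<Sum>\<^sub>\<infinity>h\<in>A. c h * w h) = (\<Sum>i. c (e i) * w (e i))" if "\<And>h. h \<in> A \<Longrightarrow> cmod (w h) \<le> B" for w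
    proof -
      have "(\<Sum>\<^sub>\<infinity>h\<in>A. c h * w h) = (\<Sum>\<^sub>\<infinity>i. c (e i) * w (e i))"
        using infsum_reindex_bij_betw[OF e, of "\<lambda>h. c h * w h"] by simp
      also have "\<dots> = (\<Sum>i. c (e i) * w (e i))"
        using that eA
        by (intro sums_unique[OF has_sum_imp_sums[OF has_sum_infsum[OF abs_summable_summable[OF ab]]]]) auto
      finally show ?thesis .
    qed
    have s2: "summable (\<lambda>i. \<integral>x. cmod (c (e i) * g (e i) x) \<partial>M)"
    proof (rule summable_comparison_test'[OF summable_mult2[OF sc, of B]])
      fix i
      have "(\<integral>x. cmod (c (e i) * g (e i) x) \<partial>M) \<le> (\<integral>x. cmod (c (e i)) * B \<partial>M)"
        by (intro integral_mono integrable_norm integrable_mult_right int eA integrable_const bnd)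
      then show "norm (\<integral>x. cmod (c (e i) * g (e i) x) \<partial>M) \<le> cmod (c (e i)) * B"
        by (simp add: prob_space)
    qed
    have int2: "\<And>i. integrable M (\<lambda>x. c (e i) * g (e i) x)"
      by (intro integrable_mult_right int eA)
    have i1: "integrable M (\<lambda>x. \<Sum>i. c (e i) * g (e i) x)"
      by (rule integrable_suminf[OF int2 AE_I2 s2]) (use s1 in auto)
    have i2: "(\<integral>x. (\<Sum>i. c (e i) * g (e i) x) \<partial>M) = (\<Sum>i. \<integral>x. c (e i) * g (e i) x \<partial>M)"
      by (rule integral_suminf[OF int2 AE_I2 s2]) (use s1 in auto)
    have ib: "cmod (\<integral>x. g h x \<partial>M) \<le> B" if "h \<in> A" for h
    proof -
      have "cmod (\<integral>x. g h x \<partial>M) \<le> (\<integral>x. cmod (g h x) \<partial>M)" by (rule integral_norm_bound)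
      also have "\<dots> \<le> (\<integral>x. B \<partial>M)" by (intro integral_mono integrable_norm int that) (auto intro: B that)
      finally show ?thesis by (simp add: prob_space)
    qed
    have c1: "integrable M (\<lambda>x. \<Sum>\<^sub>\<infinity>h\<in>A. c h * g h x)"
      using i1 by (rule Bochner_Integration.integrable_cong[THEN iffD1, rotated -1]) (auto simp: eq B)
    have "(\<integral>x. (\<Sum>\<^sub>\<infinity>h\<in>A. c h * g h x) \<partial>M) = (\<integral>x. (\<Sum>i. c (e i) * g (e i) x) \<partial>M)"
      by (intro Bochner_Integration.integral_cong) (auto simp: eq B)
    also have "\<dots> = (\<Sum>\<^sub>\<infinity>h\<in>A. c h * (\<integral>x. g h x \<partial>M))"
      by (simp add: i2 eq ib)
    finally show ?thesis using c1 by blast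
  qed
  then show "integrable M (\<lambda>x. \<Sum>\<^sub>\<infinity>h\<in>A. c h * g h x)"
    and "(\<integral>x. (\<Sum>\<^sub>\<infinity>h\<in>A. c h * g h x) \<partial>M) = (\<Sum>\<^sub>\<infinity>h\<in>A. c h * (\<integral>x. g h x \<partial>M))" by auto
qed

text \<open>The argument may be any sequence, since \<open>trig\<close> reads only its first
  \<open>s\<close> entries. Thus the series can be evaluated at lattice points, which are not
  extensional as the points of \<open>cube_measure s\<close> are.\<close>

definition fseries :: "nat \<Rightarrow> ((nat \<Rightarrow> int) \<Rightarrow> complex) \<Rightarrow> (nat \<Rightarrow> real) \<Rightarrow> complex" where
  "fseries s c y = (\<Sum>\<^sub>\<infinity>h\<in>Zs s. c h * trig s h y)"

lemma abs_summable_times_bounded: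
  fixes c w :: "'a \<Rightarrow> complex"
  assumes "c abs_summable_on A" "\<And>h. h \<in> A \<Longrightarrow> cmod (w h) \<le> B"
  shows "(\<lambda>h. c h * w h) abs_summable_on A"
proof (rule Infinite_Sum.abs_summable_on_comparison_test')
  show "(\<lambda>h. cmod (c h) * B) summable_on A" using assms(1) by (rule summable_on_cmult_left)
  show "cmod (c h * w h) \<le> cmod (c h) * B" if "h \<in> A" for h
    using assms(2)[OF that] by (simp add: norm_mult mult_left_mono)
qed

lemma abs_summable_fseries:
  "c abs_summable_on Zs s \<Longrightarrow> (\<lambda>h. c h * trig s h y) abs_summable_on Zs s"
  by (rule abs_summable_times_bounded[where B=1]) auto

lemma fseries_bound:
  assumes "c abs_summable_on Zs s"
  shows "cmod (fseries s c y) \<le> (\<Sum>\<^sub>\<infinity>h\<in>Zs s. cmod (c h))"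
  unfolding fseries_def
  using norm_infsum_bound[OF abs_summable_fseries[OF assms, of y]] by (simp add: norm_mult)

lemma integrable_fseries:
  "c abs_summable_on Zs s \<Longrightarrow> integrable (cube_measure s) (fseries s c)"
  unfolding fseries_def
  by (rule integrable_infsum_bounded[OF prob_space_cube countable_Zs, where B=1]) auto

lemma trig_orthogonal:
  assumes "h \<in> Zs s" "k \<in> Zs s"
  shows "(\<integral>y. trig s h y * cnj (trig s k y) \<partial>cube_measure s) = (if h = k then 1 else 0)"
proof -
  have "(\<lambda>j. h j - k j) \<in> Zs s" using assms by (auto simp: Zs_def)
  from integral_trig[OF this] show ?thesis
    by (simp add: trig_diff fun_eq_iff)
qed

lemma fseries_coeff:
  assumes c: "c abs_summable_on Zs s" and k: "k \<in> Zs s"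
  shows "(\<integral>y. fseries s c y * cnj (trig s k y) \<partial>cube_measure s) = c k"
proof -
  have "fseries s c y * cnj (trig s k y) = (\<Sum>\<^sub>\<infinity>h\<in>Zs s. c h * (trig s h y * cnj (trig s k y)))" for y
    unfolding fseries_def by (subst infsum_cmult_left'[symmetric]) (simp add: mult.assoc)
  then have "(\<integral>y. fseries s c y * cnj (trig s k y) \<partial>cube_measure s) =
     (\<integral>y. (\<Sum>\<^sub>\<infinity>h\<in>Zs s. c h * (trig s h y * cnj (trig s k y))) \<partial>cube_measure s)" by simp
  also have "\<dots> = (\<Sum>\<^sub>\<infinity>h\<in>Zs s. c h * (\<integral>y. trig s h y * cnj (trig s k y) \<partial>cube_measure s))"
    by (rule integral_infsum_bounded[OF prob_space_cube countable_Zs c, where B=1])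
       (auto simp: norm_mult)
  also have "\<dots> = (\<Sum>\<^sub>\<infinity>h\<in>Zs s. if h = k then c k else 0)"
    by (intro infsum_cong) (auto simp: trig_orthogonal k)
  also have "\<dots> = c k"
    by (subst infsum_cong_neutral[where T="{k}" and g="\<lambda>_. c k"]) (use k in auto)
  finally show ?thesis .
qed

text \<open>Only one factor of \<open>f * cnj f\<close> is expanded. Termwise integration is then
  legitimate because the other factor is bounded by the sum of the absolute coefficients, and each
  remaining integral is a Fourier coefficient.\<close>

lemma parseval_fseries:
  assumes c: "c abs_summable_on Zs s"
  shows "(\<lambda>h. (cmod (c h))\<^sup>2) summable_on Zs s"
    and "(\<integral>y. (cmod (fseries s c y))\<^sup>2 \<partial>cube_measure s) = (\<Sum>\<^sub>\<infinity>h\<in>Zs s. (cmod (c h))\<^sup>2)"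
proof -
  define B where "B = (\<Sum>\<^sub>\<infinity>h\<in>Zs s. cmod (c h))"
  have cB: "cmod (c h) \<le> B" if "h \<in> Zs s" for h
    using finite_sum_le_infsum[OF c, of "{h}"] that by (simp add: B_def)
  have cc: "(\<lambda>h. c h * cnj (c h)) abs_summable_on Zs s"
    by (rule abs_summable_times_bounded[OF c]) (use cB in auto)
  then show s: "(\<lambda>h. (cmod (c h))\<^sup>2) summable_on Zs s"
    by (simp add: norm_mult power2_eq_square)
  have cn: "(\<lambda>h. cnj (c h)) abs_summable_on Zs s" using c by simp
  have [measurable]: "fseries s c \<in> borel_measurable (cube_measure s)"
    using integrable_fseries[OF c] by auto
  have "of_real ((cmod (fseries s c y))\<^sup>2) =
      (\<Sum>\<^sub>\<infinity>h\<in>Zs s. cnj (c h) * (fseries s c y * cnj (trig s h y)))" for y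
  proof -
    have "of_real ((cmod (fseries s c y))\<^sup>2) = fseries s c y * cnj (fseries s c y)"
      by (metis complex_norm_square)
    also have "cnj (fseries s c y) = (\<Sum>\<^sub>\<infinity>h\<in>Zs s. cnj (c h) * cnj (trig s h y))"
      by (subst fseries_def, subst infsum_cnj[symmetric]) simp
    finally show ?thesis
      by (subst (asm) infsum_cmult_right'[symmetric]) (simp add: algebra_simps)
  qed
  then have "(\<integral>y. complex_of_real ((cmod (fseries s c y))\<^sup>2) \<partial>cube_measure s) =
      (\<Sum>\<^sub>\<infinity>h\<in>Zs s. cnj (c h) * (\<integral>y. fseries s c y * cnj (trig s h y) \<partial>cube_measure s))"
    by (simp only:) (rule integral_infsum_bounded[OF prob_space_cube countable_Zs cn, where B=B],
       auto simp: norm_mult B_def fseries_bound[OF c])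
  also have "\<dots> = (\<Sum>\<^sub>\<infinity>h\<in>Zs s. of_real ((cmod (c h))\<^sup>2))"
    by (intro infsum_cong) (simp add: fseries_coeff[OF c] complex_norm_square mult.commute del: of_real_power)
  also have "\<dots> = of_real (\<Sum>\<^sub>\<infinity>h\<in>Zs s. (cmod (c h))\<^sup>2)"
    by (rule infsumI has_sum_of_real has_sum_infsum s)+
  finally show "(\<integral>y. (cmod (fseries s c y))\<^sup>2 \<partial>cube_measure s) = (\<Sum>\<^sub>\<infinity>h\<in>Zs s. (cmod (c h))\<^sup>2)"
    by (subst (asm) integral_complex_of_real) (simp only: of_real_eq_iff)
qed

section \<open>Kernel interpolation at lattice points\<close>

abbreviation supp :: "(nat \<Rightarrow> int) \<Rightarrow> nat set" where "supp h \<equiv> {j. h j \<noteq> 0}"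

section \<open>Sums over frequencies grouped by their support\<close>

lemma abs_summable_prod_PiE:
  fixes f :: "'i \<Rightarrow> 'a \<Rightarrow> 'b::{real_normed_field}"
  assumes "finite u" and f: "\<And>j. j \<in> u \<Longrightarrow> f j abs_summable_on B j"
  shows "(\<lambda>g. \<Prod>j\<in>u. f j (g j)) abs_summable_on PiE u B"
proof (rule nonneg_bdd_above_summable_on)
  show "bdd_above (sum (\<lambda>g. norm (\<Prod>j\<in>u. f j (g j))) ` {F. F \<subseteq> PiE u B \<and> finite F})"
  proof (rule bdd_aboveI2)
    fix F assume "F \<in> {F. F \<subseteq> PiE u B \<and> finite F}"
    then have F: "F \<subseteq> PiE u B" "finite F" by auto
    \<comment> \<open>The finite set \<open>F\<close> is contained in the product of its coordinate
      projections, and over that product the sum factorises.\<close>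
    let ?B = "\<lambda>j. (\<lambda>g. g j) ` F"
    have "(\<Sum>g\<in>F. norm (\<Prod>j\<in>u. f j (g j))) \<le> (\<Sum>g\<in>PiE u ?B. \<Prod>j\<in>u. norm (f j (g j)))"
      unfolding prod_norm[symmetric]
      using F \<open>finite u\<close> by (intro sum_mono2 finite_PiE) (auto simp: PiE_iff intro: prod_nonneg)
    also have "\<dots> = (\<Prod>j\<in>u. \<Sum>a\<in>?B j. norm (f j a))"
      using F \<open>finite u\<close> by (subst prod_sum_PiE) auto
    also have "\<dots> \<le> (\<Prod>j\<in>u. \<Sum>\<^sub>\<infinity>a\<in>B j. norm (f j a))"
      using F by (intro prod_mono conjI finite_sum_le_infsum f sum_nonneg) (auto simp: PiE_iff)
    finally show "(\<Sum>g\<in>F. norm (\<Prod>j\<in>u. f j (g j))) \<le> (\<Prod>j\<in>u. \<Sum>\<^sub>\<infinity>a\<in>B j. norm (f j a))" .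
  qed
qed auto

lemma bij_betw_supp:
  "bij_betw (\<lambda>g j. if j \<in> u then g j else 0) (PiE u (\<lambda>_. UNIV - {0})) {h. supp h = u}"
proof (rule bij_betw_byWitness[where f' = "\<lambda>h. restrict h u"])
  show "\<forall>g\<in>PiE u (\<lambda>_. UNIV - {0::int}). restrict (\<lambda>j. if j \<in> u then g j else 0) u = g"
    by (auto intro!: ext simp: PiE_iff extensional_def)
  show "\<forall>h\<in>{h. supp h = u}. (\<lambda>j. if j \<in> u then restrict h u j else 0) = h"
    by (auto intro!: ext)
  show "(\<lambda>g j. if j \<in> u then g j else 0) ` PiE u (\<lambda>_. UNIV - {0}) \<subseteq> {h. supp h = u}"
    by (auto simp: PiE_iff)
  show "(\<lambda>h. restrict h u) ` {h. supp h = u} \<subseteq> PiE u (\<lambda>_. UNIV - {0})"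
    by auto
qed

lemma
  fixes w :: "nat \<Rightarrow> int \<Rightarrow> 'a::{banach,real_normed_field}"
  assumes u: "finite u" and w: "\<And>j. j \<in> u \<Longrightarrow> w j abs_summable_on UNIV - {0}"
  shows abs_summable_supp: "(\<lambda>h. \<Prod>j\<in>u. w j (h j)) abs_summable_on {h. supp h = u}"
    and infsum_supp: "(\<Sum>\<^sub>\<infinity>h\<in>{h. supp h = u}. \<Prod>j\<in>u. w j (h j)) = (\<Prod>j\<in>u. \<Sum>\<^sub>\<infinity>a\<in>UNIV - {0}. w j a)"
proof -
  have eq: "(\<Prod>j\<in>u. w j (if j \<in> u then g j else 0)) = (\<Prod>j\<in>u. w j (g j))" for g :: "nat \<Rightarrow> int"
    by (intro prod.cong) auto
  show "(\<lambda>h. \<Prod>j\<in>u. w j (h j)) abs_summable_on {h. supp h = u}"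
    by (subst summable_on_reindex_bij_betw[OF bij_betw_supp, symmetric])
       (use abs_summable_prod_PiE[OF u w] in \<open>simp add: eq\<close>)
  show "(\<Sum>\<^sub>\<infinity>h\<in>{h. supp h = u}. \<Prod>j\<in>u. w j (h j)) = (\<Prod>j\<in>u. \<Sum>\<^sub>\<infinity>a\<in>UNIV - {0}. w j a)"
    by (subst infsum_reindex_bij_betw[OF bij_betw_supp, symmetric])
       (use infsum_prod_PiE_abs[OF u w] in \<open>simp add: eq\<close>)
qed

lemma Zs_eq_UN: "Zs s = (\<Union>u\<in>Pow {..<s}. {h. supp h = u})"
proof -
  have "(\<forall>j\<ge>s. h j = 0) \<longleftrightarrow> supp h \<subseteq> {..<s}" for h :: "nat \<Rightarrow> int"
    unfolding subset_eq mem_Collect_eq lessThan_iff Ball_def by (metis not_le)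
  then show ?thesis by (intro set_eqI) (simp add: Zs_def)
qed

lemma supp_Zs: "h \<in> Zs s \<Longrightarrow> supp h \<subseteq> {..<s}" "h \<in> Zs s \<Longrightarrow> finite (supp h)"
proof -
  show "h \<in> Zs s \<Longrightarrow> supp h \<subseteq> {..<s}" by (auto simp: Zs_eq_UN)
  then show "h \<in> Zs s \<Longrightarrow> finite (supp h)" using finite_subset by blast
qed

lemma
  fixes f :: "(nat \<Rightarrow> int) \<Rightarrow> 'a::banach"
  assumes "\<And>u. u \<subseteq> {..<s} \<Longrightarrow> f abs_summable_on {h. supp h = u}"
  shows abs_summable_Zs: "f abs_summable_on Zs s"
    and infsum_Zs: "infsum f (Zs s) = (\<Sum>u\<in>Pow {..<s}. infsum f {h. supp h = u})"
proof -
  show "f abs_summable_on Zs s"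
    unfolding Zs_eq_UN using assms by (intro summable_on_finite_union_disjoint) auto
  show "infsum f (Zs s) = (\<Sum>u\<in>Pow {..<s}. infsum f {h. supp h = u})"
    unfolding Zs_eq_UN using assms by (intro sum_infsum[symmetric]) (auto intro: abs_summable_summable)
qed

text \<open>The kernel and the sums over powers of \<open>1 / r_fun\<close> all have terms of this
  shape: a factor that depends on the support alone, times one-dimensional factors. Grouping by
  support turns a sum over frequencies into a finite sum over subsets, and this is how the weights
  of subsets come back in.\<close>

lemma
  fixes w :: "nat \<Rightarrow> int \<Rightarrow> 'a::{banach,real_normed_field}" and c :: "nat set \<Rightarrow> 'a"
  assumes w: "\<And>j. j < s \<Longrightarrow> w j abs_summable_on UNIV - {0}"
  shows abs_summable_Zs_prod: "(\<lambda>h. c (supp h) * (\<Prod>j\<in>supp h. w j (h j))) abs_summable_on Zs s"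
    and infsum_Zs_prod: "(\<Sum>\<^sub>\<infinity>h\<in>Zs s. c (supp h) * (\<Prod>j\<in>supp h. w j (h j))) =
      (\<Sum>u\<in>Pow {..<s}. c u * (\<Prod>j\<in>u. \<Sum>\<^sub>\<infinity>a\<in>UNIV - {0}. w j a))"
proof -
  have 1: "(\<lambda>h. c (supp h) * (\<Prod>j\<in>supp h. w j (h j))) abs_summable_on {h. supp h = u}"
    if "u \<subseteq> {..<s}" for u
  proof -
    have "(\<lambda>h. c u * (\<Prod>j\<in>u. w j (h j))) abs_summable_on {h. supp h = u}"
      unfolding norm_mult using that
      by (intro summable_on_cmult_right abs_summable_supp w) (auto intro: finite_subset)
    then show ?thesis
      by (rule summable_on_cong[THEN iffD1, rotated]) auto
  qed
  then show "(\<lambda>h. c (supp h) * (\<Prod>j\<in>supp h. w j (h j))) abs_summable_on Zs s"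
    by (rule abs_summable_Zs)
  have "(\<Sum>\<^sub>\<infinity>h\<in>{h. supp h = u}. c (supp h) * (\<Prod>j\<in>supp h. w j (h j))) =
      c u * (\<Prod>j\<in>u. \<Sum>\<^sub>\<infinity>a\<in>UNIV - {0}. w j a)" if "u \<subseteq> {..<s}" for u
  proof -
    have fu: "finite u" using that by (auto intro: finite_subset)
    have w': "\<And>j. j \<in> u \<Longrightarrow> w j abs_summable_on UNIV - {0}" using that w by auto
    have "(\<Sum>\<^sub>\<infinity>h\<in>{h. supp h = u}. c (supp h) * (\<Prod>j\<in>supp h. w j (h j))) =
        (\<Sum>\<^sub>\<infinity>h\<in>{h. supp h = u}. c u * (\<Prod>j\<in>u. w j (h j)))"
      by (intro infsum_cong) auto
    also have "\<dots> = c u * (\<Prod>j\<in>u. \<Sum>\<^sub>\<infinity>a\<in>UNIV - {0}. w j a)"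
      by (simp add: infsum_cmult_right' infsum_supp[OF fu w'])
    finally show ?thesis .
  qed
  then show "(\<Sum>\<^sub>\<infinity>h\<in>Zs s. c (supp h) * (\<Prod>j\<in>supp h. w j (h j))) =
      (\<Sum>u\<in>Pow {..<s}. c u * (\<Prod>j\<in>u. \<Sum>\<^sub>\<infinity>a\<in>UNIV - {0}. w j a))"
    by (subst infsum_Zs[OF 1]) auto
qed

section \<open>The zeta function and the reciprocals of \<open>r_fun\<close>\<close>

lemma summable_zeta:
  assumes "1 < t"
  shows "summable (\<lambda>k. 1 / real (Suc k) powr t)"
proof -
  have "summable (\<lambda>n. real n powr - t)"
    using assms by (simp add: summable_real_powr_iff)
  then have "summable (\<lambda>n. real (Suc n) powr - t)"
    by (rule summable_Suc_iff[THEN iffD2])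
  then show ?thesis by (simp only: powr_minus_divide)
qed

lemma zeta_ge_1:
  assumes "1 < t"
  shows "1 \<le> zeta_real t"
proof -
  have "(\<Sum>k\<in>{0}. 1 / real (Suc k) powr t) \<le> (\<Sum>k. 1 / real (Suc k) powr t)"
    by (rule sum_le_suminf[OF summable_zeta[OF assms]]) auto
  then show ?thesis by (simp add: zeta_real_def)
qed

lemma has_sum_int_powr:
  assumes t: "1 < t"
  shows "((\<lambda>a::int. \<bar>of_int a\<bar> powr - t) has_sum 2 * zeta_real t) (UNIV - {0})"
proof -
  have 0: "((\<lambda>k. 1 / real (Suc k) powr t) has_sum zeta_real t) UNIV"
    unfolding zeta_real_def using summable_zeta[OF t]
    by (intro norm_summable_imp_has_sum summable_sums) auto
  have 1: "((\<lambda>a::int. \<bar>of_int a\<bar> powr - t) has_sum zeta_real t) {0<..}"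
    by (subst has_sum_reindex_bij_witness[where i = "\<lambda>k. int k + 1" and j = "\<lambda>a. nat (a - 1)"
           and T = UNIV and h = "\<lambda>k. 1 / real (Suc k) powr t", OF _ _ _ _ _ refl])
       (use 0 in \<open>auto simp: powr_minus_divide add.commute\<close>)
  have 2: "((\<lambda>a::int. \<bar>of_int a\<bar> powr - t) has_sum zeta_real t) {..<0}"
    by (subst has_sum_reindex_bij_witness[where i = "\<lambda>a. - a" and j = "\<lambda>a. - a"
           and T = "{0<..}" and h = "\<lambda>a::int. \<bar>of_int a\<bar> powr - t", OF _ _ _ _ _ refl]) (use 1 in auto)
  have 3: "{0<..} \<union> {..<0} = (UNIV - {0} :: int set)" "{0<..} \<inter> {..<0} = ({} :: int set)" by auto
  show ?thesis using has_sum_Un_disjoint[OF 1 2 3(2)] unfolding 3(1) mult_2 .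
qed

lemma r_fun_pos:
  assumes "h \<in> Zs s" "\<And>u. finite u \<Longrightarrow> 0 < \<gamma> u"
  shows "0 < r_fun \<alpha> \<gamma> h"
  unfolding r_fun_def using assms(2)[OF supp_Zs(2)[OF assms(1)]]
  by (intro mult_pos_pos prod_pos) auto

lemma inverse_r_fun:
  "1 / r_fun \<alpha> \<gamma> h = \<gamma> (supp h) * (\<Prod>j\<in>supp h. 1 / real_of_int \<bar>h j\<bar> ^ \<alpha>)"
proof -
  have "1 / (inverse g * P) = g * (1 / P)" for g P :: real
    by (simp add: inverse_eq_divide)
  then show ?thesis by (simp only: r_fun_def prod_dividef prod.neutral_const)
qed

lemma inverse_r_fun_powr:
  assumes "\<gamma> (supp h) \<ge> 0"
  shows "(1 / r_fun \<alpha> \<gamma> h) powr lam =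
    \<gamma> (supp h) powr lam * (\<Prod>j\<in>supp h. \<bar>real_of_int (h j)\<bar> powr - (real \<alpha> * lam))"
proof -
  have "(1 / \<bar>real_of_int a\<bar> ^ \<alpha>) powr lam = \<bar>real_of_int a\<bar> powr - (real \<alpha> * lam)" if "a \<noteq> 0" for a :: int
    using that by (simp add: powr_realpow[symmetric] powr_minus_divide powr_divide powr_powr)
  then show ?thesis
    unfolding inverse_r_fun using assms
    by (simp add: powr_mult prod_nonneg prod_powr_distrib)
qed

lemma abs_summable_inverse_power:
  assumes "2 \<le> \<alpha>"
  shows "(\<lambda>a. of_real (1 / real_of_int \<bar>a\<bar> ^ \<alpha>) :: 'a::real_normed_field) abs_summable_on UNIV - {0}"
proof -
  have "(\<lambda>a::int. \<bar>of_int a\<bar> powr - real \<alpha>) summable_on UNIV - {0}"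
    using has_sum_int_powr[of "real \<alpha>"] assms by (auto simp: summable_on_def)
  then show ?thesis
    by (rule summable_on_cong[THEN iffD1, rotated])
       (auto simp: powr_minus_divide powr_realpow norm_divide norm_power)
qed

lemma abs_summable_eta:
  assumes "2 \<le> \<alpha>"
  shows "(\<lambda>a. cis (2 * pi * real_of_int a * y) / of_int \<bar>a\<bar> ^ \<alpha>) abs_summable_on UNIV - {0}"
  using abs_summable_inverse_power[OF assms, where 'a=complex]
  by (simp add: norm_divide norm_power del: of_int_abs)

lemma of_real_eta:
  "complex_of_real (eta \<alpha> y) = (\<Sum>\<^sub>\<infinity>h\<in>UNIV - {0::int}. cis (2 * pi * real_of_int h * y) / of_int \<bar>h\<bar> ^ \<alpha>)"
  (is "_ = ?S")
proof -
  have "cnj ?S = (\<Sum>\<^sub>\<infinity>h\<in>UNIV - {0::int}. cnj (cis (2 * pi * real_of_int h * y) / of_int \<bar>h\<bar> ^ \<alpha>))"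
    by (rule infsum_cnj[symmetric])
  also have "\<dots> = ?S"
    by (rule infsum_reindex_bij_witness[where i = uminus and j = uminus]) (auto simp: cis_cnj)
  finally have "?S \<in> \<real>" by (simp add: Reals_cnj_iff)
  then show ?thesis by (simp add: eta_def of_real_Re)
qed

lemma abs_summable_inverse_r:
  assumes "2 \<le> \<alpha>"
  shows "(\<lambda>h. complex_of_real (1 / r_fun \<alpha> \<gamma> h)) abs_summable_on Zs s"
  using abs_summable_Zs_prod[of s "\<lambda>_ a. complex_of_real (1 / real_of_int \<bar>a\<bar> ^ \<alpha>)" "\<lambda>u. complex_of_real (\<gamma> u)",
      OF abs_summable_inverse_power[OF assms]]
  by (simp only: inverse_r_fun of_real_mult of_real_prod)

text \<open>The kernel is defined with the difference \<open>t - y\<close>, whose expansion carries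
  the conjugate on the factor in \<open>y\<close>. Evenness of \<open>eta\<close> exchanges the
  roles, so that a kernel section is a Fourier series in \<open>y\<close> and the conjugate sits at
  the node \<open>t\<close>.\<close>

lemma kernel_eq:
  assumes \<alpha>: "2 \<le> \<alpha>"
  shows "complex_of_real (kernel \<alpha> \<gamma> s t y) =
    (\<Sum>\<^sub>\<infinity>h\<in>Zs s. of_real (1 / r_fun \<alpha> \<gamma> h) * cnj (trig s h t) * trig s h y)"
proof -
  have "kernel \<alpha> \<gamma> s t y = kernel \<alpha> \<gamma> s y t"
  proof -
    have "eta \<alpha> (- x) = eta \<alpha> x" for x
    proof -
      have "complex_of_real (eta \<alpha> (- x)) = of_real (eta \<alpha> x)"
        unfolding of_real_eta
        by (rule infsum_reindex_bij_witness[where i = uminus and j = uminus]) auto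
      then show ?thesis by simp
    qed
    from this[of "t _ - y _"] show ?thesis by (simp add: kernel_def)
  qed
  then have "complex_of_real (kernel \<alpha> \<gamma> s t y) =
     (\<Sum>u\<in>Pow {..<s}. of_real (\<gamma> u) * (\<Prod>j\<in>u. \<Sum>\<^sub>\<infinity>h\<in>UNIV - {0::int}. cis (2 * pi * real_of_int h * (y j - t j)) / of_int \<bar>h\<bar> ^ \<alpha>))"
    by (simp add: kernel_def of_real_eta[symmetric])
  also have "\<dots> = (\<Sum>\<^sub>\<infinity>h\<in>Zs s. of_real (\<gamma> (supp h)) * (\<Prod>j\<in>supp h. cis (2 * pi * real_of_int (h j) * (y j - t j)) / of_int \<bar>h j\<bar> ^ \<alpha>))"
    by (rule infsum_Zs_prod[symmetric]) (rule abs_summable_eta[OF \<alpha>])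
  also have "\<dots> = (\<Sum>\<^sub>\<infinity>h\<in>Zs s. of_real (1 / r_fun \<alpha> \<gamma> h) * cnj (trig s h t) * trig s h y)"
  proof (rule infsum_cong)
    fix h assume h: "h \<in> Zs s"
    have "cnj (trig s h t) * trig s h y = cis (\<Sum>j<s. 2 * pi * real_of_int (h j) * (y j - t j))"
      by (simp add: trig_def cis_cnj cis_mult sum_distrib_left sum_subtractf right_diff_distrib mult.assoc)
    also have "(\<Sum>j<s. 2 * pi * real_of_int (h j) * (y j - t j)) = (\<Sum>j\<in>supp h. 2 * pi * real_of_int (h j) * (y j - t j))"
      using supp_Zs[OF h] by (intro sum.mono_neutral_right) auto
    finally show "of_real (\<gamma> (supp h)) * (\<Prod>j\<in>supp h. cis (2 * pi * real_of_int (h j) * (y j - t j)) / of_int \<bar>h j\<bar> ^ \<alpha>) =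
       of_real (1 / r_fun \<alpha> \<gamma> h) * cnj (trig s h t) * trig s h y"
      using supp_Zs[OF h]
      by (simp add: inverse_r_fun cis_sum prod_dividef mult.assoc del: of_int_abs)
  qed
  finally show ?thesis .
qed

lemma
  fixes f :: "'i \<Rightarrow> 'a \<Rightarrow> 'b::{topological_comm_monoid_add,t2_space}"
  assumes "\<And>i. i \<in> I \<Longrightarrow> f i summable_on A"
  shows summable_on_sum: "(\<lambda>x. \<Sum>i\<in>I. f i x) summable_on A"
    and infsum_sum: "(\<Sum>\<^sub>\<infinity>x\<in>A. \<Sum>i\<in>I. f i x) = (\<Sum>i\<in>I. infsum (f i) A)"
proof -
  have "(\<lambda>x. \<Sum>i\<in>I. f i x) summable_on A \<and>
     (\<Sum>\<^sub>\<infinity>x\<in>A. \<Sum>i\<in>I. f i x) = (\<Sum>i\<in>I. infsum (f i) A)"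
    using assms
  proof (induction I rule: infinite_finite_induct)
    case (insert i I)
    then show ?case by (simp add: summable_on_add infsum_add)
  qed simp_all
  then show "(\<lambda>x. \<Sum>i\<in>I. f i x) summable_on A"
    "(\<Sum>\<^sub>\<infinity>x\<in>A. \<Sum>i\<in>I. f i x) = (\<Sum>i\<in>I. infsum (f i) A)" by auto
qed

lemma infsum_Cauchy_Schwarz:
  fixes x y :: "'a \<Rightarrow> real"
  assumes x: "(\<lambda>i. (x i)\<^sup>2) summable_on A" and y: "(\<lambda>i. (y i)\<^sup>2) summable_on A"
    and nn: "\<And>i. i \<in> A \<Longrightarrow> 0 \<le> x i * y i"
  shows "(\<lambda>i. x i * y i) summable_on A"
    and "(\<Sum>\<^sub>\<infinity>i\<in>A. x i * y i)\<^sup>2 \<le> (\<Sum>\<^sub>\<infinity>i\<in>A. (x i)\<^sup>2) * (\<Sum>\<^sub>\<infinity>i\<in>A. (y i)\<^sup>2)"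
proof -
  let ?X = "\<Sum>\<^sub>\<infinity>i\<in>A. (x i)\<^sup>2" and ?Y = "\<Sum>\<^sub>\<infinity>i\<in>A. (y i)\<^sup>2"
  have fin: "(\<Sum>i\<in>F. x i * y i) \<le> sqrt (?X * ?Y)" if F: "finite F" "F \<subseteq> A" for F
  proof (rule real_le_rsqrt)
    have "(\<Sum>i\<in>F. x i * y i)\<^sup>2 \<le> (\<Sum>i\<in>F. (x i)\<^sup>2) * (\<Sum>i\<in>F. (y i)\<^sup>2)"
      by (rule Cauchy_Schwarz_ineq_sum)
    also have "\<dots> \<le> ?X * ?Y"
      using F by (intro mult_mono finite_sum_le_infsum x y sum_nonneg infsum_nonneg) auto
    finally show "(\<Sum>i\<in>F. x i * y i)\<^sup>2 \<le> ?X * ?Y" .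
  qed
  show s: "(\<lambda>i. x i * y i) summable_on A"
  proof (rule nonneg_bdd_above_summable_on[OF nn])
    show "bdd_above (sum (\<lambda>i. x i * y i) ` {F. F \<subseteq> A \<and> finite F})"
      by (rule bdd_aboveI2[where M = "sqrt (?X * ?Y)"]) (use fin in blast)
  qed
  have "(\<Sum>\<^sub>\<infinity>i\<in>A. x i * y i) \<le> sqrt (?X * ?Y)"
    by (rule infsum_le_finite_sums[OF s fin])
  then have "(\<Sum>\<^sub>\<infinity>i\<in>A. x i * y i)\<^sup>2 \<le> (sqrt (?X * ?Y))\<^sup>2"
    by (intro power_mono infsum_nonneg nn)
  also have "\<dots> = ?X * ?Y"
    by (intro real_sqrt_pow2 mult_nonneg_nonneg infsum_nonneg) auto
  finally show "(\<Sum>\<^sub>\<infinity>i\<in>A. x i * y i)\<^sup>2 \<le> ?X * ?Y" .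
qed

section \<open>Discrete orthogonality modulo n\<close>

text \<open>For fixed \<open>k\<close> this is a character of the integers modulo \<open>n\<close>.
  The value of \<open>trig s h\<close> at the \<open>k\<close>-th lattice point has this form, with
  \<open>m\<close> the scalar product of \<open>h\<close> and the generating vector.\<close>

definition unity_root :: "nat \<Rightarrow> nat \<Rightarrow> int \<Rightarrow> complex" where
  "unity_root n k m = cis (2 * pi * (real k * of_int m / real n))"

lemma norm_unity_root [simp]: "cmod (unity_root n k m) = 1"
  by (simp add: unity_root_def)

lemma unity_root_cong:
  assumes "n > 0" "int n dvd a - b"
  shows "unity_root n k a = unity_root n k b"
proof -
  obtain q where q: "a = b + int n * q" using assms(2) by (auto simp: dvd_def algebra_simps)
  have "2 * pi * (real k * of_int a / real n) = 2 * pi * (real k * of_int b / real n) + 2 * pi * of_int (int k * q)"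
    using assms(1) by (simp add: q field_simps)
  then show ?thesis
    using cis_multiple_2pi[of "of_int (int k * q)"] by (simp only: unity_root_def cis_mult[symmetric]) simp
qed

lemma unity_root_sum_k:
  assumes n: "n > 0"
  shows "(\<Sum>k=1..n. unity_root n k a * cnj (unity_root n k b)) = (if int n dvd a - b then of_nat n else 0)"
proof -
  define w where "w = cis (2 * pi * (of_int (a - b) / real n))"
  have eq: "unity_root n k a * cnj (unity_root n k b) = w ^ k" for k
    unfolding unity_root_def w_def cis_cnj cis_mult Complex.DeMoivre
    by (intro arg_cong[where f = cis]) (use n in \<open>simp add: field_simps\<close>)
  have wn: "w ^ n = 1"
  proof -
    have "real n * (2 * pi * (of_int (a - b) / real n)) = 2 * pi * of_int (a - b)"
      using n by simp
    then show ?thesis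
      unfolding w_def Complex.DeMoivre using cis_multiple_2pi[of "of_int (a - b)"] by (simp only: Ints_of_int)
  qed
  show ?thesis
  proof (cases "int n dvd a - b")
    case True
    then obtain q where q: "a - b = int n * q" by (auto simp: dvd_def)
    have "w = 1"
      unfolding w_def q using n cis_multiple_2pi[of "of_int q"] by simp
    then show ?thesis using True by (simp add: eq)
  next
    case False
    have "w \<noteq> 1"
    proof
      assume "w = 1"
      then have "cos (2 * pi * (of_int (a - b) / real n)) = 1"
        by (simp add: w_def complex_eq_iff)
      then obtain q :: int where "2 * pi * (of_int (a - b) / real n) = of_int q * 2 * pi"
        unfolding cos_one_2pi_int by blast
      then have "2 * pi * (of_int (a - b) / real n) = 2 * pi * of_int q"
        by (simp only: mult_ac)
      then have "of_int (a - b) / real n = of_int q"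
        by (simp only: mult_cancel_left) simp
      then have "real_of_int (a - b) = of_int (int n * q)"
        using n by (simp add: field_simps)
      then have "a - b = int n * q" by (simp only: of_int_eq_iff)
      then show False using False by simp
    qed
    have "(\<Sum>k=1..n. w ^ k) = (\<Sum>k<n. w * w ^ k)"
      using sum.atLeast1_atMost_eq[of "\<lambda>k. w ^ k" n] by simp
    also have "\<dots> = w * ((w ^ n - 1) / (w - 1))"
      using \<open>w \<noteq> 1\<close> by (simp add: geometric_sum sum_distrib_left[symmetric])
    finally show ?thesis using False wn by (simp add: eq)
  qed
qed

text \<open>For natural \<open>m\<close> the value \<open>unity_root n k m\<close> is symmetric in
  \<open>k\<close> and \<open>m\<close>, so this is the other orthogonality relation with the roles
  exchanged. The ranges differ by one end point, but the terms at 0 and at \<open>n\<close>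
  coincide.\<close>

lemma unity_root_sum_m:
  assumes n: "n > 0" and kl: "k \<in> {1..n}" "l \<in> {1..n}"
  shows "(\<Sum>m=0..<int n. unity_root n k m * cnj (unity_root n l m)) = (if k = l then of_nat n else 0)"
proof -
  have "(\<Sum>m=0..<int n. unity_root n k m * cnj (unity_root n l m)) =
      (\<Sum>j=1..n. unity_root n j (int k) * cnj (unity_root n j (int l)))"
  proof -
    let ?g = "\<lambda>j. unity_root n j (int k) * cnj (unity_root n j (int l))"
    have g: "unity_root n k (int j) * cnj (unity_root n l (int j)) = ?g j" for j
      by (simp add: unity_root_def mult.commute)
    have "(\<Sum>m=0..<int n. unity_root n k m * cnj (unity_root n l m)) = (\<Sum>j<n. ?g j)"
      by (rule sum.reindex_bij_witness[where i = int and j = nat]) (auto simp: g[symmetric])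
    also have "\<dots> = (\<Sum>j=1..n. ?g j)"
    proof -
      have "?g n = ?g 0"
        using unity_root_cong[of n "int k * int n" 0 1] unity_root_cong[of n "int l * int n" 0 1] n
        by (simp add: unity_root_def mult.commute)
      moreover have "{..<n} = insert 0 {1..<n}" "{1..n} = insert n {1..<n}" using n by auto
      ultimately show ?thesis by simp
    qed
    finally show ?thesis .
  qed
  also have "\<dots> = (if k = l then of_nat n else 0)"
  proof -
    have "int n dvd int k - int l \<longleftrightarrow> k = l"
    proof
      assume "int n dvd int k - int l"
      moreover have "\<bar>int k - int l\<bar> < int n" using kl by auto
      ultimately show "k = l" using dvd_imp_le_int[of "int k - int l" "int n"] by force
    qed auto
    then show ?thesis by (simp only: unity_root_sum_k[OF n])
  qed
  finally show ?thesis .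
qed

section \<open>Interpolation at the points of a lattice rule\<close>

locale lattice_rule =
  fixes \<alpha> :: nat and \<gamma> :: "nat set \<Rightarrow> real" and s n :: nat and z :: "nat \<Rightarrow> nat"
  assumes \<alpha>: "2 \<le> \<alpha>" and \<gamma>: "\<And>u. finite u \<Longrightarrow> 0 < \<gamma> u" and s: "1 \<le> s" and prime: "prime n"
    and z: "\<And>j. j < s \<Longrightarrow> z j \<in> {1..n-1}"
begin

abbreviation "r \<equiv> r_fun \<alpha> \<gamma>"
abbreviation "pt \<equiv> lattice_point n z"
abbreviation "K \<equiv> kernel \<alpha> \<gamma> s"

definition dotz :: "(nat \<Rightarrow> int) \<Rightarrow> int" where
  "dotz h = (\<Sum>j<s. h j * int (z j))"

lemma n_pos: "n > 0" using prime prime_gt_0_nat by blast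

lemma r_pos: "h \<in> Zs s \<Longrightarrow> 0 < r h"
  by (rule r_fun_pos[OF _ \<gamma>])

text \<open>Passing to the fractional part changes each phase by \<open>2 * pi\<close> times the
  integer \<open>h j * \<lfloor>k * z j / n\<rfloor>\<close>, which the exponential ignores.\<close>

lemma trig_pt: "trig s h (pt k) = unity_root n k (dotz h)"
proof -
  have "cis (2 * pi * of_int (h j) * pt k j) = cis (2 * pi * (real k * (of_int (h j) * real (z j)) / real n))" for j
  proof -
    let ?x = "real k * real (z j) / real n"
    have "2 * pi * of_int (h j) * pt k j =
        2 * pi * (real k * (of_int (h j) * real (z j)) / real n) - 2 * pi * of_int (h j * \<lfloor>?x\<rfloor>)"
      by (simp add: lattice_point_def frac_def algebra_simps)
    then show ?thesis
      using cis_multiple_2pi[of "of_int (h j * \<lfloor>?x\<rfloor>)"]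
      by (simp only: cis_divide[symmetric]) simp
  qed
  then have "trig s h (pt k) = (\<Prod>j<s. cis (2 * pi * (real k * (of_int (h j) * real (z j)) / real n)))"
    by (simp only: trig_prod)
  also have "\<dots> = cis (\<Sum>j<s. 2 * pi * (real k * (of_int (h j) * real (z j)) / real n))"
    by (simp add: cis_sum)
  also have "\<dots> = unity_root n k (dotz h)"
    by (simp add: unity_root_def dotz_def sum_distrib_left sum_divide_distrib)
  finally show ?thesis .
qed

text \<open>All \<open>trig s h\<close> with \<open>h\<close> in one class coincide at the lattice
  points; the classes consist of the frequencies that sampling cannot separate.\<close>

definition rclass :: "int \<Rightarrow> (nat \<Rightarrow> int) set" where
  "rclass m = {h \<in> Zs s. int n dvd dotz h - m}"

lemma rclass_partition: "Zs s = (\<Union>m\<in>{0..<int n}. rclass m)"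
proof (intro set_eqI iffI)
  fix h assume "h \<in> Zs s"
  then have "h \<in> rclass (dotz h mod int n)" by (simp add: rclass_def)
  moreover have "dotz h mod int n \<in> {0..<int n}" using n_pos by simp
  ultimately show "h \<in> (\<Union>m\<in>{0..<int n}. rclass m)" by blast
qed (auto simp: rclass_def)

lemma rclass_disjoint:
  assumes "a \<in> {0..<int n}" "b \<in> {0..<int n}" "a \<noteq> b"
  shows "rclass a \<inter> rclass b = {}"
proof (rule ccontr)
  assume "\<not> ?thesis"
  then obtain h where h: "int n dvd dotz h - a" "int n dvd dotz h - b" by (auto simp: rclass_def)
  then have "int n dvd a - b" using dvd_diff[OF h(2,1)] by simp
  moreover have "\<bar>a - b\<bar> < int n" using assms by auto
  ultimately show False using dvd_imp_le_int[of "a - b" "int n"] assms(3) by force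
qed

lemma infsum_rclass:
  fixes f :: "(nat \<Rightarrow> int) \<Rightarrow> 'a::banach"
  assumes "f summable_on Zs s"
  shows "infsum f (Zs s) = (\<Sum>m=0..<int n. infsum f (rclass m))"
  unfolding rclass_partition
proof (rule sum_infsum[symmetric])
  show "f summable_on rclass m" for m
    by (rule summable_on_subset_banach[OF assms]) (auto simp: rclass_def)
qed (simp_all add: rclass_disjoint)

lemma abs_summable_1r: "(\<lambda>h. complex_of_real (1 / r h)) abs_summable_on Zs s"
  by (rule abs_summable_inverse_r[OF \<alpha>])

lemma summable_1r: "(\<lambda>h. 1 / r h) summable_on Zs s"
proof -
  have "(\<lambda>h. norm (complex_of_real (1 / r h))) summable_on Zs s \<longleftrightarrow> ?thesis"
    by (rule summable_on_cong) (use r_pos in \<open>simp add: norm_divide less_imp_le\<close>)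
  then show ?thesis using abs_summable_1r by blast
qed

text \<open>Since \<open>n\<close> is prime, \<open>z 0\<close> is invertible modulo
  \<open>n\<close>, and frequencies supported in component 0 alone reach every residue. This makes
  every \<open>R m\<close> positive and hence the interpolation problem solvable.\<close>

lemma rclass_nonempty: "\<exists>h. h \<in> rclass m"
proof -
  have "coprime (int (z 0)) (int n)"
  proof -
    have "z 0 \<in> {1..n-1}" using z s by simp
    then have "\<not> n dvd z 0" using prime_gt_1_nat[OF prime] by (auto dest: dvd_imp_le)
    then have "coprime n (z 0)" using prime_imp_coprime_nat[OF prime] by blast
    then show ?thesis by (simp add: coprime_commute)
  qed
  then obtain x v where "x * int (z 0) + v * int n = 1"
    using bezout_int[of "int (z 0)" "int n"] by auto
  then have "int (z 0) * x - 1 = int n * (- v)" by (simp add: algebra_simps)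
  then have *: "int n dvd int (z 0) * x - 1" by (metis dvd_triv_left)
  define h where "h = (\<lambda>j::nat. if j = 0 then x * m else 0)"
  have "dotz h = x * m * int (z 0)"
    unfolding dotz_def h_def using s by (subst sum.mono_neutral_right[where S = "{0}"]) auto
  then have "dotz h - m = (int (z 0) * x - 1) * m" by (simp add: algebra_simps)
  then have "int n dvd dotz h - m" using * by simp
  moreover have "h \<in> Zs s" using s by (auto simp: Zs_def h_def)
  ultimately show ?thesis by (auto simp: rclass_def)
qed

text \<open>The matrix of kernel values at the lattice points is circulant; up to the factor
  \<open>n\<close> these numbers are its eigenvalues.\<close>

definition R :: "int \<Rightarrow> real" where "R m = (\<Sum>\<^sub>\<infinity>h\<in>rclass m. 1 / r h)"

lemma R_pos: "0 < R m"
proof -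
  obtain h where h: "h \<in> rclass m" using rclass_nonempty by blast
  have hz: "h \<in> Zs s" using h by (simp add: rclass_def)
  have "(\<lambda>h. 1 / r h) summable_on rclass m"
    by (rule summable_on_subset_banach[OF summable_1r]) (auto simp: rclass_def)
  moreover have "0 \<le> 1 / r k" if "k \<in> rclass m" for k
    using r_pos[of k] that by (simp add: rclass_def less_imp_le)
  ultimately have "(\<Sum>k\<in>{h}. 1 / r k) \<le> R m"
    unfolding R_def using h by (intro finite_sum_le_infsum) auto
  then show ?thesis using r_pos[OF hz] by (simp add: less_le_trans[of 0 "1 / r h"])
qed

text \<open>These are the Fourier coefficients of a linear combination of kernel sections. Apart
  from the factor \<open>1 / r h\<close> they depend only on the class of \<open>h\<close>, and this
  is what makes the interpolation error orthogonal to them.\<close>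

definition kcoeff :: "(nat \<Rightarrow> complex) \<Rightarrow> (nat \<Rightarrow> int) \<Rightarrow> complex" where
  "kcoeff c h = of_real (1 / r h) * (\<Sum>k=1..n. c k * cnj (unity_root n k (dotz h)))"

lemma kernel_sum_bound:
  "cmod (\<Sum>k=1..n. c k * cnj (unity_root n k m)) \<le> (\<Sum>k=1..n. cmod (c k))"
proof -
  have "cmod (\<Sum>k=1..n. c k * cnj (unity_root n k m)) \<le> (\<Sum>k=1..n. cmod (c k * cnj (unity_root n k m)))"
    by (rule norm_sum)
  then show ?thesis by (simp add: norm_mult)
qed

lemma abs_summable_kcoeff: "kcoeff c abs_summable_on Zs s"
  unfolding kcoeff_def by (rule abs_summable_times_bounded[OF abs_summable_1r kernel_sum_bound])

lemma kernel_sum_fseries: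
  "(\<Sum>k=1..n. c k * of_real (K (pt k) y)) = fseries s (kcoeff c) y"
proof -
  have "(\<Sum>k=1..n. c k * of_real (K (pt k) y)) =
     (\<Sum>k=1..n. \<Sum>\<^sub>\<infinity>h\<in>Zs s. c k * (of_real (1 / r h) * cnj (unity_root n k (dotz h)) * trig s h y))"
    by (simp only: kernel_eq[OF \<alpha>] trig_pt infsum_cmult_right'[symmetric])
  also have "\<dots> = (\<Sum>\<^sub>\<infinity>h\<in>Zs s. \<Sum>k=1..n. c k * (of_real (1 / r h) * cnj (unity_root n k (dotz h)) * trig s h y))"
  proof (rule infsum_sum[symmetric])
    fix k
    have "(\<lambda>h. of_real (1 / r h) * (c k * cnj (unity_root n k (dotz h)) * trig s h y)) abs_summable_on Zs s"
      by (rule abs_summable_times_bounded[OF abs_summable_1r, where B = "cmod (c k)"]) (simp add: norm_mult)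
    then show "(\<lambda>h. c k * (of_real (1 / r h) * cnj (unity_root n k (dotz h)) * trig s h y)) summable_on Zs s"
      using abs_summable_summable by (simp only: mult.assoc mult.left_commute[of "c k"])
  qed
  also have "\<dots> = fseries s (kcoeff c) y"
    unfolding fseries_def kcoeff_def
    by (intro infsum_cong) (simp add: sum_distrib_left sum_distrib_right mult_ac)
  finally show ?thesis .
qed

lemma fseries_pt:
  assumes a: "a abs_summable_on Zs s"
  shows "fseries s a (pt l) = (\<Sum>m=0..<int n. (\<Sum>\<^sub>\<infinity>h\<in>rclass m. a h) * unity_root n l m)"
proof -
  have "fseries s a (pt l) = (\<Sum>m=0..<int n. \<Sum>\<^sub>\<infinity>h\<in>rclass m. a h * trig s h (pt l))"
    unfolding fseries_def by (rule infsum_rclass[OF abs_summable_summable[OF abs_summable_fseries[OF a]]])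
  also have "\<dots> = (\<Sum>m=0..<int n. \<Sum>\<^sub>\<infinity>h\<in>rclass m. a h * unity_root n l m)"
    by (intro sum.cong refl infsum_cong)
       (simp add: trig_pt rclass_def unity_root_cong[OF n_pos])
  finally show ?thesis by (simp add: infsum_cmult_left')
qed

text \<open>This is the inverse discrete Fourier transform.\<close>

lemma rclass_sum_0:
  assumes a: "a abs_summable_on Zs s" and 0: "\<And>l. l \<in> {1..n} \<Longrightarrow> fseries s a (pt l) = 0"
    and m: "m \<in> {0..<int n}"
  shows "(\<Sum>\<^sub>\<infinity>h\<in>rclass m. a h) = 0"
proof -
  let ?F = "\<lambda>m. \<Sum>\<^sub>\<infinity>h\<in>rclass m. a h"
  have "0 = (\<Sum>l=1..n. fseries s a (pt l) * cnj (unity_root n l m))"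
    by (simp add: 0)
  also have "\<dots> = (\<Sum>l=1..n. \<Sum>m'=0..<int n. ?F m' * (unity_root n l m' * cnj (unity_root n l m)))"
    by (simp add: fseries_pt[OF a] sum_distrib_right mult.assoc)
  also have "\<dots> = (\<Sum>m'=0..<int n. ?F m' * (\<Sum>l=1..n. unity_root n l m' * cnj (unity_root n l m)))"
    by (subst sum.swap) (simp add: sum_distrib_left)
  also have "\<dots> = (\<Sum>m'=0..<int n. if m' = m then ?F m * of_nat n else 0)"
  proof (rule sum.cong[OF refl])
    fix m' assume m': "m' \<in> {0..<int n}"
    have "int n dvd m' - m \<longleftrightarrow> m' = m"
    proof
      assume "int n dvd m' - m"
      moreover have "\<bar>m' - m\<bar> < int n" using m m' by auto
      ultimately show "m' = m" using dvd_imp_le_int[of "m' - m" "int n"] by force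
    qed auto
    then show "?F m' * (\<Sum>l=1..n. unity_root n l m' * cnj (unity_root n l m)) = (if m' = m then ?F m * of_nat n else 0)"
      by (simp only: unity_root_sum_k[OF n_pos]) auto
  qed
  also have "\<dots> = ?F m * of_nat n" using m by simp
  finally show ?thesis using n_pos by simp
qed

text \<open>The circulant system is solved explicitly: \<open>F\<close> is the discrete Fourier
  transform of the data, it is divided by the positive numbers \<open>R m\<close>, and
  \<open>c\<close> is the inverse transform of the quotient. A combination with these coefficients
  has class sums \<open>F m\<close>, so it takes the prescribed values.\<close>

lemma interpolant_exists:
  "\<exists>c :: nat \<Rightarrow> real. \<forall>l\<in>{1..n}. (\<Sum>k=1..n. c k * K (pt k) (pt l)) = f (pt l)"
proof -
  define F where "F m = (1 / of_nat n) * (\<Sum>l=1..n. of_real (f (pt l)) * cnj (unity_root n l m))" for m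
  define c where "c k = (1 / of_nat n) * (\<Sum>m=0..<int n. F m / of_real (R m) * unity_root n k m)" for k
  have C: "(\<Sum>k=1..n. c k * cnj (unity_root n k m)) = F m / of_real (R m)" if m: "m \<in> {0..<int n}" for m
  proof -
    have "(\<Sum>k=1..n. c k * cnj (unity_root n k m)) =
       (1 / of_nat n) * (\<Sum>k=1..n. \<Sum>m'=0..<int n. F m' / of_real (R m') * (unity_root n k m' * cnj (unity_root n k m)))"
      by (simp add: c_def sum_distrib_right sum_distrib_left mult.assoc)
    also have "\<dots> = (1 / of_nat n) * (\<Sum>m'=0..<int n. F m' / of_real (R m') * (\<Sum>k=1..n. unity_root n k m' * cnj (unity_root n k m)))"
      by (subst sum.swap) (simp add: sum_distrib_left)
    also have "(\<Sum>m'=0..<int n. F m' / of_real (R m') * (\<Sum>k=1..n. unity_root n k m' * cnj (unity_root n k m))) =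
       (\<Sum>m'=0..<int n. if m' = m then F m / of_real (R m) * of_nat n else 0)"
    proof (rule sum.cong[OF refl])
      fix m' assume m': "m' \<in> {0..<int n}"
      have "int n dvd m' - m \<longleftrightarrow> m' = m"
      proof
        assume "int n dvd m' - m"
        moreover have "\<bar>m' - m\<bar> < int n" using m m' by auto
        ultimately show "m' = m" using dvd_imp_le_int[of "m' - m" "int n"] by force
      qed auto
      then show "F m' / of_real (R m') * (\<Sum>k=1..n. unity_root n k m' * cnj (unity_root n k m)) =
         (if m' = m then F m / of_real (R m) * of_nat n else 0)"
        by (simp only: unity_root_sum_k[OF n_pos]) auto
    qed
    also have "\<dots> = F m / of_real (R m) * of_nat n" using m by simp
    finally show ?thesis using n_pos by simp
  qed
  have sumk: "(\<Sum>\<^sub>\<infinity>h\<in>rclass m. kcoeff c h) = F m" if m: "m \<in> {0..<int n}" for m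
  proof -
    have "(\<Sum>\<^sub>\<infinity>h\<in>rclass m. kcoeff c h) = (\<Sum>\<^sub>\<infinity>h\<in>rclass m. of_real (1 / r h) * (F m / of_real (R m)))"
    proof (rule infsum_cong)
      fix h assume "h \<in> rclass m"
      then have "unity_root n k (dotz h) = unity_root n k m" for k
        by (intro unity_root_cong n_pos) (simp add: rclass_def)
      then show "kcoeff c h = of_real (1 / r h) * (F m / of_real (R m))"
        by (simp only: kcoeff_def C[OF m])
    qed
    also have "\<dots> = of_real (R m) * (F m / of_real (R m))"
    proof -
      have "(\<lambda>h. 1 / r h) summable_on rclass m"
        by (rule summable_on_subset_banach[OF summable_1r]) (auto simp: rclass_def)
      then have "(\<Sum>\<^sub>\<infinity>h\<in>rclass m. complex_of_real (1 / r h)) = of_real (R m)"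
        unfolding R_def by (intro infsumI has_sum_of_real has_sum_infsum)
      then show ?thesis by (simp only: infsum_cmult_left')
    qed
    finally show ?thesis using R_pos[of m] by simp
  qed
  have val: "(\<Sum>k=1..n. c k * of_real (K (pt k) (pt l))) = of_real (f (pt l))" if l: "l \<in> {1..n}" for l
  proof -
    have "(\<Sum>k=1..n. c k * of_real (K (pt k) (pt l))) = (\<Sum>m=0..<int n. F m * unity_root n l m)"
      by (simp only: kernel_sum_fseries fseries_pt[OF abs_summable_kcoeff]) (intro sum.cong refl, simp only: sumk)
    also have "\<dots> = (1 / of_nat n) * (\<Sum>m=0..<int n. \<Sum>k=1..n. of_real (f (pt k)) * (unity_root n l m * cnj (unity_root n k m)))"
      by (simp add: F_def sum_distrib_right sum_distrib_left mult_ac)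
    also have "\<dots> = (1 / of_nat n) * (\<Sum>k=1..n. of_real (f (pt k)) * (\<Sum>m=0..<int n. unity_root n l m * cnj (unity_root n k m)))"
      by (subst sum.swap) (simp add: sum_distrib_left)
    also have "(\<Sum>k=1..n. of_real (f (pt k)) * (\<Sum>m=0..<int n. unity_root n l m * cnj (unity_root n k m))) =
       (\<Sum>k=1..n. if k = l then of_real (f (pt l)) * of_nat n else 0)"
    proof (rule sum.cong[OF refl])
      fix k assume k: "k \<in> {1..n}"
      show "of_real (f (pt k)) * (\<Sum>m=0..<int n. unity_root n l m * cnj (unity_root n k m)) =
         (if k = l then of_real (f (pt l)) * of_nat n else 0)"
        by (simp only: unity_root_sum_m[OF n_pos l k]) auto
    qed
    also have "\<dots> = of_real (f (pt l)) * of_nat n" using l by simp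
    finally show ?thesis using n_pos by simp
  qed
  show ?thesis
  proof (intro exI ballI)
    fix l assume l: "l \<in> {1..n}"
    \<comment> \<open>Kernel values and data are real, so the real parts of the complex coefficients
      satisfy the same equations.\<close>
    have "(\<Sum>k=1..n. Re (c k) * K (pt k) (pt l)) = Re (\<Sum>k=1..n. c k * of_real (K (pt k) (pt l)))"
      by simp
    then show "(\<Sum>k=1..n. Re (c k) * K (pt k) (pt l)) = f (pt l)" by (simp only: val[OF l] Re_complex_of_real)
  qed
qed

text \<open>The interpolant is the orthogonal projection onto the span of the kernel sections.\<close>

lemma interpolation_projection:
  fixes c :: "nat \<Rightarrow> real"
  assumes a: "a abs_summable_on Zs s" and ra: "(\<lambda>h. r h * (cmod (a h))\<^sup>2) summable_on Zs s"
    and int: "\<And>l. l \<in> {1..n} \<Longrightarrow> fseries s a (pt l) = of_real (\<Sum>k=1..n. c k * K (pt k) (pt l))"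
  defines "g \<equiv> kcoeff (\<lambda>k. of_real (c k))"
  defines "e \<equiv> \<lambda>h. a h - g h"
  shows "e abs_summable_on Zs s"
    and "fseries s e y = fseries s a y - of_real (\<Sum>k=1..n. c k * K (pt k) y)"
    and "\<And>m. m \<in> {0..<int n} \<Longrightarrow> (\<Sum>\<^sub>\<infinity>h\<in>rclass m. e h) = 0"
    and "(\<lambda>h. r h * (cmod (e h))\<^sup>2) summable_on Zs s"
    and "(\<lambda>h. r h * (cmod (g h))\<^sup>2) summable_on Zs s"
    and "(\<Sum>\<^sub>\<infinity>h\<in>Zs s. r h * (cmod (a h))\<^sup>2) =
      (\<Sum>\<^sub>\<infinity>h\<in>Zs s. r h * (cmod (e h))\<^sup>2) + (\<Sum>\<^sub>\<infinity>h\<in>Zs s. r h * (cmod (g h))\<^sup>2)"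
proof -
  define C where "C h = (\<Sum>k=1..n. of_real (c k) * cnj (unity_root n k (dotz h)))" for h
  define B where "B = (\<Sum>k=1..n. cmod (of_real (c k)))"
  have CB: "cmod (C h) \<le> B" for h unfolding C_def B_def by (rule kernel_sum_bound)
  have g: "g h = of_real (1 / r h) * C h" for h by (simp add: g_def kcoeff_def C_def)
  have gs: "g abs_summable_on Zs s" unfolding g_def by (rule abs_summable_kcoeff)
  show es: "e abs_summable_on Zs s"
    unfolding e_def
  proof (rule Infinite_Sum.abs_summable_on_comparison_test')
    show "(\<lambda>h. cmod (a h) + cmod (g h)) summable_on Zs s" by (rule summable_on_add[OF a gs])
    show "cmod (a h - g h) \<le> cmod (a h) + cmod (g h)" for h by (rule norm_triangle_ineq4)
  qed
  have fe: "fseries s e y = fseries s a y - of_real (\<Sum>k=1..n. c k * K (pt k) y)" for y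
  proof -
    have "fseries s e y = (\<Sum>\<^sub>\<infinity>h\<in>Zs s. a h * trig s h y + (- (g h * trig s h y)))"
      by (simp add: fseries_def e_def algebra_simps)
    also have "\<dots> = fseries s a y + (- fseries s g y)"
      unfolding fseries_def infsum_uminus[symmetric]
      by (intro infsum_add summable_on_uminus[THEN iffD2] abs_summable_summable[OF abs_summable_fseries[OF a]]
          abs_summable_summable[OF abs_summable_fseries[OF gs]])
    finally show ?thesis using kernel_sum_fseries[of "\<lambda>k. of_real (c k)" y] by (simp add: g_def)
  qed
  then show "fseries s e y = fseries s a y - of_real (\<Sum>k=1..n. c k * K (pt k) y)" .
  show e0: "(\<Sum>\<^sub>\<infinity>h\<in>rclass m. e h) = 0" if "m \<in> {0..<int n}" for m
    by (rule rclass_sum_0[OF es _ that]) (simp add: fe int)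
  have rg: "r h * (cmod (g h))\<^sup>2 = (1 / r h) * (cmod (C h))\<^sup>2" if "h \<in> Zs s" for h
    using r_pos[OF that] by (simp add: g norm_mult norm_divide power2_eq_square field_simps)
  show rgs: "(\<lambda>h. r h * (cmod (g h))\<^sup>2) summable_on Zs s"
  proof (rule summable_on_comparison_test)
    show "(\<lambda>h. (1 / r h) * B\<^sup>2) summable_on Zs s" by (rule summable_on_cmult_left[OF summable_1r])
    fix h assume h: "h \<in> Zs s"
    show "r h * (cmod (g h))\<^sup>2 \<le> 1 / r h * B\<^sup>2"
      unfolding rg[OF h] using r_pos[OF h] by (intro mult_left_mono power_mono CB) auto
    show "0 \<le> r h * (cmod (g h))\<^sup>2" using r_pos[OF h] by simp
  qed
  show res: "(\<lambda>h. r h * (cmod (e h))\<^sup>2) summable_on Zs s"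
  proof (rule summable_on_comparison_test)
    show "(\<lambda>h. 2 * (r h * (cmod (a h))\<^sup>2) + 2 * (r h * (cmod (g h))\<^sup>2)) summable_on Zs s"
      by (intro summable_on_add summable_on_cmult_right ra rgs)
    fix h assume h: "h \<in> Zs s"
    have "(cmod (e h))\<^sup>2 \<le> (cmod (a h) + cmod (g h))\<^sup>2"
      unfolding e_def by (intro power_mono norm_triangle_ineq4) auto
    also have "\<dots> \<le> 2 * (cmod (a h))\<^sup>2 + 2 * (cmod (g h))\<^sup>2"
      using sum_squares_ge_zero[of "cmod (a h) - cmod (g h)" 0] by (simp add: power2_eq_square algebra_simps)
    finally have "r h * (cmod (e h))\<^sup>2 \<le> r h * (2 * (cmod (a h))\<^sup>2 + 2 * (cmod (g h))\<^sup>2)"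
      using r_pos[OF h] by simp
    then show "r h * (cmod (e h))\<^sup>2 \<le> 2 * (r h * (cmod (a h))\<^sup>2) + 2 * (r h * (cmod (g h))\<^sup>2)"
      by (simp add: algebra_simps)
    show "0 \<le> r h * (cmod (e h))\<^sup>2" using r_pos[OF h] by simp
  qed
  \<comment> \<open>Up to conjugation this is the summand of the inner product of \<open>e\<close>
    and \<open>g\<close> in the kernel space, where the factor \<open>r h\<close> cancels
    \<open>1 / r h\<close>. Its sum vanishes because \<open>C\<close> is constant on every class
    while \<open>e\<close> sums to zero over it.\<close>
  have cs: "(\<lambda>h. e h * cnj (C h)) abs_summable_on Zs s"
    by (rule abs_summable_times_bounded[OF es, where B=B]) (use CB in simp)
  have "(\<Sum>\<^sub>\<infinity>h\<in>Zs s. e h * cnj (C h)) = (\<Sum>m=0..<int n. \<Sum>\<^sub>\<infinity>h\<in>rclass m. e h * cnj (C h))"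
    by (rule infsum_rclass[OF abs_summable_summable[OF cs]])
  also have "\<dots> = (\<Sum>m=0..<int n. \<Sum>\<^sub>\<infinity>h\<in>rclass m. e h * cnj (\<Sum>k=1..n. of_real (c k) * cnj (unity_root n k m)))"
  proof (intro sum.cong refl infsum_cong)
    fix m h assume "h \<in> rclass m"
    then have "unity_root n k (dotz h) = unity_root n k m" for k
      by (intro unity_root_cong n_pos) (simp add: rclass_def)
    then show "e h * cnj (C h) = e h * cnj (\<Sum>k=1..n. of_real (c k) * cnj (unity_root n k m))"
      by (simp add: C_def)
  qed
  also have "\<dots> = 0"
    by (simp only: infsum_cmult_left') (simp add: e0)
  finally have cross: "(\<Sum>\<^sub>\<infinity>h\<in>Zs s. e h * cnj (C h)) = 0" .
  have id: "r h * (cmod (a h))\<^sup>2 = r h * (cmod (e h))\<^sup>2 + r h * (cmod (g h))\<^sup>2 + 2 * Re (e h * cnj (C h))"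
    if h: "h \<in> Zs s" for h
  proof -
    have "a h = e h + g h" by (simp add: e_def)
    then have "(cmod (a h))\<^sup>2 = (cmod (e h + g h))\<^sup>2" by (simp only:)
    also have "\<dots> = (cmod (e h))\<^sup>2 + (cmod (g h))\<^sup>2 + 2 * Re (e h * cnj (g h))"
      unfolding cmod_power2 by (simp add: power2_eq_square algebra_simps)
    finally have "(cmod (a h))\<^sup>2 = (cmod (e h))\<^sup>2 + (cmod (g h))\<^sup>2 + 2 * Re (e h * cnj (g h))" .
    moreover have "r h * Re (e h * cnj (g h)) = Re (e h * cnj (C h))"
      unfolding g using r_pos[OF h] by (simp add: field_simps)
    ultimately show ?thesis by (simp add: algebra_simps)
  qed
  have "(\<Sum>\<^sub>\<infinity>h\<in>Zs s. r h * (cmod (a h))\<^sup>2) =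
      (\<Sum>\<^sub>\<infinity>h\<in>Zs s. (r h * (cmod (e h))\<^sup>2 + r h * (cmod (g h))\<^sup>2) + 2 * Re (e h * cnj (C h)))"
    by (rule infsum_cong) (rule id)
  also have "\<dots> = ((\<Sum>\<^sub>\<infinity>h\<in>Zs s. r h * (cmod (e h))\<^sup>2) + (\<Sum>\<^sub>\<infinity>h\<in>Zs s. r h * (cmod (g h))\<^sup>2)) +
      2 * (\<Sum>\<^sub>\<infinity>h\<in>Zs s. Re (e h * cnj (C h)))"
    by (simp only: infsum_cmult_right' infsum_add[OF res rgs]
        infsum_add[OF summable_on_add[OF res rgs]
          summable_on_cmult_right[OF summable_on_Re[OF abs_summable_summable[OF cs]]]])
  also have "(\<Sum>\<^sub>\<infinity>h\<in>Zs s. Re (e h * cnj (C h))) = 0"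
    using infsum_Re[OF abs_summable_summable[OF cs]] cross by simp
  finally show "(\<Sum>\<^sub>\<infinity>h\<in>Zs s. r h * (cmod (a h))\<^sup>2) =
      (\<Sum>\<^sub>\<infinity>h\<in>Zs s. r h * (cmod (e h))\<^sup>2) + (\<Sum>\<^sub>\<infinity>h\<in>Zs s. r h * (cmod (g h))\<^sup>2)" by simp
qed

text \<open>Such a combination interpolates the zero function. The orthogonal decomposition of zero
  forces its kernel norm, and thus each of its Fourier coefficients, to vanish. It is the function,
  as chosen by \<open>THE\<close>, whose uniqueness matters.\<close>

lemma interpolant_unique:
  fixes c :: "nat \<Rightarrow> real"
  assumes "\<And>l. l \<in> {1..n} \<Longrightarrow> (\<Sum>k=1..n. c k * K (pt k) (pt l)) = 0"
  shows "(\<Sum>k=1..n. c k * K (pt k) y) = 0"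
proof -
  let ?a = "\<lambda>_. 0 :: complex"
  define g where "g = kcoeff (\<lambda>k. complex_of_real (c k))"
  have a: "?a abs_summable_on Zs s" and ra: "(\<lambda>h. r h * (cmod (?a h))\<^sup>2) summable_on Zs s"
    by simp_all
  have int: "fseries s ?a (pt l) = of_real (\<Sum>k=1..n. c k * K (pt k) (pt l))" if "l \<in> {1..n}" for l
    using assms[OF that] by (simp add: fseries_def)
  note P = interpolation_projection[OF a ra int, folded g_def]
  have nn: "0 \<le> r h * x\<^sup>2" if "h \<in> Zs s" for h x
    using r_pos[OF that] by simp
  have "0 \<le> (\<Sum>\<^sub>\<infinity>h\<in>Zs s. r h * (cmod (0 - g h))\<^sup>2)"
    by (rule infsum_nonneg) (rule nn)
  moreover have "0 \<le> (\<Sum>\<^sub>\<infinity>h\<in>Zs s. r h * (cmod (g h))\<^sup>2)"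
    by (rule infsum_nonneg) (rule nn)
  moreover have "(\<Sum>\<^sub>\<infinity>h\<in>Zs s. r h * (cmod (0::complex))\<^sup>2) = 0" by simp
  ultimately have 0: "(\<Sum>\<^sub>\<infinity>h\<in>Zs s. r h * (cmod (g h))\<^sup>2) \<le> 0"
    using P(6) by linarith
  have "r h * (cmod (g h))\<^sup>2 = 0" if "h \<in> Zs s" for h
    using nonneg_infsum_le_0D[OF 0 P(5) nn that] .
  then have "g h = 0" if "h \<in> Zs s" for h
    using r_pos[OF that] that by fastforce
  then have "fseries s g y = 0"
    unfolding fseries_def by (intro infsum_0) simp
  moreover have "complex_of_real (\<Sum>k=1..n. c k * K (pt k) y) = fseries s g y"
    using kernel_sum_fseries[of "\<lambda>k. of_real (c k)" y] by (simp add: g_def)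
  ultimately show ?thesis by (simp only: of_real_eq_0_iff)
qed

lemma kernel_interpolant_eqI:
  assumes "\<And>l. l \<in> {1..n} \<Longrightarrow> (\<Sum>k=1..n. c k * K (pt k) (pt l)) = f (pt l)"
  shows "kernel_interpolant \<alpha> \<gamma> s n z f = (\<lambda>y. \<Sum>k=1..n. c k * K (pt k) y)"
  unfolding kernel_interpolant_def
proof (rule the_equality)
  show "(\<exists>c'. (\<lambda>y. \<Sum>k=1..n. c k * K (pt k) y) = (\<lambda>y. \<Sum>k=1..n. c' k * K (pt k) y)) \<and>
    (\<forall>l\<in>{1..n}. (\<Sum>k=1..n. c k * K (pt k) (pt l)) = f (pt l))"
    using assms by blast
next
  fix g
  assume "(\<exists>c'. g = (\<lambda>y. \<Sum>k=1..n. c' k * K (pt k) y)) \<and> (\<forall>l\<in>{1..n}. g (pt l) = f (pt l))"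
  then obtain c' where g: "g = (\<lambda>y. \<Sum>k=1..n. c' k * K (pt k) y)" "\<And>l. l \<in> {1..n} \<Longrightarrow> g (pt l) = f (pt l)"
    by blast
  have "(\<Sum>k=1..n. (c' k - c k) * K (pt k) (pt l)) = 0" if "l \<in> {1..n}" for l
    using g(2)[OF that] assms[OF that] by (simp only: g(1) left_diff_distrib sum_subtractf)
  then have "(\<Sum>k=1..n. (c' k - c k) * K (pt k) y) = 0" for y
    by (rule interpolant_unique)
  then show "g = (\<lambda>y. \<Sum>k=1..n. c k * K (pt k) y)"
    unfolding g(1) by (simp only: left_diff_distrib sum_subtractf right_minus_eq)
qed

text \<open>This linearity lets interpolation in \<open>y\<close> pass through a basis expansion in
  \<open>x\<close>: the factors \<open>x i\<close> become values of basis functions at a fixed point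
  of the domain.\<close>

lemma kernel_interpolant_sum:
  "kernel_interpolant \<alpha> \<gamma> s n z (\<lambda>y. \<Sum>i\<in>I. x i * f i y) =
   (\<lambda>y. \<Sum>i\<in>I. x i * kernel_interpolant \<alpha> \<gamma> s n z (f i) y)"
proof -
  have "\<forall>i. \<exists>c. \<forall>l\<in>{1..n}. (\<Sum>k=1..n. c k * K (pt k) (pt l)) = f i (pt l)"
    using interpolant_exists by blast
  then obtain c where c: "\<And>i l. l \<in> {1..n} \<Longrightarrow> (\<Sum>k=1..n. c i k * K (pt k) (pt l)) = f i (pt l)"
    by metis
  have sw: "(\<Sum>k=1..n. (\<Sum>i\<in>I. x i * c i k) * K (pt k) y) = (\<Sum>i\<in>I. x i * (\<Sum>k=1..n. c i k * K (pt k) y))" for y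
    unfolding sum_distrib_left sum_distrib_right mult.assoc by (rule sum.swap)
  have "kernel_interpolant \<alpha> \<gamma> s n z (\<lambda>y. \<Sum>i\<in>I. x i * f i y) =
      (\<lambda>y. \<Sum>k=1..n. (\<Sum>i\<in>I. x i * c i k) * K (pt k) y)"
    by (rule kernel_interpolant_eqI) (simp only: sw c)
  then show ?thesis
    by (simp only: sw kernel_interpolant_eqI[OF c])
qed

section \<open>Aliasing and the error in L2\<close>

definition aliases :: "(nat \<Rightarrow> int) \<Rightarrow> (nat \<Rightarrow> int) set" where
  "aliases h = {k \<in> Zs s. k \<noteq> h \<and> int n dvd dotz k - dotz h}"

text \<open>The quantity that the construction of the generating vector controls, with
  \<open>k = h + \<ell>\<close> as summation variable in place of the dual lattice vector
  \<open>\<ell>\<close>.\<close>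

definition lattice_sum :: real where
  "lattice_sum = (\<Sum>\<^sub>\<infinity>h\<in>Zs s. (1 / r h) * (\<Sum>\<^sub>\<infinity>k\<in>aliases h. 1 / r k))"

lemma summable_aliases: "(\<lambda>k. 1 / r k) summable_on aliases h"
  by (rule summable_on_subset_banach[OF summable_1r], unfold aliases_def) blast

lemma aliases_sum_bounds:
  "0 \<le> (\<Sum>\<^sub>\<infinity>k\<in>aliases h. 1 / r k)" "(\<Sum>\<^sub>\<infinity>k\<in>aliases h. 1 / r k) \<le> (\<Sum>\<^sub>\<infinity>k\<in>Zs s. 1 / r k)"
proof -
  have nn: "0 \<le> 1 / r k" if "k \<in> Zs s" for k using r_pos[OF that] by simp
  show "0 \<le> (\<Sum>\<^sub>\<infinity>k\<in>aliases h. 1 / r k)"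
    by (rule infsum_nonneg) (simp add: aliases_def nn del: zero_le_divide_1_iff)
  show "(\<Sum>\<^sub>\<infinity>k\<in>aliases h. 1 / r k) \<le> (\<Sum>\<^sub>\<infinity>k\<in>Zs s. 1 / r k)"
    by (rule infsum_mono2[OF summable_aliases summable_1r]) (use nn in \<open>auto simp: aliases_def\<close>)
qed

lemma summable_lattice_sum:
  "(\<lambda>h. (1 / r h) * (\<Sum>\<^sub>\<infinity>k\<in>aliases h. 1 / r k)) summable_on Zs s"
proof (rule summable_on_comparison_test)
  show "(\<lambda>h. (1 / r h) * (\<Sum>\<^sub>\<infinity>k\<in>Zs s. 1 / r k)) summable_on Zs s"
    by (rule summable_on_cmult_left[OF summable_1r])
  fix h assume h: "h \<in> Zs s"
  have nn: "0 \<le> 1 / r h" using r_pos[OF h] by simp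
  show "(1 / r h) * (\<Sum>\<^sub>\<infinity>k\<in>aliases h. 1 / r k) \<le> (1 / r h) * (\<Sum>\<^sub>\<infinity>k\<in>Zs s. 1 / r k)"
    by (rule mult_left_mono[OF aliases_sum_bounds(2) nn])
  show "0 \<le> (1 / r h) * (\<Sum>\<^sub>\<infinity>k\<in>aliases h. 1 / r k)"
    by (rule mult_nonneg_nonneg[OF nn aliases_sum_bounds(1)])
qed

text \<open>With \<open>M = X powr (-1/2)\<close>, frequencies with \<open>r h > M\<close> are controlled by the kernel norm, the
  others because each coefficient is minus the sum of its aliases.\<close>

lemma L2_bound:
  assumes e: "e abs_summable_on Zs s" and re: "(\<lambda>h. r h * (cmod (e h))\<^sup>2) summable_on Zs s"
    and e0: "\<And>m. m \<in> {0..<int n} \<Longrightarrow> (\<Sum>\<^sub>\<infinity>h\<in>rclass m. e h) = 0"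
    and X: "lattice_sum \<le> X" "0 < X"
  shows "(\<Sum>\<^sub>\<infinity>h\<in>Zs s. (cmod (e h))\<^sup>2) \<le> 2 * sqrt X * (\<Sum>\<^sub>\<infinity>h\<in>Zs s. r h * (cmod (e h))\<^sup>2)"
proof -
  let ?N = "\<lambda>h. \<Sum>\<^sub>\<infinity>k\<in>aliases h. 1 / r k"
  define E where "E = (\<Sum>\<^sub>\<infinity>h\<in>Zs s. r h * (cmod (e h))\<^sup>2)"
  have nn: "0 \<le> r h * (cmod (e h))\<^sup>2" if "h \<in> Zs s" for h using r_pos[OF that] by simp
  have E0: "0 \<le> E" unfolding E_def by (rule infsum_nonneg) (rule nn)
  \<comment> \<open>Cauchy-Schwarz with the weights \<open>1 / r\<close> and \<open>r\<close>,
    applied to \<open>e h\<close> as minus the sum over its aliases; the sum weighted by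
    \<open>r\<close> is then enlarged to the full kernel norm.\<close>
  have bound: "(cmod (e h))\<^sup>2 \<le> ?N h * E" if h: "h \<in> Zs s" for h
  proof -
    define m where "m = dotz h mod int n"
    have m: "m \<in> {0..<int n}" using n_pos by (simp add: m_def)
    have mh: "int n dvd dotz h - m" by (simp add: m_def)
    have iff: "int n dvd dotz k - m \<longleftrightarrow> int n dvd dotz k - dotz h" for k
      using dvd_add_right_iff[OF mh, of "dotz k - dotz h"] by simp
    have "rclass m = {k \<in> Zs s. int n dvd dotz k - dotz h}"
      unfolding rclass_def iff ..
    also have "\<dots> = insert h (aliases h)"
      unfolding aliases_def using h by auto
    finally have cl: "rclass m = insert h (aliases h)" .
    have sub: "aliases h \<subseteq> Zs s" unfolding aliases_def by blast
    have ea: "e abs_summable_on aliases h" by (rule summable_on_subset_banach[OF e sub])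
    have "(\<Sum>\<^sub>\<infinity>k\<in>rclass m. e k) = e h + (\<Sum>\<^sub>\<infinity>k\<in>aliases h. e k)"
      unfolding cl by (rule infsum_insert[OF abs_summable_summable[OF ea]]) (simp add: aliases_def)
    then have "cmod (e h) = cmod (\<Sum>\<^sub>\<infinity>k\<in>aliases h. e k)"
      using e0[OF m] by (metis add_eq_0_iff norm_minus_cancel)
    also have "\<dots> \<le> (\<Sum>\<^sub>\<infinity>k\<in>aliases h. cmod (e k))"
      by (rule norm_infsum_bound[OF ea])
    also have "\<dots> = (\<Sum>\<^sub>\<infinity>k\<in>aliases h. sqrt (1 / r k) * (sqrt (r k) * cmod (e k)))"
    proof (rule infsum_cong)
      fix k assume "k \<in> aliases h"
      then have "0 < r k" using sub r_pos by blast
      then show "cmod (e k) = sqrt (1 / r k) * (sqrt (r k) * cmod (e k))"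
        by (simp add: real_sqrt_divide)
    qed
    finally have le: "cmod (e h) \<le> (\<Sum>\<^sub>\<infinity>k\<in>aliases h. sqrt (1 / r k) * (sqrt (r k) * cmod (e k)))" .
    have sq1: "(sqrt (1 / r k))\<^sup>2 = 1 / r k" and sq2: "(sqrt (r k) * cmod (e k))\<^sup>2 = r k * (cmod (e k))\<^sup>2"
      if "k \<in> aliases h" for k
      using r_pos[of k] that sub by (auto simp: power_mult_distrib less_imp_le subset_iff)
    have rsub: "(\<lambda>k. r k * (cmod (e k))\<^sup>2) summable_on aliases h"
      by (rule summable_on_subset_banach[OF re sub])
    have s1: "(\<lambda>k. (sqrt (1 / r k))\<^sup>2) summable_on aliases h"
      by (rule summable_on_cong[THEN iffD2, OF sq1 summable_aliases])
    have s2: "(\<lambda>k. (sqrt (r k) * cmod (e k))\<^sup>2) summable_on aliases h"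
      by (rule summable_on_cong[THEN iffD2, OF sq2 rsub])
    have pos: "0 \<le> sqrt (1 / r k) * (sqrt (r k) * cmod (e k))" if "k \<in> aliases h" for k
      using r_pos[of k] that sub by (auto simp: subset_iff less_imp_le)
    have "(cmod (e h))\<^sup>2 \<le> (\<Sum>\<^sub>\<infinity>k\<in>aliases h. sqrt (1 / r k) * (sqrt (r k) * cmod (e k)))\<^sup>2"
      by (rule power_mono[OF le]) simp
    also have "\<dots> \<le> (\<Sum>\<^sub>\<infinity>k\<in>aliases h. (sqrt (1 / r k))\<^sup>2) * (\<Sum>\<^sub>\<infinity>k\<in>aliases h. (sqrt (r k) * cmod (e k))\<^sup>2)"
      by (rule infsum_Cauchy_Schwarz(2)[OF s1 s2 pos])
    also have "(\<Sum>\<^sub>\<infinity>k\<in>aliases h. (sqrt (1 / r k))\<^sup>2) = ?N h"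
      by (rule infsum_cong) (rule sq1)
    also have "(\<Sum>\<^sub>\<infinity>k\<in>aliases h. (sqrt (r k) * cmod (e k))\<^sup>2) = (\<Sum>\<^sub>\<infinity>k\<in>aliases h. r k * (cmod (e k))\<^sup>2)"
      by (rule infsum_cong) (rule sq2)
    also have "?N h * \<dots> \<le> ?N h * E"
      unfolding E_def
      by (intro mult_left_mono infsum_mono2 rsub re sub aliases_sum_bounds) (use nn in blast)
    finally show ?thesis .
  qed
  \<comment> \<open>The two contributions are \<open>M * E * X\<close> and \<open>E / M\<close>.
    This threshold makes them equal, whence the factor 2 in the result.\<close>
  define M where "M = 1 / sqrt X"
  have M: "0 < M" using X by (simp add: M_def)
  \<comment> \<open>For every \<open>h\<close> both estimates are added up although one of them
    suffices, so that the infinite sum does not have to be split at the threshold.\<close>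
  have pw: "(cmod (e h))\<^sup>2 \<le> (M * E) * ((1 / r h) * ?N h) + (1 / M) * (r h * (cmod (e h))\<^sup>2)" if h: "h \<in> Zs s" for h
  proof (cases "r h \<le> M")
    case True
    have "(cmod (e h))\<^sup>2 \<le> 1 * (?N h * E)" using bound[OF h] by simp
    also have "\<dots> \<le> (M * (1 / r h)) * (?N h * E)"
      using True r_pos[OF h] E0 aliases_sum_bounds(1)[of h]
      by (intro mult_right_mono) (auto simp: field_simps)
    finally have "(cmod (e h))\<^sup>2 \<le> (M * E) * ((1 / r h) * ?N h)" by (simp only: mult_ac)
    then show ?thesis using nn[OF h] M by (simp add: add_increasing2)
  next
    case False
    have "(cmod (e h))\<^sup>2 = (1 / M) * (M * (cmod (e h))\<^sup>2)" using M by simp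
    also have "\<dots> \<le> (1 / M) * (r h * (cmod (e h))\<^sup>2)"
      using False M by (intro mult_left_mono mult_right_mono) auto
    finally have 1: "(cmod (e h))\<^sup>2 \<le> (1 / M) * (r h * (cmod (e h))\<^sup>2)" .
    have "0 \<le> (M * E) * ((1 / r h) * ?N h)"
      using M E0 r_pos[OF h] aliases_sum_bounds(1)[of h] by (intro mult_nonneg_nonneg) auto
    then show ?thesis using 1 by linarith
  qed
  have sm: "(\<lambda>h. (M * E) * ((1 / r h) * ?N h) + (1 / M) * (r h * (cmod (e h))\<^sup>2)) summable_on Zs s"
    by (intro summable_on_add summable_on_cmult_right summable_lattice_sum re)
  have "(\<Sum>\<^sub>\<infinity>h\<in>Zs s. (cmod (e h))\<^sup>2) \<le>
      (\<Sum>\<^sub>\<infinity>h\<in>Zs s. (M * E) * ((1 / r h) * ?N h) + (1 / M) * (r h * (cmod (e h))\<^sup>2))"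
    by (rule infsum_mono[OF parseval_fseries(1)[OF e] sm pw])
  also have "\<dots> = (M * E) * lattice_sum + (1 / M) * E"
    by (simp only: infsum_add[OF summable_on_cmult_right[OF summable_lattice_sum] summable_on_cmult_right[OF re]]
        infsum_cmult_right' lattice_sum_def E_def)
  also have "\<dots> \<le> (M * E) * X + (1 / M) * E"
    using X M E0 by (intro add_right_mono mult_left_mono) auto
  also have "\<dots> = 2 * sqrt X * E"
    using X by (simp add: M_def field_simps)
  finally show ?thesis by (simp add: E_def)
qed

end

section \<open>Component-by-component construction\<close>

text \<open>Each term satisfies \<open>a i powr lam \<le> Y\<close>, hence exceeds
  \<open>a i powr lam\<close> at most by the factor \<open>Y powr (1 / lam - 1)\<close>. Summing
  this gives Jensen's inequality for sums, together with the convergence of the sum of the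
  \<open>a i\<close>.\<close>

lemma
  fixes a :: "'a \<Rightarrow> real"
  assumes lam: "0 < lam" "lam \<le> 1" and a: "\<And>i. i \<in> A \<Longrightarrow> 0 \<le> a i"
    and s: "(\<lambda>i. a i powr lam) summable_on A" and Y: "(\<Sum>\<^sub>\<infinity>i\<in>A. a i powr lam) \<le> Y"
  shows summable_powr_le_1: "a summable_on A"
    and infsum_powr_le_1: "infsum a A \<le> Y powr (1 / lam)"
proof -
  have Y0: "0 \<le> Y" using infsum_nonneg[of A "\<lambda>i. a i powr lam"] Y by simp
  have pt: "a i \<le> a i powr lam * Y powr (1 / lam - 1)" if i: "i \<in> A" for i
  proof (cases "a i = 0")
    case False
    have "(\<Sum>j\<in>{i}. a j powr lam) \<le> (\<Sum>\<^sub>\<infinity>j\<in>A. a j powr lam)"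
      by (rule finite_sum_le_infsum[OF s]) (use i in auto)
    then have le: "a i powr lam \<le> Y" using Y by simp
    have "a i = a i powr lam * (a i powr lam) powr (1 / lam - 1)"
      using False a[OF i] lam by (simp add: powr_powr powr_add[symmetric] right_diff_distrib)
    also have "\<dots> \<le> a i powr lam * Y powr (1 / lam - 1)"
      using le lam by (intro mult_left_mono powr_mono2) auto
    finally show ?thesis .
  qed simp
  have s2: "(\<lambda>i. a i powr lam * Y powr (1 / lam - 1)) summable_on A"
    by (rule summable_on_cmult_left[OF s])
  show s3: "a summable_on A"
    by (rule summable_on_comparison_test[OF s2 pt a])
  have "infsum a A \<le> (\<Sum>\<^sub>\<infinity>i\<in>A. a i powr lam * Y powr (1 / lam - 1))"
    by (rule infsum_mono[OF s3 s2 pt])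
  also have "\<dots> = (\<Sum>\<^sub>\<infinity>i\<in>A. a i powr lam) * Y powr (1 / lam - 1)"
    by (rule infsum_cmult_left')
  also have "\<dots> \<le> Y * Y powr (1 / lam - 1)"
    by (rule mult_right_mono[OF Y]) simp
  also have "\<dots> = Y powr (1 / lam)"
    using Y0 by (cases "Y = 0") (simp_all add: powr_diff)
  finally show "infsum a A \<le> Y powr (1 / lam)" .
qed

text \<open>Members of \<open>A\<close> lie in one residue class and have modulus at least
  \<open>n / 2\<close>. The sign of \<open>a\<close> and the quotient of
  \<open>2 * \<bar>a\<bar>\<close> by \<open>n\<close> determine \<open>a\<close>, so
  \<open>q\<close> maps \<open>A\<close> injectively into the nonzero integers, and
  \<open>\<bar>a\<bar>\<close> is at least \<open>n / 2\<close> times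
  \<open>\<bar>q a\<bar>\<close>. The sum is therefore at most \<open>(n / 2) powr - t\<close> times
  the full sum \<open>2 * zeta_real t\<close>; of the decay \<open>n powr - t\<close> only the
  factor \<open>1 / n\<close> is kept.\<close>

lemma
  fixes t :: real and n :: nat and c :: int
  assumes t: "1 < t" and n: "0 < n"
  defines "A \<equiv> {a::int. int n \<le> 2 * \<bar>a\<bar> \<and> int n dvd a - c}"
  shows summable_residue_tail: "(\<lambda>a. \<bar>of_int a\<bar> powr - t) summable_on A"
    and infsum_residue_tail: "(\<Sum>\<^sub>\<infinity>a\<in>A. \<bar>of_int a\<bar> powr - t) \<le> 2 powr (t + 1) * zeta_real t / real n"
proof -
  define q :: "int \<Rightarrow> int" where "q a = sgn a * (2 * \<bar>a\<bar> div int n)" for a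
  have full: "(\<lambda>a::int. \<bar>of_int a\<bar> powr - t) summable_on UNIV - {0}"
    and fullv: "(\<Sum>\<^sub>\<infinity>a\<in>UNIV - {0::int}. \<bar>of_int a\<bar> powr - t) = 2 * zeta_real t"
    using has_sum_int_powr[OF t] by (auto simp: summable_on_def intro: infsumI)
  have A0: "0 < \<bar>a\<bar>" if "a \<in> A" for a using that n by (auto simp: A_def)
  have q1: "1 \<le> 2 * \<bar>a\<bar> div int n" if "a \<in> A" for a
    using that n by (simp add: A_def pos_imp_zdiv_pos_iff int_one_le_iff_zero_less)
  have absq: "\<bar>q a\<bar> = 2 * \<bar>a\<bar> div int n" if "a \<in> A" for a
    using A0[OF that] q1[OF that] by (simp add: q_def abs_mult)
  show sA: "(\<lambda>a. \<bar>of_int a\<bar> powr - t) summable_on A"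
    by (rule summable_on_subset_banach[OF full]) (use A0 in force)
  have inj: "inj_on q A"
  proof (rule inj_onI)
    fix a b assume a: "a \<in> A" and b: "b \<in> A" and ab: "q a = q b"
    have "sgn (q a) = sgn a" "sgn (q b) = sgn b"
      using q1[OF a] q1[OF b] by (simp_all add: q_def sgn_mult)
    then have sg: "sgn a = sgn b" using ab by simp
    have d: "2 * \<bar>a\<bar> div int n = 2 * \<bar>b\<bar> div int n"
      using absq[OF a] absq[OF b] ab by simp
    have "\<bar>2 * \<bar>a\<bar> - 2 * \<bar>b\<bar>\<bar> < int n"
    proof -
      have "2 * \<bar>a\<bar> = int n * (2 * \<bar>a\<bar> div int n) + 2 * \<bar>a\<bar> mod int n"
        "2 * \<bar>b\<bar> = int n * (2 * \<bar>a\<bar> div int n) + 2 * \<bar>b\<bar> mod int n"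
        by (simp, simp only: d mult_div_mod_eq)
      moreover have "0 \<le> 2 * \<bar>a\<bar> mod int n" "2 * \<bar>a\<bar> mod int n < int n"
        "0 \<le> 2 * \<bar>b\<bar> mod int n" "2 * \<bar>b\<bar> mod int n < int n" using n by simp_all
      ultimately show ?thesis by linarith
    qed
    moreover have "\<bar>a\<bar> - \<bar>b\<bar> = sgn a * (a - b)"
      using sg by (simp add: abs_sgn right_diff_distrib mult.commute)
    moreover have "\<bar>sgn a\<bar> = 1" using A0[OF a] by (simp add: abs_sgn_eq)
    ultimately have lt: "\<bar>a - b\<bar> < int n" by (simp add: abs_mult flip: right_diff_distrib)
    have "int n dvd a - b"
      using dvd_diff[of "int n" "a - c" "b - c"] a b by (simp add: A_def)
    then show "a = b" using lt dvd_imp_le_int[of "a - b" "int n"] by force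
  qed
  have qA: "q ` A \<subseteq> UNIV - {0}" using absq q1 by force
  have sq: "(\<lambda>a. \<bar>of_int (q a)\<bar> powr - t) summable_on A"
    using summable_on_subset_banach[OF full qA] summable_on_reindex[OF inj, of "\<lambda>a. \<bar>of_int a\<bar> powr - t"]
    by (simp add: o_def)
  have pt: "\<bar>of_int a\<bar> powr - t \<le> (real n / 2) powr - t * \<bar>of_int (q a)\<bar> powr - t" if a: "a \<in> A" for a
  proof -
    have "int n * (2 * \<bar>a\<bar> div int n) \<le> 2 * \<bar>a\<bar>"
      using n by (metis mult_div_mod_eq add_increasing2 le_add_same_cancel1 of_nat_0_less_iff pos_mod_sign)
    then have "int n * \<bar>q a\<bar> \<le> 2 * \<bar>a\<bar>" by (simp only: absq[OF a])
    then have "real_of_int (int n * \<bar>q a\<bar>) \<le> real_of_int (2 * \<bar>a\<bar>)" by (simp only: of_int_le_iff)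
    then have "real n / 2 * \<bar>of_int (q a)\<bar> \<le> \<bar>of_int a\<bar>" by simp
    moreover have "0 < real n / 2 * \<bar>of_int (q a)\<bar>" using n absq[OF a] q1[OF a] by simp
    ultimately have "\<bar>of_int a\<bar> powr - t \<le> (real n / 2 * \<bar>of_int (q a)\<bar>) powr - t"
      using t by (intro powr_mono2') auto
    then show ?thesis by (subst (asm) powr_mult) auto
  qed
  have "(\<Sum>\<^sub>\<infinity>a\<in>A. \<bar>of_int a\<bar> powr - t) \<le> (\<Sum>\<^sub>\<infinity>a\<in>A. (real n / 2) powr - t * \<bar>of_int (q a)\<bar> powr - t)"
    by (rule infsum_mono[OF sA summable_on_cmult_right[OF sq] pt])
  also have "\<dots> = (real n / 2) powr - t * (\<Sum>\<^sub>\<infinity>a\<in>q ` A. \<bar>of_int a\<bar> powr - t)"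
    by (simp add: infsum_cmult_right' infsum_reindex[OF inj] o_def)
  also have "\<dots> \<le> (real n / 2) powr - t * (2 * zeta_real t)"
  proof (rule mult_left_mono)
    show "(\<Sum>\<^sub>\<infinity>a\<in>q ` A. \<bar>of_int a\<bar> powr - t) \<le> 2 * zeta_real t"
      unfolding fullv[symmetric]
      by (rule infsum_mono2[OF summable_on_subset_banach[OF full qA] full qA]) simp
  qed simp
  also have "\<dots> \<le> (2 powr t / real n) * (2 * zeta_real t)"
  proof (rule mult_right_mono)
    have "real n powr 1 \<le> real n powr t" using n t by (intro powr_mono) auto
    then have "real n \<le> real n powr t" using n by simp
    then show "(real n / 2) powr - t \<le> 2 powr t / real n"
      using n by (simp add: powr_divide powr_minus_divide frac_le)
    show "0 \<le> 2 * zeta_real t" using zeta_ge_1[OF t] by simp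
  qed
  also have "\<dots> = 2 powr (t + 1) * zeta_real t / real n"
    by (simp add: powr_add)
  finally show "(\<Sum>\<^sub>\<infinity>a\<in>A. \<bar>of_int a\<bar> powr - t) \<le> 2 powr (t + 1) * zeta_real t / real n" .
qed

lemma
  fixes f g :: "'a \<Rightarrow> real"
  assumes f: "f summable_on A" and g: "g summable_on B"
    and "\<And>x. x \<in> A \<Longrightarrow> 0 \<le> f x" "\<And>x. x \<in> B \<Longrightarrow> 0 \<le> g x"
  shows summable_on_times: "(\<lambda>(x, y). f x * g y) summable_on A \<times> B"
    and infsum_times: "(\<Sum>\<^sub>\<infinity>(x, y)\<in>A \<times> B. f x * g y) = infsum f A * infsum g B"
proof -
  have af: "f abs_summable_on A" and ag: "g abs_summable_on B"
    by (rule iffD1[OF summable_on_iff_abs_summable_on_real f], rule iffD1[OF summable_on_iff_abs_summable_on_real g])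
  have 1: "(\<lambda>y. norm (case (x, y) of (x, y) \<Rightarrow> f x * g y)) summable_on B" for x
    unfolding prod.case norm_mult by (rule summable_on_cmult_right[OF ag])
  have "norm (\<Sum>\<^sub>\<infinity>y\<in>B. norm (case (x, y) of (x, y) \<Rightarrow> f x * g y)) = norm (f x) * (\<Sum>\<^sub>\<infinity>y\<in>B. norm (g y))" for x
    unfolding prod.case norm_mult infsum_cmult_right' by (simp add: infsum_nonneg)
  then have 2: "(\<lambda>x. \<Sum>\<^sub>\<infinity>y\<in>B. norm (case (x, y) of (x, y) \<Rightarrow> f x * g y)) abs_summable_on A"
    by (simp only:) (rule summable_on_cmult_left[OF af])
  have "(\<lambda>(x, y). f x * g y) abs_summable_on A \<times> B"
    by (rule iffD2[OF Infinite_Sum.abs_summable_on_Sigma_iff], intro conjI ballI) (rule 1, rule 2)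
  then show s: "(\<lambda>(x, y). f x * g y) summable_on A \<times> B"
    by (rule abs_summable_summable)
  show "(\<Sum>\<^sub>\<infinity>(x, y)\<in>A \<times> B. f x * g y) = infsum f A * infsum g B"
    using infsum_Sigma'_banach[OF s] by (simp add: infsum_cmult_right' infsum_cmult_left')
qed

section \<open>Splitting the lattice sum along the components of z\<close>

context lattice_rule
begin

text \<open>With \<open>k = h + \<ell>\<close> the summand of \<open>CBC_T\<close> becomes a plain
  product and the conditions on \<open>\<ell>\<close> become conditions on the difference, so the
  double sum runs over one set of pairs.\<close>

definition cbc_pairs :: "nat \<Rightarrow> ((nat \<Rightarrow> int) \<times> (nat \<Rightarrow> int)) set" where
  "cbc_pairs d = {(h, k). h \<in> Zs s \<and> k \<in> Zs s \<and> int n dvd dotz k - dotz h \<and> k d \<noteq> h d \<and> (\<forall>j>d. k j = h j)}"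

lemma cbc_pairs_subset: "cbc_pairs d \<subseteq> Zs s \<times> Zs s" by (auto simp: cbc_pairs_def)

lemma summable_1r_pairs: "(\<lambda>(h, k). (1 / r h) * (1 / r k)) summable_on Zs s \<times> Zs s"
proof (rule summable_on_times[OF summable_1r summable_1r])
  show "0 \<le> 1 / r h" if "h \<in> Zs s" for h using r_pos[OF that] by simp
  then show "0 \<le> 1 / r h" if "h \<in> Zs s" for h using that .
qed

lemma dotz_add: "dotz (\<lambda>j. h j + l j) = dotz h + dotz l"
  by (simp add: dotz_def distrib_right sum.distrib)

lemma CBC_T_eq: "CBC_T \<alpha> \<gamma> s n d z = (\<Sum>\<^sub>\<infinity>(h, k)\<in>cbc_pairs d. (1 / r h) * (1 / r k))"
proof -
  define B where "B h = {k \<in> Zs s. int n dvd dotz k - dotz h \<and> k d \<noteq> h d \<and> (\<forall>j>d. k j = h j)}" for h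
  have "CBC_T \<alpha> \<gamma> s n d z = (\<Sum>\<^sub>\<infinity>h\<in>Zs s. \<Sum>\<^sub>\<infinity>k\<in>B h. (1 / r h) * (1 / r k))"
    unfolding CBC_T_def dotz_def[symmetric]
  proof (rule infsum_cong)
    fix h assume h: "h \<in> Zs s"
    show "(\<Sum>\<^sub>\<infinity>l\<in>{l \<in> Zs s. int n dvd dotz l \<and> l d \<noteq> 0 \<and> (\<forall>j>d. l j = 0)}. 1 / (r h * r (\<lambda>j. h j + l j))) =
      (\<Sum>\<^sub>\<infinity>k\<in>B h. (1 / r h) * (1 / r k))"
    proof (rule infsum_reindex_bij_witness[where i = "\<lambda>k j. k j - h j" and j = "\<lambda>l j. h j + l j"])
      fix l assume "l \<in> {l \<in> Zs s. int n dvd dotz l \<and> l d \<noteq> 0 \<and> (\<forall>j>d. l j = 0)}"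
      then show "(\<lambda>j. h j + l j) \<in> B h"
        using h dotz_add[of h l] by (auto simp: B_def Zs_def)
    next
      fix k assume k: "k \<in> B h"
      have "dotz k = dotz h + dotz (\<lambda>j. k j - h j)"
        using dotz_add[of h "\<lambda>j. k j - h j"] by simp
      then show "(\<lambda>j. k j - h j) \<in> {l \<in> Zs s. int n dvd dotz l \<and> l d \<noteq> 0 \<and> (\<forall>j>d. l j = 0)}"
        using h k unfolding B_def Zs_def by auto
    qed auto
  qed
  also have "\<dots> = (\<Sum>\<^sub>\<infinity>(h, k)\<in>Sigma (Zs s) B. (1 / r h) * (1 / r k))"
    by (rule infsum_Sigma'_banach, rule summable_on_subset_banach[OF summable_1r_pairs]) (auto simp: B_def)
  also have "Sigma (Zs s) B = cbc_pairs d"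
    by (auto simp: B_def cbc_pairs_def)
  finally show ?thesis .
qed

lemma CBC_T_nonneg: "0 \<le> CBC_T \<alpha> \<gamma> s n d z"
  unfolding CBC_T_eq
proof (rule infsum_nonneg)
  fix x assume "x \<in> cbc_pairs d"
  then obtain h k where x: "x = (h, k)" "h \<in> Zs s" "k \<in> Zs s" by (auto simp: cbc_pairs_def)
  then show "0 \<le> (case x of (h, k) \<Rightarrow> (1 / r h) * (1 / r k))"
    using r_pos[of h] r_pos[of k] by simp
qed

text \<open>The largest index at which two distinct aliases differ assigns each pair to exactly one
  \<open>d\<close>, and this index lies below \<open>s\<close> as both vanish from there on.\<close>

lemma lattice_sum_eq: "lattice_sum = (\<Sum>d<s. CBC_T \<alpha> \<gamma> s n d z)"
proof -
  have "lattice_sum = (\<Sum>\<^sub>\<infinity>h\<in>Zs s. \<Sum>\<^sub>\<infinity>k\<in>aliases h. (1 / r h) * (1 / r k))"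
    by (simp only: lattice_sum_def infsum_cmult_right')
  also have "\<dots> = (\<Sum>\<^sub>\<infinity>(h, k)\<in>Sigma (Zs s) aliases. (1 / r h) * (1 / r k))"
    by (rule infsum_Sigma'_banach, rule summable_on_subset_banach[OF summable_1r_pairs]) (auto simp: aliases_def)
  also have "Sigma (Zs s) aliases = (\<Union>d\<in>{..<s}. cbc_pairs d)"
  proof (intro set_eqI iffI)
    fix x assume "x \<in> Sigma (Zs s) aliases"
    then obtain h k where x: "x = (h, k)" and h: "h \<in> Zs s" and k: "k \<in> Zs s" "k \<noteq> h" "int n dvd dotz k - dotz h"
      by (auto simp: aliases_def)
    define d where "d = Max {j. k j \<noteq> h j}"
    have sub: "{j. k j \<noteq> h j} \<subseteq> {..<s}"
      using h k by (auto simp: Zs_def)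
    have fin: "finite {j. k j \<noteq> h j}" by (rule finite_subset[OF sub]) simp
    have ne: "{j. k j \<noteq> h j} \<noteq> {}" using k(2) by (auto simp: fun_eq_iff)
    have d: "d \<in> {j. k j \<noteq> h j}" unfolding d_def by (rule Max_in[OF fin ne])
    have "k j = h j" if "j > d" for j
      using that Max_ge[OF fin, of j] by (force simp: d_def[symmetric])
    then have "x \<in> cbc_pairs d" using d h k x by (simp add: cbc_pairs_def)
    moreover have "d \<in> {..<s}" using d sub by blast
    ultimately show "x \<in> (\<Union>d\<in>{..<s}. cbc_pairs d)" by blast
  next
    fix x assume "x \<in> (\<Union>d\<in>{..<s}. cbc_pairs d)"
    then show "x \<in> Sigma (Zs s) aliases" by (force simp: cbc_pairs_def aliases_def)
  qed
  also have "(\<Sum>\<^sub>\<infinity>(h, k)\<in>(\<Union>d\<in>{..<s}. cbc_pairs d). (1 / r h) * (1 / r k)) =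
      (\<Sum>d<s. \<Sum>\<^sub>\<infinity>(h, k)\<in>cbc_pairs d. (1 / r h) * (1 / r k))"
  proof (rule sum_infsum[symmetric])
    show "(\<lambda>(h, k). (1 / r h) * (1 / r k)) summable_on cbc_pairs d" for d
      by (rule summable_on_subset_banach[OF summable_1r_pairs cbc_pairs_subset])
    fix d d' :: nat assume "d \<noteq> d'"
    then consider "d < d'" | "d' < d" by linarith
    then show "cbc_pairs d \<inter> cbc_pairs d' = {}" by cases (fastforce simp: cbc_pairs_def)+
  qed simp
  finally show ?thesis by (simp only: CBC_T_eq)
qed

end

section \<open>Estimates for averaging over the choices of one component\<close>

locale lattice_rule_powr = lattice_rule +
  fixes lam :: real
  assumes lam: "0 < lam" "lam \<le> 1" and t: "1 < real \<alpha> * lam"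
begin

definition rho :: "(nat \<Rightarrow> int) \<Rightarrow> real" where
  "rho h = (1 / r h) powr lam"

abbreviation "Z2 \<equiv> 2 * zeta_real (real \<alpha> * lam)"

text \<open>\<open>G0\<close> is the sum of \<open>rho\<close> over all frequencies.
  \<open>G1\<close> carries the factor \<open>card u\<close> because a subset is met once for each
  of its members when bounds are summed over the components \<open>d\<close>.\<close>

definition G0 :: real where "G0 = (\<Sum>u\<in>Pow {..<s}. \<gamma> u powr lam * Z2 ^ card u)"
definition G1 :: real where "G1 = (\<Sum>u\<in>Pow {..<s}. real (card u) * \<gamma> u powr lam * Z2 ^ card u)"

lemma Z2_ge_1: "1 \<le> Z2" using zeta_ge_1[OF t] by simp

lemma rho_eq: "h \<in> Zs s \<Longrightarrow> rho h = \<gamma> (supp h) powr lam * (\<Prod>j\<in>supp h. \<bar>of_int (h j)\<bar> powr - (real \<alpha> * lam))"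
  unfolding rho_def using \<gamma>[OF supp_Zs(2)] by (intro inverse_r_fun_powr) (auto intro: less_imp_le)

lemma rho_nonneg: "0 \<le> rho h" by (simp add: rho_def)

lemma abs_summable_int_powr: "(\<lambda>a::int. \<bar>of_int a\<bar> powr - (real \<alpha> * lam)) abs_summable_on UNIV - {0}"
  using has_sum_imp_summable[OF has_sum_int_powr[OF t]] by simp

lemma summable_rho: "rho summable_on Zs s" and infsum_rho: "infsum rho (Zs s) = G0"
proof -
  let ?w = "\<lambda>(_::nat) (a::int). \<bar>of_int a\<bar> powr - (real \<alpha> * lam)"
  have eq: "rho h = \<gamma> (supp h) powr lam * (\<Prod>j\<in>supp h. ?w j (h j))" if "h \<in> Zs s" for h
    using rho_eq[OF that] .
  have "(\<lambda>h. \<gamma> (supp h) powr lam * (\<Prod>j\<in>supp h. ?w j (h j))) summable_on Zs s"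
    by (rule abs_summable_summable, rule abs_summable_Zs_prod[of s ?w "\<lambda>u. \<gamma> u powr lam", OF abs_summable_int_powr])
  then show "rho summable_on Zs s"
    by (rule summable_on_cong[THEN iffD2, rotated]) (rule eq)
  have "infsum rho (Zs s) = (\<Sum>\<^sub>\<infinity>h\<in>Zs s. \<gamma> (supp h) powr lam * (\<Prod>j\<in>supp h. ?w j (h j)))"
    by (rule infsum_cong) (rule eq)
  also have "\<dots> = (\<Sum>u\<in>Pow {..<s}. \<gamma> u powr lam * (\<Prod>j\<in>u. \<Sum>\<^sub>\<infinity>a\<in>UNIV - {0}. ?w j a))"
    by (rule infsum_Zs_prod[of s ?w "\<lambda>u. \<gamma> u powr lam", OF abs_summable_int_powr])
  also have "\<dots> = G0"
    unfolding G0_def by (simp add: infsumI[OF has_sum_int_powr[OF t]])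
  finally show "infsum rho (Zs s) = G0" .
qed

definition tailset :: "nat \<Rightarrow> int \<Rightarrow> (nat \<Rightarrow> int) set" where
  "tailset d c = {k \<in> Zs s. int n \<le> 2 * \<bar>k d\<bar> \<and> int n dvd k d - c}"

definition Ct :: real where "Ct = 2 powr (real \<alpha> * lam + 1) * zeta_real (real \<alpha> * lam)"

lemma Ct_nonneg: "0 \<le> Ct" using zeta_ge_1[OF t] by (simp add: Ct_def)

text \<open>The sum factorises as before, except that in component \<open>d\<close> only large
  members of one residue class remain; these contribute \<open>Ct / n\<close>, every other component
  of the support contributes \<open>Z2\<close>. Supports without \<open>d\<close> drop out because a
  large integer is nonzero.\<close>

lemma infsum_tailset:
  "infsum rho (tailset d c) \<le> Ct / real n * (\<Sum>u\<in>{u \<in> Pow {..<s}. d \<in> u}. \<gamma> u powr lam * Z2 ^ card u)"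
proof -
  define A where "A = {a::int. int n \<le> 2 * \<bar>a\<bar> \<and> int n dvd a - c}"
  let ?p = "\<lambda>a::int. \<bar>of_int a\<bar> powr - (real \<alpha> * lam)"
  \<comment> \<open>Setting the factor of component \<open>d\<close> to zero off \<open>A\<close>
    encodes membership in \<open>tailset\<close> in the product itself, so the sum can run over all
    of \<open>Zs s\<close>; \<open>g\<close> discards the supports that miss
    \<open>d\<close>.\<close>
  define w where "w j a = (if j = d then (if a \<in> A then ?p a else 0) else ?p a)" for j :: nat and a :: int
  define g where "g u = (if d \<in> u then \<gamma> u powr lam else 0)" for u
  have A0: "A \<subseteq> UNIV - {0}" using n_pos by (auto simp: A_def)
  have ws: "w j abs_summable_on UNIV - {0}" for j
    by (rule Infinite_Sum.abs_summable_on_comparison_test[OF abs_summable_int_powr]) (simp add: w_def)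
  have wj: "(\<Sum>\<^sub>\<infinity>a\<in>UNIV - {0}. w j a) = Z2" if "j \<noteq> d" for j
    using infsumI[OF has_sum_int_powr[OF t]] that by (simp add: w_def)
  have "(\<Sum>\<^sub>\<infinity>a\<in>UNIV - {0}. w d a) = (\<Sum>\<^sub>\<infinity>a\<in>A. ?p a)"
    by (rule infsum_cong_neutral) (use A0 in \<open>auto simp: w_def\<close>)
  also have "\<dots> \<le> Ct / real n"
    using infsum_residue_tail[OF t n_pos, of c] unfolding A_def Ct_def .
  finally have wd: "(\<Sum>\<^sub>\<infinity>a\<in>UNIV - {0}. w d a) \<le> Ct / real n" .
  have "infsum rho (tailset d c) = (\<Sum>\<^sub>\<infinity>h\<in>Zs s. g (supp h) * (\<Prod>j\<in>supp h. w j (h j)))"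
  proof (rule infsum_cong_neutral)
    fix h assume "h \<in> Zs s - tailset d c"
    then have h: "h \<in> Zs s" "h d \<notin> A" by (auto simp: tailset_def A_def)
    show "g (supp h) * (\<Prod>j\<in>supp h. w j (h j)) = 0"
    proof (cases "d \<in> supp h")
      case True
      moreover have "w d (h d) = 0" using h by (simp add: w_def)
      ultimately have "(\<Prod>j\<in>supp h. w j (h j)) = 0"
        using supp_Zs(2)[OF h(1)] by (intro prod_zero) auto
      then show ?thesis by simp
    qed (simp add: g_def)
  next
    fix h assume "h \<in> tailset d c \<inter> Zs s"
    then have h: "h \<in> Zs s" "h d \<in> A" by (auto simp: tailset_def A_def)
    then have "d \<in> supp h" using A0 by auto
    moreover have "(\<Prod>j\<in>supp h. w j (h j)) = (\<Prod>j\<in>supp h. ?p (h j))"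
      using h by (intro prod.cong) (auto simp: w_def)
    ultimately show "rho h = g (supp h) * (\<Prod>j\<in>supp h. w j (h j))"
      by (simp add: rho_eq[OF h(1)] g_def)
  qed (auto simp: tailset_def)
  also have "\<dots> = (\<Sum>u\<in>Pow {..<s}. g u * (\<Prod>j\<in>u. \<Sum>\<^sub>\<infinity>a\<in>UNIV - {0}. w j a))"
    by (rule infsum_Zs_prod) (rule ws)
  also have "\<dots> = (\<Sum>u\<in>{u \<in> Pow {..<s}. d \<in> u}. g u * (\<Prod>j\<in>u. \<Sum>\<^sub>\<infinity>a\<in>UNIV - {0}. w j a))"
    by (rule sum.mono_neutral_right) (auto simp: g_def)
  also have "\<dots> \<le> (\<Sum>u\<in>{u \<in> Pow {..<s}. d \<in> u}. Ct / real n * (\<gamma> u powr lam * Z2 ^ card u))"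
  proof (rule sum_mono)
    fix u assume "u \<in> {u \<in> Pow {..<s}. d \<in> u}"
    then have u: "finite u" "d \<in> u" by (auto intro: finite_subset)
    have "(\<Prod>j\<in>u. \<Sum>\<^sub>\<infinity>a\<in>UNIV - {0}. w j a) = (\<Sum>\<^sub>\<infinity>a\<in>UNIV - {0}. w d a) * (\<Prod>j\<in>u - {d}. \<Sum>\<^sub>\<infinity>a\<in>UNIV - {0}. w j a)"
      by (rule prod.remove[OF u])
    also have "(\<Prod>j\<in>u - {d}. \<Sum>\<^sub>\<infinity>a\<in>UNIV - {0}. w j a) = Z2 ^ card (u - {d})"
      by (simp add: wj)
    also have "(\<Sum>\<^sub>\<infinity>a\<in>UNIV - {0}. w d a) * \<dots> \<le> Ct / real n * Z2 ^ card u"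
      using u Z2_ge_1 Ct_nonneg by (intro mult_mono wd power_increasing card_mono) auto
    finally have "\<gamma> u powr lam * (\<Prod>j\<in>u. \<Sum>\<^sub>\<infinity>a\<in>UNIV - {0}. w j a) \<le> \<gamma> u powr lam * (Ct / real n * Z2 ^ card u)"
      by (rule mult_left_mono) simp
    also have "\<dots> = Ct / real n * (\<gamma> u powr lam * Z2 ^ card u)"
      by (rule mult.left_commute)
    finally show "g u * (\<Prod>j\<in>u. \<Sum>\<^sub>\<infinity>a\<in>UNIV - {0}. w j a) \<le> Ct / real n * (\<gamma> u powr lam * Z2 ^ card u)"
      using u by (simp only: g_def if_True)
  qed
  finally show ?thesis by (simp only: sum_distrib_left)
qed

lemma summable_rho_pairs: "(\<lambda>(h, k). rho h * rho k) summable_on Zs s \<times> Zs s"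
  and infsum_rho_pairs: "(\<Sum>\<^sub>\<infinity>(h, k)\<in>Zs s \<times> Zs s. rho h * rho k) = G0\<^sup>2"
  unfolding power2_eq_square infsum_rho[symmetric]
  by (rule summable_on_times[OF summable_rho summable_rho rho_nonneg rho_nonneg])
     (rule infsum_times[OF summable_rho summable_rho rho_nonneg rho_nonneg])

text \<open>This is Jensen's inequality with exponent \<open>lam\<close>. The \<open>lam\<close>-th
  power of the left-hand side is then bounded by a plain sum of products of \<open>rho\<close>,
  which can be averaged over choices of a component.\<close>

lemma CBC_T_le:
  "CBC_T \<alpha> \<gamma> s n d z \<le> (\<Sum>\<^sub>\<infinity>(h, k)\<in>cbc_pairs d. rho h * rho k) powr (1 / lam)"
  unfolding CBC_T_eq
proof (rule infsum_powr_le_1[OF lam])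
  have eq: "(case x of (h, k) \<Rightarrow> (1 / r h) * (1 / r k)) powr lam = (case x of (h, k) \<Rightarrow> rho h * rho k)"
    and nn: "0 \<le> (case x of (h, k) \<Rightarrow> (1 / r h) * (1 / r k))" if xd: "x \<in> cbc_pairs d" for x
  proof -
    obtain h k where x: "x = (h, k)" "h \<in> Zs s" "k \<in> Zs s"
      using xd cbc_pairs_subset[of d] by (cases x) auto
    have "0 \<le> 1 / r h" "0 \<le> 1 / r k" using r_pos x by (simp_all add: less_imp_le)
    then show "(case x of (h, k) \<Rightarrow> (1 / r h) * (1 / r k)) powr lam = (case x of (h, k) \<Rightarrow> rho h * rho k)"
      "0 \<le> (case x of (h, k) \<Rightarrow> (1 / r h) * (1 / r k))"
      unfolding x(1) prod.case rho_def by (simp_all only: powr_mult mult_nonneg_nonneg)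
  qed
  show "\<And>x. x \<in> cbc_pairs d \<Longrightarrow> 0 \<le> (case x of (h, k) \<Rightarrow> (1 / r h) * (1 / r k))" by (rule nn)
  show "(\<lambda>x. (case x of (h, k) \<Rightarrow> (1 / r h) * (1 / r k)) powr lam) summable_on cbc_pairs d"
    using summable_on_subset_banach[OF summable_rho_pairs cbc_pairs_subset]
    by (rule summable_on_cong[THEN iffD2, rotated]) (rule eq)
  show "(\<Sum>\<^sub>\<infinity>x\<in>cbc_pairs d. (case x of (h, k) \<Rightarrow> (1 / r h) * (1 / r k)) powr lam) \<le> (\<Sum>\<^sub>\<infinity>(h, k)\<in>cbc_pairs d. rho h * rho k)"
    by (rule eq_refl, rule infsum_cong) (rule eq)
qed

text \<open>For these pairs the divisibility of \<open>dotz k - dotz h\<close> by \<open>n\<close>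
  is unaffected by the choice of \<open>z d\<close>, so averaging gains nothing; the factor
  \<open>1 / n\<close> has to come from their sparsity. Equality of the later components is left
  out, which only enlarges the set.\<close>

definition congr_pairs :: "nat \<Rightarrow> ((nat \<Rightarrow> int) \<times> (nat \<Rightarrow> int)) set" where
  "congr_pairs d = {(h, k). h \<in> Zs s \<and> k \<in> Zs s \<and> k d \<noteq> h d \<and> int n dvd k d - h d}"

text \<open>Two distinct integers that are congruent modulo \<open>n\<close> are not both smaller than \<open>n / 2\<close>
  in absolute value.\<close>

lemma infsum_congr_pairs:
  "(\<Sum>\<^sub>\<infinity>(h, k)\<in>congr_pairs d. rho h * rho k) \<le>
    2 * (G0 * (Ct / real n * (\<Sum>u\<in>{u \<in> Pow {..<s}. d \<in> u}. \<gamma> u powr lam * Z2 ^ card u)))"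
proof -
  let ?Q = "Ct / real n * (\<Sum>u\<in>{u \<in> Pow {..<s}. d \<in> u}. \<gamma> u powr lam * Z2 ^ card u)"
  \<comment> \<open>The pairs in which \<open>k d\<close> is the large one. Swapping the entries
    covers the other case and, as the summand is symmetric, does not change the sum.\<close>
  define L where "L = Sigma (Zs s) (\<lambda>h. tailset d (h d))"
  have Lsub: "L \<subseteq> Zs s \<times> Zs s" by (auto simp: L_def tailset_def)
  have Lsub': "prod.swap ` L \<subseteq> Zs s \<times> Zs s" using Lsub by auto
  have sL: "(\<lambda>(h, k). rho h * rho k) summable_on L"
    by (rule summable_on_subset_banach[OF summable_rho_pairs Lsub])
  have sL': "(\<lambda>(h, k). rho h * rho k) summable_on prod.swap ` L"
    by (rule summable_on_subset_banach[OF summable_rho_pairs Lsub'])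
  have "(\<Sum>\<^sub>\<infinity>(h, k)\<in>L. rho h * rho k) = (\<Sum>\<^sub>\<infinity>h\<in>Zs s. \<Sum>\<^sub>\<infinity>k\<in>tailset d (h d). rho h * rho k)"
    unfolding L_def by (rule infsum_Sigma'_banach[symmetric]) (rule sL[unfolded L_def])
  also have "\<dots> \<le> (\<Sum>\<^sub>\<infinity>h\<in>Zs s. rho h * ?Q)"
  proof (rule infsum_mono)
    show "(\<lambda>h. \<Sum>\<^sub>\<infinity>k\<in>tailset d (h d). rho h * rho k) summable_on Zs s"
      using summable_on_Sigma_banach[OF sL[unfolded L_def]] by simp
    show "(\<lambda>h. rho h * ?Q) summable_on Zs s" by (rule summable_on_cmult_left[OF summable_rho])
    show "(\<Sum>\<^sub>\<infinity>k\<in>tailset d (h d). rho h * rho k) \<le> rho h * ?Q" for h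
      unfolding infsum_cmult_right' by (rule mult_left_mono[OF infsum_tailset rho_nonneg])
  qed
  also have "\<dots> = G0 * ?Q" by (simp only: infsum_cmult_left' infsum_rho)
  finally have L: "(\<Sum>\<^sub>\<infinity>(h, k)\<in>L. rho h * rho k) \<le> G0 * ?Q" .
  have L': "(\<Sum>\<^sub>\<infinity>(h, k)\<in>prod.swap ` L. rho h * rho k) = (\<Sum>\<^sub>\<infinity>(h, k)\<in>L. rho h * rho k)"
    by (subst infsum_reindex) (auto simp: o_def case_prod_unfold mult.commute intro: inj_onI)
  have dsub: "congr_pairs d \<subseteq> Zs s \<times> Zs s" by (auto simp: congr_pairs_def)
  have sub: "congr_pairs d \<subseteq> L \<union> (prod.swap ` L - L)"
  proof
    fix x assume "x \<in> congr_pairs d"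
    then obtain h k where x: "x = (h, k)" and hk: "h \<in> Zs s" "k \<in> Zs s" "k d \<noteq> h d" "int n dvd k d - h d"
      by (auto simp: congr_pairs_def)
    have "int n \<le> \<bar>k d - h d\<bar>" using dvd_imp_le_int[OF _ hk(4)] hk(3) by simp
    then have "int n \<le> 2 * \<bar>k d\<bar> \<or> int n \<le> 2 * \<bar>h d\<bar>" by linarith
    moreover have "int n dvd h d - k d" using hk(4) by (simp add: dvd_diff_commute)
    ultimately have "(h, k) \<in> L \<or> (k, h) \<in> L" using hk by (auto simp: L_def tailset_def)
    then show "x \<in> L \<union> (prod.swap ` L - L)" unfolding x by force
  qed
  have sD: "(\<lambda>(h, k). rho h * rho k) summable_on (prod.swap ` L - L)"
    by (rule summable_on_subset_banach[OF sL']) auto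
  have nn: "0 \<le> (case x of (h, k) \<Rightarrow> rho h * rho k)" for x
    by (simp add: case_prod_unfold rho_nonneg)
  have "(\<Sum>\<^sub>\<infinity>(h, k)\<in>congr_pairs d. rho h * rho k) \<le> (\<Sum>\<^sub>\<infinity>(h, k)\<in>L \<union> (prod.swap ` L - L). rho h * rho k)"
    by (rule infsum_mono2[OF summable_on_subset_banach[OF summable_rho_pairs dsub] summable_on_Un_disjoint[OF sL sD] sub nn]) blast
  also have "\<dots> = (\<Sum>\<^sub>\<infinity>(h, k)\<in>L. rho h * rho k) + (\<Sum>\<^sub>\<infinity>(h, k)\<in>prod.swap ` L - L. rho h * rho k)"
    by (rule infsum_Un_disjoint[OF sL sD]) blast
  also have "(\<Sum>\<^sub>\<infinity>(h, k)\<in>prod.swap ` L - L. rho h * rho k) \<le> (\<Sum>\<^sub>\<infinity>(h, k)\<in>prod.swap ` L. rho h * rho k)"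
    by (rule infsum_mono2[OF sD sL' _ nn]) blast
  finally show ?thesis using L L' by linarith
qed

end

text \<open>Minimality bounds the \<open>lam\<close>-th power of \<open>T_d\<close> by the average
  of the corresponding sums over all \<open>n - 1\<close> values of \<open>z d\<close>. A pair with
  \<open>k d\<close> and \<open>h d\<close> incongruent modulo \<open>n\<close> occurs for at most
  one value, so averaging gains \<open>1 / (n - 1)\<close>; the other pairs belong to
  \<open>congr_pairs\<close>. The sets \<open>E d\<close> are disjoint, so over all \<open>d\<close>
  the averaged part adds up to at most \<open>G0\<^sup>2 / (n - 1)\<close>.\<close>

lemma CBC_lattice_sum:
  assumes "lattice_rule_powr \<alpha> \<gamma> s n z lam" and cbc: "CBC_vector \<alpha> \<gamma> s n z"
  defines "G0 \<equiv> lattice_rule_powr.G0 \<alpha> \<gamma> s lam" and "G1 \<equiv> lattice_rule_powr.G1 \<alpha> \<gamma> s lam"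
    and "Ct \<equiv> lattice_rule_powr.Ct \<alpha> lam"
  shows "lattice_rule.lattice_sum \<alpha> \<gamma> s n z \<le> (2 / real n * (G0\<^sup>2 + Ct * G0 * G1)) powr (1 / lam)"
proof -
  interpret L: lattice_rule_powr \<alpha> \<gamma> s n z lam by fact
  have n2: "2 \<le> n" using L.prime prime_ge_2_nat by blast
  let ?W = "{1..n - 1}"
  let ?rr = "\<lambda>(h, k). L.rho h * L.rho k"
  let ?T = "\<lambda>d. CBC_T \<alpha> \<gamma> s n d z"
  have lr: "lattice_rule_powr \<alpha> \<gamma> s n (z(d := w)) lam" if "w \<in> ?W" for d w
    using L.lattice_rule_powr_axioms that
    by (auto simp: lattice_rule_powr_def lattice_rule_def)
  define E where "E d = {(h, k). h \<in> Zs s \<and> k \<in> Zs s \<and> k d \<noteq> h d \<and> (\<forall>j>d. k j = h j)}" for d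
  have Esub: "E d \<subseteq> Zs s \<times> Zs s" for d by (auto simp: E_def)
  have sE: "?rr summable_on A" if "A \<subseteq> Zs s \<times> Zs s" for A
    by (rule summable_on_subset_banach[OF L.summable_rho_pairs that])
  have nn: "0 \<le> ?rr x" for x by (simp add: case_prod_unfold L.rho_nonneg)
  define P where "P d w = lattice_rule.cbc_pairs s n (z(d := w)) d" for d w
  have Psub: "P d w \<subseteq> E d" if "w \<in> ?W" for d w
  proof -
    interpret Lw: lattice_rule_powr \<alpha> \<gamma> s n "z(d := w)" lam by (rule lr[OF that])
    show ?thesis by (auto simp: P_def Lw.cbc_pairs_def E_def)
  qed
  have Tw: "?T d powr lam \<le> infsum ?rr (P d w)" if d: "d < s" and w: "w \<in> ?W" for d w
  proof -
    interpret Lw: lattice_rule_powr \<alpha> \<gamma> s n "z(d := w)" lam by (rule lr[OF w])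
    have "?T d \<le> CBC_T \<alpha> \<gamma> s n d (z(d := w))"
      using cbc d w by (simp add: CBC_vector_def)
    also have "\<dots> \<le> infsum ?rr (P d w) powr (1 / lam)"
      unfolding P_def by (rule Lw.CBC_T_le)
    finally have "?T d powr lam \<le> (infsum ?rr (P d w) powr (1 / lam)) powr lam"
      using L.CBC_T_nonneg L.lam by (intro powr_mono2) auto
    also have "\<dots> = infsum ?rr (P d w)"
      using L.lam infsum_nonneg[of "P d w" ?rr, OF nn] by (simp add: powr_powr)
    finally show ?thesis .
  qed
  have cnt: "(\<Sum>w\<in>?W. if x \<in> P d w then ?rr x else 0) \<le>
      ?rr x + real (n - 1) * (if x \<in> L.congr_pairs d then ?rr x else 0)" if d: "d < s" and x: "x \<in> E d" for d x
  proof -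
    obtain h k where xhk: "x = (h, k)" and hk: "h \<in> Zs s" "k \<in> Zs s" "k d \<noteq> h d" "\<forall>j>d. k j = h j"
      using x by (auto simp: E_def)
    have eq: "(\<Sum>w\<in>?W. if x \<in> P d w then ?rr x else 0) = real (card {w \<in> ?W. x \<in> P d w}) * ?rr x"
      by (simp add: sum.If_cases Int_def)
    show ?thesis
    proof (cases "int n dvd k d - h d")
      case True
      then have "x \<in> L.congr_pairs d" using hk xhk by (simp add: L.congr_pairs_def)
      moreover have "card {w \<in> ?W. x \<in> P d w} \<le> card ?W" by (rule card_mono) auto
      then have "real (card {w \<in> ?W. x \<in> P d w}) * ?rr x \<le> real (n - 1) * ?rr x"
        by (intro mult_right_mono nn) simp
      ultimately show ?thesis using nn[of x] eq by simp
    next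
      case False
      \<comment> \<open>Changing \<open>z d\<close> from \<open>w'\<close> to \<open>w\<close>
        alters \<open>dotz k - dotz h\<close> by \<open>(k d - h d) * (w - w')\<close>. The prime
        \<open>n\<close> divides this but not the first factor.\<close>
      have "w = w'" if w: "w \<in> ?W" "x \<in> P d w" and w': "w' \<in> ?W" "x \<in> P d w'" for w w'
      proof -
        interpret Lw: lattice_rule_powr \<alpha> \<gamma> s n "z(d := w)" lam by (rule lr[OF w(1)])
        interpret Lw': lattice_rule_powr \<alpha> \<gamma> s n "z(d := w')" lam by (rule lr[OF w'(1)])
        have 1: "int n dvd Lw.dotz k - Lw.dotz h" "int n dvd Lw'.dotz k - Lw'.dotz h"
          using w(2) w'(2) by (auto simp: P_def xhk Lw.cbc_pairs_def Lw'.cbc_pairs_def)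
        have "(Lw.dotz k - Lw.dotz h) - (Lw'.dotz k - Lw'.dotz h) =
            (\<Sum>j<s. (k j - h j) * (int ((z(d := w)) j) - int ((z(d := w')) j)))"
          unfolding Lw.dotz_def Lw'.dotz_def by (simp add: sum_subtractf[symmetric] algebra_simps del: fun_upd_apply)
        also have "\<dots> = (\<Sum>j\<in>{d}. (k j - h j) * (int ((z(d := w)) j) - int ((z(d := w')) j)))"
          by (rule sum.mono_neutral_right) (use d in auto)
        finally have "int n dvd (k d - h d) * (int w - int w')"
          using dvd_diff[OF 1] by simp
        moreover have "prime (int n)" using L.prime by simp
        ultimately have "int n dvd int w - int w'"
          using False prime_dvd_mult_iff by blast
        moreover have "\<bar>int w - int w'\<bar> < int n" using w(1) w'(1) by auto
        ultimately show "w = w'" using dvd_imp_le_int[of "int w - int w'" "int n"] by force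
      qed
      then have "card {w \<in> ?W. x \<in> P d w} \<le> 1"
        by (subst One_nat_def, subst card_le_Suc0_iff_eq) auto
      then have "real (card {w \<in> ?W. x \<in> P d w}) * ?rr x \<le> 1 * ?rr x"
        by (intro mult_right_mono nn) simp
      moreover have "x \<notin> L.congr_pairs d" using False by (auto simp: L.congr_pairs_def xhk)
      ultimately show ?thesis using nn[of x] eq by simp
    qed
  qed
  have Td: "?T d powr lam \<le> 1 / real (n - 1) * infsum ?rr (E d) + infsum ?rr (L.congr_pairs d)" if d: "d < s" for d
  proof -
    have csub: "L.congr_pairs d \<subseteq> Zs s \<times> Zs s" by (auto simp: L.congr_pairs_def)
    let ?c = "\<lambda>x. if x \<in> L.congr_pairs d then ?rr x else 0"
    have sc: "?c summable_on E d"
    proof (rule summable_on_comparison_test[OF sE[OF Esub[of d]]])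
      show "?c x \<le> ?rr x" "0 \<le> ?c x" for x using nn[of x] by auto
    qed
    have sP: "(\<lambda>x. if x \<in> P d w then ?rr x else 0) summable_on E d" for w
    proof (rule summable_on_comparison_test[OF sE[OF Esub[of d]]])
      show "(if x \<in> P d w then ?rr x else 0) \<le> ?rr x" "0 \<le> (if x \<in> P d w then ?rr x else 0)" for x using nn[of x] by auto
    qed
    have "real (n - 1) * ?T d powr lam = (\<Sum>w\<in>?W. ?T d powr lam)" by simp
    also have "\<dots> \<le> (\<Sum>w\<in>?W. infsum ?rr (P d w))" by (intro sum_mono Tw d)
    also have "\<dots> = (\<Sum>w\<in>?W. \<Sum>\<^sub>\<infinity>x\<in>E d. if x \<in> P d w then ?rr x else 0)"
    proof (rule sum.cong[OF refl])
      fix w assume "w \<in> ?W"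
      from Psub[OF this] show "infsum ?rr (P d w) = (\<Sum>\<^sub>\<infinity>x\<in>E d. if x \<in> P d w then ?rr x else 0)"
        by (intro infsum_cong_neutral) auto
    qed
    also have "\<dots> = (\<Sum>\<^sub>\<infinity>x\<in>E d. \<Sum>w\<in>?W. if x \<in> P d w then ?rr x else 0)"
      by (rule infsum_sum[symmetric]) (rule sP)
    also have "\<dots> \<le> (\<Sum>\<^sub>\<infinity>x\<in>E d. ?rr x + real (n - 1) * ?c x)"
      by (rule infsum_mono[OF summable_on_sum[OF sP] summable_on_add[OF sE[OF Esub] summable_on_cmult_right[OF sc]] cnt[OF d]])
    also have "\<dots> = infsum ?rr (E d) + real (n - 1) * infsum ?c (E d)"
      by (simp only: infsum_add[OF sE[OF Esub] summable_on_cmult_right[OF sc]] infsum_cmult_right')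
    also have "infsum ?c (E d) \<le> infsum ?rr (L.congr_pairs d)"
      by (rule infsum_mono_neutral[OF sc sE[OF csub]]) (use nn in auto)
    finally have "real (n - 1) * ?T d powr lam \<le> infsum ?rr (E d) + real (n - 1) * infsum ?rr (L.congr_pairs d)"
      using n2 by simp
    then show ?thesis using n2 by (simp add: field_simps)
  qed
  have Esum: "(\<Sum>d<s. infsum ?rr (E d)) \<le> G0\<^sup>2"
  proof -
    have "(\<Sum>d<s. infsum ?rr (E d)) = infsum ?rr (\<Union>d\<in>{..<s}. E d)"
    proof (rule sum_infsum)
      fix d d' :: nat assume "d \<noteq> d'"
      then consider "d < d'" | "d' < d" by linarith
      then show "E d \<inter> E d' = {}" by cases (fastforce simp: E_def)+
    qed (use sE Esub in auto)
    also have "\<dots> \<le> infsum ?rr (Zs s \<times> Zs s)"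
      by (rule infsum_mono2[OF sE L.summable_rho_pairs]) (use Esub nn in blast)+
    finally show ?thesis by (simp only: L.infsum_rho_pairs G0_def)
  qed
  have Csum: "(\<Sum>d<s. infsum ?rr (L.congr_pairs d)) \<le> 2 * (G0 * (Ct / real n * G1))"
  proof -
    have "(\<Sum>d<s. infsum ?rr (L.congr_pairs d)) \<le>
      (\<Sum>d<s. 2 * (G0 * (Ct / real n * (\<Sum>u\<in>{u \<in> Pow {..<s}. d \<in> u}. \<gamma> u powr lam * L.Z2 ^ card u))))"
      unfolding G0_def Ct_def by (intro sum_mono L.infsum_congr_pairs)
    also have "\<dots> = 2 * (G0 * (Ct / real n * (\<Sum>d<s. \<Sum>u\<in>{u \<in> Pow {..<s}. d \<in> u}. \<gamma> u powr lam * L.Z2 ^ card u)))"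
      by (simp only: sum_distrib_left)
    also have "(\<Sum>d<s. \<Sum>u\<in>{u \<in> Pow {..<s}. d \<in> u}. \<gamma> u powr lam * L.Z2 ^ card u) =
        (\<Sum>u\<in>Pow {..<s}. \<Sum>d\<in>{d \<in> {..<s}. d \<in> u}. \<gamma> u powr lam * L.Z2 ^ card u)"
      by (rule sum.swap_restrict) auto
    also have "\<dots> = G1"
      unfolding G1_def L.G1_def
    proof (rule sum.cong[OF refl])
      fix u assume "u \<in> Pow {..<s}"
      then have "{d \<in> {..<s}. d \<in> u} = u" by auto
      then show "(\<Sum>d\<in>{d \<in> {..<s}. d \<in> u}. \<gamma> u powr lam * L.Z2 ^ card u) = real (card u) * \<gamma> u powr lam * L.Z2 ^ card u"
        by simp
    qed
    finally show ?thesis .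
  qed
  have "(\<Sum>d<s. ?T d powr lam) \<le> (\<Sum>d<s. 1 / real (n - 1) * infsum ?rr (E d) + infsum ?rr (L.congr_pairs d))"
    by (intro sum_mono Td) simp
  also have "\<dots> = 1 / real (n - 1) * (\<Sum>d<s. infsum ?rr (E d)) + (\<Sum>d<s. infsum ?rr (L.congr_pairs d))"
    by (simp only: sum.distrib sum_distrib_left)
  also have "\<dots> \<le> 2 / real n * G0\<^sup>2 + 2 * (G0 * (Ct / real n * G1))"
  proof (rule add_mono[OF _ Csum])
    have "1 / real (n - 1) \<le> 2 / real n" using n2 by (simp add: of_nat_diff field_simps)
    moreover have "0 \<le> (\<Sum>d<s. infsum ?rr (E d))" by (intro sum_nonneg infsum_nonneg nn)
    ultimately show "1 / real (n - 1) * (\<Sum>d<s. infsum ?rr (E d)) \<le> 2 / real n * G0\<^sup>2"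
      using Esum by (intro mult_mono) auto
  qed
  also have "\<dots> = 2 / real n * (G0\<^sup>2 + Ct * G0 * G1)" by (simp add: algebra_simps)
  finally have fin: "(\<Sum>d<s. ?T d powr lam) \<le> 2 / real n * (G0\<^sup>2 + Ct * G0 * G1)" .
  \<comment> \<open>Jensen's inequality a second time, now over the finitely many components, undoes
    the \<open>lam\<close>-th powers.\<close>
  have "infsum ?T {..<s} \<le> (2 / real n * (G0\<^sup>2 + Ct * G0 * G1)) powr (1 / lam)"
    by (rule infsum_powr_le_1[OF L.lam L.CBC_T_nonneg]) (use fin in simp_all)
  then show ?thesis by (simp add: L.lattice_sum_eq)
qed

section \<open>Parametric linear systems\<close>

text \<open>A partition of \<open>n + 1\<close> elements into \<open>m + 1\<close> blocks is given
  by the \<open>k\<close> elements outside the block of the last element and a partition of these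
  into \<open>m\<close> blocks. The formal proof is an induction with Pascal's rule.\<close>

lemma sum_binomial_Stirling: "(\<Sum>k\<le>n. (n choose k) * Stirling k m) = Stirling (Suc n) (Suc m)"
proof (induction n arbitrary: m)
  case 0
  then show ?case by (cases m) auto
next
  case (Suc n)
  have "(\<Sum>k\<le>Suc n. (Suc n choose k) * Stirling k m) =
      Stirling 0 m + (\<Sum>k\<le>n. (Suc n choose Suc k) * Stirling (Suc k) m)"
    by (simp add: sum.atMost_Suc_shift del: sum.atMost_Suc binomial_Suc_Suc Stirling.simps)
  also have "(\<Sum>k\<le>n. (Suc n choose Suc k) * Stirling (Suc k) m) =
      (\<Sum>k\<le>n. (n choose k) * Stirling (Suc k) m) + (\<Sum>k\<le>n. (n choose Suc k) * Stirling (Suc k) m)"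
    by (simp add: distrib_right sum.distrib del: Stirling.simps)
  also have "Stirling 0 m + (\<dots>) =
      (\<Sum>k\<le>n. (n choose k) * Stirling (Suc k) m) + (\<Sum>k\<le>Suc n. (n choose k) * Stirling k m)"
    by (simp add: sum.atMost_Suc_shift del: sum.atMost_Suc Stirling.simps)
  also have "(\<Sum>k\<le>Suc n. (n choose k) * Stirling k m) = Stirling (Suc n) (Suc m)"
    by (simp add: Suc.IH[of m] del: Stirling.simps)
  also have "(\<Sum>k\<le>n. (n choose k) * Stirling (Suc k) m) + Stirling (Suc n) (Suc m) = Stirling (Suc (Suc n)) (Suc m)"
  proof (cases m)
    case 0
    then show ?thesis by simp
  next
    case (Suc m')
    have "(\<Sum>k\<le>n. (n choose k) * Stirling (Suc k) m) =
        m * (\<Sum>k\<le>n. (n choose k) * Stirling k m) + (\<Sum>k\<le>n. (n choose k) * Stirling k m')"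
      unfolding Suc by (simp add: sum_distrib_left sum.distrib[symmetric] algebra_simps)
    also have "\<dots> = m * Stirling (Suc n) (Suc m) + Stirling (Suc n) (Suc m')"
      by (simp only: Suc.IH)
    finally show ?thesis using Suc by simp
  qed
  finally show ?case .
qed

text \<open>Counts partitions into \<open>m + 1\<close> blocks with one marked block, by the size of that block.\<close>

lemma sum_binomial_Stirling_pos:
  "(\<Sum>l=1..n. (n choose l) * Stirling (n - l) m) = Suc m * Stirling n (Suc m)"
proof -
  have "(\<Sum>l=1..n. (n choose l) * Stirling (n - l) m) = (\<Sum>k<n. (n choose k) * Stirling k m)"
    by (rule sum.reindex_bij_witness[where i = "\<lambda>k. n - k" and j = "\<lambda>l. n - l"])
       (auto simp: binomial_symmetric[symmetric])
  moreover have "(\<Sum>k\<le>n. (n choose k) * Stirling k m) = (\<Sum>k<n. (n choose k) * Stirling k m) + Stirling n m"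
    by (simp add: lessThan_Suc_atMost[symmetric])
  ultimately show ?thesis
    using sum_binomial_Stirling[of n m] by simp
qed

text \<open>The bound for the derivative of order \<open>\<nu>\<close>, of Faa di Bruno type. Every
  \<open>m j\<close> ranges up to a fixed \<open>K\<close> instead of \<open>\<nu> j\<close>: the
  additional terms vanish with the Stirling numbers as long as \<open>\<nu> j \<le> K\<close>, and
  the index set stays the same when the recursion lowers \<open>\<nu>\<close>.\<close>

definition fdb_sum :: "nat \<Rightarrow> nat \<Rightarrow> (nat \<Rightarrow> real) \<Rightarrow> (nat \<Rightarrow> nat) \<Rightarrow> real" where
  "fdb_sum s K b \<nu> = (\<Sum>m\<in>{..<s} \<rightarrow>\<^sub>E {..K}. fact (\<Sum>j<s. m j) * (\<Prod>j<s. b j ^ m j * real (Stirling (\<nu> j) (m j))))"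

text \<open>In component \<open>j\<close> the identity for Stirling numbers collapses the sum over
  \<open>l\<close> into a shift of \<open>m j\<close> by one. After reindexing, the term of
  \<open>m\<close> carries \<open>fact (\<bar>m\<bar> - 1) * m j\<close>, where
  \<open>\<bar>m\<bar>\<close> is the sum of the entries, and summation over \<open>j\<close>
  restores \<open>fact \<bar>m\<bar>\<close>.\<close>

lemma fdb_sum_rec:
  assumes b: "\<And>j. 0 \<le> b j" and \<nu>: "\<And>j. j < s \<Longrightarrow> \<nu> j \<le> K"
  shows "(\<Sum>j<s. \<Sum>l=1..\<nu> j. real (\<nu> j choose l) * b j * fdb_sum s K b (\<nu>(j := \<nu> j - l))) \<le> fdb_sum s K b \<nu>"
proof -
  let ?X = "{..<s} \<rightarrow>\<^sub>E {..K}"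
  let ?F = "\<lambda>m. \<Prod>j<s. b j ^ m j * real (Stirling (\<nu> j) (m j))"
  let ?t = "\<lambda>m. \<Sum>i<s. m i"
  have fX: "finite ?X" by (intro finite_PiE) auto
  have one: "(\<Sum>l=1..\<nu> j. real (\<nu> j choose l) * b j * fdb_sum s K b (\<nu>(j := \<nu> j - l))) =
      (\<Sum>m\<in>?X. fact (?t m - 1) * real (m j) * ?F m)" if j: "j < s" for j
  proof -
    let ?R = "\<lambda>m. \<Prod>i\<in>{..<s} - {j}. b i ^ m i * real (Stirling (\<nu> i) (m i))"
    have split: "?F m = b j ^ m j * real (Stirling (\<nu> j) (m j)) * ?R m" for m
      using j by (subst prod.remove[of _ j]) auto
    have trm: "(\<Sum>l=1..\<nu> j. real (\<nu> j choose l) * b j *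
        (fact (?t m) * (\<Prod>i<s. b i ^ m i * real (Stirling ((\<nu>(j := \<nu> j - l)) i) (m i))))) =
        fact (?t m) * real (Suc (m j)) * ?F (m(j := Suc (m j)))" for m
    proof -
      have "(\<Prod>i<s. b i ^ m i * real (Stirling ((\<nu>(j := \<nu> j - l)) i) (m i))) =
          b j ^ m j * real (Stirling (\<nu> j - l) (m j)) * ?R m" for l
        using j by (subst prod.remove[of _ j]) (auto intro!: prod.cong)
      then have "(\<Sum>l=1..\<nu> j. real (\<nu> j choose l) * b j *
        (fact (?t m) * (\<Prod>i<s. b i ^ m i * real (Stirling ((\<nu>(j := \<nu> j - l)) i) (m i))))) =
        (\<Sum>l=1..\<nu> j. real ((\<nu> j choose l) * Stirling (\<nu> j - l) (m j)) * (fact (?t m) * b j ^ Suc (m j) * ?R m))"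
        by (intro sum.cong refl) (simp add: mult_ac)
      also have "\<dots> = real (\<Sum>l=1..\<nu> j. (\<nu> j choose l) * Stirling (\<nu> j - l) (m j)) * (fact (?t m) * b j ^ Suc (m j) * ?R m)"
        by (simp only: sum_distrib_right of_nat_sum)
      also have "\<dots> = real (Suc (m j) * Stirling (\<nu> j) (Suc (m j))) * (fact (?t m) * b j ^ Suc (m j) * ?R m)"
        by (simp only: sum_binomial_Stirling_pos)
      also have "\<dots> = fact (?t m) * real (Suc (m j)) * ?F (m(j := Suc (m j)))"
      proof -
        have R: "?R (m(j := Suc (m j))) = ?R m" by (intro prod.cong) auto
        show ?thesis unfolding split R by (simp only: fun_upd_same of_nat_mult mult_ac)
      qed
      finally show ?thesis .
    qed
    have "(\<Sum>l=1..\<nu> j. real (\<nu> j choose l) * b j * fdb_sum s K b (\<nu>(j := \<nu> j - l))) =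
       (\<Sum>m\<in>?X. \<Sum>l=1..\<nu> j. real (\<nu> j choose l) * b j *
        (fact (?t m) * (\<Prod>i<s. b i ^ m i * real (Stirling ((\<nu>(j := \<nu> j - l)) i) (m i)))))"
      unfolding fdb_sum_def sum_distrib_left by (rule sum.swap)
    also have "\<dots> = (\<Sum>m\<in>?X. fact (?t m) * real (Suc (m j)) * ?F (m(j := Suc (m j))))"
      by (simp only: trm)
    \<comment> \<open>For \<open>m j = K\<close> the shifted index would leave the index set, but
      then \<open>\<nu> j \<le> K\<close> makes the Stirling number zero.\<close>
    also have "\<dots> = (\<Sum>m\<in>{m \<in> ?X. m j < K}. fact (?t m) * real (Suc (m j)) * ?F (m(j := Suc (m j))))"
    proof (rule sum.mono_neutral_right[OF fX])
      show "\<forall>m\<in>?X - {m \<in> ?X. m j < K}. fact (?t m) * real (Suc (m j)) * ?F (m(j := Suc (m j))) = 0"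
      proof
        fix m assume "m \<in> ?X - {m \<in> ?X. m j < K}"
        then have "\<not> m j < K" by blast
        then have "\<nu> j < Suc (m j)" using \<nu>[OF j] by linarith
        then have "Stirling (\<nu> j) (Suc (m j)) = 0" by (rule Stirling_less)
        then have "?F (m(j := Suc (m j))) = 0"
          unfolding split by (simp del: Stirling.simps)
        then show "fact (?t m) * real (Suc (m j)) * ?F (m(j := Suc (m j))) = 0" by simp
      qed
    qed auto
    also have "\<dots> = (\<Sum>m\<in>{m \<in> ?X. 0 < m j}. fact (?t m - 1) * real (m j) * ?F m)"
    proof (rule sum.reindex_bij_witness[where i = "\<lambda>m. m(j := m j - 1)" and j = "\<lambda>m. m(j := Suc (m j))"])
      fix m assume m: "m \<in> {m \<in> ?X. m j < K}"
      have "?t (m(j := Suc (m j))) = Suc (?t m)"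
        using j by (simp add: sum.remove[of "{..<s}" j])
      then show "fact (?t (m(j := Suc (m j))) - 1) * real ((m(j := Suc (m j))) j) * ?F (m(j := Suc (m j))) =
        fact (?t m) * real (Suc (m j)) * ?F (m(j := Suc (m j)))" by simp
      show "m(j := Suc (m j)) \<in> {m \<in> ?X. 0 < m j}" using m j by (auto simp: PiE_iff extensional_def)
    next
      fix m assume m: "m \<in> {m \<in> ?X. 0 < m j}"
      then have "m j \<le> K" "0 < m j" using j by (auto simp: PiE_iff)
      then have "m j - 1 \<le> K" "m j - 1 < K" by linarith+
      then show "m(j := m j - 1) \<in> {m \<in> ?X. m j < K}" using m j by (auto simp: PiE_iff extensional_def)
    qed auto
    also have "\<dots> = (\<Sum>m\<in>?X. fact (?t m - 1) * real (m j) * ?F m)"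
      by (rule sum.mono_neutral_left[OF fX]) auto
    finally show ?thesis .
  qed
  have "(\<Sum>j<s. \<Sum>l=1..\<nu> j. real (\<nu> j choose l) * b j * fdb_sum s K b (\<nu>(j := \<nu> j - l))) =
      (\<Sum>j<s. \<Sum>m\<in>?X. fact (?t m - 1) * real (m j) * ?F m)"
    by (intro sum.cong refl one) simp
  also have "\<dots> = (\<Sum>m\<in>?X. (fact (?t m - 1) * real (?t m)) * ?F m)"
    by (subst sum.swap) (simp add: sum_distrib_left sum_distrib_right)
  \<comment> \<open>\<open>fact (t - 1) * t\<close> equals \<open>fact t\<close> except for
    \<open>t = 0\<close>, where it is 0 instead of 1; the term \<open>m = 0\<close> is the only
    loss.\<close>
  also have "\<dots> \<le> (\<Sum>m\<in>?X. fact (?t m) * ?F m)"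
  proof (rule sum_mono, rule mult_right_mono)
    fix m
    show "fact (?t m - 1) * real (?t m) \<le> fact (?t m)"
      by (cases "?t m") (auto simp: algebra_simps)
    show "0 \<le> ?F m" by (intro prod_nonneg) (use b in auto)
  qed
  finally show ?thesis by (simp add: fdb_sum_def)
qed

lemma fdb_sum_0: "fdb_sum s K b (\<lambda>_. 0) = 1"
proof -
  have *: "(\<Prod>j<s. b j ^ m j * real (Stirling 0 (m j))) = (if m = (\<lambda>j\<in>{..<s}. 0) then 1 else 0)"
    if m: "m \<in> {..<s} \<rightarrow>\<^sub>E {..K}" for m
  proof (cases "m = (\<lambda>j\<in>{..<s}. 0)")
    case False
    then obtain j where "j < s" "m j \<noteq> 0" using m by (auto simp: fun_eq_iff PiE_iff extensional_def split: if_splits)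
    then have "(\<Prod>j<s. b j ^ m j * real (Stirling 0 (m j))) = 0"
      by (intro prod_zero) (auto intro!: bexI[of _ j] simp: gr0_conv_Suc)
    then show ?thesis using False by simp
  qed simp
  have "fdb_sum s K b (\<lambda>_. 0) = (\<Sum>m\<in>{..<s} \<rightarrow>\<^sub>E {..K}. if m = (\<lambda>j\<in>{..<s}. 0) then 1 else 0)"
    unfolding fdb_sum_def by (intro sum.cong refl) (simp add: *)
  also have "\<dots> = 1"
    by (subst sum.delta) (auto intro!: finite_PiE)
  finally show ?thesis .
qed

text \<open>\<open>Stirling \<sigma> 0\<close> is zero and \<open>Stirling 0 m\<close> is zero for
  positive \<open>m\<close>, so only multi-indices supported exactly on \<open>u\<close> survive.
  The result is the sum over multi-indices from which the weights are built.\<close>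

lemma fdb_sum_indicator:
  assumes u: "u \<subseteq> {..<s}" and \<sigma>: "1 \<le> \<sigma>"
  shows "fdb_sum s \<sigma> b (\<lambda>j. if j \<in> u then \<sigma> else 0) =
    (\<Sum>m\<in>u \<rightarrow>\<^sub>E {1..\<sigma>}. fact (\<Sum>j\<in>u. m j) * (\<Prod>j\<in>u. b j ^ m j * real (Stirling \<sigma> (m j))))"
proof -
  let ?\<nu> = "\<lambda>j. if j \<in> u then \<sigma> else 0"
  let ?X = "{..<s} \<rightarrow>\<^sub>E {..\<sigma>}"
  let ?Y = "{m \<in> ?X. \<forall>j<s. if j \<in> u then 1 \<le> m j else m j = 0}"
  let ?F = "\<lambda>m. \<Prod>j<s. b j ^ m j * real (Stirling (?\<nu> j) (m j))"
  have "fdb_sum s \<sigma> b ?\<nu> = (\<Sum>m\<in>?Y. fact (\<Sum>j<s. m j) * ?F m)"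
    unfolding fdb_sum_def
  proof (rule sum.mono_neutral_right)
    show "finite ?X" by (intro finite_PiE) auto
    show "\<forall>m\<in>?X - ?Y. fact (\<Sum>j<s. m j) * ?F m = 0"
    proof
      fix m assume "m \<in> ?X - ?Y"
      then obtain j where j: "j < s" "if j \<in> u then m j = 0 else m j > 0" by (auto split: if_splits)
      have "Stirling (?\<nu> j) (m j) = 0"
        using j \<sigma> by (cases "j \<in> u") (auto simp: gr0_conv_Suc Suc_le_eq)
      then have "?F m = 0" using j by (intro prod_zero) (auto intro!: bexI[of _ j])
      then show "fact (\<Sum>j<s. m j) * ?F m = 0" by simp
    qed
  qed auto
  also have "\<dots> = (\<Sum>m\<in>u \<rightarrow>\<^sub>E {1..\<sigma>}. fact (\<Sum>j\<in>u. m j) * (\<Prod>j\<in>u. b j ^ m j * real (Stirling \<sigma> (m j))))"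
  proof (rule sum.reindex_bij_witness[where i = "\<lambda>m. \<lambda>j\<in>{..<s}. if j \<in> u then m j else 0" and j = "\<lambda>m. restrict m u"])
    fix m assume m: "m \<in> ?Y"
    show "restrict m u \<in> u \<rightarrow>\<^sub>E {1..\<sigma>}" using m u by (auto simp: PiE_iff)
    show "(\<lambda>j\<in>{..<s}. if j \<in> u then restrict m u j else 0) = m"
      using m by (auto simp: fun_eq_iff PiE_iff extensional_def)
    have "(\<Sum>j\<in>u. restrict m u j) = (\<Sum>j<s. m j)"
      using m u by (intro sum.mono_neutral_cong_left) auto
    moreover have "(\<Prod>j\<in>u. b j ^ restrict m u j * real (Stirling \<sigma> (restrict m u j))) = ?F m"
      using m u by (intro prod.mono_neutral_cong_left) auto
    ultimately show "fact (\<Sum>j\<in>u. restrict m u j) * (\<Prod>j\<in>u. b j ^ restrict m u j * real (Stirling \<sigma> (restrict m u j))) =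
       fact (\<Sum>j<s. m j) * ?F m" by simp
  next
    fix m assume m: "m \<in> u \<rightarrow>\<^sub>E {1..\<sigma>}"
    show "restrict (\<lambda>j\<in>{..<s}. if j \<in> u then m j else 0) u = m"
      using m u by (auto simp: fun_eq_iff PiE_iff extensional_def)
    show "(\<lambda>j\<in>{..<s}. if j \<in> u then m j else 0) \<in> ?Y"
      using m u by (auto simp: PiE_iff)
  qed
  finally show ?thesis .
qed

section \<open>Operations on Fourier coefficients\<close>

lemma fseries_cmult: "fseries s (\<lambda>h. x * c h) y = x * fseries s c y"
  by (simp add: fseries_def mult.assoc infsum_cmult_right')

lemma
  assumes "\<And>i. i \<in> I \<Longrightarrow> c i abs_summable_on Zs s"
  shows abs_summable_sum_family: "(\<lambda>h. \<Sum>i\<in>I. c i h :: complex) abs_summable_on Zs s"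
    and fseries_sum: "fseries s (\<lambda>h. \<Sum>i\<in>I. c i h) y = (\<Sum>i\<in>I. fseries s (c i) y)"
proof -
  show "(\<lambda>h. \<Sum>i\<in>I. c i h) abs_summable_on Zs s"
  proof (rule Infinite_Sum.abs_summable_on_comparison_test')
    show "(\<lambda>h. \<Sum>i\<in>I. cmod (c i h)) summable_on Zs s" by (rule summable_on_sum[OF assms])
    show "cmod (\<Sum>i\<in>I. c i h) \<le> (\<Sum>i\<in>I. cmod (c i h))" for h by (rule norm_sum)
  qed
  have "fseries s (\<lambda>h. \<Sum>i\<in>I. c i h) y = (\<Sum>\<^sub>\<infinity>h\<in>Zs s. \<Sum>i\<in>I. c i h * trig s h y)"
    by (simp add: fseries_def sum_distrib_right)
  also have "\<dots> = (\<Sum>i\<in>I. fseries s (c i) y)"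
    unfolding fseries_def
    by (rule infsum_sum) (rule abs_summable_summable[OF abs_summable_fseries[OF assms]])
  finally show "fseries s (\<lambda>h. \<Sum>i\<in>I. c i h) y = (\<Sum>i\<in>I. fseries s (c i) y)" .
qed

lemma
  assumes "c abs_summable_on Zs s" "d abs_summable_on Zs s"
  shows abs_summable_fadd: "(\<lambda>h. c h + d h :: complex) abs_summable_on Zs s"
    and fseries_add: "fseries s (\<lambda>h. c h + d h) y = fseries s c y + fseries s d y"
proof -
  have 1: "(if i then c else d) abs_summable_on Zs s" for i using assms by (cases i) auto
  show "(\<lambda>h. c h + d h) abs_summable_on Zs s"
    using abs_summable_sum_family[of UNIV "\<lambda>i. if i then c else d", OF 1] by (simp add: UNIV_bool add.commute)
  show "fseries s (\<lambda>h. c h + d h) y = fseries s c y + fseries s d y"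
    using fseries_sum[of UNIV "\<lambda>i. if i then c else d", OF 1] by (simp add: UNIV_bool add.commute)
qed

lemma abs_summable_fcmult: "c abs_summable_on Zs s \<Longrightarrow> (\<lambda>h. x * c h :: complex) abs_summable_on Zs s"
  unfolding norm_mult by (rule summable_on_cmult_right)

lemma
  fixes \<delta> :: int
  assumes j: "j < s"
  shows bij_shift: "bij_betw (\<lambda>h. h(j := h j + \<delta>)) (Zs s) (Zs s)"
    and trig_shift: "trig s (h(j := h j + \<delta>)) y = cis (2 * pi * (of_int \<delta> * y j)) * trig s h y"
proof -
  show "bij_betw (\<lambda>h. h(j := h j + \<delta>)) (Zs s) (Zs s)"
    by (rule bij_betw_byWitness[where f' = "\<lambda>h. h(j := h j - \<delta>)"]) (use j in \<open>auto simp: Zs_def\<close>)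
  have "(\<Sum>i<s. of_int ((h(j := h j + \<delta>)) i) * y i) = of_int \<delta> * y j + (\<Sum>i<s. of_int (h i) * y i)"
    using j by (simp add: sum.remove[of "{..<s}" j] algebra_simps)
  then show "trig s (h(j := h j + \<delta>)) y = cis (2 * pi * (of_int \<delta> * y j)) * trig s h y"
    by (simp only: trig_def cis_mult distrib_left)
qed

text \<open>The shifts by 1 and by -1 together realise multiplication by
  \<open>sin (2 * pi * y j)\<close> on the side of the coefficients.\<close>

lemma
  fixes \<delta> :: int
  assumes j: "j < s" and c: "c abs_summable_on Zs s"
  shows abs_summable_shift: "(\<lambda>h. c (h(j := h j - \<delta>))) abs_summable_on Zs s"
    and fseries_shift: "fseries s (\<lambda>h. c (h(j := h j - \<delta>))) y = cis (2 * pi * (of_int \<delta> * y j)) * fseries s c y"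
proof -
  have 1: "(h(j := h j + \<delta>))(j := (h(j := h j + \<delta>)) j - \<delta>) = h" for h :: "nat \<Rightarrow> int" by simp
  show "(\<lambda>h. c (h(j := h j - \<delta>))) abs_summable_on Zs s"
    by (subst summable_on_reindex_bij_betw[OF bij_shift[OF j, of \<delta>], symmetric]) (simp only: 1 c)
  have "fseries s (\<lambda>h. c (h(j := h j - \<delta>))) y = (\<Sum>\<^sub>\<infinity>h\<in>Zs s. c h * trig s (h(j := h j + \<delta>)) y)"
    unfolding fseries_def
    by (subst infsum_reindex_bij_betw[OF bij_shift[OF j, of \<delta>], symmetric]) (simp only: 1)
  also have "\<dots> = (\<Sum>\<^sub>\<infinity>h\<in>Zs s. cis (2 * pi * (of_int \<delta> * y j)) * (c h * trig s h y))"
    by (simp only: trig_shift[OF j] mult.left_commute)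
  finally show "fseries s (\<lambda>h. c (h(j := h j - \<delta>))) y = cis (2 * pi * (of_int \<delta> * y j)) * fseries s c y"
    by (simp only: infsum_cmult_right' fseries_def)
qed

text \<open>Up to powers of \<open>2 * pi * \<i>\<close> this is the symbol of the mixed derivative
  of order \<open>\<nu>\<close>. Leaving these powers out matches \<open>r_fun\<close>, which
  contains no factors \<open>2 * pi\<close> either.\<close>

definition ipow :: "nat \<Rightarrow> (nat \<Rightarrow> nat) \<Rightarrow> (nat \<Rightarrow> int) \<Rightarrow> complex" where
  "ipow s \<nu> h = (\<Prod>j<s. of_int (h j) ^ \<nu> j)"

text \<open>Binomial expansion of the power of \<open>h j = \<delta> + (h j - \<delta>)\<close>: the
  Leibniz rule for the product with one exponential, read off on the coefficients.\<close>

lemma ipow_shift: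
  assumes j: "j < s"
  shows "ipow s \<nu> h = (\<Sum>l\<le>\<nu> j. of_nat (\<nu> j choose l) * of_int \<delta> ^ l * ipow s (\<nu>(j := \<nu> j - l)) (h(j := h j - \<delta>)))"
proof -
  let ?R = "\<Prod>i\<in>{..<s} - {j}. (of_int (h i) :: complex) ^ \<nu> i"
  have 1: "ipow s (\<nu>(j := \<nu> j - l)) (h(j := h j - \<delta>)) = of_int (h j - \<delta>) ^ (\<nu> j - l) * ?R" for l
    unfolding ipow_def using j by (subst prod.remove[of _ j]) (auto intro!: prod.cong)
  have "ipow s \<nu> h = of_int (h j) ^ \<nu> j * ?R"
    unfolding ipow_def using j by (subst prod.remove[of _ j]) auto
  also have "(of_int (h j) :: complex) ^ \<nu> j = (of_int \<delta> + of_int (h j - \<delta>)) ^ \<nu> j" by simp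
  also have "\<dots> = (\<Sum>l\<le>\<nu> j. of_nat (\<nu> j choose l) * of_int \<delta> ^ l * of_int (h j - \<delta>) ^ (\<nu> j - l))"
    by (rule binomial_ring)
  finally show ?thesis by (simp only: 1 sum_distrib_right mult.assoc)
qed

definition rapidly_decreasing :: "nat \<Rightarrow> ((nat \<Rightarrow> int) \<Rightarrow> complex) \<Rightarrow> bool" where
  "rapidly_decreasing s c \<longleftrightarrow> (\<forall>\<nu>. (\<lambda>h. ipow s \<nu> h * c h) abs_summable_on Zs s)"

lemma ipow_0 [simp]: "ipow s (\<lambda>_. 0) h = 1" by (simp add: ipow_def)

lemma rapidly_decreasing_abs_summable: "rapidly_decreasing s c \<Longrightarrow> c abs_summable_on Zs s"
  unfolding rapidly_decreasing_def by (drule spec[of _ "\<lambda>_. 0"]) simp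

lemma
  assumes j: "j < s" and c: "rapidly_decreasing s c"
  shows abs_summable_ipow_shift: "(\<lambda>h. ipow s \<nu> h * c (h(j := h j - \<delta>))) abs_summable_on Zs s"
    and fseries_ipow_shift: "fseries s (\<lambda>h. ipow s \<nu> h * c (h(j := h j - \<delta>))) y =
      cis (2 * pi * (of_int \<delta> * y j)) *
      (\<Sum>l\<le>\<nu> j. of_nat (\<nu> j choose l) * of_int \<delta> ^ l * fseries s (\<lambda>h. ipow s (\<nu>(j := \<nu> j - l)) h * c h) y)"
proof -
  define d where "d l h = of_nat (\<nu> j choose l) * of_int \<delta> ^ l * (ipow s (\<nu>(j := \<nu> j - l)) h * c h)" for l h
  have ds: "d l abs_summable_on Zs s" for l
    unfolding d_def by (rule abs_summable_fcmult) (use c in \<open>simp add: rapidly_decreasing_def\<close>)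
  have eq: "ipow s \<nu> h * c (h(j := h j - \<delta>)) = (\<Sum>l\<le>\<nu> j. d l (h(j := h j - \<delta>)))" for h
    unfolding d_def by (subst ipow_shift[OF j, of \<nu> h \<delta>]) (simp only: sum_distrib_right mult.assoc)
  have dss: "(\<lambda>h. d l (h(j := h j - \<delta>))) abs_summable_on Zs s" for l
    by (rule abs_summable_shift[OF j ds])
  show "(\<lambda>h. ipow s \<nu> h * c (h(j := h j - \<delta>))) abs_summable_on Zs s"
    unfolding eq by (rule abs_summable_sum_family[OF dss])
  have "fseries s (\<lambda>h. ipow s \<nu> h * c (h(j := h j - \<delta>))) y =
     (\<Sum>l\<le>\<nu> j. cis (2 * pi * (of_int \<delta> * y j)) * fseries s (d l) y)"
    unfolding eq by (simp only: fseries_sum[OF dss] fseries_shift[OF j ds])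
  also have "\<dots> = cis (2 * pi * (of_int \<delta> * y j)) *
      (\<Sum>l\<le>\<nu> j. of_nat (\<nu> j choose l) * of_int \<delta> ^ l * fseries s (\<lambda>h. ipow s (\<nu>(j := \<nu> j - l)) h * c h) y)"
    unfolding d_def by (simp only: fseries_cmult sum_distrib_left)
  finally show "fseries s (\<lambda>h. ipow s \<nu> h * c (h(j := h j - \<delta>))) y =
      cis (2 * pi * (of_int \<delta> * y j)) *
      (\<Sum>l\<le>\<nu> j. of_nat (\<nu> j choose l) * of_int \<delta> ^ l * fseries s (\<lambda>h. ipow s (\<nu>(j := \<nu> j - l)) h * c h) y)" .
qed

section \<open>Real matrices acting on complex vectors\<close>

definition cop :: "'i set \<Rightarrow> ('i \<Rightarrow> 'i \<Rightarrow> real) \<Rightarrow> ('i \<Rightarrow> complex) \<Rightarrow> 'i \<Rightarrow> complex" where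
  "cop I M x i = (\<Sum>k\<in>I. of_real (M i k) * x k)"

definition cn :: "'i set \<Rightarrow> ('i \<Rightarrow> complex) \<Rightarrow> real" where
  "cn I x = L2_set (\<lambda>i. cmod (x i)) I"

lemma cn_nonneg: "0 \<le> cn I x" by (simp add: cn_def)

lemma cn_sq: "(cn I x)\<^sup>2 = (\<Sum>i\<in>I. (cmod (x i))\<^sup>2)"
  by (simp add: cn_def L2_set_def sum_nonneg)

lemma cn_add: "cn I (\<lambda>i. x i + y i) \<le> cn I x + cn I y"
proof -
  have "cn I (\<lambda>i. x i + y i) \<le> L2_set (\<lambda>i. cmod (x i) + cmod (y i)) I"
    unfolding cn_def by (rule L2_set_mono) (auto intro: norm_triangle_ineq)
  also have "\<dots> \<le> cn I x + cn I y" unfolding cn_def by (rule L2_set_triangle_ineq)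
  finally show ?thesis .
qed

lemma cn_sum: "cn I (\<lambda>i. \<Sum>a\<in>F. f a i) \<le> (\<Sum>a\<in>F. cn I (f a))"
proof (induction F rule: infinite_finite_induct)
  case (insert a F)
  have "cn I (\<lambda>i. \<Sum>a\<in>insert a F. f a i) = cn I (\<lambda>i. f a i + (\<Sum>a\<in>F. f a i))"
    using insert by simp
  also have "\<dots> \<le> cn I (f a) + cn I (\<lambda>i. \<Sum>a\<in>F. f a i)" by (rule cn_add)
  finally show ?case using insert by simp
qed (simp_all add: cn_def L2_set_def)

lemma cn_cmult: "cn I (\<lambda>i. c * x i) = cmod c * cn I x"
  by (simp add: cn_def norm_mult L2_set_right_distrib)

lemma cn_cong: "(\<And>i. i \<in> I \<Longrightarrow> x i = y i) \<Longrightarrow> cn I x = cn I y"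
  unfolding cn_def by (rule L2_set_cong) auto

lemma norm_le_cn: "finite I \<Longrightarrow> i \<in> I \<Longrightarrow> cmod (x i) \<le> cn I x"
  unfolding cn_def by (rule member_le_L2_set)

lemma Re_inner_le_cn: "Re (\<Sum>i\<in>I. cnj (x i) * w i) \<le> cn I x * cn I w"
proof -
  have "Re (\<Sum>i\<in>I. cnj (x i) * w i) \<le> cmod (\<Sum>i\<in>I. cnj (x i) * w i)" by (rule complex_Re_le_cmod)
  also have "\<dots> \<le> (\<Sum>i\<in>I. \<bar>cmod (x i)\<bar> * \<bar>cmod (w i)\<bar>)"
    by (rule order_trans[OF norm_sum]) (simp add: norm_mult)
  also have "\<dots> \<le> cn I x * cn I w" unfolding cn_def by (rule L2_set_mult_ineq)
  finally show ?thesis .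
qed

lemma Re_cop: "Re (cop I M x i) = (\<Sum>k\<in>I. M i k * Re (x k))"
  and Im_cop: "Im (cop I M x i) = (\<Sum>k\<in>I. M i k * Im (x k))"
  by (simp_all add: cop_def)

text \<open>Testing the bilinear bound with the image of \<open>w\<close> itself gives the operator
  bound on real vectors. As the matrix is real, it acts separately on real and imaginary parts, and
  the squares of the norms add.\<close>

lemma cop_bound:
  assumes \<beta>: "0 \<le> \<beta>" and M: "\<And>x w :: 'i \<Rightarrow> real. \<bar>\<Sum>i\<in>I. \<Sum>k\<in>I. x i * M i k * w k\<bar> \<le> \<beta> * L2_set x I * L2_set w I"
  shows "cn I (cop I M x) \<le> \<beta> * cn I x"
proof -
  have real: "(\<Sum>i\<in>I. (\<Sum>k\<in>I. M i k * w k)\<^sup>2) \<le> \<beta>\<^sup>2 * (\<Sum>i\<in>I. (w i)\<^sup>2)" for w :: "'i \<Rightarrow> real"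
  proof -
    define v where "v i = (\<Sum>k\<in>I. M i k * w k)" for i
    have sq: "(L2_set f I)\<^sup>2 = (\<Sum>i\<in>I. (f i)\<^sup>2)" for f by (simp add: L2_set_def sum_nonneg)
    have "(L2_set v I)\<^sup>2 = (\<Sum>i\<in>I. \<Sum>k\<in>I. v i * M i k * w k)"
    proof -
      have "v i * v i = (\<Sum>k\<in>I. v i * M i k * w k)" for i
        by (subst (2) v_def) (simp only: sum_distrib_left mult.assoc)
      then show ?thesis unfolding sq by (simp only: power2_eq_square)
    qed
    also have "\<dots> \<le> \<beta> * L2_set v I * L2_set w I" using M[of v w] by linarith
    finally have "L2_set v I * L2_set v I \<le> L2_set v I * (\<beta> * L2_set w I)"
      by (simp add: power2_eq_square mult_ac)
    then have "L2_set v I \<le> \<beta> * L2_set w I"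
    proof (cases "L2_set v I = 0")
      case False
      then have "0 < L2_set v I" using L2_set_nonneg[of v I] by linarith
      then show ?thesis using \<open>L2_set v I * L2_set v I \<le> _\<close> by (rule mult_left_le_imp_le[rotated])
    qed (use \<beta> in simp)
    then have "(L2_set v I)\<^sup>2 \<le> (\<beta> * L2_set w I)\<^sup>2" by (rule power_mono) simp
    then show ?thesis by (simp only: power_mult_distrib sq) (simp only: v_def)
  qed
  have "(cn I (cop I M x))\<^sup>2 = (\<Sum>i\<in>I. (\<Sum>k\<in>I. M i k * Re (x k))\<^sup>2) + (\<Sum>i\<in>I. (\<Sum>k\<in>I. M i k * Im (x k))\<^sup>2)"
    by (simp only: cn_sq cmod_power2 Re_cop Im_cop sum.distrib)
  also have "\<dots> \<le> \<beta>\<^sup>2 * (\<Sum>i\<in>I. (Re (x i))\<^sup>2) + \<beta>\<^sup>2 * (\<Sum>i\<in>I. (Im (x i))\<^sup>2)"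
    by (intro add_mono real)
  also have "\<dots> = (\<beta> * cn I x)\<^sup>2"
    by (simp only: power_mult_distrib cn_sq cmod_power2 sum.distrib distrib_left)
  finally show ?thesis by (rule power2_le_imp_le) (intro mult_nonneg_nonneg \<beta> cn_nonneg)
qed

lemma fseries_unique:
  assumes "c abs_summable_on Zs s" "d abs_summable_on Zs s" "k \<in> Zs s"
    and "\<And>y. y \<in> space (cube_measure s) \<Longrightarrow> fseries s c y = fseries s d y"
  shows "c k = d k"
proof -
  have "c k = (\<integral>y. fseries s c y * cnj (trig s k y) \<partial>cube_measure s)"
    by (rule fseries_coeff[symmetric]) fact+
  also have "\<dots> = (\<integral>y. fseries s d y * cnj (trig s k y) \<partial>cube_measure s)"
    by (rule Bochner_Integration.integral_cong) (simp_all add: assms(4))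
  also have "\<dots> = d k" by (rule fseries_coeff) fact+
  finally show ?thesis .
qed

definition fbox :: "nat \<Rightarrow> nat \<Rightarrow> (nat \<Rightarrow> int) set" where
  "fbox s m = {h \<in> Zs s. \<forall>j<s. \<bar>h j\<bar> \<le> int m}"

lemma finite_fbox: "finite (fbox s m)" and card_fbox: "card (fbox s m) \<le> (2 * m + 1) ^ s"
proof -
  let ?P = "{..<s} \<rightarrow>\<^sub>E {- int m..int m}"
  let ?f = "\<lambda>g j. if j < s then g j else 0"
  have fin: "finite ?P" by (intro finite_PiE) auto
  have sub: "fbox s m \<subseteq> ?f ` ?P"
  proof
    fix h assume h: "h \<in> fbox s m"
    have "h = ?f (restrict h {..<s})" using h by (auto simp: fbox_def Zs_def fun_eq_iff)
    moreover have "restrict h {..<s} \<in> ?P" 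
      using h by (auto simp: restrict_PiE_iff fbox_def abs_le_iff minus_le_iff)
    ultimately show "h \<in> ?f ` ?P" by blast
  qed
  show "finite (fbox s m)" by (rule finite_subset[OF sub]) (use fin in simp)
  have "card (fbox s m) \<le> card (?f ` ?P)" by (rule card_mono[OF _ sub]) (use fin in simp)
  also have "\<dots> \<le> card ?P" by (rule card_image_le[OF fin])
  also have "\<dots> = (2 * m + 1) ^ s"
  proof -
    have "int m - (- int m) + 1 = int (2 * m + 1)" by simp
    then have "card {- int m..int m} = 2 * m + 1" by (simp only: card_atLeastAtMost_int nat_int)
    then show ?thesis by (simp add: card_PiE)
  qed
  finally show "card (fbox s m) \<le> (2 * m + 1) ^ s" .
qed

lemma summable_poly_geometric:
  assumes "0 \<le> \<rho>" "\<rho> < 1"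
  shows "summable (\<lambda>m. (2 * real m + 1) ^ K * (\<rho>::real) ^ m)"
proof (cases "\<rho> = 0")
  case True
  have "(\<lambda>m. (2 * real m + 1) ^ K * \<rho> ^ m) = (\<lambda>m. if m = 0 then 1 else 0)"
    using True by (auto simp: fun_eq_iff)
  then show ?thesis by simp
next
  case False
  then have \<rho>: "0 < \<rho>" "\<rho> < 1" using assms by auto
  have "(\<lambda>m. ((2 * real m + 3) / (2 * real m + 1)) ^ K * \<rho>) \<longlonglongrightarrow> 1 ^ K * \<rho>"
    by (intro tendsto_mult tendsto_power tendsto_const) real_asymp
  then have "eventually (\<lambda>m. ((2 * real m + 3) / (2 * real m + 1)) ^ K * \<rho> < (1 + \<rho>) / 2) sequentially"
    using \<rho> by (intro order_tendstoD) auto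
  then obtain N where N: "\<And>m. N \<le> m \<Longrightarrow> ((2 * real m + 3) / (2 * real m + 1)) ^ K * \<rho> < (1 + \<rho>) / 2"
    by (auto simp: eventually_sequentially)
  show ?thesis
  proof (rule summable_ratio_test[of "(1 + \<rho>) / 2" N])
    show "(1 + \<rho>) / 2 < 1" using \<rho> by simp
    fix m assume m: "N \<le> m"
    have "(2 * real (Suc m) + 1) ^ K * \<rho> ^ Suc m =
        (((2 * real m + 3) / (2 * real m + 1)) ^ K * \<rho>) * ((2 * real m + 1) ^ K * \<rho> ^ m)"
      by (simp add: power_divide add.commute)
    also have "\<dots> \<le> (1 + \<rho>) / 2 * ((2 * real m + 1) ^ K * \<rho> ^ m)"
      using N[OF m] \<rho> by (intro mult_right_mono) auto
    finally show "norm ((2 * real (Suc m) + 1) ^ K * \<rho> ^ Suc m) \<le> (1 + \<rho>) / 2 * norm ((2 * real m + 1) ^ K * \<rho> ^ m)"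
      using \<rho> by simp
  qed
qed

section \<open>Parametric systems: contraction and differentiation\<close>

text \<open>Unlike membership in the space of \<open>cube_measure s\<close> this leaves the entries
  from index \<open>s\<close> on free, so it also covers lattice points, at which the system has to
  be solved too.\<close>

definition in_cube :: "nat \<Rightarrow> (nat \<Rightarrow> real) \<Rightarrow> bool" where
  "in_cube s y \<longleftrightarrow> (\<forall>j<s. 0 \<le> y j \<and> y j \<le> 1)"

lemma space_cube_in_cube: "y \<in> space (cube_measure s) \<Longrightarrow> in_cube s y"
  by (auto simp: cube_measure_def space_PiM PiE_iff space_restrict_space in_cube_def)

text \<open>What remains of the differential equation after expansion in an orthonormal basis. The
  same \<open>amin\<close> appears in \<open>coercive\<close> and in \<open>bound\<close>, so that
  inverting the matrix leaves exactly \<open>b j\<close>, the sequence in the weights. The number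
  \<open>\<beta>0\<close> influences the speed of the iteration but not the final estimates.\<close>

locale parametric_system =
  fixes I :: "'i set" and s :: nat and A0 :: "'i \<Rightarrow> 'i \<Rightarrow> real" and A :: "nat \<Rightarrow> 'i \<Rightarrow> 'i \<Rightarrow> real"
    and b :: "nat \<Rightarrow> real" and amin \<beta>0 :: real and q :: "'i \<Rightarrow> real"
  assumes fin: "finite I" and amin: "0 < amin" and b: "\<And>j. 0 \<le> b j" and \<beta>0: "0 \<le> \<beta>0"
    and coercive: "\<And>y x. in_cube s y \<Longrightarrow> amin * (\<Sum>i\<in>I. (x i)\<^sup>2) \<le>
      (\<Sum>i\<in>I. \<Sum>k\<in>I. x i * (A0 i k + (\<Sum>j<s. sin (2 * pi * y j) * A j i k)) * x k)"
    and bound0: "\<And>x w. \<bar>\<Sum>i\<in>I. \<Sum>k\<in>I. x i * A0 i k * w k\<bar> \<le> \<beta>0 * L2_set x I * L2_set w I"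
    and bound: "\<And>j x w. j < s \<Longrightarrow>
      \<bar>\<Sum>i\<in>I. \<Sum>k\<in>I. x i * A j i k * w k\<bar> \<le> amin * b j * L2_set x I * L2_set w I"
begin

definition Ay :: "(nat \<Rightarrow> real) \<Rightarrow> 'i \<Rightarrow> 'i \<Rightarrow> real" where
  "Ay y i k = A0 i k + (\<Sum>j<s. sin (2 * pi * y j) * A j i k)"

abbreviation "aop y \<equiv> cop I (Ay y)"
abbreviation "nq \<equiv> cn I (\<lambda>i. of_real (q i))"

text \<open>A common bound for the operator norms of all \<open>Ay y\<close>. The summand
  \<open>amin\<close> secures \<open>amin \<le> L\<close>, which holds then also when
  \<open>I\<close> is empty.\<close>

definition L :: real where "L = \<beta>0 + (\<Sum>j<s. amin * b j) + amin"

lemma L_pos: "amin \<le> L" "0 < L"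
proof -
  have "0 \<le> (\<Sum>j<s. amin * b j)" using amin b by (intro sum_nonneg) simp
  then show "amin \<le> L" "0 < L" using amin \<beta>0 by (simp_all add: L_def)
qed

lemma aop_eq: "aop y x i = cop I A0 x i + (\<Sum>j<s. of_real (sin (2 * pi * y j)) * cop I (A j) x i)"
proof -
  have "aop y x i = cop I A0 x i + (\<Sum>k\<in>I. \<Sum>j<s. of_real (sin (2 * pi * y j)) * (of_real (A j i k) * x k))"
    by (simp add: cop_def Ay_def distrib_right sum.distrib sum_distrib_right mult.assoc)
  also have "(\<Sum>k\<in>I. \<Sum>j<s. of_real (sin (2 * pi * y j)) * (of_real (A j i k) * x k)) =
      (\<Sum>j<s. of_real (sin (2 * pi * y j)) * cop I (A j) x i)"
    unfolding cop_def sum_distrib_left by (rule sum.swap)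
  finally show ?thesis .
qed

lemma aop_bound: "cn I (aop y x) \<le> L * cn I x"
proof -
  have "cn I (aop y x) \<le> cn I (cop I A0 x) + cn I (\<lambda>i. \<Sum>j<s. of_real (sin (2 * pi * y j)) * cop I (A j) x i)"
    unfolding aop_eq by (rule cn_add)
  also have "\<dots> \<le> \<beta>0 * cn I x + (\<Sum>j<s. amin * b j * cn I x)"
  proof (rule add_mono)
    show "cn I (cop I A0 x) \<le> \<beta>0 * cn I x" by (rule cop_bound[OF \<beta>0 bound0])
    have "cn I (\<lambda>i. \<Sum>j<s. of_real (sin (2 * pi * y j)) * cop I (A j) x i) \<le>
        (\<Sum>j<s. cn I (\<lambda>i. of_real (sin (2 * pi * y j)) * cop I (A j) x i))" by (rule cn_sum)
    also have "\<dots> \<le> (\<Sum>j<s. amin * b j * cn I x)"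
    proof (rule sum_mono)
      fix j assume j: "j \<in> {..<s}"
      have "cn I (\<lambda>i. of_real (sin (2 * pi * y j)) * cop I (A j) x i) = \<bar>sin (2 * pi * y j)\<bar> * cn I (cop I (A j) x)"
        by (simp only: cn_cmult norm_of_real)
      also have "\<dots> \<le> 1 * cn I (cop I (A j) x)"
        by (rule mult_right_mono[OF abs_sin_le_one cn_nonneg])
      also have "\<dots> \<le> amin * b j * cn I x"
        unfolding mult_1 using amin b j by (intro cop_bound bound) auto
      finally show "cn I (\<lambda>i. of_real (sin (2 * pi * y j)) * cop I (A j) x i) \<le> amin * b j * cn I x" .
    qed
    finally show "cn I (\<lambda>i. \<Sum>j<s. of_real (sin (2 * pi * y j)) * cop I (A j) x i) \<le> (\<Sum>j<s. amin * b j * cn I x)" .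
  qed
  also have "\<dots> \<le> L * cn I x"
    using amin cn_nonneg[of I x] by (simp add: L_def distrib_right sum_distrib_right)
  finally show ?thesis .
qed

lemma aop_coercive:
  assumes y: "in_cube s y"
  shows "amin * (cn I x)\<^sup>2 \<le> Re (\<Sum>i\<in>I. cnj (x i) * aop y x i)"
proof -
  have "amin * (cn I x)\<^sup>2 = amin * (\<Sum>i\<in>I. (Re (x i))\<^sup>2) + amin * (\<Sum>i\<in>I. (Im (x i))\<^sup>2)"
    by (simp only: cn_sq cmod_power2 sum.distrib distrib_left)
  also have "\<dots> \<le> (\<Sum>i\<in>I. \<Sum>k\<in>I. Re (x i) * Ay y i k * Re (x k)) + (\<Sum>i\<in>I. \<Sum>k\<in>I. Im (x i) * Ay y i k * Im (x k))"
    unfolding Ay_def by (intro add_mono coercive y)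
  also have "\<dots> = (\<Sum>i\<in>I. Re (x i) * (\<Sum>k\<in>I. Ay y i k * Re (x k)) + Im (x i) * (\<Sum>k\<in>I. Ay y i k * Im (x k)))"
    by (simp only: sum_distrib_left sum.distrib mult.assoc)
  also have "\<dots> = Re (\<Sum>i\<in>I. cnj (x i) * aop y x i)"
    by (simp add: Re_cop Im_cop)
  finally show ?thesis .
qed

lemma aop_lower:
  assumes y: "in_cube s y"
  shows "amin * cn I x \<le> cn I (aop y x)"
proof (cases "cn I x = 0")
  case True
  then show ?thesis using cn_nonneg[of I "aop y x"] by simp
next
  case False
  then have pos: "0 < cn I x" using cn_nonneg[of I x] by linarith
  have "amin * (cn I x)\<^sup>2 \<le> cn I x * cn I (aop y x)"
    using aop_coercive[OF y] Re_inner_le_cn by (rule order_trans)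
  then have "cn I x * (amin * cn I x) \<le> cn I x * cn I (aop y x)"
    by (simp only: power2_eq_square mult_ac)
  then show ?thesis using pos by simp
qed

text \<open>This step size minimises \<open>1 - 2 * tau * amin + tau\<^sup>2 * L\<^sup>2\<close>,
  the bound for the squared contraction factor that coercivity and the operator bound yield;
  \<open>rate\<close> is the square root of the minimum.\<close>

definition tau :: real where "tau = amin / L\<^sup>2"
definition rate :: real where "rate = sqrt (1 - (amin / L)\<^sup>2)"

lemma rate: "0 \<le> rate" "rate < 1"
proof -
  have "0 < amin / L" "amin / L \<le> 1" using L_pos amin by simp_all
  then have "0 < (amin / L)\<^sup>2" by (intro zero_less_power)
  moreover have "(amin / L)\<^sup>2 \<le> 1"
    by (rule power_le_one) (use \<open>0 < amin / L\<close> \<open>amin / L \<le> 1\<close> in linarith)+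
  ultimately show "0 \<le> rate" "rate < 1" by (simp_all add: rate_def)
qed

lemma tau_pos: "0 < tau" using amin L_pos by (simp add: tau_def)

lemma richardson_contraction:
  assumes y: "in_cube s y"
  shows "cn I (\<lambda>i. x i - of_real tau * aop y x i) \<le> rate * cn I x"
proof -
  have "(cn I (\<lambda>i. x i - of_real tau * aop y x i))\<^sup>2 =
      (\<Sum>i\<in>I. (cmod (x i))\<^sup>2 - 2 * tau * Re (cnj (x i) * aop y x i) + tau\<^sup>2 * (cmod (aop y x i))\<^sup>2)"
    unfolding cn_sq
  proof (rule sum.cong[OF refl])
    fix i
    show "(cmod (x i - of_real tau * aop y x i))\<^sup>2 =
       (cmod (x i))\<^sup>2 - 2 * tau * Re (cnj (x i) * aop y x i) + tau\<^sup>2 * (cmod (aop y x i))\<^sup>2"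
      unfolding cmod_power2 by (simp add: power2_eq_square algebra_simps)
  qed
  also have "\<dots> = (cn I x)\<^sup>2 - 2 * tau * Re (\<Sum>i\<in>I. cnj (x i) * aop y x i) + tau\<^sup>2 * (cn I (aop y x))\<^sup>2"
    by (simp only: cn_sq sum.distrib sum_subtractf sum_distrib_left Re_sum)
  also have "\<dots> \<le> (cn I x)\<^sup>2 - 2 * tau * (amin * (cn I x)\<^sup>2) + tau\<^sup>2 * (L * cn I x)\<^sup>2"
    using tau_pos cn_nonneg aop_coercive[OF y, of x] aop_bound[of y x]
    by (intro add_mono diff_mono mult_left_mono power_mono) auto
  also have "\<dots> = (rate * cn I x)\<^sup>2"
  proof -
    have "(rate)\<^sup>2 = 1 - (amin / L)\<^sup>2"
      using L_pos amin unfolding rate_def by (intro real_sqrt_pow2) (simp add: power_le_one)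
    moreover have "2 * tau * amin = 2 * (amin / L)\<^sup>2" "tau\<^sup>2 * L\<^sup>2 = (amin / L)\<^sup>2"
      using L_pos by (simp_all add: tau_def power2_eq_square)
    ultimately have "(rate)\<^sup>2 = 1 - 2 * tau * amin + tau\<^sup>2 * L\<^sup>2" by simp
    then show ?thesis by (simp only: power_mult_distrib) (simp add: algebra_simps)
  qed
  finally show ?thesis by (rule power2_le_imp_le) (intro mult_nonneg_nonneg rate cn_nonneg)
qed

text \<open>\<open>T\<close> is the parametric operator acting on vector-valued Fourier coefficients.\<close>

definition T :: "((nat \<Rightarrow> int) \<Rightarrow> 'i \<Rightarrow> complex) \<Rightarrow> (nat \<Rightarrow> int) \<Rightarrow> 'i \<Rightarrow> complex" where
  "T c h i = cop I A0 (c h) i +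
    (\<Sum>j<s. 1 / (2 * \<i>) * (cop I (A j) (c (h(j := h j - 1))) i - cop I (A j) (c (h(j := h j - (-1)))) i))"

text \<open>Up to the factor \<open>\<i> ^ l\<close> this is the \<open>l\<close>-th derivative of
  the sine at \<open>2 * pi * y j\<close>; it arises when the shifts by 1 and by -1 are
  combined.\<close>

definition om :: "nat \<Rightarrow> nat \<Rightarrow> (nat \<Rightarrow> real) \<Rightarrow> complex" where
  "om j l y = (cis (2 * pi * y j) - (-1) ^ l * cis (- (2 * pi * y j))) / (2 * \<i>)"

lemma om_0: "om j 0 y = of_real (sin (2 * pi * y j))"
  by (simp add: om_def complex_eq_iff)

lemma norm_om: "cmod (om j l y) \<le> 1"
proof -
  have "cmod (cis (2 * pi * y j) - (-1) ^ l * cis (- (2 * pi * y j))) \<le> 1 + 1"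
    by (rule order_trans[OF norm_triangle_ineq4]) (simp add: norm_mult norm_power)
  then show ?thesis by (simp add: om_def norm_divide norm_mult)
qed

text \<open>Up to powers of \<open>2 * pi * \<i>\<close> this is the derivative of order
  \<open>\<nu>\<close> of the vector function with coefficients \<open>c\<close>. \<open>Wj\<close>
  collects the terms of the Leibniz rule in which the matrix is differentiated at least once; as the
  matrix is a sum of functions of single variables, all these derivatives are in one variable
  \<open>j\<close>.\<close>

definition W :: "((nat \<Rightarrow> int) \<Rightarrow> 'i \<Rightarrow> complex) \<Rightarrow> (nat \<Rightarrow> nat) \<Rightarrow> (nat \<Rightarrow> real) \<Rightarrow> 'i \<Rightarrow> complex" where
  "W c \<nu> y k = fseries s (\<lambda>h. ipow s \<nu> h * c h k) y"

definition Wj :: "((nat \<Rightarrow> int) \<Rightarrow> 'i \<Rightarrow> complex) \<Rightarrow> (nat \<Rightarrow> nat) \<Rightarrow> (nat \<Rightarrow> real) \<Rightarrow> 'i \<Rightarrow> complex" where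
  "Wj c \<nu> y i = (\<Sum>j<s. \<Sum>l=1..\<nu> j. of_nat (\<nu> j choose l) * om j l y * cop I (A j) (W c (\<nu>(j := \<nu> j - l)) y) i)"

text \<open>This is the Leibniz rule for the product of the parametric matrix with the vector
  function: the derivative either leaves the matrix alone, which gives \<open>aop\<close>, or falls
  on it, which gives \<open>Wj\<close>. Rapid decrease makes all rearrangements of the series
  legitimate.\<close>

lemma T_fseries:
  assumes c: "\<And>k. k \<in> I \<Longrightarrow> rapidly_decreasing s (\<lambda>h. c h k)"
  shows "(\<lambda>h. ipow s \<nu> h * T c h i) abs_summable_on Zs s"
    and "fseries s (\<lambda>h. ipow s \<nu> h * T c h i) y = aop y (W c \<nu> y) i + Wj c \<nu> y i"
proof -
  define f0 where "f0 k h = of_real (A0 i k) * (ipow s \<nu> h * c h k)" for k h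
  define f1 where "f1 j \<delta> k h = of_real (A j i k) * (ipow s \<nu> h * c (h(j := h j - \<delta>)) k)" for j \<delta> k and h :: "nat \<Rightarrow> int"
  have eq: "ipow s \<nu> h * T c h i = (\<Sum>k\<in>I. f0 k h) +
     (\<Sum>j<s. 1 / (2 * \<i>) * ((\<Sum>k\<in>I. f1 j 1 k h) + (- 1) * (\<Sum>k\<in>I. f1 j (-1) k h)))" for h
    unfolding T_def cop_def f0_def f1_def
    by (simp add: distrib_left sum_distrib_left right_diff_distrib mult_ac sum_negf)
  have s0: "(\<lambda>h. ipow s \<nu> h * c h k) abs_summable_on Zs s" if "k \<in> I" for k
    using c[OF that] by (simp add: rapidly_decreasing_def)
  have a0: "f0 k abs_summable_on Zs s" if "k \<in> I" for k
    unfolding f0_def by (rule abs_summable_fcmult[OF s0[OF that]])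
  have a1: "f1 j \<delta> k abs_summable_on Zs s" if "k \<in> I" "j < s" for j \<delta> k
    unfolding f1_def by (rule abs_summable_fcmult[OF abs_summable_ipow_shift[OF that(2) c[OF that(1)]]])
  have a1s: "(\<lambda>h. \<Sum>k\<in>I. f1 j \<delta> k h) abs_summable_on Zs s" if "j < s" for j \<delta>
    by (rule abs_summable_sum_family) (rule a1[OF _ that])
  have a2: "(\<lambda>h. (\<Sum>k\<in>I. f1 j 1 k h) + (- 1) * (\<Sum>k\<in>I. f1 j (-1) k h)) abs_summable_on Zs s" if "j < s" for j
    by (rule abs_summable_fadd[OF a1s[OF that] abs_summable_fcmult[OF a1s[OF that]]])
  have a3: "(\<lambda>h. \<Sum>j<s. 1 / (2 * \<i>) * ((\<Sum>k\<in>I. f1 j 1 k h) + (- 1) * (\<Sum>k\<in>I. f1 j (-1) k h))) abs_summable_on Zs s"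
    by (rule abs_summable_sum_family, rule abs_summable_fcmult, rule a2) simp
  show "(\<lambda>h. ipow s \<nu> h * T c h i) abs_summable_on Zs s"
    unfolding eq by (rule abs_summable_fadd[OF abs_summable_sum_family[OF a0] a3])
  have v0: "fseries s (\<lambda>h. \<Sum>k\<in>I. f0 k h) y = cop I A0 (W c \<nu> y) i"
  proof -
    have "fseries s (\<lambda>h. \<Sum>k\<in>I. f0 k h) y = (\<Sum>k\<in>I. fseries s (f0 k) y)"
      by (rule fseries_sum) (rule a0)
    then show ?thesis by (simp only: cop_def W_def f0_def[abs_def] fseries_cmult)
  qed
  have v1: "fseries s (\<lambda>h. \<Sum>k\<in>I. f1 j \<delta> k h) y = cis (2 * pi * (of_int \<delta> * y j)) *
      (\<Sum>l\<le>\<nu> j. of_nat (\<nu> j choose l) * of_int \<delta> ^ l * cop I (A j) (W c (\<nu>(j := \<nu> j - l)) y) i)" if j: "j < s" for j \<delta>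
  proof -
    have "fseries s (\<lambda>h. \<Sum>k\<in>I. f1 j \<delta> k h) y = (\<Sum>k\<in>I. of_real (A j i k) * (cis (2 * pi * (of_int \<delta> * y j)) *
      (\<Sum>l\<le>\<nu> j. of_nat (\<nu> j choose l) * of_int \<delta> ^ l * W c (\<nu>(j := \<nu> j - l)) y k)))"
    proof -
      have "fseries s (\<lambda>h. \<Sum>k\<in>I. f1 j \<delta> k h) y = (\<Sum>k\<in>I. fseries s (f1 j \<delta> k) y)"
        by (rule fseries_sum) (rule a1[OF _ j])
      also have "\<dots> = (\<Sum>k\<in>I. of_real (A j i k) * (cis (2 * pi * (of_int \<delta> * y j)) *
        (\<Sum>l\<le>\<nu> j. of_nat (\<nu> j choose l) * of_int \<delta> ^ l * W c (\<nu>(j := \<nu> j - l)) y k)))"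
      proof (rule sum.cong[OF refl])
        fix k assume k: "k \<in> I"
        show "fseries s (f1 j \<delta> k) y = of_real (A j i k) * (cis (2 * pi * (of_int \<delta> * y j)) *
          (\<Sum>l\<le>\<nu> j. of_nat (\<nu> j choose l) * of_int \<delta> ^ l * W c (\<nu>(j := \<nu> j - l)) y k))"
          by (simp only: f1_def[abs_def] fseries_cmult fseries_ipow_shift[OF j c[OF k]] W_def)
      qed
      finally show ?thesis .
    qed
    also have "\<dots> = cis (2 * pi * (of_int \<delta> * y j)) *
      (\<Sum>k\<in>I. \<Sum>l\<le>\<nu> j. of_nat (\<nu> j choose l) * of_int \<delta> ^ l * (of_real (A j i k) * W c (\<nu>(j := \<nu> j - l)) y k))"
      by (simp only: sum_distrib_left mult_ac)
    also have "(\<Sum>k\<in>I. \<Sum>l\<le>\<nu> j. of_nat (\<nu> j choose l) * of_int \<delta> ^ l * (of_real (A j i k) * W c (\<nu>(j := \<nu> j - l)) y k)) =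
       (\<Sum>l\<le>\<nu> j. of_nat (\<nu> j choose l) * of_int \<delta> ^ l * cop I (A j) (W c (\<nu>(j := \<nu> j - l)) y) i)"
      unfolding cop_def sum_distrib_left by (rule sum.swap)
    finally show ?thesis .
  qed
  \<comment> \<open>The two shifts carry \<open>1 ^ l\<close> and \<open>(-1) ^ l\<close>, which
    combine to \<open>om j l y\<close>. The term \<open>l = 0\<close> reproduces the sine; those
    with \<open>l\<close> at least 1 lower the order of differentiation.\<close>
  have v2: "fseries s (\<lambda>h. 1 / (2 * \<i>) * ((\<Sum>k\<in>I. f1 j 1 k h) + (- 1) * (\<Sum>k\<in>I. f1 j (-1) k h))) y =
      of_real (sin (2 * pi * y j)) * cop I (A j) (W c \<nu> y) i +
      (\<Sum>l=1..\<nu> j. of_nat (\<nu> j choose l) * om j l y * cop I (A j) (W c (\<nu>(j := \<nu> j - l)) y) i)" if j: "j < s" for j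
  proof -
    let ?V = "\<lambda>l. cop I (A j) (W c (\<nu>(j := \<nu> j - l)) y) i"
    have "fseries s (\<lambda>h. 1 / (2 * \<i>) * ((\<Sum>k\<in>I. f1 j 1 k h) + (- 1) * (\<Sum>k\<in>I. f1 j (-1) k h))) y =
      1 / (2 * \<i>) * (cis (2 * pi * y j) * (\<Sum>l\<le>\<nu> j. of_nat (\<nu> j choose l) * ?V l) +
         (- 1) * (cis (- (2 * pi * y j)) * (\<Sum>l\<le>\<nu> j. of_nat (\<nu> j choose l) * (-1) ^ l * ?V l)))"
      by (subst fseries_cmult, subst fseries_add[OF a1s[OF j] abs_summable_fcmult[OF a1s[OF j]]],
          subst fseries_cmult, subst (1 2) v1[OF j]) simp
    also have "\<dots> = (\<Sum>l\<le>\<nu> j. of_nat (\<nu> j choose l) * om j l y * ?V l)"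
      unfolding sum_distrib_left sum.distrib[symmetric]
      by (intro sum.cong refl) (simp add: om_def field_simps)
    also have "{..\<nu> j} = insert 0 {1..\<nu> j}" by auto
    also have "(\<Sum>l\<in>insert 0 {1..\<nu> j}. of_nat (\<nu> j choose l) * om j l y * ?V l) =
       om j 0 y * ?V 0 + (\<Sum>l=1..\<nu> j. of_nat (\<nu> j choose l) * om j l y * ?V l)"
      by (subst sum.insert) auto
    finally show ?thesis by (simp add: om_0)
  qed
  have "fseries s (\<lambda>h. ipow s \<nu> h * T c h i) y = cop I A0 (W c \<nu> y) i +
     (\<Sum>j<s. fseries s (\<lambda>h. 1 / (2 * \<i>) * ((\<Sum>k\<in>I. f1 j 1 k h) + (- 1) * (\<Sum>k\<in>I. f1 j (-1) k h))) y)"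
    unfolding eq by (subst fseries_add[OF abs_summable_sum_family[OF a0] a3], assumption, subst v0, subst fseries_sum)
      (rule abs_summable_fcmult, rule a2, simp, rule refl)
  also have "\<dots> = aop y (W c \<nu> y) i + Wj c \<nu> y i"
  proof -
    have "(\<Sum>j<s. fseries s (\<lambda>h. 1 / (2 * \<i>) * ((\<Sum>k\<in>I. f1 j 1 k h) + (- 1) * (\<Sum>k\<in>I. f1 j (-1) k h))) y) =
      (\<Sum>j<s. of_real (sin (2 * pi * y j)) * cop I (A j) (W c \<nu> y) i +
      (\<Sum>l=1..\<nu> j. of_nat (\<nu> j choose l) * om j l y * cop I (A j) (W c (\<nu>(j := \<nu> j - l)) y) i))"
      by (intro sum.cong refl v2) simp
    then show ?thesis by (simp only: aop_eq Wj_def sum.distrib add.assoc)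
  qed
  finally show "fseries s (\<lambda>h. ipow s \<nu> h * T c h i) y = aop y (W c \<nu> y) i + Wj c \<nu> y i" .
qed

end

section \<open>The Fourier coefficients of the solution\<close>

context parametric_system
begin

text \<open>\<open>P m\<close> holds the Fourier coefficients of the \<open>m\<close>-th term of the Neumann series obtained from
  Richardson's iteration; it is a trigonometric polynomial of degree \<open>m\<close> in each variable.\<close>

primrec P :: "nat \<Rightarrow> (nat \<Rightarrow> int) \<Rightarrow> 'i \<Rightarrow> complex" where
  "P 0 = (\<lambda>h i. if h = (\<lambda>_. 0) then of_real tau * of_real (q i) else 0)"
| "P (Suc m) = (\<lambda>h i. P m h i - of_real tau * T (P m) h i)"

lemma P_support: "h \<notin> fbox s m \<Longrightarrow> P m h i = 0"
proof (induction m arbitrary: h i)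
  case 0
  then have "h \<noteq> (\<lambda>_. 0)" by (auto simp: fbox_def Zs_def)
  then show ?case by simp
next
  case (Suc m)
  have 1: "h \<notin> fbox s m" using Suc.prems by (auto simp: fbox_def)
  have 2: "h(j := h j - \<delta>) \<notin> fbox s m" if j: "j < s" and \<delta>: "\<delta> = 1 \<or> \<delta> = -1" for j \<delta>
  proof
    assume *: "h(j := h j - \<delta>) \<in> fbox s m"
    have "h \<in> Zs s" using * j by (auto simp: fbox_def Zs_def)
    moreover have "\<bar>h i\<bar> \<le> int (Suc m)" if "i < s" for i
    proof (cases "i = j")
      case True
      have "\<bar>(h(j := h j - \<delta>)) j\<bar> \<le> int m" using * j unfolding fbox_def by blast
      then show ?thesis using True \<delta> by auto
    next
      case False
      have "\<bar>(h(j := h j - \<delta>)) i\<bar> \<le> int m" using * that unfolding fbox_def by blast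
      then show ?thesis using False by auto
    qed
    ultimately have "h \<in> fbox s (Suc m)" by (simp add: fbox_def)
    then show False using Suc.prems by blast
  qed
  have "P m (h(j := h j - 1)) k = 0" "P m (h(j := h j - (-1))) k = 0" if "j < s" for j k
    by (rule Suc.IH[OF 2[OF that]], simp)+
  then show ?case by (simp add: Suc.IH[OF 1] T_def cop_def)
qed

lemma rapidly_decreasing_P: "rapidly_decreasing s (\<lambda>h. P m h k)"
  unfolding rapidly_decreasing_def
proof
  fix \<nu>
  have "(\<lambda>h. norm (ipow s \<nu> h * P m h k)) summable_on fbox s m" by (simp add: finite_fbox)
  then show "(\<lambda>h. ipow s \<nu> h * P m h k) abs_summable_on Zs s"
    by (rule summable_on_cong_neutral[THEN iffD1, rotated -1]) (auto simp: fbox_def P_support)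
qed

definition p :: "nat \<Rightarrow> (nat \<Rightarrow> real) \<Rightarrow> 'i \<Rightarrow> complex" where
  "p m y i = fseries s (\<lambda>h. P m h i) y"

lemma abs_summable_P: "(\<lambda>h. P m h i) abs_summable_on Zs s"
  by (rule rapidly_decreasing_abs_summable[OF rapidly_decreasing_P])

lemma W_0: "W c (\<lambda>_. 0) y k = fseries s (\<lambda>h. c h k) y" by (simp add: W_def)

lemma Wj_0: "Wj c (\<lambda>_. 0) y i = 0" by (simp add: Wj_def)

lemma T_fseries_0:
  assumes "\<And>k. k \<in> I \<Longrightarrow> rapidly_decreasing s (\<lambda>h. c h k)"
  shows "(\<lambda>h. T c h i) abs_summable_on Zs s"
    and "fseries s (\<lambda>h. T c h i) y = aop y (\<lambda>k. fseries s (\<lambda>h. c h k) y) i"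
  using T_fseries[OF assms, where \<nu> = "\<lambda>_. 0" and i = i] by (simp_all add: W_0[abs_def] Wj_0)

lemma p_Suc: "p (Suc m) y i = p m y i - of_real tau * aop y (p m y) i"
proof -
  have T1: "(\<lambda>h. T (P m) h i) abs_summable_on Zs s" by (rule T_fseries_0[OF rapidly_decreasing_P])
  have "p (Suc m) y i = fseries s (\<lambda>h. P m h i + (- of_real tau) * T (P m) h i) y"
    by (simp add: p_def)
  also have "\<dots> = p m y i + (- of_real tau) * fseries s (\<lambda>h. T (P m) h i) y"
    unfolding p_def by (subst fseries_add[OF abs_summable_P abs_summable_fcmult[OF T1]], subst fseries_cmult) (rule refl)
  also have "fseries s (\<lambda>h. T (P m) h i) y = aop y (p m y) i"
    by (simp only: T_fseries_0(2)[OF rapidly_decreasing_P] p_def[abs_def])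
  finally show ?thesis by simp
qed

lemma fseries_delta: "fseries s (\<lambda>h. if h = (\<lambda>_. 0) then x h else 0) y = x (\<lambda>_. 0)"
  and abs_summable_delta: "(\<lambda>h. if h = (\<lambda>_. 0) then x h else 0 :: complex) abs_summable_on Zs s"
proof -
  have z: "(\<lambda>_. 0) \<in> Zs s" by (simp add: Zs_def)
  have "fseries s (\<lambda>h. if h = (\<lambda>_. 0) then x h else 0) y = (\<Sum>\<^sub>\<infinity>h\<in>{\<lambda>_. 0}. x h * trig s h y)"
    unfolding fseries_def by (rule infsum_cong_neutral) (use z in auto)
  then show "fseries s (\<lambda>h. if h = (\<lambda>_. 0) then x h else 0) y = x (\<lambda>_. 0)" by simp
  have "(\<lambda>h. norm (x h)) summable_on {\<lambda>_. 0}" by simp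
  then show "(\<lambda>h. if h = (\<lambda>_. 0) then x h else 0) abs_summable_on Zs s"
    by (rule summable_on_cong_neutral[THEN iffD1, rotated -1]) (use z in auto)
qed

lemma p_0: "p 0 y i = of_real tau * of_real (q i)"
  unfolding p_def P.simps by (rule fseries_delta)

lemma p_bound:
  assumes y: "in_cube s y"
  shows "cn I (p m y) \<le> rate ^ m * (tau * nq)"
proof (induction m)
  case 0
  have "cn I (p 0 y) = tau * nq"
    using tau_pos by (simp add: p_0[abs_def] cn_cmult)
  then show ?case by simp
next
  case (Suc m)
  have "cn I (p (Suc m) y) = cn I (\<lambda>i. p m y i - of_real tau * aop y (p m y) i)"
    by (rule cn_cong) (rule p_Suc)
  also have "\<dots> \<le> rate * cn I (p m y)" by (rule richardson_contraction[OF y])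
  also have "\<dots> \<le> rate * (rate ^ m * (tau * nq))" by (rule mult_left_mono[OF Suc rate(1)])
  finally show ?case by (simp add: mult_ac)
qed

lemma rate_tau_nonneg: "0 \<le> rate ^ m * (tau * nq)"
  by (intro mult_nonneg_nonneg zero_le_power rate cn_nonneg less_imp_le[OF tau_pos])

text \<open>By Parseval a coefficient is at most the \<open>L2\<close> norm of its series over the
  cube, and there the contraction bound holds at every point.\<close>

lemma P_bound:
  assumes i: "i \<in> I" and h: "h \<in> Zs s"
  shows "cmod (P m h i) \<le> rate ^ m * (tau * nq)"
proof -
  interpret prob_space "cube_measure s" by (rule prob_space_cube)
  let ?B = "rate ^ m * (tau * nq)"
  have B0: "0 \<le> ?B" by (rule rate_tau_nonneg)
  note ps = parseval_fseries[OF abs_summable_P[of m i]]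
  have "(\<Sum>k\<in>{h}. (cmod (P m k i))\<^sup>2) \<le> (\<Sum>\<^sub>\<infinity>k\<in>Zs s. (cmod (P m k i))\<^sup>2)"
    by (rule finite_sum_le_infsum[OF ps(1)]) (use h in auto)
  also have "\<dots> = (\<integral>y. (cmod (p m y i))\<^sup>2 \<partial>cube_measure s)"
    unfolding p_def by (rule ps(2)[symmetric])
  also have "\<dots> \<le> (\<integral>y. ?B\<^sup>2 \<partial>cube_measure s)"
  proof (rule integral_mono_AE')
    show "AE y in cube_measure s. (cmod (p m y i))\<^sup>2 \<le> ?B\<^sup>2"
    proof (rule AE_I2)
      fix y assume "y \<in> space (cube_measure s)"
      then have "cmod (p m y i) \<le> ?B"
        using order_trans[OF norm_le_cn[OF fin i] p_bound[OF space_cube_in_cube]] by blast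
      then show "(cmod (p m y i))\<^sup>2 \<le> ?B\<^sup>2" by (rule power_mono) simp
    qed
  qed auto
  also have "\<dots> = ?B\<^sup>2" by (simp add: prob_space)
  finally have "(cmod (P m h i))\<^sup>2 \<le> ?B\<^sup>2" by simp
  then show ?thesis by (rule power2_le_imp_le[OF _ B0])
qed

lemma norm_ipow_fbox:
  assumes "h \<in> fbox s m"
  shows "cmod (ipow s \<nu> h) \<le> (2 * real m + 1) ^ (\<Sum>j<s. \<nu> j)"
proof -
  have "cmod (ipow s \<nu> h) = (\<Prod>j<s. \<bar>real_of_int (h j)\<bar> ^ \<nu> j)"
    by (simp add: ipow_def prod_norm[symmetric] norm_power)
  also have "\<dots> \<le> (\<Prod>j<s. (2 * real m + 1) ^ \<nu> j)"
  proof (rule prod_mono, intro conjI power_mono)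
    fix j assume "j \<in> {..<s}"
    then have "\<bar>h j\<bar> \<le> int m" using assms by (auto simp: fbox_def)
    then have "real_of_int \<bar>h j\<bar> \<le> real_of_int (int m)" by (simp only: of_int_le_iff)
    then show "\<bar>real_of_int (h j)\<bar> \<le> 2 * real m + 1" by simp
  qed auto
  also have "\<dots> = (2 * real m + 1) ^ (\<Sum>j<s. \<nu> j)" by (rule power_sum[symmetric])
  finally show ?thesis .
qed

text \<open>The term of index \<open>m\<close> involves at most \<open>(2 * m + 1) ^ s\<close>
  frequencies, on each of which \<open>ipow\<close> is bounded by a power of
  \<open>2 * m + 1\<close>; this polynomial growth loses against \<open>rate ^ m\<close>. The size
  of the sum depends on \<open>s\<close>, which is harmless as it only serves to justify
  interchanges of summation.\<close>

lemma abs_summable_P_pairs: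
  assumes i: "i \<in> I"
  shows "(\<lambda>(m, h). ipow s \<nu> h * P m h i) abs_summable_on UNIV \<times> Zs s"
proof (rule iffD2[OF Infinite_Sum.abs_summable_on_Sigma_iff], intro conjI ballI)
  define K where "K = (\<Sum>j<s. \<nu> j) + s"
  have in1: "(\<lambda>h. norm (case (m, h) of (m, h) \<Rightarrow> ipow s \<nu> h * P m h i)) summable_on Zs s" for m
    using rapidly_decreasing_P[of m i] unfolding rapidly_decreasing_def prod.case by blast
  then show "(\<lambda>h. norm (case (m, h) of (m, h) \<Rightarrow> ipow s \<nu> h * P m h i)) summable_on Zs s" for m .
  have le: "(\<Sum>\<^sub>\<infinity>h\<in>Zs s. norm (case (m, h) of (m, h) \<Rightarrow> ipow s \<nu> h * P m h i)) \<le>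
     (tau * nq) * ((2 * real m + 1) ^ K * rate ^ m)" for m
  proof -
    have "(\<Sum>\<^sub>\<infinity>h\<in>Zs s. norm (case (m, h) of (m, h) \<Rightarrow> ipow s \<nu> h * P m h i)) =
      (\<Sum>\<^sub>\<infinity>h\<in>fbox s m. cmod (ipow s \<nu> h) * cmod (P m h i))"
      by (rule infsum_cong_neutral) (auto simp: fbox_def P_support norm_mult)
    also have "\<dots> = (\<Sum>h\<in>fbox s m. cmod (ipow s \<nu> h) * cmod (P m h i))"
      by (rule infsum_finite[OF finite_fbox])
    also have "\<dots> \<le> (\<Sum>h\<in>fbox s m. (2 * real m + 1) ^ (\<Sum>j<s. \<nu> j) * (rate ^ m * (tau * nq)))"
      by (intro sum_mono mult_mono norm_ipow_fbox P_bound i) (auto simp: fbox_def)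
    also have "\<dots> = real (card (fbox s m)) * ((2 * real m + 1) ^ (\<Sum>j<s. \<nu> j) * (rate ^ m * (tau * nq)))"
      by simp
    also have "\<dots> \<le> (2 * real m + 1) ^ s * ((2 * real m + 1) ^ (\<Sum>j<s. \<nu> j) * (rate ^ m * (tau * nq)))"
    proof (rule mult_right_mono)
      have "real (card (fbox s m)) \<le> real ((2 * m + 1) ^ s)" using card_fbox[of s m] by (simp only: of_nat_le_iff)
      then show "real (card (fbox s m)) \<le> (2 * real m + 1) ^ s" by (simp add: add.commute)
      show "0 \<le> (2 * real m + 1) ^ (\<Sum>j<s. \<nu> j) * (rate ^ m * (tau * nq))"
        by (rule mult_nonneg_nonneg[OF _ rate_tau_nonneg]) simp
    qed
    also have "\<dots> = (tau * nq) * ((2 * real m + 1) ^ K * rate ^ m)"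
      by (simp add: K_def power_add mult_ac)
    finally show ?thesis .
  qed
  have "summable (\<lambda>m. (tau * nq) * ((2 * real m + 1) ^ K * rate ^ m))"
    by (rule summable_mult[OF summable_poly_geometric[OF rate]])
  then have "(\<lambda>m. (tau * nq) * ((2 * real m + 1) ^ K * rate ^ m)) summable_on UNIV"
    by (subst summable_on_UNIV_nonneg_real_iff)
       (intro mult_nonneg_nonneg zero_le_power rate cn_nonneg less_imp_le[OF tau_pos], simp_all)
  then show "(\<lambda>m. \<Sum>\<^sub>\<infinity>h\<in>Zs s. norm (case (m, h) of (m, h) \<Rightarrow> ipow s \<nu> h * P m h i)) abs_summable_on UNIV"
  proof (rule Infinite_Sum.abs_summable_on_comparison_test')
    fix m
    have "0 \<le> (\<Sum>\<^sub>\<infinity>h\<in>Zs s. norm (case (m, h) of (m, h) \<Rightarrow> ipow s \<nu> h * P m h i))"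
      by (rule infsum_nonneg) simp
    then show "norm (\<Sum>\<^sub>\<infinity>h\<in>Zs s. norm (case (m, h) of (m, h) \<Rightarrow> ipow s \<nu> h * P m h i)) \<le>
      (tau * nq) * ((2 * real m + 1) ^ K * rate ^ m)"
      using le[of m] by simp
  qed
qed

definition uhat :: "(nat \<Rightarrow> int) \<Rightarrow> 'i \<Rightarrow> complex" where
  "uhat h i = (\<Sum>\<^sub>\<infinity>m. P m h i)"

lemma rapidly_decreasing_uhat:
  assumes i: "i \<in> I"
  shows "rapidly_decreasing s (\<lambda>h. uhat h i)"
  unfolding rapidly_decreasing_def
proof
  fix \<nu>
  have bij: "bij_betw prod.swap (Zs s \<times> (UNIV :: nat set)) (UNIV \<times> Zs s)"
    by (rule bij_betw_byWitness[where f' = prod.swap]) auto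
  have sw: "(\<lambda>(h, m). ipow s \<nu> h * P m h i) abs_summable_on Zs s \<times> UNIV"
    using summable_on_reindex_bij_betw[OF bij, of "\<lambda>x. norm (case x of (m, h) \<Rightarrow> ipow s \<nu> h * P m h i)"]
      abs_summable_P_pairs[OF i, of \<nu>] by (simp add: case_prod_unfold)
  note sg = iffD1[OF Infinite_Sum.abs_summable_on_Sigma_iff sw]
  have s1: "(\<lambda>m. ipow s \<nu> h * P m h i) abs_summable_on UNIV" if "h \<in> Zs s" for h
    using conjunct1[OF sg, rule_format, OF that] by simp
  show "(\<lambda>h. ipow s \<nu> h * uhat h i) abs_summable_on Zs s"
  proof (rule Infinite_Sum.abs_summable_on_comparison_test[OF conjunct2[OF sg]])
    fix h assume h: "h \<in> Zs s"
    have "cmod (ipow s \<nu> h * uhat h i) = cmod (\<Sum>\<^sub>\<infinity>m. ipow s \<nu> h * P m h i)"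
      by (simp only: uhat_def infsum_cmult_right')
    also have "\<dots> \<le> (\<Sum>\<^sub>\<infinity>m. cmod (ipow s \<nu> h * P m h i))" by (rule norm_infsum_bound[OF s1[OF h]])
    finally show "norm (ipow s \<nu> h * uhat h i) \<le>
        norm (\<Sum>\<^sub>\<infinity>m. norm (case (h, m) of (h, m) \<Rightarrow> ipow s \<nu> h * P m h i))"
      unfolding prod.case by (rule order_trans) simp
  qed
qed

lemma fseries_uhat:
  assumes i: "i \<in> I"
  shows "(\<lambda>m. p m y i) abs_summable_on UNIV" and "fseries s (\<lambda>h. uhat h i) y = (\<Sum>\<^sub>\<infinity>m. p m y i)"
proof -
  have 1: "(\<lambda>(m, h). P m h i * trig s h y) abs_summable_on UNIV \<times> Zs s"
    using abs_summable_P_pairs[OF i, of "\<lambda>_. 0"] by (simp add: case_prod_unfold norm_mult)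
  note sg = iffD1[OF Infinite_Sum.abs_summable_on_Sigma_iff 1]
  show "(\<lambda>m. p m y i) abs_summable_on UNIV"
  proof (rule Infinite_Sum.abs_summable_on_comparison_test[OF conjunct2[OF sg]])
    fix m :: nat
    have "cmod (p m y i) \<le> (\<Sum>\<^sub>\<infinity>h\<in>Zs s. cmod (P m h i * trig s h y))"
      unfolding p_def fseries_def by (rule norm_infsum_bound[OF abs_summable_fseries[OF abs_summable_P]])
    then show "norm (p m y i) \<le> norm (\<Sum>\<^sub>\<infinity>h\<in>Zs s. norm (case (m, h) of (m, h) \<Rightarrow> P m h i * trig s h y))"
      unfolding prod.case by (rule order_trans) simp
  qed
  have "fseries s (\<lambda>h. uhat h i) y = (\<Sum>\<^sub>\<infinity>h\<in>Zs s. \<Sum>\<^sub>\<infinity>m. P m h i * trig s h y)"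
    by (simp only: fseries_def uhat_def infsum_cmult_left')
  also have "\<dots> = (\<Sum>\<^sub>\<infinity>m. \<Sum>\<^sub>\<infinity>h\<in>Zs s. P m h i * trig s h y)"
    by (rule infsum_swap_banach[symmetric]) (rule abs_summable_summable[OF 1])
  finally show "fseries s (\<lambda>h. uhat h i) y = (\<Sum>\<^sub>\<infinity>m. p m y i)"
    by (simp only: p_def fseries_def)
qed

text \<open>The iteration makes \<open>tau * aop y (p m y)\<close> the difference of consecutive
  \<open>p\<close>, so the sum over \<open>m\<close> telescopes to \<open>p 0\<close>, which is
  \<open>tau * q\<close>.\<close>

lemma aop_uhat:
  assumes y: "in_cube s y" and i: "i \<in> I"
  shows "aop y (\<lambda>k. fseries s (\<lambda>h. uhat h k) y) i = of_real (q i)"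
proof -
  have sp: "(\<lambda>m. p m y k) summable_on UNIV" if "k \<in> I" for k
    by (rule abs_summable_summable[OF fseries_uhat(1)[OF that]])
  have sums: "(\<lambda>m. aop y (p m y) i) sums aop y (\<lambda>k. fseries s (\<lambda>h. uhat h k) y) i"
    unfolding cop_def
  proof (intro sums_sum sums_mult)
    fix k assume k: "k \<in> I"
    show "(\<lambda>m. p m y k) sums fseries s (\<lambda>h. uhat h k) y"
      unfolding fseries_uhat(2)[OF k] by (rule has_sum_imp_sums[OF has_sum_infsum[OF sp[OF k]]])
  qed
  have lim: "(\<lambda>m. p m y i) \<longlonglongrightarrow> 0"
    by (rule summable_LIMSEQ_zero[OF summable_on_imp_summable[OF sp[OF i]]])
  have "(\<lambda>m. p m y i - p (Suc m) y i) sums (p 0 y i - 0)"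
    by (rule telescope_sums'[OF lim])
  moreover have "p m y i - p (Suc m) y i = of_real tau * aop y (p m y) i" for m
    by (simp add: p_Suc)
  ultimately have "(\<lambda>m. of_real tau * aop y (p m y) i) sums (of_real tau * of_real (q i))"
    by (simp add: p_0)
  moreover have "(\<lambda>m. of_real tau * aop y (p m y) i) sums (of_real tau * aop y (\<lambda>k. fseries s (\<lambda>h. uhat h k) y) i)"
    by (rule sums_mult[OF sums])
  ultimately have "complex_of_real tau * of_real (q i) = of_real tau * aop y (\<lambda>k. fseries s (\<lambda>h. uhat h k) y) i"
    by (rule sums_unique2)
  then show ?thesis using tau_pos by simp
qed

text \<open>Coercivity makes the system uniquely solvable at each \<open>y\<close>. Hence a family
  of solutions, given without any regularity in \<open>y\<close>, inherits the Fourier expansion of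
  the constructed one.\<close>

lemma solution_eq_fseries:
  assumes y: "in_cube s y" and c: "\<And>i. i \<in> I \<Longrightarrow> (\<Sum>k\<in>I. Ay y i k * c k) = q i" and i: "i \<in> I"
  shows "complex_of_real (c i) = fseries s (\<lambda>h. uhat h i) y"
proof -
  let ?x = "\<lambda>k. fseries s (\<lambda>h. uhat h k) y + (- of_real (c k))"
  have "aop y ?x i = 0" if i: "i \<in> I" for i
  proof -
    have "aop y ?x i = aop y (\<lambda>k. fseries s (\<lambda>h. uhat h k) y) i - of_real (\<Sum>k\<in>I. Ay y i k * c k)"
      by (simp add: cop_def right_diff_distrib sum_subtractf)
    then show ?thesis by (simp add: aop_uhat[OF y i] c[OF i])
  qed
  then have "cn I (aop y ?x) = 0" by (simp add: cn_def L2_set_def)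
  then have "amin * cn I ?x \<le> 0" using aop_lower[OF y, of ?x] by simp
  then have "cn I ?x = 0" using amin cn_nonneg[of I ?x] by (simp add: mult_le_0_iff)
  then have "cmod (?x i) \<le> 0" using norm_le_cn[OF fin i, of ?x] by simp
  then show ?thesis by simp
qed

section \<open>Differentiating the equation, and the kernel norm of the solution\<close>

text \<open>Two absolutely convergent series that agree on the cube have the same coefficients. On
  that level the equation can be multiplied by \<open>ipow s \<nu> h\<close>, which amounts to
  differentiating it.\<close>

lemma T_uhat:
  assumes i: "i \<in> I" and h: "h \<in> Zs s"
  shows "T uhat h i = (if h = (\<lambda>_. 0) then of_real (q i) else 0)"
proof (rule fseries_unique[OF T_fseries_0(1)[OF rapidly_decreasing_uhat] abs_summable_delta[of "\<lambda>_. of_real (q i)"] h])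
  fix y assume "y \<in> space (cube_measure s)"
  then have "fseries s (\<lambda>h. T uhat h i) y = of_real (q i)"
    by (simp only: T_fseries_0(2)[OF rapidly_decreasing_uhat] aop_uhat[OF space_cube_in_cube i])
  then show "fseries s (\<lambda>h. T uhat h i) y = fseries s (\<lambda>h. if h = (\<lambda>_. 0) then of_real (q i) else 0) y"
    by (simp only: fseries_delta)
qed

lemma W_equation:
  assumes i: "i \<in> I"
  shows "aop y (W uhat \<nu> y) i + Wj uhat \<nu> y i = (if \<forall>j<s. \<nu> j = 0 then of_real (q i) else 0)"
proof -
  have "aop y (W uhat \<nu> y) i + Wj uhat \<nu> y i = fseries s (\<lambda>h. ipow s \<nu> h * T uhat h i) y"
    by (rule T_fseries(2)[OF rapidly_decreasing_uhat, symmetric])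
  also have "\<dots> = fseries s (\<lambda>h. if h = (\<lambda>_. 0) then ipow s \<nu> h * of_real (q i) else 0) y"
    unfolding fseries_def by (intro infsum_cong) (simp add: T_uhat[OF i])
  also have "\<dots> = ipow s \<nu> (\<lambda>_. 0) * of_real (q i)" by (rule fseries_delta)
  also have "\<dots> = (if \<forall>j<s. \<nu> j = 0 then of_real (q i) else 0)"
  proof (cases "\<forall>j<s. \<nu> j = 0")
    case False
    then obtain j where "j < s" "\<nu> j \<noteq> 0" by blast
    then have "ipow s \<nu> (\<lambda>_. 0) = 0" unfolding ipow_def by (intro prod_zero) auto
    then show ?thesis unfolding if_not_P[OF False] by simp
  qed (simp add: ipow_def)
  finally show ?thesis .
qed

lemma fdb_sum_cong: "(\<And>j. j < s \<Longrightarrow> \<nu> j = \<mu> j) \<Longrightarrow> fdb_sum s K b \<nu> = fdb_sum s K b \<mu>"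
proof -
  assume eq: "\<And>j. j < s \<Longrightarrow> \<nu> j = \<mu> j"
  have "(\<Prod>j<s. b j ^ m j * real (Stirling (\<nu> j) (m j))) = (\<Prod>j<s. b j ^ m j * real (Stirling (\<mu> j) (m j)))" for m
    by (rule prod.cong[OF refl]) (simp add: eq)
  then show ?thesis unfolding fdb_sum_def by (simp only:)
qed

text \<open>Induction on the total order. Coercivity bounds the derivative by the terms in which the
  matrix is differentiated; these involve lower orders, and the \<open>amin\<close> from
  \<open>bound\<close> cancels the one in the induction hypothesis. The resulting recursion is the
  one that \<open>fdb_sum\<close> satisfies.\<close>

lemma W_bound:
  assumes y: "in_cube s y" and \<nu>: "\<And>j. j < s \<Longrightarrow> \<nu> j \<le> K"
  shows "cn I (W uhat \<nu> y) \<le> nq / amin * fdb_sum s K b \<nu>"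
  using \<nu>
proof (induction "\<Sum>j<s. \<nu> j" arbitrary: \<nu> rule: less_induct)
  case less
  have nq0: "0 \<le> nq / amin" by (intro divide_nonneg_pos cn_nonneg amin)
  show ?case
  proof (cases "\<forall>j<s. \<nu> j = 0")
    case True
    have "Wj uhat \<nu> y i = 0" for i using True by (simp add: Wj_def)
    then have "aop y (W uhat \<nu> y) i = of_real (q i)" if "i \<in> I" for i
      using W_equation[OF that, of y \<nu>] True by simp
    then have "cn I (aop y (W uhat \<nu> y)) = nq" by (rule cn_cong)
    then have "amin * cn I (W uhat \<nu> y) \<le> nq" using aop_lower[OF y, of "W uhat \<nu> y"] by simp
    moreover have "fdb_sum s K b \<nu> = 1" using fdb_sum_cong[of \<nu> "\<lambda>_. 0" K] True fdb_sum_0 by simp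
    ultimately show ?thesis using amin by (simp add: field_simps)
  next
    case False
    have "aop y (W uhat \<nu> y) i = (- 1) * Wj uhat \<nu> y i" if "i \<in> I" for i
      using W_equation[OF that, of y \<nu>] unfolding if_not_P[OF False] by (simp add: add_eq_0_iff2)
    then have "cn I (aop y (W uhat \<nu> y)) = cn I (\<lambda>i. (- 1) * Wj uhat \<nu> y i)" by (rule cn_cong)
    also have "\<dots> = cn I (\<lambda>i. Wj uhat \<nu> y i)" by (simp only: cn_cmult) simp
    also have "\<dots> \<le> (\<Sum>j<s. \<Sum>l=1..\<nu> j. cn I (\<lambda>i. (of_nat (\<nu> j choose l) * om j l y) * cop I (A j) (W uhat (\<nu>(j := \<nu> j - l)) y) i))"
      unfolding Wj_def by (rule order_trans[OF cn_sum]) (intro sum_mono cn_sum)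
    also have "\<dots> \<le> (\<Sum>j<s. \<Sum>l=1..\<nu> j. nq * (real (\<nu> j choose l) * b j * fdb_sum s K b (\<nu>(j := \<nu> j - l))))"
    proof (intro sum_mono)
      fix j l assume j: "j \<in> {..<s}" and l: "l \<in> {1..\<nu> j}"
      let ?\<mu> = "\<nu>(j := \<nu> j - l)"
      have "(\<Sum>i<s. ?\<mu> i) < (\<Sum>i<s. \<nu> i)"
        using j l by (intro sum_strict_mono_ex1) auto
      then have IH: "cn I (W uhat ?\<mu> y) \<le> nq / amin * fdb_sum s K b ?\<mu>"
        by (rule less.hyps) (use less.prems in \<open>auto intro: diff_le_self[THEN order_trans]\<close>)
      have "cn I (\<lambda>i. (of_nat (\<nu> j choose l) * om j l y) * cop I (A j) (W uhat ?\<mu> y) i) =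
         real (\<nu> j choose l) * cmod (om j l y) * cn I (cop I (A j) (W uhat ?\<mu> y))"
        by (simp only: cn_cmult norm_mult norm_of_nat)
      also have "\<dots> \<le> real (\<nu> j choose l) * 1 * (amin * b j * (nq / amin * fdb_sum s K b ?\<mu>))"
      proof (intro mult_mono norm_om order_refl)
        have "cn I (cop I (A j) (W uhat ?\<mu> y)) \<le> amin * b j * cn I (W uhat ?\<mu> y)"
          using amin b j by (intro cop_bound bound) auto
        also have "\<dots> \<le> amin * b j * (nq / amin * fdb_sum s K b ?\<mu>)"
          using amin b by (intro mult_left_mono IH) auto
        finally show "cn I (cop I (A j) (W uhat ?\<mu> y)) \<le> amin * b j * (nq / amin * fdb_sum s K b ?\<mu>)" .
      qed (auto simp: cn_nonneg)
      also have "\<dots> = nq * (real (\<nu> j choose l) * b j * fdb_sum s K b ?\<mu>)"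
        using amin by simp
      finally show "cn I (\<lambda>i. (of_nat (\<nu> j choose l) * om j l y) * cop I (A j) (W uhat ?\<mu> y) i) \<le>
         nq * (real (\<nu> j choose l) * b j * fdb_sum s K b ?\<mu>)" .
    qed
    also have "\<dots> = nq * (\<Sum>j<s. \<Sum>l=1..\<nu> j. real (\<nu> j choose l) * b j * fdb_sum s K b (\<nu>(j := \<nu> j - l)))"
      by (simp only: sum_distrib_left)
    also have "\<dots> \<le> nq * fdb_sum s K b \<nu>"
      by (intro mult_left_mono fdb_sum_rec b less.prems cn_nonneg)
    finally have "amin * cn I (W uhat \<nu> y) \<le> nq * fdb_sum s K b \<nu>"
      using aop_lower[OF y, of "W uhat \<nu> y"] by simp
    then show ?thesis using amin by (simp add: field_simps)
  qed
qed

lemma ipow_norm: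
  assumes "\<And>j. j < s \<Longrightarrow> \<nu> j \<le> K"
  shows "i \<in> I \<Longrightarrow> (\<lambda>h. (cmod (ipow s \<nu> h * uhat h i))\<^sup>2) summable_on Zs s"
    and "(\<Sum>i\<in>I. \<Sum>\<^sub>\<infinity>h\<in>Zs s. (cmod (ipow s \<nu> h * uhat h i))\<^sup>2) \<le> (nq / amin * fdb_sum s K b \<nu>)\<^sup>2"
proof -
  interpret prob_space "cube_measure s" by (rule prob_space_cube)
  let ?B = "nq / amin * fdb_sum s K b \<nu>"
  have s: "(\<lambda>h. ipow s \<nu> h * uhat h i) abs_summable_on Zs s" if "i \<in> I" for i
    using rapidly_decreasing_uhat[OF that] by (simp add: rapidly_decreasing_def)
  show "i \<in> I \<Longrightarrow> (\<lambda>h. (cmod (ipow s \<nu> h * uhat h i))\<^sup>2) summable_on Zs s"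
    by (rule parseval_fseries(1)[OF s])
  have int: "integrable (cube_measure s) (\<lambda>y. (cmod (W uhat \<nu> y i))\<^sup>2)" if i: "i \<in> I" for i
  proof (rule integrable_const_bound)
    let ?M = "\<Sum>\<^sub>\<infinity>h\<in>Zs s. cmod (ipow s \<nu> h * uhat h i)"
    show "AE y in cube_measure s. norm ((cmod (W uhat \<nu> y i))\<^sup>2) \<le> ?M\<^sup>2"
      using fseries_bound[OF s[OF i]] by (auto simp: W_def intro!: AE_I2 power_mono)
    show "(\<lambda>y. (cmod (W uhat \<nu> y i))\<^sup>2) \<in> borel_measurable (cube_measure s)"
      using borel_measurable_integrable[OF integrable_fseries[OF s[OF i]]] unfolding W_def
      by measurable
  qed
  have "(\<Sum>i\<in>I. \<Sum>\<^sub>\<infinity>h\<in>Zs s. (cmod (ipow s \<nu> h * uhat h i))\<^sup>2) = (\<Sum>i\<in>I. \<integral>y. (cmod (W uhat \<nu> y i))\<^sup>2 \<partial>cube_measure s)"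
    unfolding W_def by (intro sum.cong refl parseval_fseries(2)[OF s, symmetric])
  also have "\<dots> = (\<integral>y. (\<Sum>i\<in>I. (cmod (W uhat \<nu> y i))\<^sup>2) \<partial>cube_measure s)"
    by (rule Bochner_Integration.integral_sum[symmetric]) (rule int)
  also have "\<dots> \<le> (\<integral>y. ?B\<^sup>2 \<partial>cube_measure s)"
  proof (rule integral_mono)
    show "integrable (cube_measure s) (\<lambda>y. \<Sum>i\<in>I. (cmod (W uhat \<nu> y i))\<^sup>2)"
      by (rule Bochner_Integration.integrable_sum) (rule int)
    fix y assume "y \<in> space (cube_measure s)"
    then have "cn I (W uhat \<nu> y) \<le> ?B" by (intro W_bound space_cube_in_cube assms)
    then have "(cn I (W uhat \<nu> y))\<^sup>2 \<le> ?B\<^sup>2" by (rule power_mono[OF _ cn_nonneg])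
    then show "(\<Sum>i\<in>I. (cmod (W uhat \<nu> y i))\<^sup>2) \<le> ?B\<^sup>2" by (simp only: cn_sq)
  qed simp
  also have "\<dots> = ?B\<^sup>2" by (simp add: prob_space)
  finally show "(\<Sum>i\<in>I. \<Sum>\<^sub>\<infinity>h\<in>Zs s. (cmod (ipow s \<nu> h * uhat h i))\<^sup>2) \<le> ?B\<^sup>2" .
qed

text \<open>On frequencies with support \<open>u\<close> the factor
  \<open>r_fun (2 * \<sigma>) \<gamma> h\<close> is the square of \<open>ipow\<close> for the order
  equal to \<open>\<sigma>\<close> on \<open>u\<close> and 0 elsewhere, divided by
  \<open>\<gamma> u\<close>; an even smoothness parameter makes this order integral. Enlarging each
  sum from the support \<open>u\<close> to all frequencies permits Parseval, after which the
  derivative bound applies.\<close>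

lemma kernel_norm_uhat:
  assumes \<sigma>: "1 \<le> \<sigma>" and \<gamma>: "\<And>u. finite u \<Longrightarrow> 0 < \<gamma> u"
  defines "B \<equiv> \<lambda>u. \<Sum>m\<in>u \<rightarrow>\<^sub>E {1..\<sigma>}. fact (\<Sum>j\<in>u. m j) * (\<Prod>j\<in>u. b j ^ m j * real (Stirling \<sigma> (m j)))"
  shows "i \<in> I \<Longrightarrow> (\<lambda>h. r_fun (2 * \<sigma>) \<gamma> h * (cmod (uhat h i))\<^sup>2) summable_on Zs s"
    and "(\<Sum>i\<in>I. \<Sum>\<^sub>\<infinity>h\<in>Zs s. r_fun (2 * \<sigma>) \<gamma> h * (cmod (uhat h i))\<^sup>2) \<le>
      (nq / amin)\<^sup>2 * (\<Sum>u\<in>Pow {..<s}. (B u)\<^sup>2 / \<gamma> u)"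
proof -
  let ?f = "\<lambda>i h. r_fun (2 * \<sigma>) \<gamma> h * (cmod (uhat h i))\<^sup>2"
  let ?\<nu> = "\<lambda>u j. if j \<in> u then \<sigma> else 0"
  have sub: "{h. supp h = u} \<subseteq> Zs s" if "u \<subseteq> {..<s}" for u
    unfolding Zs_eq_UN using that by blast
  have eq: "?f i h = (1 / \<gamma> u) * (cmod (ipow s (?\<nu> u) h * uhat h i))\<^sup>2" if u: "u \<subseteq> {..<s}" and h: "supp h = u" for u h i
  proof -
    have "cmod (ipow s (?\<nu> u) h) = (\<Prod>j<s. \<bar>real_of_int (h j)\<bar> ^ ?\<nu> u j)"
      by (simp only: ipow_def prod_norm[symmetric] norm_power norm_of_int)
    also have "\<dots> = (\<Prod>j\<in>u. \<bar>real_of_int (h j)\<bar> ^ \<sigma>)"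
      using u by (intro prod.mono_neutral_cong_right) auto
    finally have "(cmod (ipow s (?\<nu> u) h))\<^sup>2 = (\<Prod>j\<in>u. real_of_int \<bar>h j\<bar> ^ (2 * \<sigma>))"
      by (simp add: prod_power_distrib[symmetric] power_mult[symmetric] mult.commute)
    then show ?thesis
      unfolding r_fun_def h by (simp add: norm_mult power_mult_distrib inverse_eq_divide)
  qed
  have nb: "?\<nu> u j \<le> \<sigma>" for u j by simp
  have sm: "?f i summable_on {h. supp h = u}" if i: "i \<in> I" and u: "u \<subseteq> {..<s}" for i u
  proof -
    have "(\<lambda>h. (1 / \<gamma> u) * (cmod (ipow s (?\<nu> u) h * uhat h i))\<^sup>2) summable_on {h. supp h = u}"
      by (rule summable_on_cmult_right, rule summable_on_subset_banach[OF ipow_norm(1)[OF nb i] sub[OF u]])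
    then show ?thesis by (rule summable_on_cong[THEN iffD2, rotated]) (rule eq[OF u], simp)
  qed
  have nnf: "0 \<le> ?f i h" if "h \<in> Zs s" for i h
    using r_fun_pos[OF that \<gamma>] by (simp add: less_imp_le)
  have smn: "?f i abs_summable_on {h. supp h = u}" if i: "i \<in> I" and u: "u \<subseteq> {..<s}" for i u
    by (rule iffD1[OF summable_on_iff_abs_summable_on_real sm[OF that]])
  show "i \<in> I \<Longrightarrow> ?f i summable_on Zs s"
    by (rule abs_summable_summable, rule abs_summable_Zs) (rule smn)
  have "(\<Sum>i\<in>I. infsum (?f i) (Zs s)) = (\<Sum>i\<in>I. \<Sum>u\<in>Pow {..<s}. infsum (?f i) {h. supp h = u})"
    by (intro sum.cong refl infsum_Zs smn)
  also have "\<dots> \<le> (\<Sum>i\<in>I. \<Sum>u\<in>Pow {..<s}. (1 / \<gamma> u) * (\<Sum>\<^sub>\<infinity>h\<in>Zs s. (cmod (ipow s (?\<nu> u) h * uhat h i))\<^sup>2))"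
  proof (intro sum_mono)
    fix i u assume i: "i \<in> I" and u: "u \<in> Pow {..<s}"
    then have u': "u \<subseteq> {..<s}" by blast
    have "infsum (?f i) {h. supp h = u} = (\<Sum>\<^sub>\<infinity>h\<in>{h. supp h = u}. (1 / \<gamma> u) * (cmod (ipow s (?\<nu> u) h * uhat h i))\<^sup>2)"
      by (rule infsum_cong) (rule eq[OF u'], simp)
    also have "\<dots> = (1 / \<gamma> u) * (\<Sum>\<^sub>\<infinity>h\<in>{h. supp h = u}. (cmod (ipow s (?\<nu> u) h * uhat h i))\<^sup>2)"
      by (rule infsum_cmult_right')
    also have "\<dots> \<le> (1 / \<gamma> u) * (\<Sum>\<^sub>\<infinity>h\<in>Zs s. (cmod (ipow s (?\<nu> u) h * uhat h i))\<^sup>2)"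
    proof (rule mult_left_mono)
      show "(\<Sum>\<^sub>\<infinity>h\<in>{h. supp h = u}. (cmod (ipow s (?\<nu> u) h * uhat h i))\<^sup>2) \<le> (\<Sum>\<^sub>\<infinity>h\<in>Zs s. (cmod (ipow s (?\<nu> u) h * uhat h i))\<^sup>2)"
        by (rule infsum_mono2[OF summable_on_subset_banach[OF ipow_norm(1)[OF nb i] sub[OF u']] ipow_norm(1)[OF nb i] sub[OF u']]) simp
      have "finite u" using u' by (rule finite_subset) simp
      then show "0 \<le> 1 / \<gamma> u" using \<gamma> by (simp add: less_imp_le)
    qed
    finally show "infsum (?f i) {h. supp h = u} \<le> (1 / \<gamma> u) * (\<Sum>\<^sub>\<infinity>h\<in>Zs s. (cmod (ipow s (?\<nu> u) h * uhat h i))\<^sup>2)" .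
  qed
  also have "\<dots> = (\<Sum>u\<in>Pow {..<s}. (1 / \<gamma> u) * (\<Sum>i\<in>I. \<Sum>\<^sub>\<infinity>h\<in>Zs s. (cmod (ipow s (?\<nu> u) h * uhat h i))\<^sup>2))"
    unfolding sum_distrib_left by (rule sum.swap)
  also have "\<dots> \<le> (\<Sum>u\<in>Pow {..<s}. (1 / \<gamma> u) * (nq / amin * B u)\<^sup>2)"
  proof (rule sum_mono)
    fix u assume u: "u \<in> Pow {..<s}"
    then have u': "u \<subseteq> {..<s}" by blast
    have eqB: "fdb_sum s \<sigma> b (?\<nu> u) = B u" unfolding B_def by (rule fdb_sum_indicator[OF u' \<sigma>])
    have "(\<Sum>i\<in>I. \<Sum>\<^sub>\<infinity>h\<in>Zs s. (cmod (ipow s (?\<nu> u) h * uhat h i))\<^sup>2) \<le> (nq / amin * B u)\<^sup>2"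
      unfolding eqB[symmetric] by (rule ipow_norm(2)[OF nb])
    moreover have "finite u" using u' by (rule finite_subset) simp
    then have "0 \<le> 1 / \<gamma> u" using \<gamma> by (simp add: less_imp_le)
    ultimately show "(1 / \<gamma> u) * (\<Sum>i\<in>I. \<Sum>\<^sub>\<infinity>h\<in>Zs s. (cmod (ipow s (?\<nu> u) h * uhat h i))\<^sup>2) \<le> (1 / \<gamma> u) * (nq / amin * B u)\<^sup>2"
      by (rule mult_left_mono)
  qed
  also have "\<dots> = (nq / amin)\<^sup>2 * (\<Sum>u\<in>Pow {..<s}. (B u)\<^sup>2 / \<gamma> u)"
    unfolding sum_distrib_left
    by (intro sum.cong refl) (simp add: power_mult_distrib power_divide)
  finally show "(\<Sum>i\<in>I. infsum (?f i) (Zs s)) \<le> (nq / amin)\<^sup>2 * (\<Sum>u\<in>Pow {..<s}. (B u)\<^sup>2 / \<gamma> u)" .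
qed

end

section \<open>Dimension-independent bounds for the weights\<close>

lemma sum_powr_subadd:
  fixes a :: "'a \<Rightarrow> real"
  assumes lam: "0 < lam" "lam \<le> 1" and a: "\<And>i. i \<in> A \<Longrightarrow> 0 \<le> a i" and fin: "finite A"
  shows "(\<Sum>i\<in>A. a i) powr lam \<le> (\<Sum>i\<in>A. a i powr lam)"
proof -
  let ?Y = "\<Sum>i\<in>A. a i powr lam"
  have "infsum a A \<le> ?Y powr (1 / lam)"
    by (rule infsum_powr_le_1[OF lam a]) (use fin in simp_all)
  then have "(\<Sum>i\<in>A. a i) \<le> ?Y powr (1 / lam)" using fin by simp
  then have "(\<Sum>i\<in>A. a i) powr lam \<le> (?Y powr (1 / lam)) powr lam"
    using lam by (intro powr_mono2 sum_nonneg a) auto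
  also have "\<dots> = ?Y" using lam by (simp add: powr_powr sum_nonneg)
  finally show ?thesis .
qed

lemma geometric_sum_le_exp:
  assumes "0 \<le> (x::real)"
  shows "1 + (\<Sum>i=1..\<sigma>. x ^ i) \<le> exp (real \<sigma> * x)"
proof -
  have "(\<Sum>i\<le>\<sigma>. x ^ i) \<le> (1 + x) ^ \<sigma>"
  proof (induction \<sigma>)
    case (Suc \<sigma>)
    have "x ^ \<sigma> \<le> (1 + x) ^ \<sigma>" using assms by (intro power_mono) auto
    then have "x * x ^ \<sigma> \<le> x * (1 + x) ^ \<sigma>" using assms by (rule mult_left_mono)
    then show ?case using Suc by (simp add: distrib_right)
  qed simp
  also have "\<dots> \<le> exp x ^ \<sigma>" using assms by (intro power_mono) auto
  also have "\<dots> = exp (real \<sigma> * x)" by (simp add: exp_of_nat_mult)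
  finally have "(\<Sum>i\<le>\<sigma>. x ^ i) \<le> exp (real \<sigma> * x)" .
  moreover have "{..\<sigma>} = insert 0 {1..\<sigma>}" by auto
  ultimately show ?thesis by simp
qed

text \<open>Weighting the terms with \<open>|m| = k\<close> by the \<open>k\<close>-th power of \<open>k + 1\<close> turns the multi-index sum
  into a product over the coordinates.\<close>

lemma sum_fact_powr_bounded:
  fixes a :: "nat \<Rightarrow> real"
  assumes a: "\<And>j. 0 \<le> a j" and sa: "summable a" and p: "0 < p" "p < 1"
  shows "\<exists>C. \<forall>s. (\<Sum>u\<in>Pow {..<s}. \<Sum>m\<in>u \<rightarrow>\<^sub>E {1..\<sigma>}. fact (\<Sum>j\<in>u. m j) powr p * (\<Prod>j\<in>u. a j ^ m j)) \<le> C"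
proof -
  define Y where "Y = real \<sigma> * suminf a"
  have Y0: "0 \<le> Y" using suminf_nonneg[OF sa a] by (simp add: Y_def)
  \<comment> \<open>Chosen so that \<open>c k * (k + 1) ^ k\<close> equals
    \<open>fact k powr p\<close>. For \<open>k\<close> the sum of the entries of \<open>m\<close>
    the original term is then recovered exactly, and it is one of the nonnegative terms of the sum
    over all \<open>k\<close>.\<close>
  define c where "c k = fact k powr p / (real k + 1) ^ k" for k
  define e where "e k = c k * exp (Y * (real k + 1))" for k
  have e0: "0 \<le> e k" and c0: "0 \<le> c k" for k by (simp_all add: e_def c_def)
  \<comment> \<open>The product over coordinates grows like \<open>exp (Y * (k + 1))\<close>, while
    \<open>c k\<close> decays like a \<open>k\<close>-th power of
    \<open>(k + 1) powr - (1 - p)\<close>. Since \<open>p < 1\<close>, the latter wins and leaves a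
    geometric series of ratio 1/2.\<close>
  have "filterlim (\<lambda>k. (real k + 1) powr (1 - p)) at_top sequentially"
  proof (rule filterlim_compose[OF real_powr_at_top])
    show "filterlim (\<lambda>k. real k + 1) at_top sequentially"
      by (rule filterlim_at_top_mono[OF filterlim_real_sequentially]) simp
  qed (use p in simp)
  then have "eventually (\<lambda>k. 2 * exp Y \<le> (real k + 1) powr (1 - p)) sequentially"
    by (simp add: filterlim_at_top)
  then obtain N where N: "\<And>k. N \<le> k \<Longrightarrow> 2 * exp Y \<le> (real k + 1) powr (1 - p)"
    by (auto simp: eventually_sequentially)
  have se: "summable e"
  proof (rule summable_comparison_test'[where N = N])
    show "summable (\<lambda>k. exp Y * (1 / 2) ^ k)" by (intro summable_mult summable_geometric) simp
    fix k assume k: "N \<le> k"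
    have f: "fact k \<le> (real k + 1) ^ k"
    proof -
      have "(fact k :: real) \<le> real k ^ k"
        using fact_le_power[of k, where 'a = real] by simp
      also have "\<dots> \<le> (real k + 1) ^ k" by (intro power_mono) auto
      finally show ?thesis .
    qed
    have "c k \<le> ((real k + 1) ^ k) powr p / (real k + 1) ^ k"
      unfolding c_def using f p by (intro divide_right_mono powr_mono2) auto
    also have "\<dots> = 1 / ((real k + 1) powr (1 - p)) ^ k"
    proof -
      have "((real k + 1) ^ k) powr p * ((real k + 1) powr (1 - p)) ^ k = (real k + 1) ^ k"
        by (simp add: powr_realpow[symmetric] powr_powr powr_add[symmetric] algebra_simps)
      moreover have "0 < (real k + 1) powr (1 - p)" "0 < (real k + 1) ^ k" by simp_all
      ultimately show ?thesis by (simp add: divide_simps)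
    qed
    also have "\<dots> \<le> 1 / (2 * exp Y) ^ k"
      by (intro divide_left_mono power_mono N[OF k] mult_pos_pos zero_less_power) auto
    finally have "e k \<le> 1 / (2 * exp Y) ^ k * exp (Y * (real k + 1))"
      unfolding e_def by (rule mult_right_mono) simp
    also have "exp (Y * (real k + 1)) = exp Y * exp Y ^ k"
      by (simp add: exp_of_nat_mult[symmetric] exp_add[symmetric] algebra_simps)
    also have "1 / (2 * exp Y) ^ k * (exp Y * exp Y ^ k) = exp Y * (1 / 2) ^ k"
      by (simp add: power_mult_distrib power_divide)
    finally show "norm (e k) \<le> exp Y * (1 / 2) ^ k" using e0 by simp
  qed
  show ?thesis
  proof (intro exI allI)
    fix s
    let ?deg = "\<lambda>u m. \<Sum>j\<in>u. m j :: nat"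
    have tm: "fact (?deg u m) powr p * (\<Prod>j\<in>u. a j ^ m j) \<le>
        (\<Sum>k\<le>s * \<sigma>. c k * (\<Prod>j\<in>u. ((real k + 1) * a j) ^ m j))"
      if u: "u \<in> Pow {..<s}" and m: "m \<in> u \<rightarrow>\<^sub>E {1..\<sigma>}" for u m
    proof -
      have "?deg u m \<le> (\<Sum>j\<in>u. \<sigma>)" using m by (intro sum_mono) (auto simp: PiE_iff)
      also have "\<dots> \<le> s * \<sigma>" using u card_mono[of "{..<s}" u] by simp
      finally have k: "?deg u m \<in> {..s * \<sigma>}" by simp
      have "fact (?deg u m) powr p * (\<Prod>j\<in>u. a j ^ m j) =
          c (?deg u m) * (\<Prod>j\<in>u. ((real (?deg u m) + 1) * a j) ^ m j)"
      proof -
        define d where "d = ?deg u m"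
        have "(\<Prod>j\<in>u. ((real d + 1) * a j) ^ m j) = (real d + 1) ^ d * (\<Prod>j\<in>u. a j ^ m j)"
          by (simp add: power_mult_distrib prod.distrib power_sum[symmetric] d_def)
        moreover have "(real d + 1) ^ d \<noteq> 0" by (simp add: add_eq_0_iff2)
        ultimately show ?thesis unfolding d_def[symmetric] by (simp add: c_def)
      qed
      also have "\<dots> \<le> (\<Sum>k\<le>s * \<sigma>. c k * (\<Prod>j\<in>u. ((real k + 1) * a j) ^ m j))"
        by (rule member_le_sum[OF k]) (auto intro!: mult_nonneg_nonneg c0 prod_nonneg zero_le_power a)
      finally show ?thesis .
    qed
    have pk: "(\<Sum>u\<in>Pow {..<s}. \<Sum>m\<in>u \<rightarrow>\<^sub>E {1..\<sigma>}. \<Prod>j\<in>u. x j ^ m j) \<le> exp (real \<sigma> * (\<Sum>j<s. x j))"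
      if x: "\<And>j. 0 \<le> x j" for x :: "nat \<Rightarrow> real"
    proof -
      have "(\<Sum>u\<in>Pow {..<s}. \<Sum>m\<in>u \<rightarrow>\<^sub>E {1..\<sigma>}. \<Prod>j\<in>u. x j ^ m j) = (\<Sum>u\<in>Pow {..<s}. \<Prod>j\<in>u. \<Sum>i=1..\<sigma>. x j ^ i)"
        by (intro sum.cong refl prod_sum_PiE[symmetric]) (auto intro: finite_subset)
      also have "\<dots> = (\<Prod>j<s. (\<Sum>i=1..\<sigma>. x j ^ i) + 1)"
        by (subst prod_add) simp_all
      also have "\<dots> \<le> (\<Prod>j<s. exp (real \<sigma> * x j))"
      proof (rule prod_mono, rule conjI)
        fix j
        show "0 \<le> (\<Sum>i=1..\<sigma>. x j ^ i) + 1" using x by (intro add_nonneg_nonneg sum_nonneg) auto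
        show "(\<Sum>i=1..\<sigma>. x j ^ i) + 1 \<le> exp (real \<sigma> * x j)"
          using geometric_sum_le_exp[OF x[of j], of \<sigma>] by (simp only: add.commute)
      qed
      also have "\<dots> = exp (real \<sigma> * (\<Sum>j<s. x j))"
        by (simp add: exp_sum sum_distrib_left)
      finally show ?thesis .
    qed
    have "(\<Sum>u\<in>Pow {..<s}. \<Sum>m\<in>u \<rightarrow>\<^sub>E {1..\<sigma>}. fact (?deg u m) powr p * (\<Prod>j\<in>u. a j ^ m j)) \<le>
      (\<Sum>u\<in>Pow {..<s}. \<Sum>m\<in>u \<rightarrow>\<^sub>E {1..\<sigma>}. \<Sum>k\<le>s * \<sigma>. c k * (\<Prod>j\<in>u. ((real k + 1) * a j) ^ m j))"
      by (intro sum_mono tm)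
    also have "\<dots> = (\<Sum>u\<in>Pow {..<s}. \<Sum>k\<le>s * \<sigma>. c k * (\<Sum>m\<in>u \<rightarrow>\<^sub>E {1..\<sigma>}. \<Prod>j\<in>u. ((real k + 1) * a j) ^ m j))"
      by (subst sum.swap) (simp only: sum_distrib_left)
    also have "\<dots> = (\<Sum>k\<le>s * \<sigma>. c k * (\<Sum>u\<in>Pow {..<s}. \<Sum>m\<in>u \<rightarrow>\<^sub>E {1..\<sigma>}. \<Prod>j\<in>u. ((real k + 1) * a j) ^ m j))"
      by (subst sum.swap) (simp only: sum_distrib_left)
    also have "\<dots> \<le> (\<Sum>k\<le>s * \<sigma>. e k)"
    proof (rule sum_mono)
      fix k
      have "(\<Sum>j<s. a j) \<le> suminf a" by (rule sum_le_suminf[OF sa]) (use a in auto)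
      then have "(real k + 1) * (real \<sigma> * (\<Sum>j<s. a j)) \<le> (real k + 1) * (real \<sigma> * suminf a)"
        by (intro mult_left_mono) auto
      then have le: "exp (real \<sigma> * (\<Sum>j<s. (real k + 1) * a j)) \<le> exp (Y * (real k + 1))"
        unfolding Y_def sum_distrib_left[symmetric] by (simp only: exp_le_cancel_iff mult_ac)
      have "(\<Sum>u\<in>Pow {..<s}. \<Sum>m\<in>u \<rightarrow>\<^sub>E {1..\<sigma>}. \<Prod>j\<in>u. ((real k + 1) * a j) ^ m j) \<le> exp (Y * (real k + 1))"
        by (rule order_trans[OF pk le]) (simp add: a)
      then show "c k * (\<Sum>u\<in>Pow {..<s}. \<Sum>m\<in>u \<rightarrow>\<^sub>E {1..\<sigma>}. \<Prod>j\<in>u. ((real k + 1) * a j) ^ m j) \<le> e k"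
        unfolding e_def by (rule mult_left_mono[OF _ c0])
    qed
    also have "\<dots> \<le> suminf e" by (rule sum_le_suminf[OF se]) (use e0 in auto)
    finally show "(\<Sum>u\<in>Pow {..<s}. \<Sum>m\<in>u \<rightarrow>\<^sub>E {1..\<sigma>}. fact (?deg u m) powr p * (\<Prod>j\<in>u. a j ^ m j)) \<le> suminf e" .
  qed
qed

definition fdb_term :: "nat \<Rightarrow> (nat \<Rightarrow> real) \<Rightarrow> nat set \<Rightarrow> (nat \<Rightarrow> nat) \<Rightarrow> real" where
  "fdb_term \<sigma> b u m = fact (\<Sum>j\<in>u. m j) * (\<Prod>j\<in>u. b j ^ m j * real (Stirling \<sigma> (m j)))"

lemma Stirling_pos: "1 \<le> m \<Longrightarrow> m \<le> n \<Longrightarrow> 0 < Stirling n m"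
proof (induction n arbitrary: m)
  case (Suc n)
  then obtain k where k: "m = Suc k" by (cases m) auto
  show ?case
  proof (cases "k = 0")
    case False
    then show ?thesis using Suc k by simp
  qed (simp only: k Stirling_1)
qed simp

lemma fdb_term_pos:
  assumes b: "\<And>j. 0 < b j" and m: "m \<in> u \<rightarrow>\<^sub>E {1..\<sigma>}" and u: "finite u"
  shows "0 < fdb_term \<sigma> b u m"
proof -
  have "0 < Stirling \<sigma> (m j)" if "j \<in> u" for j using m that by (intro Stirling_pos) (auto simp: PiE_iff)
  then show ?thesis unfolding fdb_term_def using b by (intro mult_pos_pos prod_pos) auto
qed

text \<open>Every entry of \<open>m\<close> is at least 1, so one factor \<open>c * S\<close> for
  each member of \<open>u\<close> is at most \<open>(c * S) ^ m j\<close> and can be absorbed into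
  the base \<open>a j\<close>. This uses \<open>c * S \<ge> 1\<close>, which the summand 1 in
  \<open>S\<close> guarantees; summability of \<open>a\<close> is that of
  \<open>b j powr p\<close>.\<close>

lemma fdb_term_powr_bounded:
  assumes b: "\<And>j. 0 < b j" and sb: "summable (\<lambda>j. b j powr p)" and p: "0 < p" "p < 1" and c: "1 \<le> c"
  shows "\<exists>C. \<forall>s. (\<Sum>u\<in>Pow {..<s}. c ^ card u * (\<Sum>m\<in>u \<rightarrow>\<^sub>E {1..\<sigma>}. fdb_term \<sigma> b u m powr p)) \<le> C"
proof -
  define S where "S = (\<Sum>i\<le>\<sigma>. real (Stirling \<sigma> i) powr p) + 1"
  have S: "real (Stirling \<sigma> i) powr p \<le> S" if "i \<le> \<sigma>" for i
    using member_le_sum[of i "{..\<sigma>}" "\<lambda>i. real (Stirling \<sigma> i) powr p"] that by (simp add: S_def)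
  have S1: "1 \<le> S" unfolding S_def by (simp add: sum_nonneg)
  define a where "a j = (c * S) * b j powr p" for j
  have a: "0 \<le> a j" for j using c S1 by (simp add: a_def)
  have sa: "summable a" unfolding a_def by (rule summable_mult[OF sb])
  have cS: "1 \<le> c * S" using mult_mono[OF c S1] c by simp
  obtain C where C: "\<And>s. (\<Sum>u\<in>Pow {..<s}. \<Sum>m\<in>u \<rightarrow>\<^sub>E {1..\<sigma>}. fact (\<Sum>j\<in>u. m j) powr p * (\<Prod>j\<in>u. a j ^ m j)) \<le> C"
    using sum_fact_powr_bounded[OF a sa p] by blast
  show ?thesis
  proof (intro exI allI)
    fix s
    have "(\<Sum>u\<in>Pow {..<s}. c ^ card u * (\<Sum>m\<in>u \<rightarrow>\<^sub>E {1..\<sigma>}. fdb_term \<sigma> b u m powr p)) \<le>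
      (\<Sum>u\<in>Pow {..<s}. \<Sum>m\<in>u \<rightarrow>\<^sub>E {1..\<sigma>}. fact (\<Sum>j\<in>u. m j) powr p * (\<Prod>j\<in>u. a j ^ m j))"
      unfolding sum_distrib_left
    proof (intro sum_mono)
      fix u m assume u: "u \<in> Pow {..<s}" and m: "m \<in> u \<rightarrow>\<^sub>E {1..\<sigma>}"
      have mj: "1 \<le> m j" "m j \<le> \<sigma>" if "j \<in> u" for j using m that by (auto simp: PiE_iff)
      have "fdb_term \<sigma> b u m powr p = fact (\<Sum>j\<in>u. m j) powr p * (\<Prod>j\<in>u. (b j ^ m j * real (Stirling \<sigma> (m j))) powr p)"
        unfolding fdb_term_def using b
        by (subst powr_mult) (auto intro!: prod_nonneg simp: prod_powr_distrib less_imp_le)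
      also have "(\<Prod>j\<in>u. (b j ^ m j * real (Stirling \<sigma> (m j))) powr p) = (\<Prod>j\<in>u. (b j powr p) ^ m j * real (Stirling \<sigma> (m j)) powr p)"
      proof (rule prod.cong[OF refl])
        fix j
        show "(b j ^ m j * real (Stirling \<sigma> (m j))) powr p = (b j powr p) ^ m j * real (Stirling \<sigma> (m j)) powr p"
          using b[of j] by (subst powr_mult) (auto simp: powr_realpow[symmetric] powr_powr mult.commute less_imp_le)
      qed
      finally have 1: "fdb_term \<sigma> b u m powr p = fact (\<Sum>j\<in>u. m j) powr p * (\<Prod>j\<in>u. (b j powr p) ^ m j * real (Stirling \<sigma> (m j)) powr p)" .
      have "c ^ card u * fdb_term \<sigma> b u m powr p =
          fact (\<Sum>j\<in>u. m j) powr p * (\<Prod>j\<in>u. c * ((b j powr p) ^ m j * real (Stirling \<sigma> (m j)) powr p))"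
        unfolding 1 by (simp add: prod.distrib)
      also have "\<dots> \<le> fact (\<Sum>j\<in>u. m j) powr p * (\<Prod>j\<in>u. a j ^ m j)"
      proof (intro mult_left_mono prod_mono conjI)
        fix j assume j: "j \<in> u"
        show "0 \<le> c * ((b j powr p) ^ m j * real (Stirling \<sigma> (m j)) powr p)" using c by simp
        have "c * ((b j powr p) ^ m j * real (Stirling \<sigma> (m j)) powr p) \<le> c * ((b j powr p) ^ m j * S)"
          using c S[OF mj(2)[OF j]] by (intro mult_left_mono) auto
        also have "\<dots> = (c * S) ^ 1 * (b j powr p) ^ m j" by simp
        also have "\<dots> \<le> (c * S) ^ m j * (b j powr p) ^ m j"
          using cS mj(1)[OF j] by (intro mult_right_mono power_increasing) auto
        also have "\<dots> = a j ^ m j" by (simp add: a_def power_mult_distrib)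
        finally show "c * ((b j powr p) ^ m j * real (Stirling \<sigma> (m j)) powr p) \<le> a j ^ m j" .
      qed simp
      finally show "c ^ card u * fdb_term \<sigma> b u m powr p \<le> fact (\<Sum>j\<in>u. m j) powr p * (\<Prod>j\<in>u. a j ^ m j)" .
    qed
    also have "\<dots> \<le> C" by (rule C)
    finally show "(\<Sum>u\<in>Pow {..<s}. c ^ card u * (\<Sum>m\<in>u \<rightarrow>\<^sub>E {1..\<sigma>}. fdb_term \<sigma> b u m powr p)) \<le> C" .
  qed
qed

section \<open>Domination for both families of weights\<close>

text \<open>All that the remaining proof uses of the weights. The first inequality serves the
  lattice sum, where \<open>max (card u) 1\<close> covers \<open>G0\<close> and \<open>G1\<close> at
  once; the second serves the kernel norm. Both right-hand sides are the same, and their sum over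
  \<open>u\<close> is bounded independently of the dimension.\<close>

definition weight_dominated :: "nat \<Rightarrow> real \<Rightarrow> real \<Rightarrow> (nat \<Rightarrow> real) \<Rightarrow> real \<Rightarrow> real \<Rightarrow> (nat set \<Rightarrow> real) \<Rightarrow> bool" where
  "weight_dominated \<sigma> lam Z b c p \<gamma> \<longleftrightarrow> (\<forall>u. finite u \<longrightarrow> 0 < \<gamma> u \<and>
     real (max (card u) 1) * \<gamma> u powr lam * Z ^ card u \<le> c ^ card u * (\<Sum>m\<in>u \<rightarrow>\<^sub>E {1..\<sigma>}. fdb_term \<sigma> b u m powr p) \<and>
     (\<Sum>m\<in>u \<rightarrow>\<^sub>E {1..\<sigma>}. fdb_term \<sigma> b u m)\<^sup>2 / \<gamma> u \<le> c ^ card u * (\<Sum>m\<in>u \<rightarrow>\<^sub>E {1..\<sigma>}. fdb_term \<sigma> b u m powr p))"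

lemma max_card_le: "real (max (card u) 1) \<le> 2 ^ card u"
proof -
  have "card u < 2 ^ card u" by (rule less_exp)
  moreover have "(1::nat) \<le> 2 ^ card u" by simp
  ultimately have "max (card u) 1 \<le> 2 ^ card u" by simp
  then have "real (max (card u) 1) \<le> real (2 ^ card u)" by (simp only: of_nat_le_iff)
  then show ?thesis by simp
qed

lemma exponents:
  fixes p lam :: real
  assumes p: "0 < p" "p < 1" and lam: "lam = p / (2 - p)"
  shows "0 < lam" "lam \<le> 1" "1 / (1 + lam) = 1 - p / 2" "lam * (1 - p / 2) = p / 2" "2 / (1 + lam) = 2 - p"
    "lam * (2 - p) = p"
proof -
  have q: "0 < 2 - p" using p by simp
  have e: "1 + lam = 2 / (2 - p)" using q by (simp add: lam field_simps)
  have h: "1 - p / 2 = (2 - p) / 2" by simp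
  show "0 < lam" using p q by (simp add: lam)
  show "lam \<le> 1" using p q by (simp add: lam)
  show "1 / (1 + lam) = 1 - p / 2" unfolding e h by simp
  show "lam * (1 - p / 2) = p / 2" unfolding lam h using q by simp
  show "2 / (1 + lam) = 2 - p" unfolding e by simp
  show "lam * (2 - p) = p" unfolding lam using q by simp
qed

lemma PiE_nonempty_Stirling: "1 \<le> \<sigma> \<Longrightarrow> u \<rightarrow>\<^sub>E {1..\<sigma>} \<noteq> ({} :: (nat \<Rightarrow> nat) set)"
  unfolding PiE_eq_empty_iff by auto

text \<open>With \<open>Y\<close> the factor that multiplies \<open>\<gamma> u powr lam\<close>,
  this weight is the one for which \<open>Y * \<gamma> u powr lam\<close> and
  \<open>B\<^sup>2 / \<gamma> u\<close> are equal; both become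
  \<open>Y powr (1 - p / 2) * B powr p\<close>. Subadditivity splits \<open>B powr p\<close> into
  the powers of the single terms, and \<open>max (card u) 1 \<le> 2 ^ card u\<close> is absorbed
  into the power of \<open>3 * Z\<close>.\<close>

lemma weight1_dominated:
  assumes b: "\<And>j. 0 < b j" and p: "0 < p" "p < 1" and lam: "lam = p / (2 - p)" and \<sigma>: "1 \<le> \<sigma>"
    and t: "1 < real \<alpha> * lam"
  defines "Z \<equiv> 2 * zeta_real (real \<alpha> * lam)"
  shows "weight_dominated \<sigma> lam Z b (3 * Z) p (weight1 \<alpha> \<sigma> lam b)"
  unfolding weight_dominated_def
proof (intro allI impI)
  fix u :: "nat set" assume u: "finite u"
  let ?X = "u \<rightarrow>\<^sub>E {1..\<sigma>}"
  note ex = exponents[OF p lam]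
  have Z: "1 \<le> Z" using zeta_ge_1[OF t] by (simp add: Z_def)
  define B where "B = (\<Sum>m\<in>?X. fdb_term \<sigma> b u m)"
  define Y where "Y = real (max (card u) 1) * Z ^ card u"
  have fX: "finite ?X" using u by (intro finite_PiE) auto
  have B: "0 < B" unfolding B_def
    by (intro sum_pos fX PiE_nonempty_Stirling[OF \<sigma>] fdb_term_pos[OF b _ u])
  have Y1: "1 \<le> Y"
    unfolding Y_def using Z mult_mono[of 1 "real (max (card u) 1)" 1 "Z ^ card u"] by simp
  have w: "weight1 \<alpha> \<sigma> lam b u = (B\<^sup>2 / Y) powr (1 - p / 2)"
    unfolding weight1_def ex(3) B_def Y_def Z_def fdb_term_def by simp
  have w2: "weight1 \<alpha> \<sigma> lam b u = B powr (2 - p) / Y powr (1 - p / 2)"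
  proof -
    have B2: "B\<^sup>2 = B powr 2" using B by simp
    have e: "2 * (1 - p / 2) = 2 - p" by simp
    have "(B\<^sup>2 / Y) powr (1 - p / 2) = (B powr 2) powr (1 - p / 2) / Y powr (1 - p / 2)"
      unfolding B2 by (rule powr_divide)
    then show ?thesis unfolding w by (simp only: powr_powr e)
  qed
  have Bp: "B powr p \<le> (\<Sum>m\<in>?X. fdb_term \<sigma> b u m powr p)"
    unfolding B_def by (rule sum_powr_subadd[OF p(1) less_imp_le[OF p(2)] less_imp_le[OF fdb_term_pos[OF b _ u]] fX])
  have Yb: "Y powr (1 - p / 2) \<le> (3 * Z) ^ card u"
  proof -
    have "Y powr (1 - p / 2) \<le> Y powr 1" using Y1 p by (intro powr_mono) auto
    also have "\<dots> = Y" using Y1 by simp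
    also have "\<dots> \<le> 2 ^ card u * Z ^ card u"
      unfolding Y_def using Z by (intro mult_right_mono max_card_le) auto
    also have "\<dots> = (2 * Z) ^ card u" by (simp add: power_mult_distrib)
    also have "\<dots> \<le> (3 * Z) ^ card u" using Z by (intro power_mono) auto
    finally show ?thesis .
  qed
  have main: "Y powr (1 - p / 2) * B powr p \<le> (3 * Z) ^ card u * (\<Sum>m\<in>?X. fdb_term \<sigma> b u m powr p)"
    using Z by (intro mult_mono Yb Bp) auto
  have "real (max (card u) 1) * weight1 \<alpha> \<sigma> lam b u powr lam * Z ^ card u = Y * weight1 \<alpha> \<sigma> lam b u powr lam"
    by (simp add: Y_def)
  also have "\<dots> = Y * (B powr p / Y powr (p / 2))"
    unfolding w2 by (simp only: powr_divide powr_powr mult.commute[of _ lam] ex(4,6))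
  also have "\<dots> = Y powr (1 - p / 2) * B powr p"
    using Y1 by (simp add: powr_diff)
  finally have 1: "real (max (card u) 1) * weight1 \<alpha> \<sigma> lam b u powr lam * Z ^ card u \<le>
     (3 * Z) ^ card u * (\<Sum>m\<in>?X. fdb_term \<sigma> b u m powr p)" using main by linarith
  have "B\<^sup>2 / weight1 \<alpha> \<sigma> lam b u = Y powr (1 - p / 2) * B powr p"
  proof -
    have B2: "B\<^sup>2 = B powr p * B powr (2 - p)" using B by (simp add: powr_add[symmetric])
    show ?thesis unfolding w2 B2 using B Y1 by simp
  qed
  then have 2: "B\<^sup>2 / weight1 \<alpha> \<sigma> lam b u \<le> (3 * Z) ^ card u * (\<Sum>m\<in>?X. fdb_term \<sigma> b u m powr p)"
    using main by simp
  have 3: "0 < weight1 \<alpha> \<sigma> lam b u" unfolding w using B Y1 by simp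
  show "0 < weight1 \<alpha> \<sigma> lam b u \<and>
     real (max (card u) 1) * weight1 \<alpha> \<sigma> lam b u powr lam * Z ^ card u \<le> (3 * Z) ^ card u * (\<Sum>m\<in>?X. fdb_term \<sigma> b u m powr p) \<and>
     (\<Sum>m\<in>?X. fdb_term \<sigma> b u m)\<^sup>2 / weight1 \<alpha> \<sigma> lam b u \<le> (3 * Z) ^ card u * (\<Sum>m\<in>?X. fdb_term \<sigma> b u m powr p)"
    using 1 2 3 unfolding B_def by blast
qed

text \<open>The weight is \<open>Q / \<kappa>\<close> with \<open>Q\<close> the sum of the terms to
  the power \<open>2 - p\<close>. Writing each term as its power \<open>1 - p / 2\<close> times its
  power \<open>p / 2\<close>, Cauchy-Schwarz gives \<open>B\<^sup>2 \<le> Q * R\<close>, and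
  subadditivity gives \<open>Q powr lam \<le> R\<close> because \<open>lam * (2 - p) = p\<close>.
  The constant \<open>exp (1 / exp 1)\<close> is the maximum of \<open>x powr (1 / x)\<close>; the
  estimate only uses that it lies between 1 and 3, which is where the 3 in \<open>3 * Z\<close>
  comes from.\<close>

lemma weight2_dominated:
  assumes b: "\<And>j. 0 < b j" and p: "0 < p" "p < 1" and lam: "lam = p / (2 - p)" and \<sigma>: "1 \<le> \<sigma>"
    and t: "1 < real \<alpha> * lam"
  defines "Z \<equiv> 2 * zeta_real (real \<alpha> * lam)"
  shows "weight_dominated \<sigma> lam Z b (3 * Z) p (weight2 \<alpha> \<sigma> lam b)"
  unfolding weight_dominated_def
proof (intro allI impI)
  fix u :: "nat set" assume u: "finite u"
  let ?X = "u \<rightarrow>\<^sub>E {1..\<sigma>}"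
  let ?t = "fdb_term \<sigma> b u"
  note ex = exponents[OF p lam]
  have Z: "1 \<le> Z" using zeta_ge_1[OF t] by (simp add: Z_def)
  define D where "D = exp (1 / exp 1) * Z"
  have D: "1 \<le> D" "D \<le> 3 * Z"
  proof -
    have "1 / exp (1::real) \<le> 1" by simp
    then have "exp (1 / exp (1::real)) \<le> exp 1" by (simp only: exp_le_cancel_iff)
    also have "\<dots> \<le> (3::real)" by (rule exp_le)
    finally show "D \<le> 3 * Z" unfolding D_def using Z by (intro mult_right_mono) auto
    have "1 \<le> exp (1 / exp (1::real))" by simp
    then show "1 \<le> D" unfolding D_def using mult_mono[of 1 "exp (1 / exp (1::real))" 1 Z] Z by simp
  qed
  define B where "B = (\<Sum>m\<in>?X. ?t m)"
  define Q where "Q = (\<Sum>m\<in>?X. ?t m powr (2 - p))"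
  define R where "R = (\<Sum>m\<in>?X. ?t m powr p)"
  define \<kappa> where "\<kappa> = (D powr (1 - p / 2)) ^ card u"
  have D1: "1 \<le> D powr (1 - p / 2)" using D p by (intro ge_one_powr_ge_zero) auto
  have \<kappa>1: "1 \<le> \<kappa>" unfolding \<kappa>_def using D1 by (rule one_le_power)
  have \<kappa>D: "\<kappa> \<le> (3 * Z) ^ card u"
  proof -
    have "D powr (1 - p / 2) \<le> D powr 1" using D p by (intro powr_mono) auto
    also have "\<dots> \<le> 3 * Z" using D by simp
    finally show ?thesis unfolding \<kappa>_def using D1 by (intro power_mono) auto
  qed
  have fX: "finite ?X" using u by (intro finite_PiE) auto
  have tp: "0 < ?t m" if "m \<in> ?X" for m by (rule fdb_term_pos[OF b that u])
  have Q: "0 < Q" unfolding Q_def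
  proof (intro sum_pos fX PiE_nonempty_Stirling[OF \<sigma>])
    fix m assume "m \<in> ?X"
    from tp[OF this] show "0 < ?t m powr (2 - p)" by simp
  qed
  have R0: "0 \<le> R" unfolding R_def by (intro sum_nonneg) simp
  have w: "weight2 \<alpha> \<sigma> lam b u = Q / \<kappa>"
    unfolding weight2_def Q_def sum_divide_distrib ex(5)
  proof (rule sum.cong[OF refl])
    fix m assume m: "m \<in> ?X"
    have q: "2 * exp (1 / exp 1) * zeta_real (real \<alpha> * lam) = D" by (simp add: D_def Z_def)
    have sD: "sqrt D powr (2 - p) = D powr (1 - p / 2)"
      using D by (simp add: powr_half_sqrt[symmetric] powr_powr diff_divide_distrib)
    have "(\<Prod>j\<in>u. (b j ^ m j * real (Stirling \<sigma> (m j)) / sqrt D) powr (2 - p)) =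
       (\<Prod>j\<in>u. (b j ^ m j * real (Stirling \<sigma> (m j))) powr (2 - p) / D powr (1 - p / 2))"
      using b D by (intro prod.cong refl) (simp add: powr_divide sD less_imp_le)
    also have "\<dots> = (\<Prod>j\<in>u. b j ^ m j * real (Stirling \<sigma> (m j))) powr (2 - p) / \<kappa>"
      using b by (simp add: prod_dividef \<kappa>_def prod_powr_distrib less_imp_le)
    finally show "fact (\<Sum>j\<in>u. m j) powr (2 - p) * (\<Prod>j\<in>u. (b j ^ m j * real (Stirling \<sigma> (m j)) /
        sqrt (2 * exp (1 / exp 1) * zeta_real (real \<alpha> * lam))) powr (2 - p)) = ?t m powr (2 - p) / \<kappa>"
      unfolding q fdb_term_def using b by (subst powr_mult) (auto intro!: prod_nonneg simp: less_imp_le)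
  qed
  have Qlam: "Q powr lam \<le> R"
  proof -
    have "Q powr lam \<le> (\<Sum>m\<in>?X. (?t m powr (2 - p)) powr lam)"
      unfolding Q_def by (intro sum_powr_subadd ex(1,2) fX) simp
    also have "\<dots> = R" unfolding R_def by (simp only: powr_powr mult.commute[of _ lam] ex(6))
    finally show ?thesis .
  qed
  have wl: "weight2 \<alpha> \<sigma> lam b u powr lam \<le> R"
  proof -
    have "weight2 \<alpha> \<sigma> lam b u \<le> Q" unfolding w using Q \<kappa>1 by (simp add: divide_le_eq_1 field_simps)
    moreover have "0 \<le> weight2 \<alpha> \<sigma> lam b u" unfolding w using Q \<kappa>1 by simp
    ultimately have "weight2 \<alpha> \<sigma> lam b u powr lam \<le> Q powr lam" using ex(1) by (intro powr_mono2) auto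
    then show ?thesis using Qlam by (rule order_trans)
  qed
  have 1: "real (max (card u) 1) * weight2 \<alpha> \<sigma> lam b u powr lam * Z ^ card u \<le> (3 * Z) ^ card u * R"
  proof -
    have "real (max (card u) 1) * weight2 \<alpha> \<sigma> lam b u powr lam * Z ^ card u \<le> 2 ^ card u * R * Z ^ card u"
      using Z by (intro mult_right_mono mult_mono max_card_le wl) auto
    also have "\<dots> = (2 * Z) ^ card u * R" by (simp add: power_mult_distrib)
    also have "\<dots> \<le> (3 * Z) ^ card u * R" using Z R0 by (intro mult_right_mono power_mono) auto
    finally show ?thesis .
  qed
  have BQR: "B\<^sup>2 \<le> Q * R"
  proof -
    have "B = (\<Sum>m\<in>?X. ?t m powr (1 - p / 2) * ?t m powr (p / 2))"
      unfolding B_def by (intro sum.cong refl) (use tp in \<open>simp add: powr_add[symmetric] less_imp_le\<close>)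
    then have "B\<^sup>2 \<le> (\<Sum>m\<in>?X. (?t m powr (1 - p / 2))\<^sup>2) * (\<Sum>m\<in>?X. (?t m powr (p / 2))\<^sup>2)"
      by (simp only: Cauchy_Schwarz_ineq_sum)
    also have "\<dots> = Q * R"
    proof -
      have "(x powr y)\<^sup>2 = x powr (2 * y)" for x y :: real
        by (simp add: power2_eq_square powr_add[symmetric])
      moreover have "2 * (1 - p / 2) = 2 - p" "2 * (p / 2) = p" by simp_all
      ultimately show ?thesis unfolding Q_def R_def by (simp only:)
    qed
    finally show ?thesis .
  qed
  have 2: "B\<^sup>2 / weight2 \<alpha> \<sigma> lam b u \<le> (3 * Z) ^ card u * R"
  proof -
    have "B\<^sup>2 / weight2 \<alpha> \<sigma> lam b u = \<kappa> * (B\<^sup>2 / Q)" unfolding w by simp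
    also have "\<dots> \<le> \<kappa> * R" using BQR Q \<kappa>1 by (intro mult_left_mono) (simp_all add: divide_le_eq mult.commute)
    also have "\<dots> \<le> (3 * Z) ^ card u * R" by (rule mult_right_mono[OF \<kappa>D R0])
    finally show ?thesis .
  qed
  have 3: "0 < weight2 \<alpha> \<sigma> lam b u" unfolding w using Q \<kappa>1 by simp
  show "0 < weight2 \<alpha> \<sigma> lam b u \<and>
     real (max (card u) 1) * weight2 \<alpha> \<sigma> lam b u powr lam * Z ^ card u \<le> (3 * Z) ^ card u * (\<Sum>m\<in>?X. ?t m powr p) \<and>
     (\<Sum>m\<in>?X. ?t m)\<^sup>2 / weight2 \<alpha> \<sigma> lam b u \<le> (3 * Z) ^ card u * (\<Sum>m\<in>?X. ?t m powr p)"
    using 1 2 3 unfolding B_def R_def by blast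
qed

section \<open>Smooth functions\<close>

lemma partial_derivI:
  assumes "(f has_derivative f') (at x)"
  shows "partial_deriv i f x = f' (axis i 1)"
  unfolding partial_deriv_def using frechet_derivative_at[OF assms] by simp

lemma has_derivative_differentiable:
  "f differentiable (at x) \<Longrightarrow> (f has_derivative frechet_derivative f (at x)) (at x)"
  by (simp add: frechet_derivative_works)

lemma partial_deriv_add:
  assumes "f differentiable (at x)" "g differentiable (at x)"
  shows "partial_deriv i (\<lambda>x. f x + g x) x = partial_deriv i f x + partial_deriv i g x"
  using partial_derivI[OF has_derivative_add[OF assms[THEN has_derivative_differentiable]]]
  by (simp add: partial_deriv_def)

lemma partial_deriv_mult:
  fixes f g :: "real^'d \<Rightarrow> real"
  assumes "f differentiable (at x)" "g differentiable (at x)"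
  shows "partial_deriv i (\<lambda>x. f x * g x) x = f x * partial_deriv i g x + partial_deriv i f x * g x"
  using partial_derivI[OF has_derivative_mult[OF assms[THEN has_derivative_differentiable]]]
  by (simp add: partial_deriv_def)

lemma partial_deriv_compose:
  fixes f :: "real^'d \<Rightarrow> real"
  assumes "f differentiable (at x)" "(g has_real_derivative g') (at (f x))"
  shows "(\<lambda>x. g (f x)) differentiable (at x)" "partial_deriv i (\<lambda>x. g (f x)) x = g' * partial_deriv i f x"
proof -
  have "((\<lambda>x. g (f x)) has_derivative (\<lambda>h. g' * frechet_derivative f (at x) h)) (at x)"
    using has_derivative_compose[OF has_derivative_differentiable[OF assms(1)] assms(2)[unfolded has_field_derivative_def]] .
  then show "(\<lambda>x. g (f x)) differentiable (at x)" "partial_deriv i (\<lambda>x. g (f x)) x = g' * partial_deriv i f x"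
    using partial_derivI by (auto simp: differentiable_def partial_deriv_def)
qed

lemma C_k_Suc_imp: "C_k (Suc k) f \<Longrightarrow> C_k k f"
proof (induction k arbitrary: f)
  case 0
  then have "f differentiable (at x)" for x by simp
  then have "isCont f x" for x by (rule differentiable_imp_continuous_within)
  then show ?case by (simp add: continuous_on_eq_continuous_at)
next
  case (Suc k)
  show ?case unfolding C_k.simps(2)
  proof (intro conjI allI)
    show "f differentiable (at x)" for x using Suc.prems by simp
    fix i
    have "C_k (Suc k) (partial_deriv i f)" using Suc.prems unfolding C_k.simps(2)[of "Suc k"] by blast
    then show "C_k k (partial_deriv i f)" by (rule Suc.IH)
  qed
qed

lemma C_k_0_continuous: "C_k k f \<Longrightarrow> continuous_on UNIV f"
proof (induction k)
  case (Suc k)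
  then show ?case using C_k_Suc_imp by blast
qed simp

lemma C_k_const: "C_k k (\<lambda>_::real^'d. c)"
proof (induction k arbitrary: c)
  case (Suc k)
  have "partial_deriv i (\<lambda>_. c) = (\<lambda>_. 0)" for i :: 'd
    by (rule ext, rule partial_derivI[OF has_derivative_const])
  then show ?case using Suc by simp
qed simp

lemma C_k_nth: "C_k k (\<lambda>x::real^'d. x $ i)"
proof (cases k)
  case 0
  then show ?thesis by (auto intro!: continuous_intros)
next
  case (Suc k')
  have d: "((\<lambda>x. x $ i) has_derivative (\<lambda>h. h $ i)) (at x)" for x :: "real^'d"
    by (rule bounded_linear_imp_has_derivative[OF bounded_linear_vec_nth])
  have "partial_deriv j (\<lambda>x. x $ i) = (\<lambda>_. axis j 1 $ i)" for j :: 'd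
    by (rule ext, rule partial_derivI[OF d])
  moreover have "(\<lambda>x. x $ i) differentiable (at x)" for x :: "real^'d"
    using d differentiable_def by blast
  ultimately show ?thesis by (simp add: Suc C_k_const)
qed

lemma C_k_add: "C_k k f \<Longrightarrow> C_k k g \<Longrightarrow> C_k k (\<lambda>x. f x + g x)"
proof (induction k arbitrary: f g)
  case 0
  then show ?case by (auto intro: continuous_on_add)
next
  case (Suc k)
  have d: "f differentiable (at x)" "g differentiable (at x)" for x using Suc.prems by auto
  have "partial_deriv i (\<lambda>x. f x + g x) = (\<lambda>x. partial_deriv i f x + partial_deriv i g x)" for i
    by (rule ext, rule partial_deriv_add[OF d])
  then show ?case using Suc d by (auto intro: differentiable_add)
qed

lemma C_k_mult: "C_k k f \<Longrightarrow> C_k k g \<Longrightarrow> C_k k (\<lambda>x. f x * g x)"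
proof (induction k arbitrary: f g)
  case 0
  then show ?case by (auto intro: continuous_on_mult)
next
  case (Suc k)
  have d: "f differentiable (at x)" "g differentiable (at x)" for x using Suc.prems by auto
  have e: "partial_deriv i (\<lambda>x. f x * g x) = (\<lambda>x. f x * partial_deriv i g x + partial_deriv i f x * g x)" for i
    by (rule ext, rule partial_deriv_mult[OF d])
  have f: "C_k k f" "C_k k g" using Suc.prems by (auto intro: C_k_Suc_imp)
  have "C_k k (partial_deriv i f)" "C_k k (partial_deriv i g)" for i using Suc.prems by auto
  then have "C_k k (\<lambda>x. f x * partial_deriv i g x + partial_deriv i f x * g x)" for i
    by (intro C_k_add Suc.IH f)
  then show ?case using d by (simp add: e differentiable_mult)
qed

lemma C_k_prod: "(\<And>a. a \<in> A \<Longrightarrow> C_k k (f a)) \<Longrightarrow> C_k k (\<lambda>x. \<Prod>a\<in>A. f a x)"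
  by (induction A rule: infinite_finite_induct) (auto intro: C_k_const C_k_mult)

text \<open>The hypothesis provides a whole chain of successive derivatives, because the chain rule
  leads from \<open>G n\<close> to \<open>G (Suc n)\<close> and the induction must cover all of them
  at once.\<close>

lemma C_k_compose:
  fixes G :: "nat \<Rightarrow> real \<Rightarrow> real"
  assumes G: "\<And>n t. (G n has_real_derivative G (Suc n) t) (at t)" and f: "\<And>k. C_k k f"
  shows "C_k k (\<lambda>x. G n (f x))"
proof (induction k arbitrary: n)
  case 0
  have "continuous_on UNIV (G n)" using G by (meson DERIV_isCont continuous_at_imp_continuous_on)
  then show ?case using f[of 0] by (auto intro: continuous_on_compose2)
next
  case (Suc k)
  have d: "f differentiable (at x)" for x using f[of 1] by simp
  have e: "partial_deriv i (\<lambda>x. G n (f x)) = (\<lambda>x. G (Suc n) (f x) * partial_deriv i f x)" for i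
    by (rule ext, rule partial_deriv_compose(2)[OF d G])
  have "C_k k (partial_deriv i f)" for i using f[of "Suc k"] by simp
  then have "C_k k (\<lambda>x. G (Suc n) (f x) * partial_deriv i f x)" for i
    by (intro C_k_mult Suc.IH)
  then show ?case using partial_deriv_compose(1)[OF d G] by (simp add: e)
qed

text \<open>The derivatives of \<open>exp (- 1 / t)\<close> on the positive reals are polynomials in \<open>1 / t\<close> times
  \<open>exp (- 1 / t)\<close>.\<close>

primrec flat_poly :: "nat \<Rightarrow> real poly" where
  "flat_poly 0 = 1"
| "flat_poly (Suc n) = [:0, 0, 1:] * (flat_poly n - pderiv (flat_poly n))"

definition flat :: "nat \<Rightarrow> real \<Rightarrow> real" where
  "flat n t = (if 0 < t then poly (flat_poly n) (1 / t) * exp (- (1 / t)) else 0)"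

lemma tendsto_poly_exp: "((\<lambda>s. poly q s * exp (- s)) \<longlongrightarrow> (0::real)) at_top"
proof -
  have "((\<lambda>s. \<Sum>i\<le>degree q. coeff q i * (s ^ i / exp s)) \<longlongrightarrow> (\<Sum>i\<le>degree q. coeff q i * 0)) at_top"
    by (intro tendsto_sum tendsto_mult tendsto_const tendsto_power_div_exp_0)
  then show ?thesis
    by (simp add: poly_altdef sum_distrib_right exp_minus divide_inverse mult.assoc)
qed

text \<open>Away from 0 this is the product rule. At 0 the right-hand difference quotient is again a
  polynomial in \<open>1 / h\<close> times \<open>exp (- 1 / h)\<close>, hence tends to 0, and the
  left-hand one vanishes.\<close>

lemma flat_deriv: "(flat n has_real_derivative flat (Suc n) t) (at t)"
proof -
  let ?q = "flat_poly n"
  consider "0 < t" | "t < 0" | "t = 0" by linarith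
  then show ?thesis
  proof cases
    case 1
    have "((\<lambda>t. poly ?q (1 / t) * exp (- (1 / t))) has_real_derivative
       poly (pderiv ?q) (1 / t) * (- (1 / t\<^sup>2)) * exp (- (1 / t)) + exp (- (1 / t)) * (1 / t\<^sup>2) * poly ?q (1 / t)) (at t)"
      using 1 by (auto intro!: derivative_eq_intros DERIV_chain2[OF poly_DERIV] simp: power2_eq_square field_simps)
    also have "poly (pderiv ?q) (1 / t) * (- (1 / t\<^sup>2)) * exp (- (1 / t)) + exp (- (1 / t)) * (1 / t\<^sup>2) * poly ?q (1 / t) = flat (Suc n) t"
      using 1 by (simp add: flat_def power2_eq_square field_simps)
    finally show ?thesis
    proof (rule has_field_derivative_transform_within_open[where S = "{0<..}"])
      show "poly ?q (1 / x) * exp (- (1 / x)) = flat n x" if "x \<in> {0<..}" for x using that by (simp add: flat_def)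
    qed (use 1 in auto)
  next
    case 2
    have "((\<lambda>t. 0) has_real_derivative 0) (at t)" by (rule DERIV_const)
    then have "(flat n has_real_derivative 0) (at t)"
    proof (rule has_field_derivative_transform_within_open[where S = "{..<0}"])
      show "0 = flat n x" if "x \<in> {..<0}" for x using that by (simp add: flat_def)
    qed (use 2 in auto)
    then show ?thesis using 2 by (simp add: flat_def)
  next
    case 3
    have r: "((\<lambda>h. flat n h / h) \<longlongrightarrow> 0) (at_right 0)"
    proof -
      have "((\<lambda>h. poly ([:0, 1:] * ?q) (inverse h) * exp (- inverse h)) \<longlongrightarrow> 0) (at_right 0)"
        by (rule filterlim_compose[OF tendsto_poly_exp filterlim_inverse_at_top_right])
      then show ?thesis
      proof (rule Lim_transform_eventually)
        show "eventually (\<lambda>h. poly ([:0, 1:] * ?q) (inverse h) * exp (- inverse h) = flat n h / h) (at_right 0)"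
          unfolding eventually_at_right_field by (intro exI[of _ 1]) (simp add: flat_def divide_inverse)
      qed
    qed
    have l: "((\<lambda>h. flat n h / h) \<longlongrightarrow> 0) (at_left 0)"
    proof (rule Lim_transform_eventually[OF tendsto_const])
      show "eventually (\<lambda>h. 0 = flat n h / h) (at_left 0)"
        unfolding eventually_at_left_field by (intro exI[of _ "-1"]) (simp add: flat_def)
    qed
    have "((\<lambda>h. flat n h / h) \<longlongrightarrow> 0) (at 0)" using l r by (simp add: filterlim_split_at_real)
    then have "(flat n has_real_derivative 0) (at 0)" by (simp add: DERIV_def flat_def)
    then show ?thesis using 3 by (simp add: flat_def)
  qed
qed

lemma flat_0_bounds: "0 \<le> flat 0 t" "flat 0 t \<le> 1" "t \<le> 0 \<Longrightarrow> flat 0 t = 0"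
  by (simp_all add: flat_def)

lemma C_k_affine_flat:
  fixes i :: "'d::finite"
  shows "C_k k (\<lambda>x::real^'d. flat 0 (c * x $ i + e))"
  by (rule C_k_compose[where G = flat], rule flat_deriv) (intro C_k_add C_k_mult C_k_const C_k_nth)

text \<open>Smooth functions supported in the open box and increasing to its indicator function.\<close>

definition box_bump :: "real^'d \<Rightarrow> real^'d \<Rightarrow> nat \<Rightarrow> real^'d \<Rightarrow> real" where
  "box_bump a b n x = (\<Prod>i\<in>UNIV. flat 0 (real n * x $ i + (- real n * a $ i - 1)) * flat 0 (- real n * x $ i + (real n * b $ i - 1)))"

lemma C_k_box_bump: "C_k k (box_bump a b n)"
  unfolding box_bump_def by (intro C_k_prod C_k_mult C_k_affine_flat)

lemma box_bump_bounds: "0 \<le> box_bump a b n x" "box_bump a b n x \<le> 1"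
  unfolding box_bump_def by (auto intro!: prod_nonneg prod_le_1 mult_le_one mult_nonneg_nonneg flat_0_bounds)

text \<open>The summand -1 in the arguments of \<open>flat\<close> keeps a distance
  \<open>1 / n\<close> from the faces of the box, so that the closure of the support stays inside
  the open box.\<close>

lemma box_bump_support:
  assumes n: "0 < n"
  shows "{x. box_bump a b n x \<noteq> 0} \<subseteq> cbox (\<chi> i. a $ i + 1 / real n) (\<chi> i. b $ i - 1 / real n)"
proof
  fix x assume "x \<in> {x. box_bump a b n x \<noteq> 0}"
  then have "flat 0 (real n * x $ i + (- real n * a $ i - 1)) \<noteq> 0" "flat 0 (- real n * x $ i + (real n * b $ i - 1)) \<noteq> 0" for i
    unfolding box_bump_def by auto
  then have "0 < real n * x $ i + (- real n * a $ i - 1)" "0 < - real n * x $ i + (real n * b $ i - 1)" for i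
    using flat_0_bounds(3) by (metis not_le)+
  then have "a $ i + 1 / real n \<le> x $ i" "x $ i \<le> b $ i - 1 / real n" for i
    using n by (simp_all add: field_simps less_imp_le)
  then show "x \<in> cbox (\<chi> i. a $ i + 1 / real n) (\<chi> i. b $ i - 1 / real n)" by (simp add: mem_box_cart)
qed

lemma test_function_box_bump:
  assumes D: "box a b \<subseteq> D" and n: "0 < n"
  shows "test_function D (box_bump a b n)"
proof -
  let ?K = "cbox (\<chi> i. a $ i + 1 / real n) (\<chi> i. b $ i - 1 / real n)"
  have sub: "closure {x. box_bump a b n x \<noteq> 0} \<subseteq> ?K"
    by (rule closure_minimal[OF box_bump_support[OF n] closed_cbox])
  have "?K \<subseteq> box a b"
  proof
    fix x assume "x \<in> ?K"
    then have "a $ i + 1 / real n \<le> x $ i" "x $ i \<le> b $ i - 1 / real n" for i by (simp_all add: mem_box_cart)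
    moreover have "0 < 1 / real n" using n by simp
    ultimately have "a $ i < x $ i \<and> x $ i < b $ i" for i by (smt (verit))
    then show "x \<in> box a b" by (simp add: mem_box_cart)
  qed
  moreover have "compact (closure {x. box_bump a b n x \<noteq> 0})"
    using compact_Int_closed[OF compact_cbox closed_closure, of "\<chi> i. a $ i + 1 / real n" "\<chi> i. b $ i - 1 / real n" "{x. box_bump a b n x \<noteq> 0}"] sub
    by (simp add: Int_absorb1)
  ultimately show ?thesis
    unfolding test_function_def using sub D C_k_box_bump by blast
qed

lemma tendsto_box_bump:
  fixes x :: "real^'d"
  shows "(\<lambda>n. box_bump a b n x) \<longlonglongrightarrow> indicator (box a b) x"
proof (cases "x \<in> box a b")
  case True
  have f: "(\<lambda>n. flat 0 (real n * c - 1)) \<longlonglongrightarrow> 1" if c: "0 < c" for c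
  proof -
    have top: "filterlim (\<lambda>n. real n * c - 1) at_top sequentially"
      using c by real_asymp
    have "(\<lambda>n. exp (- (1 / (real n * c - 1)))) \<longlonglongrightarrow> exp (- 0)"
      by (intro tendsto_exp tendsto_minus tendsto_divide_0[OF tendsto_const] filterlim_at_top_imp_at_infinity top)
    moreover have "eventually (\<lambda>n. 0 < real n * c - 1) sequentially"
      using top unfolding filterlim_at_top_dense by blast
    then have "eventually (\<lambda>n. exp (- (1 / (real n * c - 1))) = flat 0 (real n * c - 1)) sequentially"
      by eventually_elim (simp add: flat_def)
    ultimately show ?thesis using Lim_transform_eventually by fastforce
  qed
  have "(\<lambda>n. box_bump a b n x) \<longlonglongrightarrow> (\<Prod>i\<in>(UNIV::'d set). 1 * 1)"
    unfolding box_bump_def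
  proof (intro tendsto_prod tendsto_mult)
    fix i
    have "0 < x $ i - a $ i" "0 < b $ i - x $ i" using True by (auto simp: mem_box_cart)
    from f[OF this(1)] f[OF this(2)]
    show "(\<lambda>n. flat 0 (real n * x $ i + (- real n * a $ i - 1))) \<longlonglongrightarrow> 1"
      "(\<lambda>n. flat 0 (- real n * x $ i + (real n * b $ i - 1))) \<longlonglongrightarrow> 1"
      by (simp_all add: algebra_simps)
  qed
  then show ?thesis using True by simp
next
  case False
  then obtain i where i: "x $ i \<le> a $ i \<or> b $ i \<le> x $ i" by (auto simp: mem_box_cart not_less)
  have "box_bump a b n x = 0" for n
  proof -
    have "real n * x $ i \<le> real n * a $ i \<or> real n * b $ i \<le> real n * x $ i"
      using i by (auto intro: mult_left_mono)
    then have "flat 0 (real n * x $ i + (- real n * a $ i - 1)) * flat 0 (- real n * x $ i + (real n * b $ i - 1)) = 0"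
      using flat_0_bounds(3)[of "real n * x $ i + (- real n * a $ i - 1)"] flat_0_bounds(3)[of "- real n * x $ i + (real n * b $ i - 1)"]
      by auto
    then show ?thesis unfolding box_bump_def by (intro prod_zero) auto
  qed
  then show ?thesis using False by simp
qed

section \<open>Square integrable functions and weak gradients\<close>

lemma
  fixes f g :: "'a \<Rightarrow> 'b::euclidean_space"
  assumes f: "f \<in> borel_measurable M" "integrable M (\<lambda>x. (norm (f x))\<^sup>2)"
    and g: "g \<in> borel_measurable M" "integrable M (\<lambda>x. (norm (g x))\<^sup>2)"
  shows integrable_inner_L2: "integrable M (\<lambda>x. f x \<bullet> g x)"
    and integrable_norm_mult_L2: "integrable M (\<lambda>x. norm (f x) * norm (g x))"
    and integrable_add_L2: "integrable M (\<lambda>x. (norm (f x + g x))\<^sup>2)"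
proof -
  note [measurable] = f(1) g(1)
  have int: "integrable M (\<lambda>x. (norm (f x))\<^sup>2 + (norm (g x))\<^sup>2)" by (intro Bochner_Integration.integrable_add f g)
  have b: "norm u * norm v \<le> (norm u)\<^sup>2 + (norm v)\<^sup>2" for u v :: 'b
    using sum_squares_bound[of "norm u" "norm v"] mult_nonneg_nonneg[OF norm_ge_zero[of u] norm_ge_zero[of v]] by linarith
  show i1: "integrable M (\<lambda>x. norm (f x) * norm (g x))"
    by (rule Bochner_Integration.integrable_bound[OF int]) (use b in auto)
  show i2: "integrable M (\<lambda>x. f x \<bullet> g x)"
  proof (rule Bochner_Integration.integrable_bound[OF i1])
    show "AE x in M. norm (f x \<bullet> g x) \<le> norm (norm (f x) * norm (g x))"
      by (intro AE_I2) (simp add: Cauchy_Schwarz_ineq2)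
  qed auto
  have "integrable M (\<lambda>x. ((norm (f x))\<^sup>2 + (norm (g x))\<^sup>2) + 2 * (f x \<bullet> g x))"
    by (intro Bochner_Integration.integrable_add int integrable_mult_right i2)
  then show "integrable M (\<lambda>x. (norm (f x + g x))\<^sup>2)"
    by (simp add: dot_norm field_simps)
qed

lemma L2_inner_le:
  fixes f g :: "real^'d \<Rightarrow> 'b::euclidean_space"
  assumes f: "f \<in> L2_on D" and g: "g \<in> L2_on D"
  shows "(\<integral>x. norm (f x) * norm (g x) \<partial>lebesgue_on D) \<le> L2_norm_on D f * L2_norm_on D g"
    and "\<bar>\<integral>x. f x \<bullet> g x \<partial>lebesgue_on D\<bar> \<le> L2_norm_on D f * L2_norm_on D g"
proof -
  let ?M = "lebesgue_on D"
  have f': "f \<in> borel_measurable ?M" "integrable ?M (\<lambda>x. (norm (f x))\<^sup>2)"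
    and g': "g \<in> borel_measurable ?M" "integrable ?M (\<lambda>x. (norm (g x))\<^sup>2)"
    using f g by (auto simp: L2_on_def)
  define a where "a = (\<integral>x. (norm (f x))\<^sup>2 \<partial>?M)"
  define b where "b = (\<integral>x. norm (f x) * norm (g x) \<partial>?M)"
  define c where "c = (\<integral>x. (norm (g x))\<^sup>2 \<partial>?M)"
  note i = integrable_norm_mult_L2[OF f' g']
  have a0: "0 \<le> a" and c0: "0 \<le> c" and b0: "0 \<le> b" by (simp_all add: a_def b_def c_def)
  have q: "0 \<le> a - 2 * t * b + t\<^sup>2 * c" for t
  proof -
    have "0 \<le> (\<integral>x. (norm (f x) - t * norm (g x))\<^sup>2 \<partial>?M)" by simp
    also have "\<dots> = (\<integral>x. (norm (f x))\<^sup>2 - (2 * t) * (norm (f x) * norm (g x)) + t\<^sup>2 * (norm (g x))\<^sup>2 \<partial>?M)"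
      by (intro Bochner_Integration.integral_cong refl) (simp add: power2_eq_square algebra_simps)
    also have "\<dots> = a - 2 * t * b + t\<^sup>2 * c"
      using i f'(2) g'(2) by (simp add: a_def b_def c_def)
    finally show ?thesis .
  qed
  have "b\<^sup>2 \<le> a * c"
  proof (cases "c = 0")
    case True
    have "b = 0"
    proof (rule ccontr)
      assume "b \<noteq> 0"
      \<comment> \<open>For \<open>c = 0\<close> the polynomial is affine in \<open>t\<close>; at
        this \<open>t\<close> it would take the value -1.\<close>
      then show False using q[of "(a + 1) / (2 * b)"] True by simp
    qed
    then show ?thesis using True by simp
  next
    case False
    then have "c > 0" using c0 by simp
    then show ?thesis using q[of "b / c"] by (simp add: power2_eq_square field_simps)
  qed
  then have "b \<le> sqrt (a * c)" by (rule real_le_rsqrt)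
  then show 1: "(\<integral>x. norm (f x) * norm (g x) \<partial>?M) \<le> L2_norm_on D f * L2_norm_on D g"
    by (simp add: L2_norm_on_def a_def b_def c_def real_sqrt_mult)
  have "\<bar>\<integral>x. f x \<bullet> g x \<partial>?M\<bar> \<le> (\<integral>x. \<bar>f x \<bullet> g x\<bar> \<partial>?M)"
    using integral_norm_bound[of ?M "\<lambda>x. f x \<bullet> g x"] by simp
  also have "\<dots> \<le> (\<integral>x. norm (f x) * norm (g x) \<partial>?M)"
    by (rule integral_mono[OF _ i]) (use integrable_inner_L2[OF f' g'] in \<open>auto intro: Cauchy_Schwarz_ineq2\<close>)
  finally show "\<bar>\<integral>x. f x \<bullet> g x \<partial>?M\<bar> \<le> L2_norm_on D f * L2_norm_on D g" using 1 by linarith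
qed

lemma L2_add: "f \<in> L2_on D \<Longrightarrow> g \<in> L2_on D \<Longrightarrow> (\<lambda>x. f x + g x) \<in> L2_on D"
  unfolding L2_on_def using integrable_add_L2 by (auto intro: borel_measurable_add)

lemma L2_scale:
  assumes "f \<in> L2_on D" shows "(\<lambda>x. c *\<^sub>R f x) \<in> L2_on D"
  using assms unfolding L2_on_def by (auto simp: power_mult_distrib)

lemma L2_diff: "f \<in> L2_on D \<Longrightarrow> g \<in> L2_on D \<Longrightarrow> (\<lambda>x. f x - g x) \<in> L2_on D"
  using L2_add[OF _ L2_scale[of g D "-1"], of f] by simp

lemma L2_norm_nonneg: "0 \<le> L2_norm_on D f" by (simp add: L2_norm_on_def)

lemma L2_norm_sq: "(L2_norm_on D f)\<^sup>2 = (\<integral>x. (norm (f x))\<^sup>2 \<partial>lebesgue_on D)"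
  by (simp add: L2_norm_on_def)

lemma L2_triangle:
  assumes f: "f \<in> L2_on D" and g: "g \<in> L2_on D"
  shows "L2_norm_on D (\<lambda>x. f x + g x) \<le> L2_norm_on D f + L2_norm_on D g"
proof -
  have f': "f \<in> borel_measurable (lebesgue_on D)" "integrable (lebesgue_on D) (\<lambda>x. (norm (f x))\<^sup>2)"
    and g': "g \<in> borel_measurable (lebesgue_on D)" "integrable (lebesgue_on D) (\<lambda>x. (norm (g x))\<^sup>2)"
    using f g by (auto simp: L2_on_def)
  have "(L2_norm_on D (\<lambda>x. f x + g x))\<^sup>2 = (\<integral>x. (norm (f x))\<^sup>2 + (norm (g x))\<^sup>2 + 2 * (f x \<bullet> g x) \<partial>lebesgue_on D)"
    unfolding L2_norm_sq by (intro Bochner_Integration.integral_cong refl) (simp add: dot_norm field_simps)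
  also have "\<dots> = (L2_norm_on D f)\<^sup>2 + (L2_norm_on D g)\<^sup>2 + 2 * (\<integral>x. f x \<bullet> g x \<partial>lebesgue_on D)"
    using f'(2) g'(2) integrable_inner_L2[OF f' g'] by (simp add: L2_norm_sq)
  also have "\<dots> \<le> (L2_norm_on D f + L2_norm_on D g)\<^sup>2"
    using L2_inner_le(2)[OF f g] by (simp add: power2_sum)
  finally show ?thesis by (rule power2_le_imp_le) (simp add: L2_norm_nonneg)
qed

lemma L2_norm_scale: "L2_norm_on D (\<lambda>x. c *\<^sub>R f x) = \<bar>c\<bar> * L2_norm_on D f"
  by (simp add: L2_norm_on_def power_mult_distrib real_sqrt_mult)

lemma L2_norm_cong_AE:
  fixes f g :: "real^'d \<Rightarrow> 'b::euclidean_space"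
  assumes "AE x in lebesgue_on D. f x = g x" "f \<in> borel_measurable (lebesgue_on D)" "g \<in> borel_measurable (lebesgue_on D)"
  shows "L2_norm_on D f = L2_norm_on D g"
  unfolding L2_norm_on_def
  by (intro arg_cong[where f = sqrt] integral_cong_AE) (use assms in auto)

section \<open>Test functions on a bounded open set\<close>

locale bounded_domain =
  fixes D :: "(real^'d) set"
  assumes open_D: "open D" and bounded_D: "bounded D" and D_ne: "D \<noteq> {}"
begin

abbreviation "MD \<equiv> lebesgue_on D"

lemma D_sets: "D \<in> sets lebesgue" using open_D by (simp add: borel_open)

lemma finite_measure_D: "finite_measure MD"
proof (rule finite_measureI)
  have "D \<in> lmeasurable" by (rule lmeasurable_open[OF bounded_D open_D])
  then show "emeasure MD (space MD) \<noteq> \<infinity>"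
    using D_sets by (simp add: space_restrict_space emeasure_restrict_space fmeasurable_def)
qed

lemma continuous_measurable_D: "continuous_on UNIV f \<Longrightarrow> (f :: real^'d \<Rightarrow> 'b::euclidean_space) \<in> borel_measurable MD"
  by (rule measurable_restrict_space1, rule measurable_completion) (simp add: borel_measurable_continuous_onI)

lemma test_function_bounded:
  assumes "test_function D \<phi>"
  shows "\<exists>B. \<forall>x. \<bar>\<phi> x\<bar> \<le> B"
proof -
  let ?K = "closure {x. \<phi> x \<noteq> 0}"
  have c: "continuous_on ?K \<phi>" using assms C_k_0_continuous[of 0 \<phi>] unfolding test_function_def
    by (meson continuous_on_subset subset_UNIV)
  have "bounded (\<phi> ` ?K)"
    using compact_continuous_image[OF c] assms by (auto simp: test_function_def compact_imp_bounded)
  then obtain B where B: "\<And>x. x \<in> ?K \<Longrightarrow> \<bar>\<phi> x\<bar> \<le> B" by (auto simp: bounded_iff)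
  have "\<bar>\<phi> x\<bar> \<le> max B 0" for x
  proof (cases "\<phi> x = 0")
    case False
    then have "x \<in> ?K" using closure_subset by fastforce
    then show ?thesis using B by fastforce
  qed simp
  then show ?thesis by blast
qed

lemma test_function_continuous: "test_function D \<phi> \<Longrightarrow> continuous_on UNIV \<phi>"
  using C_k_0_continuous[of 0] unfolding test_function_def by blast

lemma test_function_L2:
  assumes "test_function D \<phi>" shows "\<phi> \<in> L2_on D"
proof -
  interpret finite_measure MD by (rule finite_measure_D)
  obtain B where B: "\<And>x. \<bar>\<phi> x\<bar> \<le> B" using test_function_bounded[OF assms] by blast
  have [measurable]: "\<phi> \<in> borel_measurable MD"
    by (rule continuous_measurable_D[OF test_function_continuous[OF assms]])
  have "\<bar>\<phi> x\<bar>\<^sup>2 \<le> B\<^sup>2" for x by (rule power_mono[OF B]) simp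
  then have "integrable MD (\<lambda>x. (norm (\<phi> x))\<^sup>2)"
    by (intro integrable_const_bound[where B = "B\<^sup>2"]) auto
  then show ?thesis by (simp add: L2_on_def)
qed

lemma test_function_differentiable: "test_function D \<phi> \<Longrightarrow> \<phi> differentiable (at x)"
proof -
  assume "test_function D \<phi>"
  then have "C_k (Suc 0) \<phi>" unfolding test_function_def by blast
  then show ?thesis by simp
qed

lemma partial_deriv_outside_support:
  fixes f :: "real^'d \<Rightarrow> real"
  assumes "x \<notin> closure {x. f x \<noteq> 0}"
  shows "partial_deriv i f x = 0"
proof -
  have "((\<lambda>_. 0) has_derivative (\<lambda>_. 0)) (at x)" by simp
  then have "(f has_derivative (\<lambda>_. 0)) (at x)"
  proof (rule has_derivative_transform_within_open[where s = "- closure {x. f x \<noteq> 0}"])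
    fix y assume "y \<in> - closure {x. f x \<noteq> 0}"
    then have "y \<notin> {x. f x \<noteq> 0}" using closure_subset[of "{x. f x \<noteq> 0}"] by blast
    then show "0 = f y" by simp
  qed (simp_all add: assms open_Compl)
  then show ?thesis by (rule partial_derivI)
qed

lemma test_function_subset:
  assumes "test_function D \<phi>" "\<And>k. C_k k \<psi>" "\<And>x. x \<notin> closure {x. \<phi> x \<noteq> 0} \<Longrightarrow> \<psi> x = 0"
  shows "test_function D \<psi>"
proof -
  have sub: "closure {x. \<psi> x \<noteq> 0} \<subseteq> closure {x. \<phi> x \<noteq> 0}"
    by (rule closure_minimal) (use assms(3) in auto)
  then have "compact (closure {x. \<psi> x \<noteq> 0})"
    using assms(1) compact_Int_closed[of "closure {x. \<phi> x \<noteq> 0}" "closure {x. \<psi> x \<noteq> 0}"]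
    by (simp add: test_function_def Int_absorb1)
  then show ?thesis using sub assms unfolding test_function_def by blast
qed

lemma test_function_partial_deriv:
  assumes "test_function D \<phi>"
  shows "test_function D (partial_deriv i \<phi>)"
proof (rule test_function_subset[OF assms])
  fix k
  have "C_k (Suc k) \<phi>" using assms unfolding test_function_def by blast
  then show "C_k k (partial_deriv i \<phi>)" by simp
qed (rule partial_deriv_outside_support)

lemma test_function_add:
  assumes \<phi>: "test_function D \<phi>" and \<psi>: "test_function D \<psi>"
  shows "test_function D (\<lambda>x. \<phi> x + \<psi> x)"
proof -
  let ?C = "\<lambda>f. closure {x. f x \<noteq> (0::real)}"
  have sub: "?C (\<lambda>x. \<phi> x + \<psi> x) \<subseteq> ?C \<phi> \<union> ?C \<psi>"
  proof (rule closure_minimal)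
    show "{x. \<phi> x + \<psi> x \<noteq> 0} \<subseteq> ?C \<phi> \<union> ?C \<psi>"
      using closure_subset[of "{x. \<phi> x \<noteq> 0}"] closure_subset[of "{x. \<psi> x \<noteq> 0}"] by force
  qed auto
  have "compact (?C \<phi> \<union> ?C \<psi>)" using \<phi> \<psi> by (auto simp: test_function_def intro: compact_Un)
  then have "compact (?C (\<lambda>x. \<phi> x + \<psi> x))"
    using sub compact_Int_closed[of "?C \<phi> \<union> ?C \<psi>" "?C (\<lambda>x. \<phi> x + \<psi> x)"] by (simp add: Int_absorb1)
  moreover have "\<forall>k. C_k k (\<lambda>x. \<phi> x + \<psi> x)"
    using \<phi> \<psi> C_k_add unfolding test_function_def by blast
  moreover have "?C \<phi> \<union> ?C \<psi> \<subseteq> D" using \<phi> \<psi> unfolding test_function_def by blast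
  ultimately show ?thesis using sub unfolding test_function_def by blast
qed

lemma test_function_scale:
  assumes \<phi>: "test_function D \<phi>"
  shows "test_function D (\<lambda>x. c * \<phi> x)"
proof (rule test_function_subset[OF \<phi>])
  show "C_k k (\<lambda>x. c * \<phi> x)" for k using \<phi> C_k_mult[OF C_k_const] unfolding test_function_def by blast
  show "c * \<phi> x = 0" if "x \<notin> closure {x. \<phi> x \<noteq> 0}" for x
    using that closure_subset[of "{x. \<phi> x \<noteq> 0}"] by auto
qed

text \<open>The restriction of \<open>w\<close> to a box in \<open>D\<close> integrates to zero over every box, since the
  intersection of two boxes is a box.\<close>

lemma fundamental_lemma:
  fixes w :: "real^'d \<Rightarrow> real"
  assumes w: "w \<in> L2_on D" and 0: "\<And>\<phi>. test_function D \<phi> \<Longrightarrow> (\<integral>x. w x * \<phi> x \<partial>MD) = 0"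
  shows "AE x in MD. w x = 0"
proof -
  interpret finite_measure MD by (rule finite_measure_D)
  have wm: "w \<in> borel_measurable MD" and wi2: "integrable MD (\<lambda>x. (norm (w x))\<^sup>2)"
    using w by (auto simp: L2_on_def)
  have wint: "integrable MD w"
  proof (rule Bochner_Integration.integrable_bound)
    show "integrable MD (\<lambda>x. 1 + (norm (w x))\<^sup>2)" by (intro Bochner_Integration.integrable_add wi2) simp
    have "\<bar>t\<bar> \<le> 1 + t\<^sup>2" for t :: real using sum_squares_bound[of "\<bar>t\<bar>" 1] by (simp add: power2_eq_square)
    then show "AE x in MD. norm (w x) \<le> norm (1 + (norm (w x))\<^sup>2)" by (intro AE_I2) (simp add: abs_of_nonneg)
  qed (rule wm)
  have boxI: "(\<integral>x. w x * indicator (box a b) x \<partial>MD) = 0" if ab: "box a b \<subseteq> D" for a b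
  proof -
    have "(\<lambda>n. \<integral>x. w x * box_bump a b (Suc n) x \<partial>MD) \<longlonglongrightarrow> (\<integral>x. w x * indicator (box a b) x \<partial>MD)"
    proof (rule integral_dominated_convergence[where w = "\<lambda>x. \<bar>w x\<bar>"])
      show "(\<lambda>x. w x * indicator (box a b) x) \<in> borel_measurable MD"
        by (rule borel_measurable_times[OF wm], rule measurable_restrict_space1, rule measurable_completion) measurable
      show "(\<lambda>x. w x * box_bump a b (Suc n) x) \<in> borel_measurable MD" for n
        by (intro borel_measurable_times wm continuous_measurable_D C_k_0_continuous[of 0] C_k_box_bump)
      show "integrable MD (\<lambda>x. \<bar>w x\<bar>)" using wint by simp
      show "AE x in MD. (\<lambda>n. w x * box_bump a b (Suc n) x) \<longlonglongrightarrow> w x * indicator (box a b) x"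
        by (intro AE_I2 tendsto_mult tendsto_const LIMSEQ_Suc tendsto_box_bump)
      show "AE x in MD. norm (w x * box_bump a b (Suc n) x) \<le> \<bar>w x\<bar>" for n
        using box_bump_bounds[of a b "Suc n"] by (intro AE_I2) (auto simp: abs_mult intro: mult_left_le)
    qed
    moreover have "(\<integral>x. w x * box_bump a b (Suc n) x \<partial>MD) = 0" for n
      by (rule 0[OF test_function_box_bump[OF ab]]) simp
    ultimately have "(\<lambda>n::nat. 0::real) \<longlonglongrightarrow> (\<integral>x. w x * indicator (box a b) x \<partial>MD)"
      by (simp only:)
    then show ?thesis by (simp add: LIMSEQ_const_iff)
  qed
  \<comment> \<open>A Borel representative on the whole space is introduced because the comparison
    of measures below takes place over \<open>lborel\<close>.\<close>
  have "(\<lambda>x. indicator D x * w x) \<in> borel_measurable lebesgue"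
    using wm D_sets by (simp add: borel_measurable_restrict_space_iff)
  then obtain w' where w'm [measurable]: "w' \<in> borel_measurable lborel" and w': "AE x in lborel. indicator D x * w x = w' x"
    using completion_ex_borel_measurable_real by blast
  have w'int: "integrable lborel w'"
  proof -
    have "integrable lebesgue (\<lambda>x. indicator D x * w x)"
      using wint D_sets by (simp add: integrable_restrict_space)
    then have "integrable lebesgue w'"
      by (rule integrable_cong_AE_imp) (use w' w'm in \<open>auto intro: AE_completion measurable_completion\<close>)
    then show ?thesis by (simp add: integrable_completion)
  qed
  have intB: "(\<integral>x. w' x * indicator (box a b) x \<partial>lborel) = 0" if ab: "box a b \<subseteq> D" for a b
  proof -
    have "(\<integral>x. w' x * indicator (box a b) x \<partial>lborel) = (\<integral>x. w' x * indicator (box a b) x \<partial>lebesgue)"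
      by (rule integral_completion[symmetric]) measurable
    also have "\<dots> = (\<integral>x. indicator D x *\<^sub>R (w x * indicator (box a b) x) \<partial>lebesgue)"
    proof (rule integral_cong_AE)
      show "(\<lambda>x. w' x * indicator (box a b) x) \<in> borel_measurable lebesgue"
        by (rule measurable_completion) measurable
      have "(\<lambda>x. (indicator D x * w x) * indicator (box a b) x) \<in> borel_measurable lebesgue"
        by (rule borel_measurable_times[OF \<open>(\<lambda>x. indicator D x * w x) \<in> borel_measurable lebesgue\<close>]) (rule measurable_completion, measurable)
      then show "(\<lambda>x. indicator D x *\<^sub>R (w x * indicator (box a b) x)) \<in> borel_measurable lebesgue" by (simp add: mult_ac)
      show "AE x in lebesgue. w' x * indicator (box a b) x = indicator D x *\<^sub>R (w x * indicator (box a b) x)"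
        using AE_completion[OF w'] by eventually_elim (simp add: mult.assoc[symmetric])
    qed
    also have "\<dots> = (\<integral>x. w x * indicator (box a b) x \<partial>MD)"
      using D_sets by (intro integral_restrict_space[symmetric]) simp
    finally show ?thesis using boxI[OF ab] by simp
  qed
  \<comment> \<open>The positive and the negative part of \<open>w'\<close> on the box serve as
    densities, \<open>f 1\<close> and \<open>f (-1)\<close>. They give every box the same finite
    measure, hence define the same measure and agree almost everywhere; at such points both parts
    are zero.\<close>
  have ae: "AE x in lborel. x \<in> box a b \<longrightarrow> w' x = 0" if ab: "box a b \<subseteq> D" for a b
  proof -
    define f where "f c x = ennreal (max (c * w' x) 0) * indicator (box a b) x" for c x
    have fm [measurable]: "f c \<in> borel_measurable lborel" for c unfolding f_def by measurable
    have fin: "integrable lborel (\<lambda>x. max (c * w' x) 0 * indicator (box u v) x)" for c u v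
      by (rule Bochner_Integration.integrable_bound[OF integrable_mult_right[OF w'int, of c]])
         (auto simp: indicator_def intro!: AE_I2)
    have em: "emeasure (density lborel (f c)) (box u v) = ennreal (\<integral>x. max (c * w' x) 0 * indicator (box a b \<inter> box u v) x \<partial>lborel)" for c u v
    proof -
      have "emeasure (density lborel (f c)) (box u v) = (\<integral>\<^sup>+x. f c x * indicator (box u v) x \<partial>lborel)"
        by (subst emeasure_density) auto
      also have "\<dots> = (\<integral>\<^sup>+x. ennreal (max (c * w' x) 0 * indicator (box a b \<inter> box u v) x) \<partial>lborel)"
        by (intro nn_integral_cong) (simp add: f_def indicator_def)
      also have "\<dots> = ennreal (\<integral>x. max (c * w' x) 0 * indicator (box a b \<inter> box u v) x \<partial>lborel)"
      proof (rule nn_integral_eq_integral)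
        show "integrable lborel (\<lambda>x. max (c * w' x) 0 * indicator (box a b \<inter> box u v) x)"
          unfolding box_Int_box by (rule fin)
      qed (auto intro!: AE_I2)
      finally show ?thesis .
    qed
    have "density lborel (f 1) = density lborel (f (-1))"
    proof (rule measure_eqI_generator_eq[where E = "range (\<lambda>(a, b). box a b)" and \<Omega> = UNIV
          and A = "\<lambda>n. box (- (real n *\<^sub>R One)) (real n *\<^sub>R One)"])
      show "Int_stable (range (\<lambda>(a, b). box a b :: (real^'d) set))"
        by (auto simp: Int_stable_def box_Int_box)
      show "sets (density lborel (f 1)) = sigma_sets UNIV (range (\<lambda>(a, b). box a b))"
        "sets (density lborel (f (-1))) = sigma_sets UNIV (range (\<lambda>(a, b). box a b))"
        by (simp_all add: borel_eq_box)
      fix X assume "X \<in> range (\<lambda>(a, b). box a b :: (real^'d) set)"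
      then obtain u v where X: "X = box u v" by auto
      have "(\<integral>x. max (1 * w' x) 0 * indicator (box a b \<inter> box u v) x \<partial>lborel) - (\<integral>x. max (- 1 * w' x) 0 * indicator (box a b \<inter> box u v) x \<partial>lborel) =
         (\<integral>x. max (1 * w' x) 0 * indicator (box a b \<inter> box u v) x - max (- 1 * w' x) 0 * indicator (box a b \<inter> box u v) x \<partial>lborel)"
        by (rule Bochner_Integration.integral_diff[symmetric]) (unfold box_Int_box, (rule fin)+)
      also have "\<dots> = (\<integral>x. w' x * indicator (box a b \<inter> box u v) x \<partial>lborel)"
        by (intro Bochner_Integration.integral_cong refl) (auto simp: max_def indicator_def)
      also have "\<dots> = 0"
        unfolding box_Int_box by (rule intB) (use ab in \<open>auto simp: box_Int_box[symmetric]\<close>)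
      finally show "emeasure (density lborel (f 1)) X = emeasure (density lborel (f (-1))) X"
        unfolding X em by simp
    next
      show "emeasure (density lborel (f 1)) (box (- (real n *\<^sub>R One)) (real n *\<^sub>R One)) \<noteq> \<infinity>" for n
        unfolding em by simp
    qed (auto simp: UN_box_eq_UNIV)
    then have "AE x in lborel. f 1 x = f (-1) x"
      by (subst (asm) sigma_finite_measure.density_unique_iff[OF lborel.sigma_finite_measure_axioms]) auto
    then show ?thesis
      by eventually_elim (auto simp: f_def max_def split: if_splits)
  qed
  define a' where "a' f = (\<Sum>i\<in>Basis. fst (f i) *\<^sub>R i)" for f :: "real^'d \<Rightarrow> real \<times> real"
  define b' where "b' f = (\<Sum>i\<in>Basis. snd (f i) *\<^sub>R i)" for f :: "real^'d \<Rightarrow> real \<times> real"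
  \<comment> \<open>An open set is the union of the boxes with rational corners that it contains, so
    only countably many null sets have to be combined.\<close>
  define J where "J = {f \<in> Basis \<rightarrow>\<^sub>E \<rat> \<times> \<rat>. box (a' f) (b' f) \<subseteq> D}"
  have DJ: "D = (\<Union>f\<in>J. box (a' f) (b' f))"
    unfolding J_def a'_def b'_def by (rule open_UNION_box[OF open_D])
  have cJ: "countable J"
    unfolding J_def by (rule countable_subset[OF Collect_restrict]) (auto intro!: countable_PiE countable_SIGMA countable_rat)
  have "AE x in lborel. \<forall>f\<in>J. x \<in> box (a' f) (b' f) \<longrightarrow> w' x = 0"
    by (subst AE_ball_countable[OF cJ]) (use ae in \<open>auto simp: J_def\<close>)
  then have "AE x in lborel. x \<in> D \<longrightarrow> w x = 0"
    using w' by eventually_elim (use DJ in \<open>auto simp: indicator_def split: if_splits\<close>)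
  then have "AE x in lebesgue. x \<in> D \<longrightarrow> w x = 0" by (rule AE_completion)
  then show ?thesis using D_sets by (simp add: AE_restrict_space_iff)
qed

end

lemma L2_nth:
  fixes g :: "real^'d \<Rightarrow> real^'d"
  assumes "g \<in> L2_on D"
  shows "(\<lambda>x. g x $ i) \<in> L2_on D"
proof -
  have m: "g \<in> borel_measurable (lebesgue_on D)" and i: "integrable (lebesgue_on D) (\<lambda>x. (norm (g x))\<^sup>2)"
    using assms by (auto simp: L2_on_def)
  have mi: "(\<lambda>x. g x $ i) \<in> borel_measurable (lebesgue_on D)"
    by (rule measurable_compose[OF m]) (auto intro: borel_measurable_continuous_onI continuous_intros)
  have "integrable (lebesgue_on D) (\<lambda>x. (norm (g x $ i))\<^sup>2)"
  proof (rule Bochner_Integration.integrable_bound[OF i])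
    show "AE x in lebesgue_on D. norm ((norm (g x $ i))\<^sup>2) \<le> norm ((norm (g x))\<^sup>2)"
    proof (rule AE_I2)
      fix x
      have "(norm (g x $ i))\<^sup>2 \<le> (norm (g x))\<^sup>2"
        using component_le_norm_cart[of "g x" i] by (intro power_mono) simp_all
      then show "norm ((norm (g x $ i))\<^sup>2) \<le> norm ((norm (g x))\<^sup>2)" by simp
    qed
  qed (use mi in measurable)
  then show ?thesis using mi by (simp add: L2_on_def)
qed

lemma L2_vec:
  fixes g :: "real^'d \<Rightarrow> real^'d"
  assumes g: "\<And>i. (\<lambda>x. g x $ i) \<in> L2_on D"
  shows "g \<in> L2_on D"
proof -
  have m: "(\<lambda>x. g x $ i) \<in> borel_measurable (lebesgue_on D)" and i: "integrable (lebesgue_on D) (\<lambda>x. (norm (g x $ i))\<^sup>2)" for i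
    using g[of i] by (auto simp: L2_on_def)
  have "g \<in> borel_measurable (lebesgue_on D)"
    by (subst borel_measurable_euclidean_space) (auto simp: Basis_vec_def inner_axis intro: m)
  moreover have "(norm (g x))\<^sup>2 = (\<Sum>i\<in>UNIV. (norm (g x $ i))\<^sup>2)" for x
    by (simp add: norm_vec_def L2_set_def sum_nonneg)
  then have "integrable (lebesgue_on D) (\<lambda>x. (norm (g x))\<^sup>2)"
    by (simp only:) (intro Bochner_Integration.integrable_sum i)
  ultimately show ?thesis by (simp add: L2_on_def)
qed

section \<open>Weak gradients and the space H01\<close>

context bounded_domain
begin

abbreviation grad :: "(real^'d \<Rightarrow> real) \<Rightarrow> real^'d \<Rightarrow> real^'d" where
  "grad \<phi> \<equiv> \<lambda>x. \<chi> i. partial_deriv i \<phi> x"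

lemma grad_L2: "test_function D \<phi> \<Longrightarrow> grad \<phi> \<in> L2_on D"
  by (rule L2_vec) (simp add: test_function_L2 test_function_partial_deriv)

lemma integrable_mult_L2:
  fixes f g :: "real^'d \<Rightarrow> real"
  assumes "f \<in> L2_on D" "g \<in> L2_on D"
  shows "integrable MD (\<lambda>x. f x * g x)"
  using integrable_inner_L2[of f MD g] assms by (auto simp: L2_on_def)

text \<open>The components of two weak gradients have equal integrals against all test functions, so
  the fundamental lemma applies to their difference. Since \<open>weak_grad\<close> is an arbitrary
  choice for each function separately, its linearity is available only almost everywhere, through
  this fact.\<close>

lemma weak_gradient_unique:
  assumes g: "has_weak_gradient D v g" and k: "has_weak_gradient D v k"
  shows "AE x in MD. g x = k x"
proof -
  have "AE x in MD. g x $ i - k x $ i = 0" for i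
  proof (rule fundamental_lemma)
    have gi: "(\<lambda>x. g x $ i) \<in> L2_on D" and ki: "(\<lambda>x. k x $ i) \<in> L2_on D"
      using g k by (auto simp: has_weak_gradient_def intro: L2_nth)
    then show "(\<lambda>x. g x $ i - k x $ i) \<in> L2_on D" by (rule L2_diff)
    fix \<phi> assume \<phi>: "test_function D \<phi>"
    have "(\<integral>x. (g x $ i - k x $ i) * \<phi> x \<partial>MD) = (\<integral>x. g x $ i * \<phi> x \<partial>MD) - (\<integral>x. k x $ i * \<phi> x \<partial>MD)"
      using integrable_mult_L2[OF gi test_function_L2[OF \<phi>]] integrable_mult_L2[OF ki test_function_L2[OF \<phi>]]
      by (simp add: left_diff_distrib)
    also have "\<dots> = 0" using g k \<phi> by (simp add: has_weak_gradient_def)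
    finally show "(\<integral>x. (g x $ i - k x $ i) * \<phi> x \<partial>MD) = 0" .
  qed
  then have "AE x in MD. \<forall>i. g x $ i - k x $ i = 0" by (simp add: AE_all_countable)
  then show ?thesis by eventually_elim (simp add: vec_eq_iff)
qed

lemma has_weak_gradient_add:
  assumes v: "has_weak_gradient D v g" and w: "has_weak_gradient D w k"
  shows "has_weak_gradient D (\<lambda>x. v x + w x) (\<lambda>x. g x + k x)"
  unfolding has_weak_gradient_def
proof (intro conjI allI impI)
  have L: "v \<in> L2_on D" "w \<in> L2_on D" "g \<in> L2_on D" "k \<in> L2_on D"
    using v w by (auto simp: has_weak_gradient_def)
  show "(\<lambda>x. v x + w x) \<in> L2_on D" "(\<lambda>x. g x + k x) \<in> L2_on D" using L by (auto intro: L2_add)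
  fix \<phi> i assume \<phi>: "test_function D \<phi>"
  note p = test_function_L2[OF test_function_partial_deriv[OF \<phi>]]
  have "(\<integral>x. (v x + w x) * partial_deriv i \<phi> x \<partial>MD) = (\<integral>x. v x * partial_deriv i \<phi> x \<partial>MD) + (\<integral>x. w x * partial_deriv i \<phi> x \<partial>MD)"
    using integrable_mult_L2[OF L(1) p] integrable_mult_L2[OF L(2) p] by (simp add: distrib_right)
  also have "\<dots> = - ((\<integral>x. g x $ i * \<phi> x \<partial>MD) + (\<integral>x. k x $ i * \<phi> x \<partial>MD))"
    using v w \<phi> by (simp add: has_weak_gradient_def)
  also have "(\<integral>x. g x $ i * \<phi> x \<partial>MD) + (\<integral>x. k x $ i * \<phi> x \<partial>MD) = (\<integral>x. (g x + k x) $ i * \<phi> x \<partial>MD)"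
    using integrable_mult_L2[OF L2_nth[OF L(3)] test_function_L2[OF \<phi>]] integrable_mult_L2[OF L2_nth[OF L(4)] test_function_L2[OF \<phi>]]
    by (simp add: distrib_right)
  finally show "(\<integral>x. (v x + w x) * partial_deriv i \<phi> x \<partial>MD) = - (\<integral>x. (g x + k x) $ i * \<phi> x \<partial>MD)" .
qed

lemma has_weak_gradient_scale:
  assumes v: "has_weak_gradient D v g"
  shows "has_weak_gradient D (\<lambda>x. c * v x) (\<lambda>x. c *\<^sub>R g x)"
  unfolding has_weak_gradient_def
proof (intro conjI allI impI)
  have L: "v \<in> L2_on D" "g \<in> L2_on D" using v by (auto simp: has_weak_gradient_def)
  show "(\<lambda>x. c * v x) \<in> L2_on D" "(\<lambda>x. c *\<^sub>R g x) \<in> L2_on D"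
    using L2_scale[OF L(1), of c] L2_scale[OF L(2), of c] by simp_all
  fix \<phi> i assume \<phi>: "test_function D \<phi>"
  then show "(\<integral>x. (c * v x) * partial_deriv i \<phi> x \<partial>MD) = - (\<integral>x. (c *\<^sub>R g x) $ i * \<phi> x \<partial>MD)"
    using v by (simp add: has_weak_gradient_def mult.assoc)
qed

lemma weak_grad_works: "has_weak_gradient D v g \<Longrightarrow> has_weak_gradient D v (weak_grad D v)"
  unfolding weak_grad_def by (rule someI[of "has_weak_gradient D v"])

lemma H01_weak_gradient: "v \<in> H01 D \<Longrightarrow> has_weak_gradient D v (weak_grad D v)"
  unfolding H01_def using weak_grad_works by blast

lemma H01_L2: "v \<in> H01 D \<Longrightarrow> v \<in> L2_on D" "v \<in> H01 D \<Longrightarrow> weak_grad D v \<in> L2_on D"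
  using H01_weak_gradient by (auto simp: has_weak_gradient_def)

lemma grad_add:
  assumes "test_function D \<phi>" "test_function D \<psi>"
  shows "grad (\<lambda>x. \<phi> x + \<psi> x) x = grad \<phi> x + grad \<psi> x"
  using partial_deriv_add[OF test_function_differentiable[OF assms(1)] test_function_differentiable[OF assms(2)]]
  by (simp add: vec_eq_iff)

lemma grad_scale:
  assumes "test_function D \<phi>"
  shows "grad (\<lambda>x. c * \<phi> x) x = c *\<^sub>R grad \<phi> x"
proof -
  have "(\<lambda>_. c) differentiable (at x)" for x :: "real^'d" by simp
  moreover have "partial_deriv i (\<lambda>_. c) x = 0" for i and x :: "real^'d"
    by (rule partial_derivI[OF has_derivative_const])
  ultimately show ?thesis
    using partial_deriv_mult[of "\<lambda>_. c" _ \<phi>, OF _ test_function_differentiable[OF assms]]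
    by (simp add: vec_eq_iff)
qed

lemma H01_add:
  assumes v: "v \<in> H01 D" and w: "w \<in> H01 D"
  shows "(\<lambda>x. v x + w x) \<in> H01 D"
proof -
  obtain g \<phi> where g: "has_weak_gradient D v g" "\<And>k::nat. test_function D (\<phi> k)"
    and g1: "(\<lambda>k. L2_norm_on D (\<lambda>x. v x - \<phi> k x)) \<longlonglongrightarrow> 0"
    and g2: "(\<lambda>k. L2_norm_on D (\<lambda>x. g x - grad (\<phi> k) x)) \<longlonglongrightarrow> 0"
    using v unfolding H01_def by blast
  obtain f \<psi> where f: "has_weak_gradient D w f" "\<And>k::nat. test_function D (\<psi> k)"
    and f1: "(\<lambda>k. L2_norm_on D (\<lambda>x. w x - \<psi> k x)) \<longlonglongrightarrow> 0"
    and f2: "(\<lambda>k. L2_norm_on D (\<lambda>x. f x - grad (\<psi> k) x)) \<longlonglongrightarrow> 0"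
    using w unfolding H01_def by blast
  have L: "v \<in> L2_on D" "w \<in> L2_on D" "g \<in> L2_on D" "f \<in> L2_on D"
    using g(1) f(1) by (auto simp: has_weak_gradient_def)
  have t: "test_function D (\<lambda>x. \<phi> k x + \<psi> k x)" for k by (rule test_function_add[OF g(2) f(2)])
  have "(\<lambda>k. L2_norm_on D (\<lambda>x. v x + w x - (\<phi> k x + \<psi> k x))) \<longlonglongrightarrow> 0"
  proof (rule tendsto_sandwich[OF _ _ tendsto_const])
    show "(\<lambda>k. L2_norm_on D (\<lambda>x. v x - \<phi> k x) + L2_norm_on D (\<lambda>x. w x - \<psi> k x)) \<longlonglongrightarrow> 0"
      using tendsto_add[OF g1 f1] by simp
    have "L2_norm_on D (\<lambda>x. v x + w x - (\<phi> k x + \<psi> k x)) \<le> L2_norm_on D (\<lambda>x. v x - \<phi> k x) + L2_norm_on D (\<lambda>x. w x - \<psi> k x)" for k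
      using L2_triangle[OF L2_diff[OF L(1) test_function_L2[OF g(2)[of k]]] L2_diff[OF L(2) test_function_L2[OF f(2)[of k]]]]
      by (simp add: algebra_simps)
    then show "eventually (\<lambda>k. L2_norm_on D (\<lambda>x. v x + w x - (\<phi> k x + \<psi> k x)) \<le> L2_norm_on D (\<lambda>x. v x - \<phi> k x) + L2_norm_on D (\<lambda>x. w x - \<psi> k x)) sequentially"
      by simp
    show "eventually (\<lambda>k. 0 \<le> L2_norm_on D (\<lambda>x. v x + w x - (\<phi> k x + \<psi> k x))) sequentially"
      by (simp add: L2_norm_nonneg)
  qed
  moreover have "(\<lambda>k. L2_norm_on D (\<lambda>x. g x + f x - grad (\<lambda>x. \<phi> k x + \<psi> k x) x)) \<longlonglongrightarrow> 0"
  proof (rule tendsto_sandwich[OF _ _ tendsto_const])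
    show "(\<lambda>k. L2_norm_on D (\<lambda>x. g x - grad (\<phi> k) x) + L2_norm_on D (\<lambda>x. f x - grad (\<psi> k) x)) \<longlonglongrightarrow> 0"
      using tendsto_add[OF g2 f2] by simp
    have "L2_norm_on D (\<lambda>x. g x + f x - grad (\<lambda>x. \<phi> k x + \<psi> k x) x) \<le> L2_norm_on D (\<lambda>x. g x - grad (\<phi> k) x) + L2_norm_on D (\<lambda>x. f x - grad (\<psi> k) x)" for k
      using L2_triangle[OF L2_diff[OF L(3) grad_L2[OF g(2)[of k]]] L2_diff[OF L(4) grad_L2[OF f(2)[of k]]]]
      unfolding grad_add[OF g(2)[of k] f(2)[of k]] by (simp add: algebra_simps)
    then show "eventually (\<lambda>k. L2_norm_on D (\<lambda>x. g x + f x - grad (\<lambda>x. \<phi> k x + \<psi> k x) x) \<le> L2_norm_on D (\<lambda>x. g x - grad (\<phi> k) x) + L2_norm_on D (\<lambda>x. f x - grad (\<psi> k) x)) sequentially"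
      by simp
    show "eventually (\<lambda>k. 0 \<le> L2_norm_on D (\<lambda>x. g x + f x - grad (\<lambda>x. \<phi> k x + \<psi> k x) x)) sequentially"
      by (simp add: L2_norm_nonneg)
  qed
  ultimately show ?thesis
    unfolding H01_def using has_weak_gradient_add[OF g(1) f(1)] t
    by (intro CollectI exI[of _ "\<lambda>x. g x + f x"] exI[of _ "\<lambda>k x. \<phi> k x + \<psi> k x"]) blast
qed

lemma H01_scale:
  assumes v: "v \<in> H01 D"
  shows "(\<lambda>x. c * v x) \<in> H01 D"
proof -
  obtain g \<phi> where g: "has_weak_gradient D v g" "\<And>k::nat. test_function D (\<phi> k)"
    and g1: "(\<lambda>k. L2_norm_on D (\<lambda>x. v x - \<phi> k x)) \<longlonglongrightarrow> 0"
    and g2: "(\<lambda>k. L2_norm_on D (\<lambda>x. g x - grad (\<phi> k) x)) \<longlonglongrightarrow> 0"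
    using v unfolding H01_def by blast
  have "L2_norm_on D (\<lambda>x. c * v x - c * \<phi> k x) = \<bar>c\<bar> * L2_norm_on D (\<lambda>x. v x - \<phi> k x)" for k
    using L2_norm_scale[of D c "\<lambda>x. v x - \<phi> k x"] by (simp add: right_diff_distrib)
  then have 1: "(\<lambda>k. L2_norm_on D (\<lambda>x. c * v x - c * \<phi> k x)) \<longlonglongrightarrow> 0"
    using tendsto_mult_right_zero[OF g1, of "\<bar>c\<bar>"] by simp
  have "L2_norm_on D (\<lambda>x. c *\<^sub>R g x - grad (\<lambda>x. c * \<phi> k x) x) = \<bar>c\<bar> * L2_norm_on D (\<lambda>x. g x - grad (\<phi> k) x)" for k
    unfolding grad_scale[OF g(2)[of k]]
    using L2_norm_scale[of D c "\<lambda>x. g x - grad (\<phi> k) x"] by (simp add: scaleR_right_diff_distrib)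
  then have 2: "(\<lambda>k. L2_norm_on D (\<lambda>x. c *\<^sub>R g x - grad (\<lambda>x. c * \<phi> k x) x)) \<longlonglongrightarrow> 0"
    using tendsto_mult_right_zero[OF g2, of "\<bar>c\<bar>"] by simp
  show ?thesis
    unfolding H01_def using 1 2 has_weak_gradient_scale[OF g(1)] test_function_scale[OF g(2)]
    by (intro CollectI exI[of _ "\<lambda>x. c *\<^sub>R g x"] exI[of _ "\<lambda>k x. c * \<phi> k x"]) blast
qed

lemma weak_grad_add:
  "v \<in> H01 D \<Longrightarrow> w \<in> H01 D \<Longrightarrow> AE x in MD. weak_grad D (\<lambda>x. v x + w x) x = weak_grad D v x + weak_grad D w x"
  by (rule weak_gradient_unique[OF H01_weak_gradient[OF H01_add] has_weak_gradient_add[OF H01_weak_gradient H01_weak_gradient]])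

lemma weak_grad_scale:
  "v \<in> H01 D \<Longrightarrow> AE x in MD. weak_grad D (\<lambda>x. c * v x) x = c *\<^sub>R weak_grad D v x"
  by (rule weak_gradient_unique[OF H01_weak_gradient[OF H01_scale] has_weak_gradient_scale[OF H01_weak_gradient]])

lemma H01_norm_scale:
  assumes v: "v \<in> H01 D"
  shows "H01_norm D (\<lambda>x. c * v x) = \<bar>c\<bar> * H01_norm D v"
proof -
  have "L2_norm_on D (weak_grad D (\<lambda>x. c * v x)) = L2_norm_on D (\<lambda>x. c *\<^sub>R weak_grad D v x)"
    by (rule L2_norm_cong_AE[OF weak_grad_scale[OF v]])
       (use H01_L2(2)[OF H01_scale[OF v]] L2_scale[OF H01_L2(2)[OF v]] in \<open>auto simp: L2_on_def\<close>)
  then show ?thesis by (simp add: H01_norm_def L2_norm_scale)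
qed

text \<open>Functions of norm zero cannot be scaled to norm one; for them the unspecified bound
  \<open>B\<close> from the definition already gives \<open>q v = 0\<close>. Otherwise
  \<open>B\<close> only ensures that the supremum is taken over a bounded set.\<close>

lemma Hminus1_bound:
  assumes q: "q \<in> Hminus1 D" and v: "v \<in> H01 D"
  shows "\<bar>q v\<bar> \<le> Hminus1_norm D q * H01_norm D v"
proof -
  obtain B where B: "\<And>v. v \<in> H01 D \<Longrightarrow> \<bar>q v\<bar> \<le> B * H01_norm D v" using q unfolding Hminus1_def by blast
  have qs: "q (\<lambda>x. c * v x) = c * q v" for c using q v unfolding Hminus1_def by blast
  have n0: "0 \<le> H01_norm D w" for w by (simp add: H01_norm_def L2_norm_nonneg)
  show ?thesis
  proof (cases "H01_norm D v = 0")
    case True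
    then show ?thesis using B[OF v] by simp
  next
    case False
    then have n: "0 < H01_norm D v" using n0[of v] by simp
    let ?w = "\<lambda>x. (1 / H01_norm D v) * v x"
    have w: "?w \<in> H01 D" "H01_norm D ?w \<le> 1"
      by (rule H01_scale[OF v]) (subst H01_norm_scale[OF v], use n in simp)
    have bdd: "bdd_above {\<bar>q v\<bar> | v. v \<in> H01 D \<and> H01_norm D v \<le> 1}"
    proof (rule bdd_aboveI)
      fix t assume "t \<in> {\<bar>q v\<bar> | v. v \<in> H01 D \<and> H01_norm D v \<le> 1}"
      then obtain u where u: "t = \<bar>q u\<bar>" "u \<in> H01 D" "H01_norm D u \<le> 1" by blast
      have "t \<le> B * H01_norm D u" using B u by simp
      also have "\<dots> \<le> \<bar>B\<bar> * 1" using u(3) n0[of u] by (intro mult_mono) auto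
      finally show "t \<le> \<bar>B\<bar>" by simp
    qed
    have "\<bar>q ?w\<bar> \<le> Hminus1_norm D q"
      unfolding Hminus1_norm_def using w by (intro cSup_upper[OF _ bdd]) blast
    moreover have "q ?w = (1 / H01_norm D v) * q v" by (rule qs)
    ultimately show ?thesis using n by (simp add: abs_mult divide_le_eq)
  qed
qed

text \<open>The integral of a partial derivative of a compactly supported function is the limit of the
  integrals of its difference quotients, which vanish by translation invariance.\<close>

lemma integral_partial_deriv_0:
  fixes F :: "real^'d \<Rightarrow> real"
  assumes dF: "\<And>x. F differentiable (at x)" and cF: "continuous_on UNIV (partial_deriv i F)"
    and K: "compact K" and FK: "\<And>x. x \<notin> K \<Longrightarrow> F x = 0"
  shows "(\<integral>x. partial_deriv i F x \<partial>lborel) = 0"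
proof -
  let ?e = "axis i 1 :: real^'d"
  have cont: "continuous_on UNIV F"
    using dF by (meson continuous_at_imp_continuous_on differentiable_imp_continuous_within)
  have pd0: "partial_deriv i F x = 0" if "x \<notin> K" for x
  proof -
    have "{x. F x \<noteq> 0} \<subseteq> K" using FK by auto
    then have "closure {x. F x \<noteq> 0} \<subseteq> K" by (rule closure_minimal) (rule compact_imp_closed[OF K])
    then show ?thesis using that by (intro partial_deriv_outside_support) blast
  qed
  obtain M where M: "\<And>x. \<bar>partial_deriv i F x\<bar> \<le> M" "0 \<le> M"
  proof -
    have "compact (partial_deriv i F ` K)" by (rule compact_continuous_image[OF continuous_on_subset[OF cF] K]) simp
    then have "bounded (partial_deriv i F ` K)" by (rule compact_imp_bounded)
    then obtain B where B: "\<And>x. x \<in> K \<Longrightarrow> \<bar>partial_deriv i F x\<bar> \<le> B" by (auto simp: bounded_iff)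
    have "\<bar>partial_deriv i F x\<bar> \<le> max B 0" for x using B[of x] pd0[of x] by (cases "x \<in> K") auto
    then show ?thesis using that[of "max B 0"] by simp
  qed
  obtain R where R: "\<And>x. x \<in> K \<Longrightarrow> norm x \<le> R" using compact_imp_bounded[OF K] by (auto simp: bounded_iff)
  have line: "((\<lambda>u. F (x + u *\<^sub>R ?e)) has_real_derivative partial_deriv i F (x + u *\<^sub>R ?e)) (at u)" for x u
  proof -
    have "((\<lambda>u. x + u *\<^sub>R ?e) has_derivative (\<lambda>h. h *\<^sub>R ?e)) (at u)"
      by (auto intro!: derivative_eq_intros)
    from has_derivative_compose[OF this has_derivative_differentiable[OF dF]]
    have "((\<lambda>u. F (x + u *\<^sub>R ?e)) has_derivative (\<lambda>h. frechet_derivative F (at (x + u *\<^sub>R ?e)) (h *\<^sub>R ?e))) (at u)" .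
    moreover have "frechet_derivative F (at (x + u *\<^sub>R ?e)) (h *\<^sub>R ?e) = partial_deriv i F (x + u *\<^sub>R ?e) * h" for h
      using linear_frechet_derivative[OF dF] by (simp add: linear_scale partial_deriv_def)
    ultimately show ?thesis by (simp add: has_field_derivative_def)
  qed
  define t where "t n = 1 / real (Suc n)" for n
  have t: "0 < t n" "t n \<le> 1" for n by (simp_all add: t_def)
  define Q where "Q n x = (F (x + t n *\<^sub>R ?e) - F x) / t n" for n x
  \<comment> \<open>The mean value theorem along the coordinate line bounds all difference quotients
    by the maximum of the partial derivative.\<close>
  have lip: "\<bar>Q n x\<bar> \<le> M" for n x
  proof -
    have "\<exists>z>0. z < t n \<and> F (x + t n *\<^sub>R ?e) - F (x + 0 *\<^sub>R ?e) = (t n - 0) * partial_deriv i F (x + z *\<^sub>R ?e)"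
      by (rule MVT2[OF t(1)]) (rule line)
    then obtain z where "F (x + t n *\<^sub>R ?e) - F x = t n * partial_deriv i F (x + z *\<^sub>R ?e)" by auto
    then have "Q n x = partial_deriv i F (x + z *\<^sub>R ?e)" using t(1)[of n] by (simp add: Q_def)
    then show ?thesis using M(1) by simp
  qed
  have mF [measurable]: "F \<in> borel_measurable borel" by (rule borel_measurable_continuous_onI[OF cont])
  have mP [measurable]: "partial_deriv i F \<in> borel_measurable borel" by (rule borel_measurable_continuous_onI[OF cF])
  have mQ [measurable]: "Q n \<in> borel_measurable borel" for n unfolding Q_def[abs_def] by measurable
  \<comment> \<open>Steps have length at most 1, so all difference quotients vanish outside one ball
    of radius \<open>R + 1\<close>; with the bound \<open>M\<close> this gives a common integrable
    majorant.\<close>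
  have Q0: "Q n x = 0" if "x \<notin> cball 0 (R + 1)" for n x
  proof -
    have nx: "R + 1 < norm x" using that by simp
    have "x \<notin> K" using R[of x] nx by auto
    moreover have "x + t n *\<^sub>R ?e \<notin> K"
    proof
      assume "x + t n *\<^sub>R ?e \<in> K"
      then have "norm (x + t n *\<^sub>R ?e) \<le> R" by (rule R)
      moreover have "norm x - norm (t n *\<^sub>R ?e) \<le> norm (x + t n *\<^sub>R ?e)"
        using norm_diff_ineq[of x "t n *\<^sub>R ?e"] by simp
      moreover have "norm (t n *\<^sub>R ?e) \<le> 1" using t[of n] by (simp add: norm_axis_1)
      ultimately show False using nx by linarith
    qed
    ultimately show ?thesis by (simp add: Q_def FK)
  qed
  have fin: "emeasure lborel (cball (0::real^'d) (R + 1)) < \<infinity>" by (rule emeasure_lborel_cball_finite)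
  have dom: "integrable lborel (\<lambda>x. M * indicator (cball (0::real^'d) (R + 1)) x)"
    by (intro integrable_mult_right integrable_real_indicator fin) simp
  have Fint: "integrable lborel F"
  proof -
    have "compact (F ` K)" by (rule compact_continuous_image[OF continuous_on_subset[OF cont] K]) simp
    then obtain B where B: "\<And>x. x \<in> K \<Longrightarrow> \<bar>F x\<bar> \<le> B" using compact_imp_bounded by (fastforce simp: bounded_iff)
    have "integrable lborel (\<lambda>x. max B 0 * indicator K x)"
      by (intro integrable_mult_right integrable_real_indicator emeasure_compact_finite K) (simp add: borel_compact K)
    then show ?thesis
    proof (rule Bochner_Integration.integrable_bound)
      show "AE x in lborel. norm (F x) \<le> norm (max B 0 * indicator K x)"
      proof (rule AE_I2)
        fix x show "norm (F x) \<le> norm (max B 0 * indicator K x)"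
          using B[of x] FK[of x] by (cases "x \<in> K") auto
      qed
    qed simp
  qed
  have tr: "integrable lborel (\<lambda>x. F (x + c))" "(\<integral>x. F (x + c) \<partial>lborel) = (\<integral>x. F x \<partial>lborel)" for c
  proof -
    have d: "distr lborel borel ((+) c) = lborel" by (rule lborel_distr_plus)
    have "integrable (distr lborel borel ((+) c)) F" using Fint by (simp only: d)
    then show "integrable lborel (\<lambda>x. F (x + c))" by (subst (asm) integrable_distr_eq) (auto simp: add.commute)
    have "(\<integral>x. F x \<partial>lborel) = (\<integral>x. F x \<partial>(distr lborel borel ((+) c)))" by (simp only: d)
    also have "\<dots> = (\<integral>x. F (c + x) \<partial>lborel)" by (subst integral_distr) auto
    finally show "(\<integral>x. F (x + c) \<partial>lborel) = (\<integral>x. F x \<partial>lborel)" by (simp add: add.commute)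
  qed
  have Qint: "(\<integral>x. Q n x \<partial>lborel) = 0" for n
  proof -
    have "(\<integral>x. Q n x \<partial>lborel) = ((\<integral>x. F (x + t n *\<^sub>R ?e) \<partial>lborel) - (\<integral>x. F x \<partial>lborel)) / t n"
      unfolding Q_def using tr(1) Fint by simp
    then show ?thesis by (simp add: tr(2))
  qed
  have t0: "t \<longlonglongrightarrow> 0" unfolding t_def by (rule LIMSEQ_Suc[OF lim_1_over_n, unfolded o_def])
  have "(\<lambda>n. \<integral>x. Q n x \<partial>lborel) \<longlonglongrightarrow> (\<integral>x. partial_deriv i F x \<partial>lborel)"
  proof (rule integral_dominated_convergence[where w = "\<lambda>x. M * indicator (cball 0 (R + 1)) x"])
    show "AE x in lborel. (\<lambda>n. Q n x) \<longlonglongrightarrow> partial_deriv i F x"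
    proof (rule AE_I2)
      fix x
      have "((\<lambda>h. (F (x + (0 + h) *\<^sub>R ?e) - F (x + 0 *\<^sub>R ?e)) / h) \<longlongrightarrow> partial_deriv i F (x + 0 *\<^sub>R ?e)) (at 0)"
        using line[of x 0] unfolding DERIV_def .
      then have "((\<lambda>h. (F (x + h *\<^sub>R ?e) - F x) / h) \<longlongrightarrow> partial_deriv i F x) (at 0)" by simp
      moreover have "filterlim t (at 0) sequentially"
        using t0 t(1) by (auto simp: filterlim_at intro!: always_eventually less_imp_neq[symmetric])
      ultimately show "(\<lambda>n. Q n x) \<longlonglongrightarrow> partial_deriv i F x"
        unfolding Q_def by (rule filterlim_compose)
    qed
    show "AE x in lborel. norm (Q n x) \<le> M * indicator (cball 0 (R + 1)) x" for n
    proof (rule AE_I2)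
      fix x show "norm (Q n x) \<le> M * indicator (cball 0 (R + 1)) x"
        using lip[of n x] Q0[of x n] by (cases "x \<in> cball 0 (R + 1)") auto
    qed
  qed (use dom in simp_all)
  then show ?thesis by (simp add: Qint LIMSEQ_const_iff)
qed

section \<open>The Poincare inequality\<close>

lemma integral_D_lborel:
  fixes f :: "real^'d \<Rightarrow> real"
  assumes f: "f \<in> borel_measurable borel" and 0: "\<And>x. x \<notin> D \<Longrightarrow> f x = 0"
  shows "(\<integral>x. f x \<partial>MD) = (\<integral>x. f x \<partial>lborel)"
proof -
  have "(\<integral>x. f x \<partial>MD) = (\<integral>x. indicator D x *\<^sub>R f x \<partial>lebesgue)"
    by (rule integral_restrict_space) (use D_sets in simp)
  also have "(\<lambda>x. indicator D x *\<^sub>R f x) = f" using 0 by (auto simp: fun_eq_iff indicator_def)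
  also have "(\<integral>x. f x \<partial>lebesgue) = (\<integral>x. f x \<partial>lborel)" by (rule integral_completion) (use f in simp)
  finally show ?thesis .
qed

text \<open>The derivative of \<open>x $ i * (\<phi> x)\<^sup>2\<close> in direction
  \<open>i\<close> has integral zero, so the integral of \<open>\<phi>\<^sup>2\<close> is -2 times
  that of \<open>x $ i * \<phi> * partial_deriv i \<phi>\<close>. Bounding the coordinate by
  \<open>R\<close> and applying Cauchy-Schwarz yields the constant \<open>2 * R\<close>; any
  direction \<open>i\<close> will do.\<close>

lemma poincare_test_function:
  assumes \<phi>: "test_function D \<phi>" and R: "\<And>x. x \<in> D \<Longrightarrow> norm x \<le> R"
  shows "L2_norm_on D \<phi> \<le> 2 * R * L2_norm_on D (grad \<phi>)"
proof -
  obtain i :: 'd where True by blast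
  have R0: "0 \<le> R" using D_ne R norm_ge_zero order_trans by blast
  let ?p = "partial_deriv i \<phi>"
  have d: "\<phi> differentiable (at x)" for x by (rule test_function_differentiable[OF \<phi>])
  have cp: "continuous_on UNIV ?p" by (rule test_function_continuous[OF test_function_partial_deriv[OF \<phi>]])
  have c\<phi>: "continuous_on UNIV \<phi>" by (rule test_function_continuous[OF \<phi>])
  let ?F = "\<lambda>x. x $ i * (\<phi> x * \<phi> x)"
  have dn: "(\<lambda>x::real^'d. x $ i) differentiable (at x)" for x
    using C_k_nth[of 1 i] by simp
  have d2: "(\<lambda>x. \<phi> x * \<phi> x) differentiable (at x)" for x by (rule differentiable_mult[OF d d])
  have pn: "partial_deriv i (\<lambda>x. x $ i) x = 1" for x :: "real^'d"
    using partial_derivI[OF bounded_linear_imp_has_derivative[OF bounded_linear_vec_nth], of i i x] by simp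
  have pF: "partial_deriv i ?F = (\<lambda>x. \<phi> x * \<phi> x + 2 * (x $ i * \<phi> x * ?p x))"
  proof
    fix x
    have "partial_deriv i ?F x = x $ i * partial_deriv i (\<lambda>x. \<phi> x * \<phi> x) x + partial_deriv i (\<lambda>x. x $ i) x * (\<phi> x * \<phi> x)"
      by (rule partial_deriv_mult[OF dn d2])
    also have "partial_deriv i (\<lambda>x. \<phi> x * \<phi> x) x = \<phi> x * ?p x + ?p x * \<phi> x"
      by (rule partial_deriv_mult[OF d d])
    finally show "partial_deriv i ?F x = \<phi> x * \<phi> x + 2 * (x $ i * \<phi> x * ?p x)"
      by (simp add: pn algebra_simps)
  qed
  have zero: "\<phi> x = 0" if "x \<notin> closure {x. \<phi> x \<noteq> 0}" for x
    using that closure_subset[of "{x. \<phi> x \<noteq> 0}"] by blast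
  have "(\<integral>x. partial_deriv i ?F x \<partial>lborel) = 0"
  proof (rule integral_partial_deriv_0[where K = "closure {x. \<phi> x \<noteq> 0}"])
    show "?F differentiable (at x)" for x by (rule differentiable_mult[OF dn d2])
    show "continuous_on UNIV (partial_deriv i ?F)"
      unfolding pF by (intro continuous_intros cp c\<phi>)
    show "compact (closure {x. \<phi> x \<noteq> 0})" using \<phi> by (simp add: test_function_def)
    show "?F x = 0" if "x \<notin> closure {x. \<phi> x \<noteq> 0}" for x
      by (simp only: zero[OF that] mult_zero_left mult_zero_right)
  qed
  moreover have out: "\<phi> x = 0" if "x \<notin> D" for x
  proof (rule zero)
    show "x \<notin> closure {x. \<phi> x \<noteq> 0}" using that \<phi> unfolding test_function_def by blast
  qed
  have L: "\<phi> \<in> L2_on D" "?p \<in> L2_on D" using test_function_L2 \<phi> test_function_partial_deriv by blast+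
  have "(\<integral>x. partial_deriv i ?F x \<partial>MD) = (\<integral>x. partial_deriv i ?F x \<partial>lborel)"
  proof (rule integral_D_lborel)
    show "partial_deriv i ?F \<in> borel_measurable borel"
      unfolding pF by (intro borel_measurable_continuous_onI continuous_intros cp c\<phi>)
  qed (simp add: pF out)
  ultimately have 0: "(\<integral>x. \<phi> x * \<phi> x + 2 * (x $ i * \<phi> x * ?p x) \<partial>MD) = 0" by (simp add: pF)
  have i1: "integrable MD (\<lambda>x. \<phi> x * \<phi> x)" by (rule integrable_mult_L2[OF L(1) L(1)])
  have Lp: "\<phi> \<in> borel_measurable MD" "integrable MD (\<lambda>x. (norm (\<phi> x))\<^sup>2)" "?p \<in> borel_measurable MD" "integrable MD (\<lambda>x. (norm (?p x))\<^sup>2)"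
    using L by (auto simp: L2_on_def)
  note i3 = integrable_norm_mult_L2[OF Lp]
  have xb: "\<bar>x $ i\<bar> \<le> R" if "x \<in> D" for x using R[OF that] component_le_norm_cart[of x i] by linarith
  have bd: "\<bar>x $ i * \<phi> x * ?p x\<bar> \<le> R * (norm (\<phi> x) * norm (?p x))" for x
  proof (cases "x \<in> D")
    case True
    then show ?thesis using xb by (auto simp: abs_mult mult.assoc intro: mult_right_mono)
  qed (simp add: out)
  have i2: "integrable MD (\<lambda>x. x $ i * \<phi> x * ?p x)"
  proof (rule Bochner_Integration.integrable_bound[OF integrable_mult_right[OF i3, of R]])
    show "(\<lambda>x. x $ i * \<phi> x * ?p x) \<in> borel_measurable MD"
      by (intro continuous_measurable_D continuous_intros cp c\<phi>)
    show "AE x in MD. norm (x $ i * \<phi> x * ?p x) \<le> norm (R * (norm (\<phi> x) * norm (?p x)))"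
      using bd R0 by (intro AE_I2) simp
  qed
  have "(L2_norm_on D \<phi>)\<^sup>2 = (\<integral>x. \<phi> x * \<phi> x \<partial>MD)" unfolding L2_norm_sq by (simp add: power2_eq_square)
  also have "\<dots> = - 2 * (\<integral>x. x $ i * \<phi> x * ?p x \<partial>MD)" using 0 i1 i2 by simp
  also have "\<dots> \<le> 2 * \<bar>\<integral>x. x $ i * \<phi> x * ?p x \<partial>MD\<bar>" by simp
  also have "\<bar>\<integral>x. x $ i * \<phi> x * ?p x \<partial>MD\<bar> \<le> (\<integral>x. R * (norm (\<phi> x) * norm (?p x)) \<partial>MD)"
  proof -
    have "\<bar>\<integral>x. x $ i * \<phi> x * ?p x \<partial>MD\<bar> \<le> (\<integral>x. \<bar>x $ i * \<phi> x * ?p x\<bar> \<partial>MD)"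
      using integral_norm_bound[of MD "\<lambda>x. x $ i * \<phi> x * ?p x"] by simp
    also have "\<dots> \<le> (\<integral>x. R * (norm (\<phi> x) * norm (?p x)) \<partial>MD)"
      by (rule integral_mono) (use i2 i3 bd in auto)
    finally show ?thesis .
  qed
  also have "\<dots> = R * (\<integral>x. norm (\<phi> x) * norm (?p x) \<partial>MD)" by simp
  also have "\<dots> \<le> R * (L2_norm_on D \<phi> * L2_norm_on D ?p)" by (intro mult_left_mono L2_inner_le(1) L R0)
  finally have sq: "(L2_norm_on D \<phi>)\<^sup>2 \<le> 2 * (R * (L2_norm_on D \<phi> * L2_norm_on D ?p))" by simp
  have "L2_norm_on D \<phi> \<le> 2 * R * L2_norm_on D ?p"
  proof (cases "L2_norm_on D \<phi> = 0")
    case True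
    then show ?thesis using R0 L2_norm_nonneg[of D ?p] by simp
  next
    case False
    then have pos: "0 < L2_norm_on D \<phi>" using L2_norm_nonneg[of D \<phi>] by linarith
    have "L2_norm_on D \<phi> * L2_norm_on D \<phi> \<le> L2_norm_on D \<phi> * (2 * R * L2_norm_on D ?p)"
      using sq by (simp add: power2_eq_square mult_ac)
    then show ?thesis using pos by (rule mult_left_le_imp_le)
  qed
  also have "\<dots> \<le> 2 * R * L2_norm_on D (grad \<phi>)"
  proof (rule mult_left_mono)
    show "L2_norm_on D ?p \<le> L2_norm_on D (grad \<phi>)"
      unfolding L2_norm_on_def
    proof (intro real_sqrt_le_mono integral_mono)
      show "integrable MD (\<lambda>x. (norm (grad \<phi> x))\<^sup>2)" using grad_L2[OF \<phi>] by (simp add: L2_on_def)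
      show "(norm (?p x))\<^sup>2 \<le> (norm (grad \<phi> x))\<^sup>2" for x
        using component_le_norm_cart[of "grad \<phi> x" i] by (intro power_mono) simp_all
    qed (rule Lp(4))
  qed (use R0 in simp)
  finally show ?thesis .
qed

text \<open>The inequality passes to the limit along the approximating test functions that the
  definition of \<open>H01\<close> provides; their limit gradient has the same norm as
  \<open>weak_grad\<close> by uniqueness.\<close>

lemma poincare:
  assumes R: "\<And>x. x \<in> D \<Longrightarrow> norm x \<le> R" and v: "v \<in> H01 D"
  shows "L2_norm_on D v \<le> 2 * R * H01_norm D v"
proof -
  have R0: "0 \<le> R" using D_ne R norm_ge_zero order_trans by blast
  obtain g \<phi> where g: "has_weak_gradient D v g" "\<And>k::nat. test_function D (\<phi> k)"
    and g1: "(\<lambda>k. L2_norm_on D (\<lambda>x. v x - \<phi> k x)) \<longlonglongrightarrow> 0"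
    and g2: "(\<lambda>k. L2_norm_on D (\<lambda>x. g x - grad (\<phi> k) x)) \<longlonglongrightarrow> 0"
    using v unfolding H01_def by blast
  have L: "v \<in> L2_on D" "g \<in> L2_on D" using g(1) by (auto simp: has_weak_gradient_def)
  have gw: "L2_norm_on D g = H01_norm D v"
    unfolding H01_norm_def
    by (rule L2_norm_cong_AE[OF weak_gradient_unique[OF g(1) H01_weak_gradient[OF v]]])
       (use L(2) H01_L2(2)[OF v] in \<open>auto simp: L2_on_def\<close>)
  have le: "L2_norm_on D v \<le> L2_norm_on D (\<lambda>x. v x - \<phi> k x) + 2 * R * (L2_norm_on D (\<lambda>x. g x - grad (\<phi> k) x) + L2_norm_on D g)" for k
  proof -
    note \<phi> = test_function_L2[OF g(2)[of k]] and G = grad_L2[OF g(2)[of k]]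
    have "L2_norm_on D v \<le> L2_norm_on D (\<lambda>x. v x - \<phi> k x) + L2_norm_on D (\<phi> k)"
      using L2_triangle[OF L2_diff[OF L(1) \<phi>] \<phi>] by simp
    also have "L2_norm_on D (\<phi> k) \<le> 2 * R * L2_norm_on D (grad (\<phi> k))"
      by (rule poincare_test_function[OF g(2) R])
    also have "L2_norm_on D (grad (\<phi> k)) \<le> L2_norm_on D (\<lambda>x. g x - grad (\<phi> k) x) + L2_norm_on D g"
    proof -
      have "L2_norm_on D (\<lambda>x. (-1) *\<^sub>R (g x - grad (\<phi> k) x) + g x) \<le> L2_norm_on D (\<lambda>x. (-1) *\<^sub>R (g x - grad (\<phi> k) x)) + L2_norm_on D g"
        by (rule L2_triangle[OF L2_scale[OF L2_diff[OF L(2) G]] L(2)])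
      then show ?thesis by (simp only: L2_norm_scale) simp
    qed
    finally show ?thesis using R0 by (simp add: mult_left_mono)
  qed
  have "(\<lambda>k. L2_norm_on D (\<lambda>x. v x - \<phi> k x) + 2 * R * (L2_norm_on D (\<lambda>x. g x - grad (\<phi> k) x) + L2_norm_on D g))
      \<longlonglongrightarrow> 0 + 2 * R * (0 + L2_norm_on D g)"
    by (intro tendsto_intros g1 g2)
  then have "L2_norm_on D v \<le> 0 + 2 * R * (0 + L2_norm_on D g)"
    by (rule LIMSEQ_le_const) (use le in blast)
  then show ?thesis by (simp add: gw)
qed

end

section \<open>Piecewise linear functions and orthonormal bases\<close>

text \<open>Affine independence makes the differences to one vertex linearly independent, so a
  linear form can be prescribed on them; its adjoint at 1 is the vector that represents it.\<close>

lemma affine_interpolation: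
  fixes C :: "'a::euclidean_space set"
  assumes "\<not> affine_dependent C"
  shows "\<exists>b c. \<forall>v\<in>C. b \<bullet> v + c = g v"
proof (cases "C = {}")
  case False
  then obtain a where a: "a \<in> C" by blast
  then have "independent ((\<lambda>x. - a + x) ` (C - {a}))"
    using assms affine_dependent_iff_dependent2 by blast
  then obtain f :: "'a \<Rightarrow> real" where f: "linear f" "\<forall>x\<in>(\<lambda>x. - a + x) ` (C - {a}). f x = g (a + x) - g a"
    using linear_independent_extend[of "(\<lambda>x. - a + x) ` (C - {a})" "\<lambda>x. g (a + x) - g a"] by blast
  have fi: "adjoint f 1 \<bullet> x = f x" for x
    using adjoint_works[OF f(1), of x 1] by (simp add: inner_commute)
  have "adjoint f 1 \<bullet> v + (g a - f a) = g v" if "v \<in> C" for v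
  proof (cases "v = a")
    case False
    with that have "- a + v \<in> (\<lambda>x. - a + x) ` (C - {a})" by blast
    with f(2) have "f (- a + v) = g v - g a" by fastforce
    moreover have "f (- a + v) = f v - f a" using linear_diff[OF f(1), of v a] by simp
    ultimately show ?thesis by (simp add: fi)
  qed (simp add: fi)
  then show ?thesis by blast
qed simp

lemma affine_eq_on_convex_hull:
  fixes b b' :: "'a::euclidean_space"
  assumes "\<And>v. v \<in> C \<Longrightarrow> b \<bullet> v + c = b' \<bullet> v + c'" "x \<in> convex hull C"
  shows "b \<bullet> x + c = b' \<bullet> x + c'"
proof -
  have "convex hull C \<subseteq> {x. (b - b') \<bullet> x = c' - c}"
  proof (rule hull_minimal)
    show "C \<subseteq> {x. (b - b') \<bullet> x = c' - c}" using assms(1) by (auto simp: inner_diff_left algebra_simps)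
  qed (rule convex_hyperplane)
  with assms(2) show ?thesis by (auto simp: inner_diff_left algebra_simps)
qed

lemma finite_nodes:
  assumes "triangulation \<T>"
  shows "finite (nodes \<T>)"
proof -
  have "finite {z. z extreme_point_of K}" if K: "K \<in> \<T>" for K
  proof -
    obtain n C where "finite C" "K = convex hull C"
      using assms K unfolding triangulation_def simplex by meson
    then show ?thesis using extreme_point_of_convex_hull finite_subset[of "{z. z extreme_point_of K}" C] by blast
  qed
  moreover have "nodes \<T> = (\<Union>K\<in>\<T>. {z. z extreme_point_of K})" by (auto simp: nodes_def)
  ultimately show ?thesis using assms by (simp add: triangulation_def)
qed

text \<open>As \<open>hat_function\<close> is defined by \<open>THE\<close>, nothing is known about
  it before existence and uniqueness are shown. The affine interpolants on two simplices agree on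
  the intersection, because this is a common face, hence the hull of extreme points that are
  vertices of both. Uniqueness holds because an affine function on a simplex is determined by its
  vertex values.\<close>

lemma continuous_on_hat_function:
  fixes \<T> :: "(real^'d) set set"
  assumes \<T>: "triangulation \<T>"
  shows "continuous_on (\<Union>\<T>) (hat_function \<T> z)"
proof -
  let ?P = "\<lambda>\<phi>. continuous_on (\<Union>\<T>) \<phi> \<and> (\<forall>K\<in>\<T>. \<exists>b c. \<forall>x\<in>K. \<phi> x = b \<bullet> x + c) \<and>
     (\<forall>w\<in>nodes \<T>. \<phi> w = (if w = z then 1 else 0)) \<and> (\<forall>x. x \<notin> \<Union>\<T> \<longrightarrow> \<phi> x = (0::real))"
  let ?ext = "\<lambda>K::(real^'d) set. {v. v extreme_point_of K}"
  have hull: "K = convex hull ?ext K" "\<not> affine_dependent (?ext K)" "closed K" "convex K" if K: "K \<in> \<T>" for K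
  proof -
    obtain n where n: "n simplex K" using \<T> K unfolding triangulation_def by blast
    then obtain C where C: "\<not> affine_dependent C" "K = convex hull C" unfolding simplex by blast
    have "?ext K = C" unfolding C(2) using extreme_point_of_convex_hull_affine_independent[OF C(1)] by auto
    with C show "K = convex hull ?ext K" "\<not> affine_dependent (?ext K)" by simp_all
    show "closed K" "convex K" using n closed_simplex convex_simplex by blast+
  qed
  have "\<exists>b c. \<forall>v\<in>?ext K. b \<bullet> v + c = (if v = z then 1 else 0)" if "K \<in> \<T>" for K
    by (rule affine_interpolation[OF hull(2)[OF that]])
  then obtain b c where bc: "\<And>K v. K \<in> \<T> \<Longrightarrow> v extreme_point_of K \<Longrightarrow> b K \<bullet> v + c K = (if v = z then 1 else 0)"
    by (simp only: mem_Collect_eq Ball_def) metis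
  have agree: "b K \<bullet> x + c K = b L \<bullet> x + c L" if K: "K \<in> \<T>" and L: "L \<in> \<T>" and x: "x \<in> K" "x \<in> L" for K L x
  proof -
    have f: "K \<inter> L face_of K" "L \<inter> K face_of L" using \<T> K L unfolding triangulation_def by blast+
    have "compact (K \<inter> L)"
      using K L \<T> compact_simplex closed_simplex unfolding triangulation_def by (meson compact_Int_closed)
    then have h: "K \<inter> L = convex hull ?ext (K \<inter> L)"
      by (rule Krein_Milman_Minkowski) (intro convex_Int hull K L)
    show ?thesis
    proof (rule affine_eq_on_convex_hull)
      show "x \<in> convex hull ?ext (K \<inter> L)" using x h by blast
      fix v assume "v \<in> ?ext (K \<inter> L)"
      then have "v extreme_point_of K" "v extreme_point_of L"
        using extreme_point_of_face[OF f(1), of v] extreme_point_of_face[OF f(2), of v] by (auto simp: Int_commute)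
      then show "b K \<bullet> v + c K = b L \<bullet> v + c L" using bc K L by simp
    qed
  qed
  define \<phi> where "\<phi> x = (if x \<in> \<Union>\<T> then let K = SOME K. K \<in> \<T> \<and> x \<in> K in b K \<bullet> x + c K else 0)" for x
  have \<phi>: "\<phi> x = b K \<bullet> x + c K" if "K \<in> \<T>" "x \<in> K" for K x
  proof -
    define L where "L = (SOME K. K \<in> \<T> \<and> x \<in> K)"
    have L: "L \<in> \<T> \<and> x \<in> L"
      unfolding L_def by (rule someI[of _ K]) (use that in simp)
    have "\<phi> x = b L \<bullet> x + c L" using that unfolding \<phi>_def Let_def L_def[symmetric] by (subst if_P) blast+
    also have "\<dots> = b K \<bullet> x + c K" using agree[of L K x] L that by blast
    finally show ?thesis .
  qed
  have "?P \<phi>"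
  proof (intro conjI ballI allI impI)
    have "continuous_on (\<Union>K\<in>\<T>. K) \<phi>"
    proof (rule continuous_on_closed_Union)
      show "finite \<T>" using \<T> by (simp add: triangulation_def)
      show "continuous_on K \<phi>" if "K \<in> \<T>" for K
      proof (rule continuous_on_eq)
        show "continuous_on K (\<lambda>x. b K \<bullet> x + c K)" by (intro continuous_intros)
        show "b K \<bullet> x + c K = \<phi> x" if "x \<in> K" for x using \<phi> \<open>K \<in> \<T>\<close> that by simp
      qed
    qed (rule hull(3))
    then show "continuous_on (\<Union>\<T>) \<phi>" by simp
    show "\<exists>b c. \<forall>x\<in>K. \<phi> x = b \<bullet> x + c" if "K \<in> \<T>" for K using \<phi>[OF that] by blast
    show "\<phi> w = (if w = z then 1 else 0)" if w: "w \<in> nodes \<T>" for w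
    proof -
      obtain K where K: "K \<in> \<T>" "w extreme_point_of K" using w by (auto simp: nodes_def)
      then have "w \<in> K" by (simp add: extreme_point_of_def)
      then show ?thesis using \<phi>[OF K(1)] bc[OF K] by simp
    qed
    show "\<phi> x = 0" if "x \<notin> \<Union>\<T>" for x using that by (simp add: \<phi>_def)
  qed
  moreover have "\<chi>' = \<phi>" if P: "?P \<chi>'" for \<chi>'
  proof
    fix x
    note P1 = P[THEN conjunct2, THEN conjunct1] and P2 = P[THEN conjunct2, THEN conjunct2, THEN conjunct1]
      and P3 = P[THEN conjunct2, THEN conjunct2, THEN conjunct2]
    show "\<chi>' x = \<phi> x"
    proof (cases "x \<in> \<Union>\<T>")
      case True
      then obtain K where K: "K \<in> \<T>" "x \<in> K" by blast
      obtain b' c' where b': "\<And>x. x \<in> K \<Longrightarrow> \<chi>' x = b' \<bullet> x + c'" using bspec[OF P1 K(1)] by blast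
      have "b' \<bullet> x + c' = b K \<bullet> x + c K"
      proof (rule affine_eq_on_convex_hull)
        show "x \<in> convex hull ?ext K" using K(2) hull(1)[OF K(1)] by blast
        fix v assume v: "v \<in> ?ext K"
        then have "v \<in> K" "v \<in> nodes \<T>" using K(1) by (auto simp: extreme_point_of_def nodes_def)
        then have "b' \<bullet> v + c' = (if v = z then 1 else 0)" using bspec[OF P2, of v] b'[of v] by simp
        then show "b' \<bullet> v + c' = b K \<bullet> v + c K" using bc K(1) v by simp
      qed
      then show ?thesis using b' \<phi> K by simp
    next
      case False
      then show ?thesis using P3 by (simp add: \<phi>_def)
    qed
  qed
  ultimately have "?P (hat_function \<T> z)"
    unfolding hat_function_def by (rule theI)
  then show ?thesis by blast
qed

lemma fe_family_triangulation:
  fixes D :: "(real^'d) set"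
  assumes "fe_family D H V" "h \<in> H"
  obtains \<T> where "triangulation \<T>" "\<Union>\<T> = closure D" "V h = P1_space D \<T>" "V h \<subseteq> H01 D"
proof -
  obtain \<T> :: "nat \<Rightarrow> (real^'d) set set" where \<T>: "regular_triangulation D (\<T> 0)" "\<And>k. uniform_partition (\<T> k) (\<T> (Suc k))"
    and V: "\<And>h. h \<in> H \<Longrightarrow> (\<exists>k. mesh_size (\<T> k) = h \<and> V h = P1_space D (\<T> k)) \<and> V h \<subseteq> H01 D"
    using assms(1) unfolding fe_family_def by blast
  have T: "triangulation (\<T> k) \<and> \<Union>(\<T> k) = closure D" for k
  proof (induction k)
    case 0
    then show ?case using \<T>(1) by (simp add: regular_triangulation_def)
  next
    case (Suc k)
    have tri: "triangulation (\<T> (Suc k))" and sub: "\<And>K'. K' \<in> \<T> (Suc k) \<Longrightarrow> \<exists>K\<in>\<T> k. K' \<subseteq> K"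
      and cover: "\<And>K. K \<in> \<T> k \<Longrightarrow> \<Union>{K'\<in>\<T> (Suc k). K' \<subseteq> K} = K"
      using \<T>(2)[of k] by (simp_all add: uniform_partition_def)
    have "\<Union>(\<T> (Suc k)) = \<Union>(\<T> k)"
    proof
      show "\<Union>(\<T> (Suc k)) \<subseteq> \<Union>(\<T> k)"
      proof (rule Union_least)
        fix K' assume "K' \<in> \<T> (Suc k)"
        then obtain K where "K \<in> \<T> k" "K' \<subseteq> K" using sub by blast
        then show "K' \<subseteq> \<Union>(\<T> k)" by blast
      qed
      show "\<Union>(\<T> k) \<subseteq> \<Union>(\<T> (Suc k))"
      proof (rule Union_least)
        fix K assume "K \<in> \<T> k"
        from cover[OF this] show "K \<subseteq> \<Union>(\<T> (Suc k))" by blast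
      qed
    qed
    with tri Suc show ?case by simp
  qed
  obtain k where "V h = P1_space D (\<T> k)" "V h \<subseteq> H01 D" using V[OF assms(2)] by (elim conjE exE)
  with T[of k] show thesis by (intro that[of "\<T> k"]) simp_all
qed

section \<open>An orthonormal basis of the finite element space\<close>

context bounded_domain begin

abbreviation grad_inner :: "(real^'d \<Rightarrow> real) \<Rightarrow> (real^'d \<Rightarrow> real) \<Rightarrow> real" where
  "grad_inner v w \<equiv> \<integral>x. weak_grad D v x \<bullet> weak_grad D w x \<partial>MD"

lemma weak_grad_measurable [measurable]: "v \<in> H01 D \<Longrightarrow> weak_grad D v \<in> borel_measurable MD"
  using H01_L2(2) by (auto simp: L2_on_def)

lemma grad_inner_integrable:
  "v \<in> H01 D \<Longrightarrow> w \<in> H01 D \<Longrightarrow> integrable MD (\<lambda>x. weak_grad D v x \<bullet> weak_grad D w x)"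
  using integrable_inner_L2[of "weak_grad D v" MD "weak_grad D w"] H01_L2(2)[of v] H01_L2(2)[of w]
  by (auto simp: L2_on_def)

lemma grad_inner_commute: "grad_inner v w = grad_inner w v"
  by (simp add: inner_commute)

lemma grad_inner_self: "grad_inner v v = (H01_norm D v)\<^sup>2"
  unfolding H01_norm_def L2_norm_sq by (simp add: power2_norm_eq_inner)

lemma H01_norm_nonneg: "0 \<le> H01_norm D v"
  unfolding H01_norm_def by (rule L2_norm_nonneg)

lemma H01_0:
  assumes "v \<in> H01 D" shows "(\<lambda>x. 0) \<in> H01 D"
  using H01_scale[OF assms, of 0] by simp

lemma H01_sum:
  assumes "finite I" "(\<lambda>x. 0) \<in> H01 D" "\<And>i. i \<in> I \<Longrightarrow> f i \<in> H01 D"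
  shows "(\<lambda>x. \<Sum>i\<in>I. c i * f i x) \<in> H01 D"
  using assms(1,3)
proof (induction I)
  case empty
  then show ?case using assms(2) by simp
next
  case (insert i I)
  then show ?case using H01_add[OF H01_scale[of "f i" "c i"], of "\<lambda>x. \<Sum>i\<in>I. c i * f i x"] by simp
qed

lemma weak_grad_0:
  assumes "(\<lambda>x. 0) \<in> H01 D"
  shows "AE x in MD. weak_grad D (\<lambda>x. 0) x = 0"
  using weak_grad_scale[OF assms, of 0] by simp

lemma weak_grad_sum:
  assumes "finite I" "(\<lambda>x. 0) \<in> H01 D" "\<And>i. i \<in> I \<Longrightarrow> f i \<in> H01 D"
  shows "AE x in MD. weak_grad D (\<lambda>x. \<Sum>i\<in>I. c i * f i x) x = (\<Sum>i\<in>I. c i *\<^sub>R weak_grad D (f i) x)"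
  using assms(1,3)
proof (induction I)
  case empty
  then show ?case using weak_grad_0[OF assms(2)] by simp
next
  case (insert i I)
  have i: "f i \<in> H01 D" and s: "(\<lambda>x. \<Sum>i\<in>I. c i * f i x) \<in> H01 D"
    using insert H01_sum[OF insert.hyps(1) assms(2)] by auto
  have "AE x in MD. weak_grad D (\<lambda>x. \<Sum>i\<in>I. c i * f i x) x = (\<Sum>i\<in>I. c i *\<^sub>R weak_grad D (f i) x)"
    using insert by auto
  with weak_grad_add[OF H01_scale[OF i, of "c i"] s] weak_grad_scale[OF i, of "c i"]
  have "AE x in MD. weak_grad D (\<lambda>x. c i * f i x + (\<Sum>i\<in>I. c i * f i x)) x
      = c i *\<^sub>R weak_grad D (f i) x + (\<Sum>i\<in>I. c i *\<^sub>R weak_grad D (f i) x)"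
    by eventually_elim simp
  then show ?case using insert.hyps by simp
qed

lemma grad_inner_sum:
  assumes "finite I" "w \<in> H01 D" "\<And>i. i \<in> I \<Longrightarrow> f i \<in> H01 D"
  shows "grad_inner (\<lambda>x. \<Sum>i\<in>I. c i * f i x) w = (\<Sum>i\<in>I. c i * grad_inner (f i) w)"
proof -
  note z = H01_0[OF assms(2)]
  have "grad_inner (\<lambda>x. \<Sum>i\<in>I. c i * f i x) w = (\<integral>x. (\<Sum>i\<in>I. c i *\<^sub>R weak_grad D (f i) x) \<bullet> weak_grad D w x \<partial>MD)"
  proof (rule integral_cong_AE)
    show "AE x in MD. weak_grad D (\<lambda>x. \<Sum>i\<in>I. c i * f i x) x \<bullet> weak_grad D w x
        = (\<Sum>i\<in>I. c i *\<^sub>R weak_grad D (f i) x) \<bullet> weak_grad D w x"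
    proof -
      have "AE x in MD. weak_grad D (\<lambda>x. \<Sum>i\<in>I. c i * f i x) x = (\<Sum>i\<in>I. c i *\<^sub>R weak_grad D (f i) x)"
        by (rule weak_grad_sum) (use assms z in auto)
      then show ?thesis by eventually_elim simp
    qed
    show "(\<lambda>x. weak_grad D (\<lambda>x. \<Sum>i\<in>I. c i * f i x) x \<bullet> weak_grad D w x) \<in> borel_measurable MD"
      by (intro borel_measurable_inner weak_grad_measurable assms(2) H01_sum[OF assms(1) z assms(3)])
    show "(\<lambda>x. (\<Sum>i\<in>I. c i *\<^sub>R weak_grad D (f i) x) \<bullet> weak_grad D w x) \<in> borel_measurable MD"
      by (intro borel_measurable_inner borel_measurable_sum borel_measurable_scaleR borel_measurable_const
          weak_grad_measurable assms(2,3))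
  qed
  also have "\<dots> = (\<integral>x. (\<Sum>i\<in>I. c i * (weak_grad D (f i) x \<bullet> weak_grad D w x)) \<partial>MD)"
    by (simp add: inner_sum_left)
  also have "\<dots> = (\<Sum>i\<in>I. c i * grad_inner (f i) w)"
    by (subst Bochner_Integration.integral_sum) (simp_all add: grad_inner_integrable assms)
  finally show ?thesis .
qed

lemma grad_inner_add:
  assumes "v \<in> H01 D" "w \<in> H01 D" "u \<in> H01 D"
  shows "grad_inner (\<lambda>x. a * v x + b * w x) u = a * grad_inner v u + b * grad_inner w u"
  using grad_inner_sum[of "{0,1::nat}" u "\<lambda>i. if i = 0 then v else w" "\<lambda>i. if i = 0 then a else b"] assms by simp

text \<open>A vector whose remainder after projection has norm zero is skipped, which takes care of
  linear dependence. The form is only semidefinite on functions defined at every point, so the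
  expansion is first obtained in the sense that the difference has \<open>H01\<close> norm
  zero.\<close>

lemma gram_schmidt:
  assumes W: "W \<subseteq> H01 D" "(\<lambda>x. 0) \<in> W" and W_lin: "\<And>v w a b. v \<in> W \<Longrightarrow> w \<in> W \<Longrightarrow> (\<lambda>x. a * v x + b * w x) \<in> W"
    and F: "finite F" "F \<subseteq> W"
  shows "\<exists>N \<phi>. (\<forall>i<N. \<phi> i \<in> W) \<and> (\<forall>i<N. \<forall>k<N. grad_inner (\<phi> i) (\<phi> k) = (if i = k then 1 else 0)) \<and>
    (\<forall>g\<in>F. \<exists>c. H01_norm D (\<lambda>x. g x - (\<Sum>i<(N::nat). c i * \<phi> i x)) = 0)"
  using F
proof (induction F)
  case empty
  then show ?case by (auto intro!: exI[of _ 0])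
next
  case (insert g F)
  then have "F \<subseteq> W" by simp
  from insert.IH[OF this] obtain N :: nat and \<phi> where \<phi>0: "\<forall>i<N. \<phi> i \<in> W"
      "\<forall>i<N. \<forall>k<N. grad_inner (\<phi> i) (\<phi> k) = (if i = k then 1 else 0)"
    and F: "\<forall>g\<in>F. \<exists>c. H01_norm D (\<lambda>x. g x - (\<Sum>i<N. c i * \<phi> i x)) = 0"
    by (elim exE conjE)
  have \<phi>: "\<And>i. i < N \<Longrightarrow> \<phi> i \<in> W"
      "\<And>i k. i < N \<Longrightarrow> k < N \<Longrightarrow> grad_inner (\<phi> i) (\<phi> k) = (if i = k then 1 else 0)"
    using \<phi>0 by blast+
  have \<phi>H: "\<phi> i \<in> H01 D" if "i < N" for i using \<phi>(1)[OF that] W(1) by blast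
  have g: "g \<in> W" "g \<in> H01 D" using insert.prems W(1) by auto
  have 0: "(\<lambda>x. 0) \<in> H01 D" using W by blast
  have sW: "(\<lambda>x. \<Sum>i<M. c i * f i x) \<in> W" if "\<And>i. i < M \<Longrightarrow> f i \<in> W" for M c and f :: "nat \<Rightarrow> real^'d \<Rightarrow> real"
    using that
  proof (induction M)
    case (Suc M)
    then show ?case using W_lin[of "\<lambda>x. \<Sum>i<M. c i * f i x" "f M" 1 "c M"] by simp
  qed (simp add: W(2))
  define s where "s x = (\<Sum>i<N. grad_inner g (\<phi> i) * \<phi> i x)" for x
  define r where "r x = g x - s x" for x
  have s: "s \<in> W" unfolding s_def[abs_def] by (rule sW) (rule \<phi>)
  then have sH: "s \<in> H01 D" using W(1) by blast
  have r: "r \<in> W" using W_lin[OF g(1) s, of 1 "-1"] by (simp add: r_def[abs_def])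
  then have rH: "r \<in> H01 D" using W(1) by blast
  have ort: "grad_inner r (\<phi> k) = 0" if k: "k < N" for k
  proof -
    have "grad_inner s (\<phi> k) = (\<Sum>i<N. grad_inner g (\<phi> i) * grad_inner (\<phi> i) (\<phi> k))"
      unfolding s_def[abs_def] by (rule grad_inner_sum) (auto intro: \<phi>H k)
    also have "\<dots> = (\<Sum>i<N. if i = k then grad_inner g (\<phi> i) else 0)"
      by (rule sum.cong) (auto simp: \<phi>(2)[OF _ k])
    also have "\<dots> = grad_inner g (\<phi> k)" using k by (simp only: sum.delta finite_lessThan lessThan_iff if_True)
    finally have "grad_inner s (\<phi> k) = grad_inner g (\<phi> k)" .
    then show ?thesis
      using grad_inner_add[OF g(2) sH \<phi>H[OF k], of 1 "-1"] by (simp add: r_def[abs_def])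
  qed
  show ?case
  proof (cases "H01_norm D r = 0")
    case True
    then have "\<exists>c. H01_norm D (\<lambda>x. g x - (\<Sum>i<N. c i * \<phi> i x)) = 0"
      by (intro exI[of _ "\<lambda>i. grad_inner g (\<phi> i)"]) (simp add: r_def[abs_def] s_def)
    with F \<phi> show ?thesis by (intro exI[of _ N] exI[of _ \<phi>]) simp
  next
    case False
    define t where "t = H01_norm D r"
    have t: "t \<noteq> 0" using False by (simp add: t_def)
    define \<phi>' where "\<phi>' i = (if i = N then (\<lambda>x. (1 / t) * r x) else \<phi> i)" for i
    have N: "\<phi>' N = (\<lambda>x. (1 / t) * r x)" and lt: "\<And>i. i < N \<Longrightarrow> \<phi>' i = \<phi> i" by (auto simp: \<phi>'_def)
    have lin: "grad_inner (\<lambda>x. (1 / t) * r x) w = (1 / t) * grad_inner r w" if "w \<in> H01 D" for w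
      using grad_inner_add[OF rH rH that, of "1 / t" 0] by simp
    have tW: "(\<lambda>x. (1 / t) * r x) \<in> W" using W_lin[OF r r, of "1 / t" 0] by simp
    have o1: "grad_inner (\<phi>' N) (\<phi> k) = 0" if "k < N" for k
      unfolding N lin[OF \<phi>H[OF that]] ort[OF that] by simp
    have o2: "grad_inner (\<phi>' N) (\<phi>' N) = 1"
    proof -
      have "grad_inner (\<phi>' N) (\<phi>' N) = (1 / t) * grad_inner (\<lambda>x. (1 / t) * r x) r"
        unfolding N by (subst lin) (use tW W(1) in \<open>auto simp: grad_inner_commute\<close>)
      also have "\<dots> = (1 / t) * ((1 / t) * t\<^sup>2)" by (simp only: lin[OF rH]) (simp only: grad_inner_self t_def)
      finally show ?thesis using t by (simp add: power2_eq_square)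
    qed
    show ?thesis
    proof (intro exI[of _ "Suc N"] exI[of _ \<phi>'] conjI allI impI ballI)
      show "\<phi>' i \<in> W" if "i < Suc N" for i using that tW \<phi>(1) by (auto simp: \<phi>'_def)
      show "grad_inner (\<phi>' i) (\<phi>' k) = (if i = k then 1 else 0)" if ik: "i < Suc N" "k < Suc N" for i k
      proof -
        consider "i < N" "k < N" | "i < N" "k = N" | "i = N" "k < N" | "i = N" "k = N" using ik by linarith
        then show ?thesis
        proof cases
          case 1 then show ?thesis using \<phi>(2) lt by simp
        next
          case 2
          then show ?thesis using o1[of i] grad_inner_commute[of "\<phi>' i" "\<phi>' k"] lt by simp
        next
          case 3 then show ?thesis using o1[of k] lt by simp
        next
          case 4 then show ?thesis using o2 by simp
        qed
      qed
      show "\<exists>c. H01_norm D (\<lambda>x. k x - (\<Sum>i<Suc N. c i * \<phi>' i x)) = 0" if k: "k \<in> insert g F" for k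
      proof (cases "k = g")
        case True
        have "(\<Sum>i<Suc N. (if i = N then t else grad_inner g (\<phi> i)) * \<phi>' i x) = g x" for x
          using t by (simp add: N lt s_def r_def)
        then have "H01_norm D (\<lambda>x. k x - (\<Sum>i<Suc N. (if i = N then t else grad_inner g (\<phi> i)) * \<phi>' i x)) = H01_norm D (\<lambda>x. 0)"
          using True by simp
        also have "\<dots> = 0" using H01_norm_scale[OF 0, of 0] by simp
        finally show ?thesis by (rule exI[of _ "\<lambda>i. if i = N then t else grad_inner g (\<phi> i)"])
      next
        case False
        then obtain c where "H01_norm D (\<lambda>x. k x - (\<Sum>i<N. c i * \<phi> i x)) = 0" using F k by blast
        then have "H01_norm D (\<lambda>x. k x - (\<Sum>i<Suc N. (if i = N then 0 else c i) * \<phi>' i x)) = 0"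
          by (simp add: lt)
        then show ?thesis by (rule exI[of _ "\<lambda>i. if i = N then 0 else c i"])
      qed
    qed
  qed
qed

text \<open>By the Poincare inequality the function vanishes almost everywhere, and by continuity
  the set where it differs from zero is open, hence empty. This upgrades expansions in norm to
  expansions at every point of \<open>D\<close>, where interpolation for a fixed \<open>x\<close>
  takes place.\<close>

lemma H01_norm_0_imp_0:
  assumes v: "v \<in> H01 D" "continuous_on D v" "H01_norm D v = 0" and x: "x \<in> D"
  shows "v x = 0"
proof (rule ccontr)
  assume ne: "v x \<noteq> 0"
  obtain R where R: "\<And>x. x \<in> D \<Longrightarrow> norm x \<le> R" using bounded_D by (auto simp: bounded_iff)
  have "L2_norm_on D v = 0" using poincare[OF R v(1)] v(3) L2_norm_nonneg[of D v] by simp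
  then have "(\<integral>x. (norm (v x))\<^sup>2 \<partial>MD) = 0" using L2_norm_sq[of D v] by simp
  moreover have "integrable MD (\<lambda>x. (norm (v x))\<^sup>2)" using H01_L2(1)[OF v(1)] by (simp add: L2_on_def)
  ultimately have "AE x in MD. (norm (v x))\<^sup>2 = 0"
    using integral_nonneg_eq_0_iff_AE[of MD "\<lambda>x. (norm (v x))\<^sup>2"] by simp
  then have "AE x in lebesgue. x \<in> D \<longrightarrow> v x = 0" using D_sets by (simp add: AE_restrict_space_iff)
  then have ae: "AE x in lebesgue. x \<notin> {x. x \<in> D \<and> v x \<noteq> 0}" by eventually_elim simp
  have op: "open {x. x \<in> D \<and> v x \<noteq> 0}"
  proof -
    have "open (D \<inter> v -` (- {0}))" by (rule continuous_open_preimage[OF v(2) open_D]) auto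
    moreover have "D \<inter> v -` (- {0}) = {x. x \<in> D \<and> v x \<noteq> 0}" by auto
    ultimately show ?thesis by simp
  qed
  then have "{x. x \<in> D \<and> v x \<noteq> 0} \<in> null_sets lebesgue" using ae by (subst AE_iff_null_sets) simp_all
  with op have "{x. x \<in> D \<and> v x \<noteq> 0} = {}" using open_not_negligible negligible_iff_null_sets by blast
  then show False using x ne by blast
qed

text \<open>Expansions are provided in two forms: at the points of \<open>D\<close>, for
  interpolation with \<open>x\<close> fixed, and with difference of \<open>H01\<close> norm zero,
  for replacing weak gradients in the equation. The basis comes from orthonormalising the hat
  functions.\<close>

lemma orthonormal_basis:
  assumes V: "fe_family D H V" "h \<in> H"
  obtains N :: nat and \<phi> where "\<And>i. i < N \<Longrightarrow> \<phi> i \<in> V h"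
    "\<And>i k. i < N \<Longrightarrow> k < N \<Longrightarrow> grad_inner (\<phi> i) (\<phi> k) = (if i = k then 1 else 0)"
    "\<And>v. v \<in> V h \<Longrightarrow> v \<in> H01 D"
    "\<And>v. v \<in> V h \<Longrightarrow> \<exists>c. H01_norm D (\<lambda>x. v x - (\<Sum>i<N. c i * \<phi> i x)) = 0 \<and> (\<forall>x\<in>D. v x = (\<Sum>i<N. c i * \<phi> i x))"
    "\<And>c. (\<lambda>x. \<Sum>i<N. c i * \<phi> i x) \<in> V h"
proof -
  obtain \<T> where \<T>: "triangulation \<T>" "\<Union>\<T> = closure D" and Vh: "V h = P1_space D \<T>" and VH: "V h \<subseteq> H01 D"
    using fe_family_triangulation[OF V] .
  let ?Z = "nodes \<T> \<inter> D"
  have finZ: "finite ?Z" using finite_nodes[OF \<T>(1)] by simp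
  have cont: "continuous_on D v" if "v \<in> V h" for v
  proof -
    have "continuous_on D (hat_function \<T> z)" for z
      by (rule continuous_on_subset[OF continuous_on_hat_function[OF \<T>(1)]]) (simp add: \<T>(2) closure_subset)
    then show ?thesis using that unfolding Vh P1_space_def by (auto intro!: continuous_intros)
  qed
  have VI: "(\<lambda>x. \<Sum>z\<in>?Z. c z * hat_function \<T> z x) \<in> V h" for c
    unfolding Vh P1_space_def by blast
  have lin: "(\<lambda>x. a * v x + b * w x) \<in> V h" if vw: "v \<in> V h" "w \<in> V h" for v w a b
  proof -
    obtain c e where "v = (\<lambda>x. \<Sum>z\<in>?Z. c z * hat_function \<T> z x)" "w = (\<lambda>x. \<Sum>z\<in>?Z. e z * hat_function \<T> z x)"
      using vw unfolding Vh P1_space_def by blast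
    then have "(\<lambda>x. a * v x + b * w x) = (\<lambda>x. \<Sum>z\<in>?Z. (a * c z + b * e z) * hat_function \<T> z x)"
      by (simp add: sum_distrib_left sum.distrib algebra_simps)
    then show ?thesis using VI by simp
  qed
  have zero: "(\<lambda>x. 0) \<in> V h" using VI[of "\<lambda>_. 0"] by simp
  have hat: "hat_function \<T> z \<in> V h" if z: "z \<in> ?Z" for z
  proof -
    have "(\<Sum>w\<in>?Z. (if w = z then 1 else 0) * hat_function \<T> w x) = hat_function \<T> z x" for x
    proof -
      have "(\<Sum>w\<in>?Z. (if w = z then 1 else 0) * hat_function \<T> w x) = (\<Sum>w\<in>?Z. if w = z then hat_function \<T> w x else 0)"
        by (rule sum.cong) auto
      also have "\<dots> = hat_function \<T> z x" using z finZ by (simp only: sum.delta if_True)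
      finally show ?thesis .
    qed
    then show ?thesis using VI[of "\<lambda>w. if w = z then 1 else 0"] by simp
  qed
  obtain N :: nat and \<phi> where \<phi>: "\<forall>i<N. \<phi> i \<in> V h"
      "\<forall>i<N. \<forall>k<N. grad_inner (\<phi> i) (\<phi> k) = (if i = k then 1 else 0)"
    and span: "\<forall>g\<in>hat_function \<T> ` ?Z. \<exists>c. H01_norm D (\<lambda>x. g x - (\<Sum>i<N. c i * \<phi> i x)) = 0"
    using gram_schmidt[OF VH zero lin, of "hat_function \<T> ` ?Z"] hat finZ by blast
  have sV: "(\<lambda>x. \<Sum>i<M. c i * f i x) \<in> V h" if "\<And>i. i < M \<Longrightarrow> f i \<in> V h" for M c and f :: "nat \<Rightarrow> real^'d \<Rightarrow> real"
    using that
  proof (induction M)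
    case (Suc M)
    then show ?case using lin[of "\<lambda>x. \<Sum>i<M. c i * f i x" "f M" 1 "c M"] by simp
  qed (simp add: zero)
  have "\<forall>z\<in>?Z. \<exists>c. \<forall>x\<in>D. hat_function \<T> z x = (\<Sum>i<N. c i * \<phi> i x)"
  proof
    fix z assume z: "z \<in> ?Z"
    with span obtain c where c: "H01_norm D (\<lambda>x. hat_function \<T> z x - (\<Sum>i<N. c i * \<phi> i x)) = 0" by blast
    have m: "(\<lambda>x. hat_function \<T> z x - (\<Sum>i<N. c i * \<phi> i x)) \<in> V h"
      using lin[OF hat[OF z] sV[of N \<phi> c], of 1 "-1"] \<phi>(1) by simp
    have "hat_function \<T> z x = (\<Sum>i<N. c i * \<phi> i x)" if "x \<in> D" for x
      using H01_norm_0_imp_0[OF subsetD[OF VH m] cont[OF m] c that] by simp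
    then show "\<exists>c. \<forall>x\<in>D. hat_function \<T> z x = (\<Sum>i<N. c i * \<phi> i x)" by blast
  qed
  then obtain e where e: "\<And>z x. z \<in> ?Z \<Longrightarrow> x \<in> D \<Longrightarrow> hat_function \<T> z x = (\<Sum>i<N. e z i * \<phi> i x)" by metis
  show thesis
  proof (rule that[of N \<phi>])
    show "\<phi> i \<in> V h" if "i < N" for i using \<phi>(1) that by blast
    show "grad_inner (\<phi> i) (\<phi> k) = (if i = k then 1 else 0)" if "i < N" "k < N" for i k using \<phi>(2) that by blast
    show "v \<in> H01 D" if "v \<in> V h" for v using VH that by blast
    show "(\<lambda>x. \<Sum>i<N. c i * \<phi> i x) \<in> V h" for c by (rule sV) (use \<phi>(1) in blast)
    show "\<exists>c. H01_norm D (\<lambda>x. v x - (\<Sum>i<N. c i * \<phi> i x)) = 0 \<and> (\<forall>x\<in>D. v x = (\<Sum>i<N. c i * \<phi> i x))"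
      if v: "v \<in> V h" for v
    proof -
      obtain a where a: "v = (\<lambda>x. \<Sum>z\<in>?Z. a z * hat_function \<T> z x)" using v unfolding Vh P1_space_def by blast
      define c where "c i = (\<Sum>z\<in>?Z. a z * e z i)" for i
      have eq: "v x = (\<Sum>i<N. c i * \<phi> i x)" if x: "x \<in> D" for x
      proof -
        have "v x = (\<Sum>z\<in>?Z. a z * (\<Sum>i<N. e z i * \<phi> i x))"
          unfolding a by (rule sum.cong) (simp_all add: e[OF _ x])
        also have "\<dots> = (\<Sum>i<N. c i * \<phi> i x)"
          unfolding c_def sum_distrib_left sum_distrib_right by (subst sum.swap) (simp add: mult.assoc)
        finally show ?thesis .
      qed
      define d where "d = (\<lambda>x. v x - (\<Sum>i<N. c i * \<phi> i x))"
      have dV: "d \<in> V h" unfolding d_def using lin[OF v sV[of N \<phi> c], of 1 "-1"] \<phi>(1) by simp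
      have d0: "d x = 0" if "x \<in> D" for x using eq[OF that] by (simp add: d_def)
      \<comment> \<open>The expansion is known at the points of \<open>D\<close>, whereas the norm
        reads the chosen representative of the gradient. That zero is a weak gradient of the
        difference ties the two together.\<close>
      have "has_weak_gradient D d (\<lambda>x. 0)"
        unfolding has_weak_gradient_def
      proof (intro conjI allI impI)
        show "d \<in> L2_on D" using dV VH H01_L2(1) by blast
        show "(\<lambda>x. 0) \<in> L2_on D" by (simp add: L2_on_def)
        show "(\<integral>x. d x * partial_deriv i \<psi> x \<partial>MD) = - (\<integral>x. (0::real^'d) $ i * \<psi> x \<partial>MD)" for \<psi> i
        proof -
          have "(\<integral>x. d x * partial_deriv i \<psi> x \<partial>MD) = (\<integral>x. 0 \<partial>MD)"
            by (rule Bochner_Integration.integral_cong) (auto simp: d0)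
          then show ?thesis by simp
        qed
      qed
      from weak_gradient_unique[OF H01_weak_gradient this] dV VH
      have "AE x in MD. weak_grad D d x = 0" by blast
      then have "L2_norm_on D (weak_grad D d) = L2_norm_on D (\<lambda>x. 0 :: real^'d)"
        by (rule L2_norm_cong_AE) (use dV VH in auto)
      then have "H01_norm D d = 0" by (simp add: H01_norm_def L2_norm_on_def)
      with eq show ?thesis unfolding d_def by blast
    qed
  qed
qed

end

section \<open>The interpolation error\<close>

lemma in_cube_lattice_point: "in_cube s (lattice_point n z k)"
  by (auto simp: in_cube_def lattice_point_def intro: less_imp_le frac_lt_1)

context parametric_system begin

text \<open>Summed over the components, the aliasing bound leaves the kernel norm of the error,
  which the projection property replaces by that of the solution; the derivative bounds estimate the
  latter. Measurability of the error in \<open>y\<close> also comes from its Fourier series.\<close>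

lemma interpolation_error:
  assumes \<sigma>: "1 \<le> \<sigma>" and lr: "lattice_rule (2 * \<sigma>) \<gamma> s n z"
    and X: "lattice_rule.lattice_sum (2 * \<sigma>) \<gamma> s n z \<le> X" "0 < X"
    and sol: "\<And>y i. in_cube s y \<Longrightarrow> i \<in> I \<Longrightarrow> (\<Sum>k\<in>I. Ay y i k * c k y) = q i"
  defines "e \<equiv> \<lambda>i y. c i y - kernel_interpolant (2 * \<sigma>) \<gamma> s n z (c i) y"
  shows "\<And>i k. i \<in> I \<Longrightarrow> k \<in> I \<Longrightarrow> integrable (cube_measure s) (\<lambda>y. e i y * e k y)"
    and "(\<Sum>i\<in>I. \<integral>y. (e i y)\<^sup>2 \<partial>cube_measure s) \<le> 2 * sqrt X * ((nq / amin)\<^sup>2 *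
      (\<Sum>u\<in>Pow {..<s}. (\<Sum>m\<in>u \<rightarrow>\<^sub>E {1..\<sigma>}. fact (\<Sum>j\<in>u. m j) * (\<Prod>j\<in>u. b j ^ m j * real (Stirling \<sigma> (m j))))\<^sup>2 / \<gamma> u))"
proof -
  interpret R: lattice_rule "2 * \<sigma>" \<gamma> s n z by (rule lr)
  interpret C: prob_space "cube_measure s" by (rule prob_space_cube)
  obtain d where d: "\<And>i l. l \<in> {1..n} \<Longrightarrow> (\<Sum>k=1..n. d i k * R.K (R.pt k) (R.pt l)) = c i (R.pt l)"
    using R.interpolant_exists[of "c _"] by metis
  define \<epsilon> where "\<epsilon> i = (\<lambda>h. uhat h i - R.kcoeff (\<lambda>k. of_real (d i k)) h)" for i
  have as: "(\<lambda>h. uhat h i) abs_summable_on Zs s" if "i \<in> I" for i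
    by (rule rapidly_decreasing_abs_summable[OF rapidly_decreasing_uhat[OF that]])
  have u: "fseries s (\<lambda>h. uhat h i) y = of_real (c i y)" if "i \<in> I" "in_cube s y" for i y
    by (rule solution_eq_fseries[OF that(2) sol[OF that(2)] that(1), symmetric])
  have int: "fseries s (\<lambda>h. uhat h i) (R.pt l) = of_real (\<Sum>k=1..n. d i k * R.K (R.pt k) (R.pt l))"
    if "i \<in> I" "l \<in> {1..n}" for i l
    by (simp only: d[OF that(2)] u[OF that(1) in_cube_lattice_point])
  have kn1: "(\<lambda>h. R.r h * (cmod (uhat h i))\<^sup>2) summable_on Zs s" if "i \<in> I" for i
    by (rule kernel_norm_uhat(1)[OF \<sigma> _ that]) (rule R.\<gamma>)
  have proj: "\<epsilon> i abs_summable_on Zs s"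
    "fseries s (\<epsilon> i) y = fseries s (\<lambda>h. uhat h i) y - of_real (\<Sum>k=1..n. d i k * R.K (R.pt k) y)"
    "m \<in> {0..<int n} \<Longrightarrow> (\<Sum>\<^sub>\<infinity>h\<in>R.rclass m. \<epsilon> i h) = 0"
    "(\<lambda>h. R.r h * (cmod (\<epsilon> i h))\<^sup>2) summable_on Zs s"
    "(\<Sum>\<^sub>\<infinity>h\<in>Zs s. R.r h * (cmod (uhat h i))\<^sup>2) = (\<Sum>\<^sub>\<infinity>h\<in>Zs s. R.r h * (cmod (\<epsilon> i h))\<^sup>2)
      + (\<Sum>\<^sub>\<infinity>h\<in>Zs s. R.r h * (cmod (R.kcoeff (\<lambda>k. of_real (d i k)) h))\<^sup>2)" if i: "i \<in> I" for i y m
  proof -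
    note P = R.interpolation_projection[OF as[OF i] kn1[OF i] int[OF i]]
    show "\<epsilon> i abs_summable_on Zs s" unfolding \<epsilon>_def by (rule P(1))
    show "fseries s (\<epsilon> i) y = fseries s (\<lambda>h. uhat h i) y - of_real (\<Sum>k=1..n. d i k * R.K (R.pt k) y)"
      unfolding \<epsilon>_def by (rule P(2))
    show "m \<in> {0..<int n} \<Longrightarrow> (\<Sum>\<^sub>\<infinity>h\<in>R.rclass m. \<epsilon> i h) = 0" unfolding \<epsilon>_def by (rule P(3))
    show "(\<lambda>h. R.r h * (cmod (\<epsilon> i h))\<^sup>2) summable_on Zs s" unfolding \<epsilon>_def by (rule P(4))
    show "(\<Sum>\<^sub>\<infinity>h\<in>Zs s. R.r h * (cmod (uhat h i))\<^sup>2) = (\<Sum>\<^sub>\<infinity>h\<in>Zs s. R.r h * (cmod (\<epsilon> i h))\<^sup>2)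
      + (\<Sum>\<^sub>\<infinity>h\<in>Zs s. R.r h * (cmod (R.kcoeff (\<lambda>k. of_real (d i k)) h))\<^sup>2)" unfolding \<epsilon>_def by (rule P(6))
  qed
  have e: "of_real (e i y) = fseries s (\<epsilon> i) y" if i: "i \<in> I" and y: "in_cube s y" for i y
  proof -
    have "kernel_interpolant (2 * \<sigma>) \<gamma> s n z (c i) = (\<lambda>y. \<Sum>k=1..n. d i k * R.K (R.pt k) y)"
      by (rule R.kernel_interpolant_eqI) (rule d)
    then have "of_real (e i y) = of_real (c i y) - complex_of_real (\<Sum>k=1..n. d i k * R.K (R.pt k) y)"
      by (simp add: e_def)
    also have "\<dots> = fseries s (\<epsilon> i) y" by (simp only: proj(2)[OF i] u[OF i y])
    finally show ?thesis .
  qed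
  have \<epsilon>: "\<epsilon> i abs_summable_on Zs s" if "i \<in> I" for i by (rule proj(1)[OF that])
  have er: "e i y = Re (fseries s (\<epsilon> i) y)" if "i \<in> I" "y \<in> space (cube_measure s)" for i y
    using e[OF that(1) space_cube_in_cube[OF that(2)]] by (metis Re_complex_of_real)
  have em: "e i \<in> borel_measurable (cube_measure s)" if "i \<in> I" for i
  proof -
    have "(\<lambda>y. Re (fseries s (\<epsilon> i) y)) \<in> borel_measurable (cube_measure s)"
      using borel_measurable_integrable[OF integrable_fseries[OF \<epsilon>[OF that]]] by measurable
    then show ?thesis by (subst measurable_cong[OF er[OF that]])
  qed
  have eb: "\<bar>e i y\<bar> \<le> (\<Sum>\<^sub>\<infinity>h\<in>Zs s. cmod (\<epsilon> i h))" if "i \<in> I" "y \<in> space (cube_measure s)" for i y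
    using order_trans[OF abs_Re_le_cmod fseries_bound[OF \<epsilon>[OF that(1)]]] by (simp only: er[OF that])
  show "integrable (cube_measure s) (\<lambda>y. e i y * e k y)" if i: "i \<in> I" and k: "k \<in> I" for i k
  proof (rule C.integrable_const_bound)
    show "AE y in cube_measure s. norm (e i y * e k y) \<le> (\<Sum>\<^sub>\<infinity>h\<in>Zs s. cmod (\<epsilon> i h)) * (\<Sum>\<^sub>\<infinity>h\<in>Zs s. cmod (\<epsilon> k h))"
      unfolding real_norm_def abs_mult
      by (intro AE_I2 mult_mono eb i k abs_ge_zero infsum_nonneg norm_ge_zero)
    show "(\<lambda>y. e i y * e k y) \<in> borel_measurable (cube_measure s)"
      by (intro borel_measurable_times em i k)
  qed
  have "(\<Sum>i\<in>I. \<integral>y. (e i y)\<^sup>2 \<partial>cube_measure s) = (\<Sum>i\<in>I. \<Sum>\<^sub>\<infinity>h\<in>Zs s. (cmod (\<epsilon> i h))\<^sup>2)"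
  proof (rule sum.cong[OF refl])
    fix i assume i: "i \<in> I"
    have "(\<integral>y. (e i y)\<^sup>2 \<partial>cube_measure s) = (\<integral>y. (cmod (fseries s (\<epsilon> i) y))\<^sup>2 \<partial>cube_measure s)"
    proof (rule Bochner_Integration.integral_cong[OF refl])
      fix y assume "y \<in> space (cube_measure s)"
      from e[OF i space_cube_in_cube[OF this]] show "(e i y)\<^sup>2 = (cmod (fseries s (\<epsilon> i) y))\<^sup>2"
        by (metis norm_of_real power2_abs)
    qed
    also have "\<dots> = (\<Sum>\<^sub>\<infinity>h\<in>Zs s. (cmod (\<epsilon> i h))\<^sup>2)" by (rule parseval_fseries(2)[OF \<epsilon>[OF i]])
    finally show "(\<integral>y. (e i y)\<^sup>2 \<partial>cube_measure s) = (\<Sum>\<^sub>\<infinity>h\<in>Zs s. (cmod (\<epsilon> i h))\<^sup>2)" .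
  qed
  also have "\<dots> \<le> (\<Sum>i\<in>I. 2 * sqrt X * (\<Sum>\<^sub>\<infinity>h\<in>Zs s. R.r h * (cmod (uhat h i))\<^sup>2))"
  proof (rule sum_mono)
    fix i assume i: "i \<in> I"
    have "(\<Sum>\<^sub>\<infinity>h\<in>Zs s. (cmod (\<epsilon> i h))\<^sup>2) \<le> 2 * sqrt X * (\<Sum>\<^sub>\<infinity>h\<in>Zs s. R.r h * (cmod (\<epsilon> i h))\<^sup>2)"
      by (rule R.L2_bound[OF \<epsilon>[OF i] _ _ X]) (rule proj(4)[OF i], rule proj(3)[OF i])
    also have "(\<Sum>\<^sub>\<infinity>h\<in>Zs s. R.r h * (cmod (\<epsilon> i h))\<^sup>2) \<le> (\<Sum>\<^sub>\<infinity>h\<in>Zs s. R.r h * (cmod (uhat h i))\<^sup>2)"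
    proof -
      have "0 \<le> (\<Sum>\<^sub>\<infinity>h\<in>Zs s. R.r h * (cmod (R.kcoeff (\<lambda>k. of_real (d i k)) h))\<^sup>2)"
        by (rule infsum_nonneg) (use R.r_pos in \<open>auto simp: less_imp_le\<close>)
      with proj(5)[OF i] show ?thesis by linarith
    qed
    finally show "(\<Sum>\<^sub>\<infinity>h\<in>Zs s. (cmod (\<epsilon> i h))\<^sup>2) \<le> 2 * sqrt X * (\<Sum>\<^sub>\<infinity>h\<in>Zs s. R.r h * (cmod (uhat h i))\<^sup>2)"
      using X(2) by (simp add: mult_left_mono)
  qed
  also have "\<dots> = 2 * sqrt X * (\<Sum>i\<in>I. \<Sum>\<^sub>\<infinity>h\<in>Zs s. R.r h * (cmod (uhat h i))\<^sup>2)"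
    by (simp only: sum_distrib_left)
  also have "\<dots> \<le> 2 * sqrt X * ((nq / amin)\<^sup>2 *
      (\<Sum>u\<in>Pow {..<s}. (\<Sum>m\<in>u \<rightarrow>\<^sub>E {1..\<sigma>}. fact (\<Sum>j\<in>u. m j) * (\<Prod>j\<in>u. b j ^ m j * real (Stirling \<sigma> (m j))))\<^sup>2 / \<gamma> u))"
    using X(2) by (intro mult_left_mono kernel_norm_uhat(2)[OF \<sigma>] R.\<gamma>) simp_all
  finally show "(\<Sum>i\<in>I. \<integral>y. (e i y)\<^sup>2 \<partial>cube_measure s) \<le> 2 * sqrt X * ((nq / amin)\<^sup>2 *
      (\<Sum>u\<in>Pow {..<s}. (\<Sum>m\<in>u \<rightarrow>\<^sub>E {1..\<sigma>}. fact (\<Sum>j\<in>u. m j) * (\<Prod>j\<in>u. b j ^ m j * real (Stirling \<sigma> (m j))))\<^sup>2 / \<gamma> u))" .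
qed

end

lemma Linf_AE:
  assumes "f \<in> Linf D"
  shows "AE x in lebesgue_on D. \<bar>f x\<bar> \<le> Linf_norm D f"
  using esssup_AE[of "\<lambda>x. ereal \<bar>f x\<bar>" "lebesgue_on D"]
proof eventually_elim
  case (elim x)
  then show ?case using assms by (cases "esssup (lebesgue_on D) (\<lambda>x. ereal \<bar>f x\<bar>)") (auto simp: Linf_norm_def Linf_def)
qed

lemma Linf_norm_pos:
  assumes f: "f \<in> Linf D" and ne: "\<not> (AE x in lebesgue_on D. f x = 0)"
  shows "0 < Linf_norm D f"
proof (rule ccontr)
  assume "\<not> 0 < Linf_norm D f"
  then have "AE x in lebesgue_on D. f x = 0"
    using Linf_AE[OF f] by (auto elim!: eventually_mono)
  with ne show False ..
qed

section \<open>The linear system in an orthonormal basis\<close>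

locale galerkin = bounded_domain D for D :: "(real^'d) set" +
  fixes N :: nat and \<phi> :: "nat \<Rightarrow> real^'d \<Rightarrow> real"
  assumes \<phi>_H01: "\<And>i. i < N \<Longrightarrow> \<phi> i \<in> H01 D" and zero_H01: "(\<lambda>x. 0) \<in> H01 D"
    and ortho: "\<And>i k. i < N \<Longrightarrow> k < N \<Longrightarrow> grad_inner (\<phi> i) (\<phi> k) = (if i = k then 1 else 0)"
begin

definition M :: "(real^'d \<Rightarrow> real) \<Rightarrow> nat \<Rightarrow> nat \<Rightarrow> real" where
  "M a i k = (\<integral>x. a x * (weak_grad D (\<phi> k) x \<bullet> weak_grad D (\<phi> i) x) \<partial>MD)"

text \<open>The gradient of the function with coefficient vector \<open>x\<close>, formed from the
  representatives chosen for the basis functions. The representative chosen for the combination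
  itself is only known to agree with it almost everywhere.\<close>

definition G :: "(nat \<Rightarrow> real) \<Rightarrow> real^'d \<Rightarrow> real^'d" where
  "G x \<xi> = (\<Sum>i<N. x i *\<^sub>R weak_grad D (\<phi> i) \<xi>)"

lemma coefficient_inner:
  fixes f g :: "real^'d \<Rightarrow> real^'d"
  assumes a: "a \<in> borel_measurable MD" "AE x in MD. \<bar>a x\<bar> \<le> B" and fg: "f \<in> L2_on D" "g \<in> L2_on D"
  shows "integrable MD (\<lambda>x. a x * (f x \<bullet> g x))"
    and "\<bar>\<integral>x. a x * (f x \<bullet> g x) \<partial>MD\<bar> \<le> B * (L2_norm_on D f * L2_norm_on D g)"
proof -
  have m: "f \<in> borel_measurable MD" "integrable MD (\<lambda>x. (norm (f x))\<^sup>2)"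
    "g \<in> borel_measurable MD" "integrable MD (\<lambda>x. (norm (g x))\<^sup>2)" using fg by (auto simp: L2_on_def)
  note i1 = integrable_norm_mult_L2[OF m]
  have bd: "AE x in MD. norm (a x * (f x \<bullet> g x)) \<le> B * (norm (f x) * norm (g x))"
    using a(2)
  proof eventually_elim
    case (elim x)
    then show ?case unfolding real_norm_def abs_mult
      by (intro mult_mono Cauchy_Schwarz_ineq2) auto
  qed
  show i: "integrable MD (\<lambda>x. a x * (f x \<bullet> g x))"
  proof (rule Bochner_Integration.integrable_bound[OF integrable_mult_right[OF i1, of B]])
    show "(\<lambda>x. a x * (f x \<bullet> g x)) \<in> borel_measurable MD"
      using a(1) m(1,3) by measurable
    show "AE x in MD. norm (a x * (f x \<bullet> g x)) \<le> norm (B * (norm (f x) * norm (g x)))"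
      using bd by eventually_elim simp
  qed
  have "\<bar>\<integral>x. a x * (f x \<bullet> g x) \<partial>MD\<bar> \<le> (\<integral>x. norm (a x * (f x \<bullet> g x)) \<partial>MD)"
    using integral_norm_bound[of MD "\<lambda>x. a x * (f x \<bullet> g x)"] by simp
  also have "\<dots> \<le> (\<integral>x. B * (norm (f x) * norm (g x)) \<partial>MD)"
    by (rule integral_mono_AE) (use i i1 bd in auto)
  also have "\<dots> = B * (\<integral>x. norm (f x) * norm (g x) \<partial>MD)" by simp
  also have "\<dots> \<le> B * (L2_norm_on D f * L2_norm_on D g)"
  proof (rule mult_left_mono[OF L2_inner_le(1)[OF fg]])
    \<comment> \<open>A nonempty open set is not a null set, so a bound for an absolute value that
      holds almost everywhere on it cannot be negative.\<close>
    show "0 \<le> B"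
    proof (rule ccontr)
      assume "\<not> 0 \<le> B"
      then have "AE x in MD. False" using a(2) by (auto elim!: eventually_mono)
      then have ae: "AE x in lebesgue. x \<notin> D" using D_sets by (simp add: AE_restrict_space_iff)
      have "D \<in> null_sets lebesgue" by (subst AE_iff_null_sets) (use ae open_D in simp_all)
      then have "negligible D" by (simp add: negligible_iff_null_sets)
      then show False using open_not_negligible open_D D_ne by blast
    qed
  qed
  finally show "\<bar>\<integral>x. a x * (f x \<bullet> g x) \<partial>MD\<bar> \<le> B * (L2_norm_on D f * L2_norm_on D g)" .
qed

lemma G_L2: "G x \<in> L2_on D"
proof -
  have "(\<lambda>\<xi>. \<Sum>i<n. x i *\<^sub>R weak_grad D (\<phi> i) \<xi>) \<in> L2_on D" if "n \<le> N" for n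
    using that
  proof (induction n)
    case 0
    then show ?case by (simp add: L2_on_def)
  next
    case (Suc n)
    then have "(\<lambda>\<xi>. \<Sum>i<n. x i *\<^sub>R weak_grad D (\<phi> i) \<xi>) \<in> L2_on D" "weak_grad D (\<phi> n) \<in> L2_on D"
      using H01_L2(2)[OF \<phi>_H01] by auto
    then show ?case using L2_add[OF _ L2_scale] by simp
  qed
  then show ?thesis unfolding G_def[abs_def] by simp
qed

lemma M_sum:
  assumes a: "a \<in> borel_measurable MD" "AE x in MD. \<bar>a x\<bar> \<le> B"
  shows "(\<Sum>i<N. \<Sum>k<N. x i * M a i k * w k) = (\<integral>\<xi>. a \<xi> * (G w \<xi> \<bullet> G x \<xi>) \<partial>MD)"
proof -
  have i: "integrable MD (\<lambda>\<xi>. a \<xi> * (weak_grad D (\<phi> k) \<xi> \<bullet> weak_grad D (\<phi> i) \<xi>))" if "i < N" "k < N" for i k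
    by (rule coefficient_inner(1)[OF a]) (use H01_L2(2) \<phi>_H01 that in auto)
  have "a \<xi> * (G w \<xi> \<bullet> G x \<xi>) = (\<Sum>i<N. \<Sum>k<N. x i * w k * (a \<xi> * (weak_grad D (\<phi> k) \<xi> \<bullet> weak_grad D (\<phi> i) \<xi>)))" for \<xi>
    unfolding G_def inner_sum_left inner_sum_right sum_distrib_left
    by (simp add: mult_ac)
  then have "(\<integral>\<xi>. a \<xi> * (G w \<xi> \<bullet> G x \<xi>) \<partial>MD)
      = (\<integral>\<xi>. (\<Sum>i<N. \<Sum>k<N. x i * w k * (a \<xi> * (weak_grad D (\<phi> k) \<xi> \<bullet> weak_grad D (\<phi> i) \<xi>))) \<partial>MD)"
    by (simp only:)
  also have "\<dots> = (\<Sum>i<N. \<Sum>k<N. \<integral>\<xi>. x i * w k * (a \<xi> * (weak_grad D (\<phi> k) \<xi> \<bullet> weak_grad D (\<phi> i) \<xi>)) \<partial>MD)"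
    by (subst Bochner_Integration.integral_sum; (intro Bochner_Integration.integrable_sum integrable_mult_right i sum.cong refl
        Bochner_Integration.integral_sum)?) (simp_all add: i)
  also have "\<dots> = (\<Sum>i<N. \<Sum>k<N. x i * M a i k * w k)"
    unfolding integral_mult_right_zero M_def by (simp only: mult_ac)
  finally show ?thesis ..
qed

lemma G_norm: "L2_norm_on D (G x) = L2_set x {..<N}"
proof -
  have "(L2_norm_on D (G x))\<^sup>2 = (\<integral>\<xi>. 1 * (G x \<xi> \<bullet> G x \<xi>) \<partial>MD)"
    unfolding L2_norm_sq by (simp add: power2_norm_eq_inner)
  also have "\<dots> = (\<Sum>i<N. \<Sum>k<N. x i * M (\<lambda>_. 1) i k * x k)"
    by (rule M_sum[symmetric, where B = 1]) auto
  also have "\<dots> = (\<Sum>i<N. \<Sum>k<N. if k = i then (x i)\<^sup>2 else 0)"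
    by (intro sum.cong refl) (auto simp: M_def ortho power2_eq_square)
  also have "\<dots> = (\<Sum>i<N. (x i)\<^sup>2)"
    by (intro sum.cong refl) (simp only: sum.delta finite_lessThan lessThan_iff if_True)
  finally have "sqrt ((L2_norm_on D (G x))\<^sup>2) = sqrt (\<Sum>i<N. (x i)\<^sup>2)" by simp
  then show ?thesis using L2_norm_nonneg[of D "G x"] by (simp add: L2_set_def)
qed

lemma M_bound:
  assumes a: "a \<in> borel_measurable MD" "AE x in MD. \<bar>a x\<bar> \<le> B"
  shows "\<bar>\<Sum>i<N. \<Sum>k<N. x i * M a i k * w k\<bar> \<le> B * L2_set x {..<N} * L2_set w {..<N}"
  using coefficient_inner(2)[OF a G_L2[of w] G_L2[of x]] unfolding M_sum[OF a] by (simp add: G_norm mult_ac)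

lemma M_coercive:
  assumes a: "a \<in> borel_measurable MD" "AE x in MD. \<bar>a x\<bar> \<le> B" and le: "\<And>x. x \<in> D \<Longrightarrow> amin \<le> a x"
  shows "amin * (\<Sum>i<N. (x i)\<^sup>2) \<le> (\<Sum>i<N. \<Sum>k<N. x i * M a i k * x k)"
proof -
  have "amin * (\<Sum>i<N. (x i)\<^sup>2) = amin * (L2_norm_on D (G x))\<^sup>2"
    by (simp add: G_norm L2_set_def sum_nonneg)
  also have "\<dots> = (\<integral>\<xi>. amin * (G x \<xi> \<bullet> G x \<xi>) \<partial>MD)"
    unfolding L2_norm_sq by (simp add: power2_norm_eq_inner)
  also have "\<dots> \<le> (\<integral>\<xi>. a \<xi> * (G x \<xi> \<bullet> G x \<xi>) \<partial>MD)"
  proof (rule integral_mono)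
    show "integrable MD (\<lambda>\<xi>. amin * (G x \<xi> \<bullet> G x \<xi>))"
      by (rule coefficient_inner(1)[where B = "\<bar>amin\<bar>"]) (auto simp: G_L2)
    show "integrable MD (\<lambda>\<xi>. a \<xi> * (G x \<xi> \<bullet> G x \<xi>))" by (rule coefficient_inner(1)[OF a G_L2 G_L2])
    show "amin * (G x \<xi> \<bullet> G x \<xi>) \<le> a \<xi> * (G x \<xi> \<bullet> G x \<xi>)" if "\<xi> \<in> space MD" for \<xi>
      using le that by (intro mult_right_mono) auto
  qed
  also have "\<dots> = (\<Sum>i<N. \<Sum>k<N. x i * M a i k * x k)" by (rule M_sum[OF a, symmetric])
  finally show ?thesis .
qed

lemma comb_H01: "(\<lambda>x. \<Sum>i<N. c i * \<phi> i x) \<in> H01 D"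
  by (rule H01_sum) (use \<phi>_H01 zero_H01 in auto)

lemma weak_grad_comb: "AE x in MD. weak_grad D (\<lambda>x. \<Sum>i<N. c i * \<phi> i x) x = G c x"
  unfolding G_def by (rule weak_grad_sum) (use \<phi>_H01 zero_H01 in auto)

lemma H01_norm_comb: "H01_norm D (\<lambda>x. \<Sum>i<N. c i * \<phi> i x) = L2_set c {..<N}"
proof -
  have "H01_norm D (\<lambda>x. \<Sum>i<N. c i * \<phi> i x) = L2_norm_on D (G c)"
    unfolding H01_norm_def
    by (rule L2_norm_cong_AE[OF weak_grad_comb weak_grad_measurable[OF comb_H01]]) (use G_L2 in \<open>auto simp: L2_on_def\<close>)
  then show ?thesis by (simp add: G_norm)
qed

lemma weak_grad_eq_G:
  assumes v: "v \<in> H01 D" and c: "H01_norm D (\<lambda>x. v x - (\<Sum>i<N. c i * \<phi> i x)) = 0"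
  shows "AE x in MD. weak_grad D v x = G c x"
proof -
  let ?S = "\<lambda>x. \<Sum>i<N. c i * \<phi> i x"
  let ?d = "\<lambda>x. v x + (-1) * ?S x"
  have dH: "?d \<in> H01 D" by (rule H01_add[OF v H01_scale[OF comb_H01]])
  have "(L2_norm_on D (weak_grad D ?d))\<^sup>2 = 0" using c by (simp add: H01_norm_def)
  then have "(\<integral>x. (norm (weak_grad D ?d x))\<^sup>2 \<partial>MD) = 0" by (simp only: L2_norm_sq)
  moreover have "integrable MD (\<lambda>x. (norm (weak_grad D ?d x))\<^sup>2)" using H01_L2(2)[OF dH] by (simp add: L2_on_def)
  ultimately have "AE x in MD. (norm (weak_grad D ?d x))\<^sup>2 = 0"
    using integral_nonneg_eq_0_iff_AE[of MD "\<lambda>x. (norm (weak_grad D ?d x))\<^sup>2"] by simp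
  with weak_grad_add[OF v H01_scale[OF comb_H01[of c], of "-1"]] weak_grad_scale[OF comb_H01[of c], of "-1"] weak_grad_comb[of c]
  show ?thesis
  proof eventually_elim
    case (elim x)
    then show ?case by simp
  qed
qed

lemma functional_comb:
  assumes q: "q \<in> Hminus1 D"
  shows "q (\<lambda>x. \<Sum>i<N. c i * \<phi> i x) = (\<Sum>i<N. c i * q (\<phi> i))"
proof -
  have add: "\<And>v w. v \<in> H01 D \<Longrightarrow> w \<in> H01 D \<Longrightarrow> q (\<lambda>x. v x + w x) = q v + q w"
    and scale: "\<And>c v. v \<in> H01 D \<Longrightarrow> q (\<lambda>x. c * v x) = c * q v"
    using q unfolding Hminus1_def by blast+
  have "q (\<lambda>x. \<Sum>i<n. c i * \<phi> i x) = (\<Sum>i<n. c i * q (\<phi> i)) \<and> (\<lambda>x. \<Sum>i<n. c i * \<phi> i x) \<in> H01 D" if "n \<le> N" for n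
    using that
  proof (induction n)
    case 0
    then show ?case using scale[OF zero_H01, of 0] zero_H01 by simp
  next
    case (Suc n)
    then have h: "\<phi> n \<in> H01 D" "(\<lambda>x. \<Sum>i<n. c i * \<phi> i x) \<in> H01 D" using \<phi>_H01 by auto
    then show ?case
      using Suc add[OF h(2) H01_scale[OF h(1), of "c n"]] scale[OF h(1)] H01_add[OF h(2) H01_scale[OF h(1), of "c n"]] by simp
  qed
  then show ?thesis by blast
qed

lemma Hminus1_norm_nonneg:
  assumes q: "q \<in> Hminus1 D" shows "0 \<le> Hminus1_norm D q"
proof -
  obtain B where B: "\<And>v. v \<in> H01 D \<Longrightarrow> \<bar>q v\<bar> \<le> B * H01_norm D v" using q unfolding Hminus1_def by blast
  have "H01_norm D (\<lambda>x. 0) = 0" using H01_norm_scale[OF zero_H01, of 0] by simp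
  then have "\<bar>q (\<lambda>x. 0)\<bar> \<le> Hminus1_norm D q"
    unfolding Hminus1_norm_def
  proof (intro cSup_upper)
    show "bdd_above {\<bar>q v\<bar> |v. v \<in> H01 D \<and> H01_norm D v \<le> 1}"
    proof (rule bdd_aboveI)
      fix t assume "t \<in> {\<bar>q v\<bar> |v. v \<in> H01 D \<and> H01_norm D v \<le> 1}"
      then obtain v where v: "v \<in> H01 D" "H01_norm D v \<le> 1" "t = \<bar>q v\<bar>" by blast
      have "B * H01_norm D v \<le> \<bar>B\<bar> * 1" using v(2) H01_norm_nonneg[of v] by (intro mult_mono) auto
      then show "t \<le> \<bar>B\<bar>" using B[OF v(1)] v(3) by simp
    qed
  qed (use zero_H01 in auto)
  then show ?thesis by linarith
qed

text \<open>\<open>q\<close> is tested with the combination whose coefficients are its own values on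
  the basis. By orthonormality the \<open>H01\<close> norm of this function is the Euclidean norm of
  the coefficients, so the bound is the same for every number of basis functions.\<close>

lemma functional_norm_le:
  assumes q: "q \<in> Hminus1 D"
  shows "L2_set (\<lambda>i. q (\<phi> i)) {..<N} \<le> Hminus1_norm D q"
proof (cases "L2_set (\<lambda>i. q (\<phi> i)) {..<N} = 0")
  case True
  then show ?thesis using Hminus1_norm_nonneg[OF q] by simp
next
  case False
  define t where "t = L2_set (\<lambda>i. q (\<phi> i)) {..<N}"
  have t: "0 < t" using False L2_set_nonneg[of "\<lambda>i. q (\<phi> i)" "{..<N}"] unfolding t_def by linarith
  have "t * t = (\<Sum>i<N. q (\<phi> i) * q (\<phi> i))" by (simp add: t_def L2_set_def sum_nonneg power2_eq_square)
  also have "\<dots> = q (\<lambda>x. \<Sum>i<N. q (\<phi> i) * \<phi> i x)" by (rule functional_comb[OF q, symmetric])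
  also have "\<dots> \<le> Hminus1_norm D q * t"
    using Hminus1_bound[OF q comb_H01[of "\<lambda>i. q (\<phi> i)"]] by (simp add: H01_norm_comb t_def)
  finally have "t \<le> Hminus1_norm D q" using t by simp
  then show ?thesis by (simp add: t_def)
qed

lemma L2_norm_comb_le:
  assumes "\<And>x. x \<in> D \<Longrightarrow> norm x \<le> R"
  shows "(\<integral>x. (\<Sum>i<N. c i * \<phi> i x)\<^sup>2 \<partial>MD) \<le> (2 * R)\<^sup>2 * (\<Sum>i<N. (c i)\<^sup>2)"
proof -
  let ?S = "\<lambda>x. \<Sum>i<N. c i * \<phi> i x"
  have "(\<integral>x. (?S x)\<^sup>2 \<partial>MD) = (L2_norm_on D ?S)\<^sup>2" unfolding L2_norm_sq by simp
  also have "\<dots> \<le> (2 * R * L2_set c {..<N})\<^sup>2"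
    using poincare[OF assms comb_H01[of c]] by (intro power_mono L2_norm_nonneg) (simp add: H01_norm_comb)
  also have "\<dots> = (2 * R)\<^sup>2 * (\<Sum>i<N. (c i)\<^sup>2)" by (simp add: power_mult_distrib L2_set_def sum_nonneg)
  finally show ?thesis .
qed

end

section \<open>Assembly of the error bound\<close>

lemma kernel_interpolant_cong:
  assumes "\<And>k. k \<in> {1..n} \<Longrightarrow> f (lattice_point n z k) = g (lattice_point n z k)"
  shows "kernel_interpolant \<alpha> \<gamma> s n z f = kernel_interpolant \<alpha> \<gamma> s n z g"
proof -
  have "(\<forall>k\<in>{1..n}. t (lattice_point n z k) = f (lattice_point n z k)) \<longleftrightarrow>
      (\<forall>k\<in>{1..n}. t (lattice_point n z k) = g (lattice_point n z k))" for t
    by (rule ball_cong[OF refl]) (simp only: assms)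
  then show ?thesis unfolding kernel_interpolant_def by simp
qed

lemma integrable_product:
  fixes g :: "'a \<Rightarrow> real" and k :: "'b \<Rightarrow> real"
  assumes "finite_measure M1" "finite_measure M2" and g: "integrable M1 g" and k: "integrable M2 k"
  shows "integrable (M1 \<Otimes>\<^sub>M M2) (\<lambda>(y, x). g y * k x)"
proof -
  interpret P: pair_sigma_finite M1 M2
    using assms(1,2) by (simp add: pair_sigma_finite_def finite_measure_def)
  have [measurable]: "g \<in> borel_measurable M1" "k \<in> borel_measurable M2" using g k by auto
  show ?thesis
  proof (rule P.Fubini_integrable)
    show "integrable M1 (\<lambda>y. \<integral>x. norm (case (y, x) of (y, x) \<Rightarrow> g y * k x) \<partial>M2)"
      using integrable_mult_left[OF integrable_abs[OF g], of "\<integral>x. \<bar>k x\<bar> \<partial>M2"] by (simp add: abs_mult)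
    show "AE y in M1. integrable M2 (\<lambda>x. case (y, x) of (y, x) \<Rightarrow> g y * k x)"
      using k by simp
  qed measurable
qed

text \<open>\<open>max (card u) 1\<close> is at least 1 and at least \<open>card u\<close>, so the
  single inequality in \<open>weight_dominated\<close> bounds both \<open>G0\<close> and
  \<open>G1\<close> by \<open>C\<close>.\<close>

lemma CBC_lattice_sum_dominated:
  assumes lr: "lattice_rule_powr \<alpha> \<gamma> s n z lam" and cbc: "CBC_vector \<alpha> \<gamma> s n z"
    and dom: "weight_dominated \<sigma> lam (2 * zeta_real (real \<alpha> * lam)) b c p \<gamma>"
    and C: "(\<Sum>u\<in>Pow {..<s}. c ^ card u * (\<Sum>m\<in>u \<rightarrow>\<^sub>E {1..\<sigma>}. fdb_term \<sigma> b u m powr p)) \<le> C"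
  shows "lattice_rule.lattice_sum \<alpha> \<gamma> s n z \<le> (2 / real n * (C\<^sup>2 + lattice_rule_powr.Ct \<alpha> lam * C\<^sup>2)) powr (1 / lam)"
proof -
  interpret R: lattice_rule_powr \<alpha> \<gamma> s n z lam by (rule lr)
  have le: "real (max (card u) 1) * (\<gamma> u powr lam * R.Z2 ^ card u)
      \<le> c ^ card u * (\<Sum>m\<in>u \<rightarrow>\<^sub>E {1..\<sigma>}. fdb_term \<sigma> b u m powr p)" if "u \<in> Pow {..<s}" for u
    using dom finite_subset[of u "{..<s}"] that unfolding weight_dominated_def by (simp add: mult.assoc)
  have nn: "0 \<le> \<gamma> u powr lam * R.Z2 ^ card u" for u using R.Z2_ge_1 by simp
  have G0: "R.G0 \<le> C"
  proof -
    have "R.G0 \<le> (\<Sum>u\<in>Pow {..<s}. c ^ card u * (\<Sum>m\<in>u \<rightarrow>\<^sub>E {1..\<sigma>}. fdb_term \<sigma> b u m powr p))"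
      unfolding R.G0_def
    proof (rule sum_mono)
      fix u assume u: "u \<in> Pow {..<s}"
      have "1 * (\<gamma> u powr lam * R.Z2 ^ card u) \<le> real (max (card u) 1) * (\<gamma> u powr lam * R.Z2 ^ card u)"
        by (intro mult_right_mono nn) simp
      then show "\<gamma> u powr lam * R.Z2 ^ card u \<le> c ^ card u * (\<Sum>m\<in>u \<rightarrow>\<^sub>E {1..\<sigma>}. fdb_term \<sigma> b u m powr p)"
        using le[OF u] by linarith
    qed
    with C show ?thesis by linarith
  qed
  have G1: "R.G1 \<le> C"
  proof -
    have "R.G1 \<le> (\<Sum>u\<in>Pow {..<s}. c ^ card u * (\<Sum>m\<in>u \<rightarrow>\<^sub>E {1..\<sigma>}. fdb_term \<sigma> b u m powr p))"
      unfolding R.G1_def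
    proof (rule sum_mono)
      fix u assume u: "u \<in> Pow {..<s}"
      have "real (card u) * (\<gamma> u powr lam * R.Z2 ^ card u) \<le> real (max (card u) 1) * (\<gamma> u powr lam * R.Z2 ^ card u)"
        by (intro mult_right_mono nn) simp
      then show "real (card u) * \<gamma> u powr lam * R.Z2 ^ card u \<le> c ^ card u * (\<Sum>m\<in>u \<rightarrow>\<^sub>E {1..\<sigma>}. fdb_term \<sigma> b u m powr p)"
        using le[OF u] by (simp only: mult.assoc)
    qed
    with C show ?thesis by linarith
  qed
  have p0: "0 \<le> R.G0" "0 \<le> R.G1"
    unfolding R.G0_def R.G1_def using R.Z2_ge_1 by (auto intro!: sum_nonneg)
  have "R.lattice_sum \<le> (2 / real n * (R.G0\<^sup>2 + R.Ct * R.G0 * R.G1)) powr (1 / lam)"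
    by (rule CBC_lattice_sum[OF lr cbc])
  also have "\<dots> \<le> (2 / real n * (C\<^sup>2 + R.Ct * C\<^sup>2)) powr (1 / lam)"
  proof (rule powr_mono2)
    show "0 \<le> 1 / lam" using R.lam by simp
    show "0 \<le> 2 / real n * (R.G0\<^sup>2 + R.Ct * R.G0 * R.G1)" using p0 R.Ct_nonneg by simp
    have "R.G0 * R.G1 \<le> C * C" by (rule mult_mono) (use G0 G1 p0 in auto)
    then have "R.Ct * (R.G0 * R.G1) \<le> R.Ct * (C * C)" using R.Ct_nonneg by (rule mult_left_mono)
    moreover have "R.G0\<^sup>2 \<le> C\<^sup>2" by (rule power_mono[OF G0 p0(1)])
    ultimately have "R.G0\<^sup>2 + R.Ct * R.G0 * R.G1 \<le> C\<^sup>2 + R.Ct * C\<^sup>2"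
      by (simp add: power2_eq_square mult.assoc)
    then show "2 / real n * (R.G0\<^sup>2 + R.Ct * R.G0 * R.G1) \<le> 2 / real n * (C\<^sup>2 + R.Ct * C\<^sup>2)"
      by (rule mult_left_mono) simp
  qed
  finally show ?thesis .
qed

text \<open>The sine vanishes at the entries that \<open>truncate\<close> sets to 0, which leaves a
  finite sum. The factor \<open>1 / sqrt 6\<close> is attached to \<open>\<psi> j\<close>, in
  agreement with \<open>b_seq\<close>.\<close>

lemma diffusion_truncate:
  "diffusion a0 \<psi> x (truncate s y) = a0 x + (\<Sum>j<s. sin (2 * pi * y j) * (1 / sqrt 6 * \<psi> j x))"
proof -
  have "(\<Sum>j. sin (2 * pi * truncate s y j) * \<psi> j x) = (\<Sum>j<s. sin (2 * pi * truncate s y j) * \<psi> j x)"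
    by (rule suminf_finite) (auto simp: truncate_def)
  also have "\<dots> = (\<Sum>j<s. sin (2 * pi * y j) * \<psi> j x)"
    by (rule sum.cong) (auto simp: truncate_def)
  finally show ?thesis unfolding diffusion_def by (simp add: sum_divide_distrib mult_ac sum_distrib_left)
qed

lemma truncate_param_set: "in_cube s y \<Longrightarrow> truncate s y \<in> param_set"
  by (auto simp: in_cube_def param_set_def truncate_def)

context galerkin begin

lemma M_add_sum:
  assumes a: "a \<in> borel_measurable MD" "AE x in MD. \<bar>a x\<bar> \<le> B"
    and f: "\<And>j. j < s \<Longrightarrow> f j \<in> borel_measurable MD" "\<And>j. j < s \<Longrightarrow> AE x in MD. \<bar>f j x\<bar> \<le> B' j"
    and ik: "i < N" "k < N"
  shows "M (\<lambda>x. a x + (\<Sum>j<s. t j * f j x)) i k = M a i k + (\<Sum>j<(s::nat). t j * M (f j) i k)"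
proof -
  note L = H01_L2(2)[OF \<phi>_H01[OF ik(2)]] H01_L2(2)[OF \<phi>_H01[OF ik(1)]]
  have i: "integrable MD (\<lambda>x. a x * (weak_grad D (\<phi> k) x \<bullet> weak_grad D (\<phi> i) x))"
    by (rule coefficient_inner(1)[OF a L])
  have j: "integrable MD (\<lambda>x. t j * (f j x * (weak_grad D (\<phi> k) x \<bullet> weak_grad D (\<phi> i) x)))" if "j < s" for j
    by (intro integrable_mult_right coefficient_inner(1)[OF f[OF that] L])
  have "M (\<lambda>x. a x + (\<Sum>j<s. t j * f j x)) i k =
      (\<integral>x. a x * (weak_grad D (\<phi> k) x \<bullet> weak_grad D (\<phi> i) x) +
        (\<Sum>j<s. t j * (f j x * (weak_grad D (\<phi> k) x \<bullet> weak_grad D (\<phi> i) x))) \<partial>MD)"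
    unfolding M_def by (simp only: distrib_right sum_distrib_right mult.assoc)
  also have "\<dots> = (\<integral>x. a x * (weak_grad D (\<phi> k) x \<bullet> weak_grad D (\<phi> i) x) \<partial>MD) +
      (\<integral>x. (\<Sum>j<s. t j * (f j x * (weak_grad D (\<phi> k) x \<bullet> weak_grad D (\<phi> i) x))) \<partial>MD)"
    by (rule Bochner_Integration.integral_add) (use i j in auto)
  also have "(\<integral>x. (\<Sum>j<s. t j * (f j x * (weak_grad D (\<phi> k) x \<bullet> weak_grad D (\<phi> i) x))) \<partial>MD) =
      (\<Sum>j<s. \<integral>x. t j * (f j x * (weak_grad D (\<phi> k) x \<bullet> weak_grad D (\<phi> i) x)) \<partial>MD)"
    by (rule Bochner_Integration.integral_sum) (use j in auto)
  also have "\<dots> = (\<Sum>j<s. t j * M (f j) i k)" unfolding integral_mult_right_zero M_def ..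
  finally show ?thesis unfolding M_def .
qed

lemma M_apply:
  assumes a: "a \<in> borel_measurable MD" "AE x in MD. \<bar>a x\<bar> \<le> B" and i: "i < N"
  shows "(\<Sum>k<N. M a i k * w k) = (\<integral>x. a x * (G w x \<bullet> weak_grad D (\<phi> i) x) \<partial>MD)"
proof -
  let ?x = "\<lambda>j. if j = i then 1 else (0::real)"
  have "G ?x = weak_grad D (\<phi> i)"
  proof
    fix \<xi>
    have "G ?x \<xi> = (\<Sum>j<N. if j = i then weak_grad D (\<phi> j) \<xi> else 0)"
      unfolding G_def by (rule sum.cong) auto
    then show "G ?x \<xi> = weak_grad D (\<phi> i) \<xi>" using i by (simp only: sum.delta finite_lessThan lessThan_iff if_True)
  qed
  moreover have "(\<Sum>j<N. \<Sum>k<N. ?x j * M a j k * w k) = (\<Sum>j<N. if j = i then (\<Sum>k<N. M a j k * w k) else 0)"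
    by (rule sum.cong) auto
  moreover have "\<dots> = (\<Sum>k<N. M a i k * w k)" using i by (simp only: sum.delta finite_lessThan lessThan_iff if_True)
  ultimately show ?thesis using M_sum[OF a, of ?x w] by simp
qed

text \<open>Interpolation acts on the basis coefficients alone, so the squared error is a finite sum
  of products of a function of \<open>y\<close> with a function of \<open>x\<close>; this gives
  joint integrability. For fixed \<open>y\<close> the Poincare inequality and orthonormality bound
  the integral over the domain by the sum of the squared coefficient errors.\<close>

lemma interpolation_error:
  assumes a0: "a0 \<in> Linf D" and \<psi>: "\<And>j. \<psi> j \<in> Linf D" and b: "\<And>j. 0 < b_seq D \<psi> amin j" and amin: "0 < amin"
    and ell: "\<And>x y. x \<in> D \<Longrightarrow> y \<in> param_set \<Longrightarrow> amin \<le> diffusion a0 \<psi> x y \<and> diffusion a0 \<psi> x y \<le> amax"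
    and q: "q \<in> Hminus1 D" and R: "\<And>x. x \<in> D \<Longrightarrow> norm x \<le> R"
    and W: "\<And>i. i < N \<Longrightarrow> \<phi> i \<in> W" "\<And>v. v \<in> W \<Longrightarrow> v \<in> H01 D"
      "\<And>v. v \<in> W \<Longrightarrow> \<exists>c. H01_norm D (\<lambda>x. v x - (\<Sum>i<N. c i * \<phi> i x)) = 0 \<and> (\<forall>x\<in>D. v x = (\<Sum>i<N. c i * \<phi> i x))"
    and uh: "\<And>y. y \<in> param_set \<Longrightarrow> fe_solution D (\<lambda>x. diffusion a0 \<psi> x y) W q (uh y)"
    and \<sigma>: "1 \<le> \<sigma>" and lr: "lattice_rule (2 * \<sigma>) \<gamma> s n z"
    and X: "lattice_rule.lattice_sum (2 * \<sigma>) \<gamma> s n z \<le> X" "0 < X"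
    and \<Gamma>: "(\<Sum>u\<in>Pow {..<s}. (\<Sum>m\<in>u \<rightarrow>\<^sub>E {1..\<sigma>}. fdb_term \<sigma> (b_seq D \<psi> amin) u m)\<^sup>2 / \<gamma> u) \<le> \<Gamma>"
  defines "err \<equiv> \<lambda>x y. uh (truncate s y) x - kernel_interpolant (2 * \<sigma>) \<gamma> s n z (\<lambda>y. uh (truncate s y) x) y"
  shows "integrable (cube_measure s \<Otimes>\<^sub>M MD) (\<lambda>(y, x). (err x y)\<^sup>2)"
    and "(\<integral>y. (\<integral>x. (err x y)\<^sup>2 \<partial>MD) \<partial>cube_measure s) \<le>
      (2 * R)\<^sup>2 * (2 * sqrt X * ((Hminus1_norm D q / amin)\<^sup>2 * \<Gamma>))"
proof -
  let ?b = "b_seq D \<psi> amin"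
  let ?a = "\<lambda>y x. diffusion a0 \<psi> x (truncate s y)"
  let ?f = "\<lambda>j x. 1 / sqrt 6 * \<psi> j x"
  have a0m: "a0 \<in> borel_measurable MD" and \<psi>m: "\<And>j. \<psi> j \<in> borel_measurable MD"
    using a0 \<psi> by (auto simp: Linf_def)
  note a0b = Linf_AE[OF a0]
  have fm: "?f j \<in> borel_measurable MD" for j using \<psi>m by simp
  have fb: "AE x in MD. \<bar>?f j x\<bar> \<le> amin * ?b j" for j
    using Linf_AE[OF \<psi>[of j]]
  proof eventually_elim
    case (elim x)
    then show ?case using amin by (simp add: b_seq_def abs_mult divide_right_mono)
  qed
  have am: "?a y \<in> borel_measurable MD" for y
    unfolding diffusion_truncate using a0m \<psi>m by measurable
  have ab: "AE x in MD. \<bar>?a y x\<bar> \<le> amax" if y: "in_cube s y" for y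
  proof (rule AE_I2)
    fix x assume "x \<in> space MD"
    then have "x \<in> D" by simp
    from ell[OF this truncate_param_set[OF y]] show "\<bar>?a y x\<bar> \<le> amax" using amin by linarith
  qed
  have Ma: "M (?a y) i k = M a0 i k + (\<Sum>j<s. sin (2 * pi * y j) * M (?f j) i k)" if "i < N" "k < N" for y i k
    unfolding diffusion_truncate by (rule M_add_sum[OF a0m a0b fm fb that])
  interpret P: parametric_system "{..<N}" s "M a0" "\<lambda>j. M (?f j)" ?b amin "\<bar>Linf_norm D a0\<bar>" "\<lambda>i. q (\<phi> i)"
  proof
    show "0 \<le> ?b j" for j using b[of j] by simp
    show "amin * (\<Sum>i<N. (x i)\<^sup>2) \<le> (\<Sum>i<N. \<Sum>k<N. x i * (M a0 i k + (\<Sum>j<s. sin (2 * pi * y j) * M (?f j) i k)) * x k)"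
      if y: "in_cube s y" for y x
    proof -
      have "amin * (\<Sum>i<N. (x i)\<^sup>2) \<le> (\<Sum>i<N. \<Sum>k<N. x i * M (?a y) i k * x k)"
        by (rule M_coercive[OF am ab[OF y]]) (use ell truncate_param_set[OF y] in blast)
      also have "\<dots> = (\<Sum>i<N. \<Sum>k<N. x i * (M a0 i k + (\<Sum>j<s. sin (2 * pi * y j) * M (?f j) i k)) * x k)"
        by (intro sum.cong refl) (simp only: Ma lessThan_iff)
      finally show ?thesis .
    qed
    show "\<bar>\<Sum>i<N. \<Sum>k<N. x i * M a0 i k * w k\<bar> \<le> \<bar>Linf_norm D a0\<bar> * L2_set x {..<N} * L2_set w {..<N}" for x w
    proof (rule M_bound[OF a0m])
      show "AE x in MD. \<bar>a0 x\<bar> \<le> \<bar>Linf_norm D a0\<bar>" using a0b by eventually_elim simp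
    qed
    show "\<bar>\<Sum>i<N. \<Sum>k<N. x i * M (?f j) i k * w k\<bar> \<le> amin * ?b j * L2_set x {..<N} * L2_set w {..<N}" for j x w
      by (rule M_bound[OF fm fb])
  qed (rule finite_lessThan amin abs_ge_zero)+
  have us: "fe_solution D (?a y) W q (uh (truncate s y))" if "in_cube s y" for y
    by (rule uh[OF truncate_param_set[OF that]])
  \<comment> \<open>Coefficients are chosen for each \<open>y\<close> separately and without any
    control of their dependence on \<open>y\<close>; the linear system satisfied by them determines
    that dependence afterwards.\<close>
  have "\<forall>y. \<exists>c. in_cube s y \<longrightarrow> H01_norm D (\<lambda>x. uh (truncate s y) x - (\<Sum>i<N. c i * \<phi> i x)) = 0
      \<and> (\<forall>x\<in>D. uh (truncate s y) x = (\<Sum>i<N. c i * \<phi> i x))"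
  proof
    fix y
    show "\<exists>c. in_cube s y \<longrightarrow> H01_norm D (\<lambda>x. uh (truncate s y) x - (\<Sum>i<N. c i * \<phi> i x)) = 0
      \<and> (\<forall>x\<in>D. uh (truncate s y) x = (\<Sum>i<N. c i * \<phi> i x))"
      using W(3)[of "uh (truncate s y)"] us[of y] unfolding fe_solution_def by (cases "in_cube s y") simp_all
  qed
  from choice[OF this] obtain c where c0: "\<forall>y. in_cube s y \<longrightarrow>
      H01_norm D (\<lambda>x. uh (truncate s y) x - (\<Sum>i<N. c y i * \<phi> i x)) = 0 \<and> (\<forall>x\<in>D. uh (truncate s y) x = (\<Sum>i<N. c y i * \<phi> i x))"
    by blast
  have c: "\<And>y. in_cube s y \<Longrightarrow> H01_norm D (\<lambda>x. uh (truncate s y) x - (\<Sum>i<N. c y i * \<phi> i x)) = 0"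
      "\<And>y x. in_cube s y \<Longrightarrow> x \<in> D \<Longrightarrow> uh (truncate s y) x = (\<Sum>i<N. c y i * \<phi> i x)" using c0 by simp_all
  have sol: "(\<Sum>k\<in>{..<N}. P.Ay y i k * c y k) = q (\<phi> i)" if y: "in_cube s y" and i: "i \<in> {..<N}" for y i
  proof -
    have i': "i < N" using i by simp
    have uH: "uh (truncate s y) \<in> H01 D" using us[OF y] W(2) unfolding fe_solution_def by blast
    have "(\<Sum>k\<in>{..<N}. P.Ay y i k * c y k) = (\<Sum>k<N. M (?a y) i k * c y k)"
      unfolding P.Ay_def using i' by (intro sum.cong refl) (simp only: Ma lessThan_iff)
    also have "\<dots> = (\<integral>x. ?a y x * (G (c y) x \<bullet> weak_grad D (\<phi> i) x) \<partial>MD)"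
      by (rule M_apply[OF am ab[OF y] i'])
    also have "\<dots> = (\<integral>x. ?a y x * (weak_grad D (uh (truncate s y)) x \<bullet> weak_grad D (\<phi> i) x) \<partial>MD)"
    proof (rule integral_cong_AE)
      show "AE x in MD. ?a y x * (G (c y) x \<bullet> weak_grad D (\<phi> i) x) = ?a y x * (weak_grad D (uh (truncate s y)) x \<bullet> weak_grad D (\<phi> i) x)"
        using weak_grad_eq_G[OF uH c(1)[OF y]] by eventually_elim simp
      have "G (c y) \<in> borel_measurable MD" using G_L2[of "c y"] by (simp add: L2_on_def)
      then show "(\<lambda>x. ?a y x * (G (c y) x \<bullet> weak_grad D (\<phi> i) x)) \<in> borel_measurable MD"
        by (intro borel_measurable_times borel_measurable_inner am weak_grad_measurable \<phi>_H01 i')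
      show "(\<lambda>x. ?a y x * (weak_grad D (uh (truncate s y)) x \<bullet> weak_grad D (\<phi> i) x)) \<in> borel_measurable MD"
        by (intro borel_measurable_times borel_measurable_inner am weak_grad_measurable \<phi>_H01 i' uH)
    qed
    also have "\<dots> = q (\<phi> i)" using us[OF y] W(1)[OF i'] unfolding fe_solution_def by blast
    finally show ?thesis .
  qed
  define e where "e i y = c y i - kernel_interpolant (2 * \<sigma>) \<gamma> s n z (\<lambda>y. c y i) y" for i y
  note E = P.interpolation_error[where c = "\<lambda>i y. c y i", OF \<sigma> lr X sol, folded e_def]
  interpret R: lattice_rule "2 * \<sigma>" \<gamma> s n z by (rule lr)
  have err: "err x y = (\<Sum>i<N. e i y * \<phi> i x)" if x: "x \<in> D" and y: "y \<in> space (cube_measure s)" for x y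
  proof -
    have "kernel_interpolant (2 * \<sigma>) \<gamma> s n z (\<lambda>y. uh (truncate s y) x)
        = kernel_interpolant (2 * \<sigma>) \<gamma> s n z (\<lambda>y. \<Sum>i<N. \<phi> i x * c y i)"
      by (rule kernel_interpolant_cong) (simp only: c(2)[OF in_cube_lattice_point x] mult.commute)
    also have "\<dots> = (\<lambda>y. \<Sum>i<N. \<phi> i x * kernel_interpolant (2 * \<sigma>) \<gamma> s n z (\<lambda>y. c y i) y)"
      by (rule R.kernel_interpolant_sum)
    finally show ?thesis
      unfolding err_def by (simp add: c(2)[OF space_cube_in_cube[OF y] x] e_def sum_subtractf left_diff_distrib)
        (simp add: mult.commute[of "\<phi> _ x"])
  qed
  have sq: "(err x y)\<^sup>2 = (\<Sum>i<N. \<Sum>k<N. (e i y * e k y) * (\<phi> i x * \<phi> k x))"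
    if "x \<in> D" "y \<in> space (cube_measure s)" for x y
    unfolding err[OF that] power2_eq_square sum_product by (simp only: mult_ac)
  interpret Cu: prob_space "cube_measure s" by (rule prob_space_cube)
  interpret FD: finite_measure MD by (rule finite_measure_D)
  interpret PS: pair_sigma_finite "cube_measure s" MD ..
  have "integrable (cube_measure s \<Otimes>\<^sub>M MD) (\<lambda>w. \<Sum>i<N. \<Sum>k<N. case w of (y, x) \<Rightarrow> (e i y * e k y) * (\<phi> i x * \<phi> k x))"
  proof (intro Bochner_Integration.integrable_sum)
    fix i k assume ik: "i \<in> {..<N}" "k \<in> {..<N}"
    show "integrable (cube_measure s \<Otimes>\<^sub>M MD) (\<lambda>w. case w of (y, x) \<Rightarrow> (e i y * e k y) * (\<phi> i x * \<phi> k x))"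
    proof (rule integrable_product)
      show "integrable (cube_measure s) (\<lambda>y. e i y * e k y)" by (rule E(1)[OF _ _ ik]) simp_all
      show "integrable MD (\<lambda>x. \<phi> i x * \<phi> k x)"
        using ik by (intro integrable_mult_L2 H01_L2(1) \<phi>_H01) simp_all
    qed unfold_locales
  qed
  moreover have "(\<Sum>i<N. \<Sum>k<N. case w of (y, x) \<Rightarrow> (e i y * e k y) * (\<phi> i x * \<phi> k x)) = (case w of (y, x) \<Rightarrow> (err x y)\<^sup>2)"
    if "w \<in> space (cube_measure s \<Otimes>\<^sub>M MD)" for w
    using that sq by (cases w) (simp add: space_pair_measure)
  ultimately show int: "integrable (cube_measure s \<Otimes>\<^sub>M MD) (\<lambda>(y, x). (err x y)\<^sup>2)"
    using Bochner_Integration.integrable_cong[OF refl] by (metis (no_types, lifting))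
  have e2: "integrable (cube_measure s) (\<lambda>y. (e i y)\<^sup>2)" if "i < N" for i
    using E(1)[of i i] that by (simp add: power2_eq_square)
  have "(\<integral>y. (\<integral>x. (err x y)\<^sup>2 \<partial>MD) \<partial>cube_measure s) \<le> (\<integral>y. (2 * R)\<^sup>2 * (\<Sum>i<N. (e i y)\<^sup>2) \<partial>cube_measure s)"
  proof (rule integral_mono)
    show "integrable (cube_measure s) (\<lambda>y. \<integral>x. (err x y)\<^sup>2 \<partial>MD)"
      using PS.integrable_fst[OF int] by simp
    show "integrable (cube_measure s) (\<lambda>y. (2 * R)\<^sup>2 * (\<Sum>i<N. (e i y)\<^sup>2))"
      by (intro integrable_mult_right Bochner_Integration.integrable_sum e2) simp
    fix y assume y: "y \<in> space (cube_measure s)"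
    have "(\<integral>x. (err x y)\<^sup>2 \<partial>MD) = (\<integral>x. (\<Sum>i<N. e i y * \<phi> i x)\<^sup>2 \<partial>MD)"
      by (rule Bochner_Integration.integral_cong) (simp_all add: err[OF _ y])
    also have "\<dots> \<le> (2 * R)\<^sup>2 * (\<Sum>i<N. (e i y)\<^sup>2)" by (rule L2_norm_comb_le[OF R])
    finally show "(\<integral>x. (err x y)\<^sup>2 \<partial>MD) \<le> (2 * R)\<^sup>2 * (\<Sum>i<N. (e i y)\<^sup>2)" .
  qed
  also have "\<dots> = (2 * R)\<^sup>2 * (\<Sum>i<N. \<integral>y. (e i y)\<^sup>2 \<partial>cube_measure s)"
    by (simp add: Bochner_Integration.integral_sum e2)
  also have "\<dots> \<le> (2 * R)\<^sup>2 * (2 * sqrt X * ((Hminus1_norm D q / amin)\<^sup>2 * \<Gamma>))"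
  proof (rule mult_left_mono)
    let ?Q = "\<Sum>u\<in>Pow {..<s}. (\<Sum>m\<in>u \<rightarrow>\<^sub>E {1..\<sigma>}. fdb_term \<sigma> ?b u m)\<^sup>2 / \<gamma> u"
    have "(\<Sum>i<N. \<integral>y. (e i y)\<^sup>2 \<partial>cube_measure s) \<le> 2 * sqrt X * ((P.nq / amin)\<^sup>2 * ?Q)"
      unfolding fdb_term_def by (rule E(2)) simp_all
    also have "\<dots> \<le> 2 * sqrt X * ((Hminus1_norm D q / amin)\<^sup>2 * \<Gamma>)"
    proof (intro mult_left_mono mult_mono power_mono divide_right_mono \<Gamma>)
      have "P.nq = L2_set (\<lambda>i. q (\<phi> i)) {..<N}" by (simp add: cn_def L2_set_def)
      then show "P.nq \<le> Hminus1_norm D q" using functional_norm_le[OF q] by simp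
      show "0 \<le> ?Q" by (intro sum_nonneg divide_nonneg_pos zero_le_power2 R.\<gamma>) (auto intro: finite_subset)
      show "0 \<le> P.nq / amin" by (rule divide_nonneg_pos[OF cn_nonneg amin])
    qed (use X(2) amin cn_nonneg in auto)
    finally show "(\<Sum>i<N. \<integral>y. (e i y)\<^sup>2 \<partial>cube_measure s) \<le> 2 * sqrt X * ((Hminus1_norm D q / amin)\<^sup>2 * \<Gamma>)" .
  qed simp
  finally show "(\<integral>y. (\<integral>x. (err x y)\<^sup>2 \<partial>MD) \<partial>cube_measure s) \<le>
      (2 * R)\<^sup>2 * (2 * sqrt X * ((Hminus1_norm D q / amin)\<^sup>2 * \<Gamma>))" .
qed

end

lemma sqrt_sqrt_powr:
  fixes K lam :: real
  assumes "0 < K" "0 < n"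
  shows "sqrt (sqrt ((2 / real n * K) powr (1 / lam))) = (2 * K) powr (1 / (4 * lam)) * real n powr - (1 / (4 * lam))"
proof -
  have "sqrt (sqrt ((2 / real n * K) powr (1 / lam))) = (2 / real n * K) powr (1 / lam * (1 / 2) * (1 / 2))"
    by (simp only: powr_half_sqrt[symmetric] powr_ge_zero powr_powr)
  also have "\<dots> = ((2 * K) * (1 / real n)) powr (1 / (4 * lam))"
    by (rule arg_cong2[of _ _ _ _ "(powr)"]) simp_all
  also have "\<dots> = (2 * K) powr (1 / (4 * lam)) * (1 / real n) powr (1 / (4 * lam))"
    by (rule powr_mult)
  also have "(1 / real n) powr (1 / (4 * lam)) = real n powr - (1 / (4 * lam))"
    using assms by (simp add: powr_divide powr_minus_divide)
  finally show ?thesis .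
qed

text \<open>The floor exceeds \<open>1 / p - 1 / 2\<close>, hence \<open>\<alpha>\<close> exceeds
  \<open>2 / p - 1\<close>, which is \<open>1 / lam\<close>. So the zeta function is evaluated
  inside its domain of convergence.\<close>

lemma smoothness_exponent:
  fixes p lam :: real
  assumes p: "0 < p" "p < 1" and \<alpha>: "\<alpha> = 2 * nat \<lfloor>1 / p + 1 / 2\<rfloor>" and lam: "lam = p / (2 - p)"
  shows "1 \<le> \<alpha> div 2" "\<alpha> = 2 * (\<alpha> div 2)" "1 < real \<alpha> * lam" "1 / (4 * lam) = 1 / (2 * p) - 1 / 4"
proof -
  have "1 \<le> 1 / p" using p by (simp add: field_simps)
  then have f: "1 \<le> \<lfloor>1 / p + 1 / 2\<rfloor>" by (simp add: le_floor_iff)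
  have "1 \<le> nat \<lfloor>1 / p + 1 / 2\<rfloor>" using f by linarith
  then show "1 \<le> \<alpha> div 2" "\<alpha> = 2 * (\<alpha> div 2)" by (simp_all only: \<alpha>) auto
  have "real (nat \<lfloor>1 / p + 1 / 2\<rfloor>) = of_int \<lfloor>1 / p + 1 / 2\<rfloor>" using f by simp
  then have "real \<alpha> = 2 * of_int \<lfloor>1 / p + 1 / 2\<rfloor>" by (simp only: \<alpha> of_nat_mult of_nat_numeral)
  moreover have "1 / p + 1 / 2 < of_int \<lfloor>1 / p + 1 / 2\<rfloor> + 1" using floor_correct[of "1 / p + 1 / 2"] by linarith
  ultimately have "2 * (1 / p - 1 / 2) < real \<alpha>" by argo
  moreover have "2 * (1 / p - 1 / 2) = 1 / lam" using p by (simp add: lam field_simps)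
  moreover have "0 < lam" using p by (simp add: lam)
  ultimately have "1 / lam < real \<alpha>" "0 < lam" by simp_all
  then show "1 < real \<alpha> * lam" by (simp add: field_simps)
  show "1 / (4 * lam) = 1 / (2 * p) - 1 / 4" using p by (simp add: lam field_simps)
qed

theorem theorem10:
  fixes D :: "(real^'d) set"
    and a0 :: "real^'d \<Rightarrow> real" and \<psi> :: "nat \<Rightarrow> real^'d \<Rightarrow> real"
    and p amin amax lam :: real and \<alpha> \<sigma> :: nat
    and \<gamma> :: "nat set \<Rightarrow> real"
    and H :: "real set" and V :: "real \<Rightarrow> (real^'d \<Rightarrow> real) set"
  assumes dim: "CARD('d) \<in> {1, 2, 3}"
    and D: "open D" "convex D" "polytope (closure D)" "D \<noteq> {}"
    and a0: "a0 \<in> Linf D"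
    and \<psi>: "\<And>j. \<psi> j \<in> Linf D" "\<And>j. \<not> (AE x in lebesgue_on D. \<psi> j x = 0)"
    and sum1: "summable (\<lambda>j. Linf_norm D (\<psi> j))"
    and p: "0 < p" "p < 1"
    and sump: "summable (\<lambda>j. Linf_norm D (\<psi> j) powr p)"
    and ellipticity: "0 < amin"
      "\<And>x y. x \<in> D \<Longrightarrow> y \<in> param_set \<Longrightarrow>
         amin \<le> diffusion a0 \<psi> x y \<and> diffusion a0 \<psi> x y \<le> amax"
    and \<alpha>: "\<alpha> = 2 * nat \<lfloor>1 / p + 1 / 2\<rfloor>"
    and \<sigma>: "\<sigma> = \<alpha> div 2"
    and lam: "lam = p / (2 - p)"
    and \<gamma>: "\<gamma> = weight1 \<alpha> \<sigma> lam (b_seq D \<psi> amin) \<or> \<gamma> = weight2 \<alpha> \<sigma> lam (b_seq D \<psi> amin)"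
    and V: "fe_family D H V"
  shows "\<exists>C>0. \<forall>q\<in>Hminus1 D. \<forall>h\<in>H. \<forall>uh :: (nat \<Rightarrow> real) \<Rightarrow> real^'d \<Rightarrow> real.
    (\<forall>y\<in>param_set. fe_solution D (\<lambda>x. diffusion a0 \<psi> x y) (V h) q (uh y)) \<longrightarrow>
    (\<forall>s\<ge>1. \<forall>n. prime n \<longrightarrow> (\<forall>z. CBC_vector \<alpha> \<gamma> s n z \<longrightarrow>
      (let ush = (\<lambda>x y. uh (truncate s y) x);
           ushn = (\<lambda>x. kernel_interpolant \<alpha> \<gamma> s n z (ush x))
       in integrable (cube_measure s \<Otimes>\<^sub>M lebesgue_on D) (\<lambda>(y, x). (ush x y - ushn x y)\<^sup>2) \<and>
          sqrt (\<integral>y. (\<integral>x. (ush x y - ushn x y)\<^sup>2 \<partial>lebesgue_on D) \<partial>cube_measure s)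
            \<le> C * Hminus1_norm D q * real n powr - (1 / (2 * p) - 1 / 4))))"
proof -
  let ?b = "b_seq D \<psi> amin"
  let ?Z = "2 * zeta_real (real \<alpha> * lam)"
  note se = smoothness_exponent[OF p \<alpha> lam]
  note ex = exponents[OF p lam]
  have \<sigma>1: "1 \<le> \<sigma>" and \<alpha>2: "\<alpha> = 2 * \<sigma>" using se(1,2) \<sigma> by simp_all
  have bD: "bounded D" using polytope_imp_bounded[OF D(3)] bounded_subset[OF _ closure_subset] by blast
  interpret B: bounded_domain D by unfold_locales (use D bD in auto)
  obtain R0 where R0: "\<And>x. x \<in> D \<Longrightarrow> norm x \<le> R0" using bD by (auto simp: bounded_iff)
  \<comment> \<open>The maximum with 1, here and in \<open>C1\<close>, keeps the final constant
    positive.\<close>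
  define R where "R = max R0 1"
  have R: "norm x \<le> R" if "x \<in> D" for x using R0[OF that] by (simp add: R_def)
  have R1: "0 < R" by (simp add: R_def)
  have b: "0 < ?b j" for j using Linf_norm_pos[OF \<psi>(1,2)] ellipticity(1) by (simp add: b_seq_def)
  have "?b j powr p = (1 / sqrt 6 / amin) powr p * Linf_norm D (\<psi> j) powr p" for j
    using Linf_norm_pos[OF \<psi>(1,2), of j] ellipticity(1) by (simp add: b_seq_def powr_mult[symmetric])
  then have sb: "summable (\<lambda>j. ?b j powr p)" using summable_mult[OF sump] by simp
  have dom: "weight_dominated \<sigma> lam ?Z ?b (3 * ?Z) p \<gamma>"
    using \<gamma> weight1_dominated[of ?b, OF b p lam \<sigma>1 se(3)] weight2_dominated[of ?b, OF b p lam \<sigma>1 se(3)] by blast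
  have \<gamma>pos: "0 < \<gamma> u" if "finite u" for u using dom that unfolding weight_dominated_def by blast
  have "1 \<le> 3 * ?Z" using zeta_ge_1[OF se(3)] by simp
  from fdb_term_powr_bounded[OF b sb p this, of \<sigma>] obtain C0
    where C0: "\<And>s. (\<Sum>u\<in>Pow {..<s}. (3 * ?Z) ^ card u * (\<Sum>m\<in>u \<rightarrow>\<^sub>E {1..\<sigma>}. fdb_term \<sigma> ?b u m powr p)) \<le> C0" by blast
  define C1 where "C1 = max C0 1"
  have C1: "(\<Sum>u\<in>Pow {..<s}. (3 * ?Z) ^ card u * (\<Sum>m\<in>u \<rightarrow>\<^sub>E {1..\<sigma>}. fdb_term \<sigma> ?b u m powr p)) \<le> C1" for s
    using C0[of s] by (simp add: C1_def)
  have C1p: "0 < C1" by (simp add: C1_def)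
  define K where "K = C1\<^sup>2 + 2 powr (real \<alpha> * lam + 1) * zeta_real (real \<alpha> * lam) * C1\<^sup>2"
  have K: "0 < K" using C1p zeta_ge_1[OF se(3)] by (simp add: K_def add_pos_nonneg)
  \<comment> \<open>All ingredients are fixed before \<open>q\<close>, \<open>h\<close>,
    \<open>s\<close> and \<open>n\<close> are introduced: \<open>2 * R\<close> is the Poincare
    constant, \<open>sqrt (2 * C1)\<close> combines the factor 2 of the aliasing bound with the sum
    in the kernel norm, \<open>1 / amin\<close> comes from coercivity, and the power of
    \<open>2 * K\<close> from the lattice sum.\<close>
  define C where "C = 2 * R * sqrt (2 * C1) / amin * (2 * K) powr (1 / (4 * lam))"
  have C: "0 < C" using R1 C1p ellipticity(1) K by (simp add: C_def)
  show ?thesis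
  proof (intro exI[of _ C] conjI ballI allI impI)
    fix q h and uh :: "(nat \<Rightarrow> real) \<Rightarrow> real^'d \<Rightarrow> real" and s n :: nat and z
    assume q: "q \<in> Hminus1 D" and h: "h \<in> H"
      and uh: "\<forall>y\<in>param_set. fe_solution D (\<lambda>x. diffusion a0 \<psi> x y) (V h) q (uh y)"
      and s: "1 \<le> s" and n: "prime n" and z: "CBC_vector \<alpha> \<gamma> s n z"
    show "let ush = (\<lambda>x y. uh (truncate s y) x);
           ushn = (\<lambda>x. kernel_interpolant \<alpha> \<gamma> s n z (ush x))
       in integrable (cube_measure s \<Otimes>\<^sub>M lebesgue_on D) (\<lambda>(y, x). (ush x y - ushn x y)\<^sup>2) \<and>
          sqrt (\<integral>y. (\<integral>x. (ush x y - ushn x y)\<^sup>2 \<partial>lebesgue_on D) \<partial>cube_measure s)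
            \<le> C * Hminus1_norm D q * real n powr - (1 / (2 * p) - 1 / 4)"
    proof (rule B.orthonormal_basis[OF V h])
    fix N :: nat and \<phi>
    assume \<phi>: "\<And>i. i < N \<Longrightarrow> \<phi> i \<in> V h"
      "\<And>i k. i < N \<Longrightarrow> k < N \<Longrightarrow> B.grad_inner (\<phi> i) (\<phi> k) = (if i = k then 1 else 0)"
      and VH: "\<And>v. v \<in> V h \<Longrightarrow> v \<in> H01 D"
      and span: "\<And>v. v \<in> V h \<Longrightarrow> \<exists>c. H01_norm D (\<lambda>x. v x - (\<Sum>i<N. c i * \<phi> i x)) = 0 \<and> (\<forall>x\<in>D. v x = (\<Sum>i<N. c i * \<phi> i x))"
      and comb: "\<And>c. (\<lambda>x. \<Sum>i<N. c i * \<phi> i x) \<in> V h"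
    \<comment> \<open>Obtained from the combination with zero coefficients, so that it is available
      for \<open>N = 0\<close> as well.\<close>
    have z0: "(\<lambda>x. 0) \<in> H01 D" using VH[OF comb[of "\<lambda>_. 0"]] by simp
    interpret galerkin D N \<phi> by unfold_locales (use \<phi> VH z0 in auto)
    have zr: "z j \<in> {1..n - 1}" if "j < s" for j using z that unfolding CBC_vector_def by blast
    have lrp: "lattice_rule_powr \<alpha> \<gamma> s n z lam"
      by unfold_locales (use \<sigma>1 \<alpha>2 \<gamma>pos s n zr ex(1,2) se(3) in auto)
    then have lr: "lattice_rule (2 * \<sigma>) \<gamma> s n z" using \<alpha>2 by (simp add: lattice_rule_powr_def)
    define X where "X = (2 / real n * K) powr (1 / lam)"
    have n0: "0 < n" using n prime_gt_0_nat by blast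
    have X: "lattice_rule.lattice_sum (2 * \<sigma>) \<gamma> s n z \<le> X"
      using CBC_lattice_sum_dominated[OF lrp z dom C1] unfolding X_def K_def lattice_rule_powr.Ct_def[OF lrp] \<alpha>2[symmetric] .
    have X0: "0 < X" using K n0 by (simp add: X_def)
    have \<Gamma>: "(\<Sum>u\<in>Pow {..<s}. (\<Sum>m\<in>u \<rightarrow>\<^sub>E {1..\<sigma>}. fdb_term \<sigma> ?b u m)\<^sup>2 / \<gamma> u) \<le> C1"
    proof (rule order_trans[OF sum_mono C1])
      fix u assume "u \<in> Pow {..<s}"
      then have "finite u" using finite_subset by blast
      then show "(\<Sum>m\<in>u \<rightarrow>\<^sub>E {1..\<sigma>}. fdb_term \<sigma> ?b u m)\<^sup>2 / \<gamma> u
          \<le> (3 * ?Z) ^ card u * (\<Sum>m\<in>u \<rightarrow>\<^sub>E {1..\<sigma>}. fdb_term \<sigma> ?b u m powr p)"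
        using dom unfolding weight_dominated_def by blast
    qed
    note E = interpolation_error[OF a0 \<psi>(1) b ellipticity(1) ellipticity(2) q R \<phi>(1) VH span bspec[OF uh] \<sigma>1 lr X X0 \<Gamma>]
    let ?I = "\<integral>y. (\<integral>x. (uh (truncate s y) x - kernel_interpolant \<alpha> \<gamma> s n z (\<lambda>y. uh (truncate s y) x) y)\<^sup>2
      \<partial>lebesgue_on D) \<partial>cube_measure s"
    have "sqrt ?I \<le> sqrt ((2 * R)\<^sup>2 * (2 * sqrt X * ((Hminus1_norm D q / amin)\<^sup>2 * C1)))"
      using E(2) unfolding \<alpha>2[symmetric] by (rule real_sqrt_le_mono)
    also have "\<dots> = 2 * R * sqrt (2 * C1) / amin * sqrt (sqrt X) * Hminus1_norm D q"
    proof -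
      let ?A = "2 * R * Hminus1_norm D q / amin"
      have s1: "sqrt (A\<^sup>2 * B * sqrt X) = \<bar>A\<bar> * sqrt B * sqrt (sqrt X)" for A B
        by (simp add: real_sqrt_mult)
      have s2: "(2 * R)\<^sup>2 * (2 * sqrt X * ((Hminus1_norm D q / amin)\<^sup>2 * C1)) = ?A\<^sup>2 * (2 * C1) * sqrt X"
        by (simp add: power_mult_distrib power_divide)
      have s3: "\<bar>?A\<bar> = ?A" using R1 ellipticity(1) Hminus1_norm_nonneg[OF q] by simp
      show ?thesis
        unfolding s2 s1 s3 by (simp only: times_divide_eq_left times_divide_eq_right mult_ac)
    qed
    also have "\<dots> = C * Hminus1_norm D q * real n powr - (1 / (4 * lam))"
      unfolding X_def sqrt_sqrt_powr[OF K n0] C_def by (simp only: mult_ac)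
    finally have "sqrt ?I \<le> C * Hminus1_norm D q * real n powr - (1 / (2 * p) - 1 / 4)"
      by (simp only: se(4))
    then show ?thesis
      using E(1) unfolding Let_def \<alpha>2[symmetric] by blast
    qed
  qed (rule C)
qed

end
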